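(* Let $p:(\Sigma,\pi_\Sigma)\to(M,\pi_M)$ be a Poisson submersion. The following statements are equivalent: (a) $p$ is a Poisson submersion with Poisson fibres; (b) $p$ maps symplectic leaves of $(\Sigma,\pi_\Sigma)$ into symplectic leaves of $(M,\pi_M)$; (c) the differential of $p$ maps the characteristic distribution $\pi_\Sigma^\sharp(T^*\Sigma)$ of $(\Sigma,\pi_\Sigma)$ into the characteristic distribution $\pi_M^\sharp(T^*M)$ of $(M,\pi_M)$.
   Context: Everything is smooth. For a Poisson manifold $(M,\pi_M)$, $\pi_M^\sharp:T^*M\to TM$ is contraction with $\pi_M$, and $\mathrm{Gr}(\pi_M)=\{\pi_M^\sharp(\xi)+\xi : \xi\in T^*M\}\subset TM\oplus T^*M$. A Poisson submersion is a submersion between Poisson manifolds which is a Poisson map. An embedded submanifold $i:X\to M$ is a Poisson-Dirac submanifold of $(M,\pi_M)$ if $i^!\mathrm{Gr}(\pi_M):=\{u+i^*\xi : i_*u=\pi_M^\sharp(\xi)\}\subset TX\oplus T^*X$ equals $\mathrm{Gr}(\pi_X)$ for a (unique, automatically Poisson) smooth bivector $\pi_X$ on $X$. A submersion $p:(\Sigma,\pi_\Sigma)\to M$ has Poisson fibres if each fibre is a Poisson-Dirac submanifold of $(\Sigma,\pi_\Sigma)$. *)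

theory Defs
  imports "HOL-Analysis.Analysis"
begin

section \<open>Smooth maps\<close>

text \<open>
  \<open>E\<close> is a linear subspace of a Euclidean space and \<open>U\<close> a relatively open subset of \<open>E\<close>. The
  derivative within \<open>U\<close> is then uniquely determined in the directions of \<open>E\<close>, and only
  these are used. Working relative to a subspace lets submanifolds of lower dimension be modelled
  on the same type as the ambient manifold.
\<close>

primrec Ck_on :: "'e::euclidean_space set \<Rightarrow> nat \<Rightarrow> 'e set \<Rightarrow> ('e \<Rightarrow> 'f::real_normed_vector) \<Rightarrow> bool"
where
  "Ck_on E 0 U f \<longleftrightarrow> continuous_on U f"
| "Ck_on E (Suc k) U f \<longleftrightarrow>
     (\<forall>x\<in>U. f differentiable (at x within U)) \<and>
     (\<forall>v\<in>E. Ck_on E k U (\<lambda>x. frechet_derivative f (at x within U) v))"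

definition smooth_on :: "'e::euclidean_space set \<Rightarrow> 'e set \<Rightarrow> ('e \<Rightarrow> 'f::real_normed_vector) \<Rightarrow> bool"
  where "smooth_on E U f \<longleftrightarrow> (\<forall>k. Ck_on E k U f)"


section \<open>Smooth manifolds\<close>

text \<open>
  A manifold is a topology together with an atlas; a chart is a pair of its domain and its map
  into the model space, which is a linear subspace of \<open>'e\<close> (so the dimension is \<open>dim (model M)\<close>).
\<close>

record ('a, 'e) manifold =
  mtop :: "'a topology"
  model :: "'e set"
  charts :: "('a set \<times> ('a \<Rightarrow> 'e)) set"

definition carrier :: "('a, 'e) manifold \<Rightarrow> 'a set"
  where "carrier M = topspace (mtop M)"

definition smooth_manifold :: "('a, 'e::euclidean_space) manifold \<Rightarrow> bool" where
  "smooth_manifold M \<longleftrightarrow>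
     Hausdorff_space (mtop M) \<and> second_countable (mtop M) \<and> subspace (model M) \<and>
     (\<forall>(U, \<phi>) \<in> charts M.
        openin (mtop M) U \<and>
        openin (top_of_set (model M)) (\<phi> ` U) \<and>
        homeomorphic_map (subtopology (mtop M) U) (top_of_set (\<phi> ` U)) \<phi>) \<and>
     carrier M = (\<Union>(U, \<phi>) \<in> charts M. U) \<and>
     (\<forall>(U, \<phi>) \<in> charts M. \<forall>(V, \<psi>) \<in> charts M.
        smooth_on (model M) (\<phi> ` (U \<inter> V)) (\<psi> \<circ> inv_into U \<phi>))"

definition smooth_fun :: "('a, 'e::euclidean_space) manifold \<Rightarrow> 'a set \<Rightarrow> ('a \<Rightarrow> real) \<Rightarrow> bool" where
  "smooth_fun M U f \<longleftrightarrow>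
     openin (mtop M) U \<and>
     (\<forall>(V, \<phi>) \<in> charts M. smooth_on (model M) (\<phi> ` (U \<inter> V)) (f \<circ> inv_into V \<phi>))"

definition smooth_near :: "('a, 'e::euclidean_space) manifold \<Rightarrow> 'a \<Rightarrow> ('a \<Rightarrow> real) \<Rightarrow> bool" where
  "smooth_near M x f \<longleftrightarrow> (\<exists>U. x \<in> U \<and> smooth_fun M U f)"

definition smooth_map ::
    "('a, 'e::euclidean_space) manifold \<Rightarrow> ('b, 'f::euclidean_space) manifold \<Rightarrow> ('a \<Rightarrow> 'b) \<Rightarrow> bool" where
  "smooth_map M N p \<longleftrightarrow>
     continuous_map (mtop M) (mtop N) p \<and>
     (\<forall>(U, \<phi>) \<in> charts M. \<forall>(V, \<psi>) \<in> charts N.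
        smooth_on (model M) (\<phi> ` {x \<in> U. p x \<in> V}) (\<psi> \<circ> p \<circ> inv_into U \<phi>))"


section \<open>Tangent and cotangent spaces\<close>

text \<open>
  Tangent vectors at \<open>x\<close> are the derivations of the algebra of germs at \<open>x\<close> of smooth functions.
  They are represented as functionals on functions which vanish (by convention) on functions
  that are not smooth near \<open>x\<close>. Covectors are linear functionals on the tangent
  space, again extended by zero; these conventions make equality of vectors and of covectors
  extensional.
\<close>

type_synonym 'a tvec = "('a \<Rightarrow> real) \<Rightarrow> real"
type_synonym 'a cvec = "'a tvec \<Rightarrow> real"

definition tangent_space :: "('a, 'e::euclidean_space) manifold \<Rightarrow> 'a \<Rightarrow> 'a tvec set" where
  "tangent_space M x =
     {v. (\<forall>f. \<not> smooth_near M x f \<longrightarrow> v f = 0) \<and>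
         (\<forall>f g U. smooth_near M x f \<and> smooth_near M x g \<and> openin (mtop M) U \<and> x \<in> U \<and>
            (\<forall>y\<in>U. f y = g y) \<longrightarrow> v f = v g) \<and>
         (\<forall>f g. smooth_near M x f \<and> smooth_near M x g \<longrightarrow> v (\<lambda>y. f y + g y) = v f + v g) \<and>
         (\<forall>c f. smooth_near M x f \<longrightarrow> v (\<lambda>y. c * f y) = c * v f) \<and>
         (\<forall>f g. smooth_near M x f \<and> smooth_near M x g \<longrightarrow>
            v (\<lambda>y. f y * g y) = f x * v g + g x * v f)}"

definition cotangent_space :: "('a, 'e::euclidean_space) manifold \<Rightarrow> 'a \<Rightarrow> 'a cvec set" where
  "cotangent_space M x =
     {\<xi>. (\<forall>v. v \<notin> tangent_space M x \<longrightarrow> \<xi> v = 0) \<and>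
         (\<forall>u\<in>tangent_space M x. \<forall>v\<in>tangent_space M x. \<xi> (\<lambda>f. u f + v f) = \<xi> u + \<xi> v) \<and>
         (\<forall>c. \<forall>v\<in>tangent_space M x. \<xi> (\<lambda>f. c * v f) = c * \<xi> v)}"

definition differential :: "('a, 'e::euclidean_space) manifold \<Rightarrow> 'a \<Rightarrow> ('a \<Rightarrow> real) \<Rightarrow> 'a cvec"
  where "differential M x f = (\<lambda>v. if v \<in> tangent_space M x then v f else 0)"

definition pushforward ::
    "('b, 'f::euclidean_space) manifold \<Rightarrow> ('a \<Rightarrow> 'b) \<Rightarrow> 'a \<Rightarrow> 'a tvec \<Rightarrow> 'b tvec"
  where "pushforward N p x v = (\<lambda>f. if smooth_near N (p x) f then v (f \<circ> p) else 0)"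

definition pullback ::
    "('a, 'e::euclidean_space) manifold \<Rightarrow> ('b, 'f::euclidean_space) manifold \<Rightarrow> ('a \<Rightarrow> 'b) \<Rightarrow> 'a
      \<Rightarrow> 'b cvec \<Rightarrow> 'a cvec"
  where "pullback M N p x \<xi> =
    (\<lambda>v. if v \<in> tangent_space M x then \<xi> (pushforward N p x v) else 0)"

definition submersion ::
    "('a, 'e::euclidean_space) manifold \<Rightarrow> ('b, 'f::euclidean_space) manifold \<Rightarrow> ('a \<Rightarrow> 'b) \<Rightarrow> bool" where
  "submersion M N p \<longleftrightarrow> smooth_map M N p \<and>
     (\<forall>x\<in>carrier M. pushforward N p x ` tangent_space M x = tangent_space N (p x))"

text \<open>\<open>X\<close> is an embedded submanifold of \<open>M\<close>; the inclusion is \<open>id\<close>.\<close>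

definition embedded_submanifold ::
    "('a, 'e::euclidean_space) manifold \<Rightarrow> ('a, 'e) manifold \<Rightarrow> bool" where
  "embedded_submanifold X M \<longleftrightarrow>
     smooth_manifold X \<and> carrier X \<subseteq> carrier M \<and>
     mtop X = subtopology (mtop M) (carrier X) \<and>
     smooth_map X M id \<and>
     (\<forall>x\<in>carrier X. inj_on (pushforward M id x) (tangent_space X x))"


section \<open>Poisson manifolds\<close>

text \<open>A bivector at \<open>x\<close> is an alternating bilinear form on the cotangent space at \<open>x\<close>.\<close>

type_synonym 'a bivector = "'a \<Rightarrow> 'a cvec \<Rightarrow> 'a cvec \<Rightarrow> real"

definition poisson_bracket ::
    "('a, 'e::euclidean_space) manifold \<Rightarrow> 'a bivector \<Rightarrow> ('a \<Rightarrow> real) \<Rightarrow> ('a \<Rightarrow> real) \<Rightarrow> 'a \<Rightarrow> real"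
  where "poisson_bracket M \<pi> f g = (\<lambda>x. \<pi> x (differential M x f) (differential M x g))"

definition smooth_bivector :: "('a, 'e::euclidean_space) manifold \<Rightarrow> 'a bivector \<Rightarrow> bool" where
  "smooth_bivector M \<pi> \<longleftrightarrow>
     (\<forall>x\<in>carrier M. \<forall>\<xi>\<in>cotangent_space M x. \<forall>\<eta>\<in>cotangent_space M x.
        \<pi> x \<xi> \<eta> = - \<pi> x \<eta> \<xi> \<and>
        (\<forall>\<zeta>\<in>cotangent_space M x. \<pi> x (\<lambda>v. \<xi> v + \<zeta> v) \<eta> = \<pi> x \<xi> \<eta> + \<pi> x \<zeta> \<eta>) \<and>
        (\<forall>c. \<pi> x (\<lambda>v. c * \<xi> v) \<eta> = c * \<pi> x \<xi> \<eta>)) \<and>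
     (\<forall>U f g. smooth_fun M U f \<and> smooth_fun M U g \<longrightarrow> smooth_fun M U (poisson_bracket M \<pi> f g))"

text \<open>
  The vanishing of the Schouten bracket of \<open>\<pi>\<close> with itself is expressed by the Jacobi identity
  for (locally defined) functions.
\<close>

definition poisson_manifold :: "('a, 'e::euclidean_space) manifold \<Rightarrow> 'a bivector \<Rightarrow> bool" where
  "poisson_manifold M \<pi> \<longleftrightarrow>
     smooth_manifold M \<and> smooth_bivector M \<pi> \<and>
     (\<forall>U f g h. smooth_fun M U f \<and> smooth_fun M U g \<and> smooth_fun M U h \<longrightarrow>
        (\<forall>x\<in>U. poisson_bracket M \<pi> f (poisson_bracket M \<pi> g h) x
              + poisson_bracket M \<pi> g (poisson_bracket M \<pi> h f) x
              + poisson_bracket M \<pi> h (poisson_bracket M \<pi> f g) x = 0))"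

text \<open>
  The contraction of \<open>\<pi>\<close> with \<open>\<xi>\<close> is the tangent vector \<open>v\<close> with \<open>\<eta>(v) = \<pi>(\<xi>, \<eta>)\<close> for all
  covectors \<open>\<eta>\<close> at \<open>x\<close>; taking \<open>\<eta> = df\<close> gives the value of the derivation \<open>v\<close> on \<open>f\<close>.
\<close>

definition sharp ::
    "('a, 'e::euclidean_space) manifold \<Rightarrow> 'a bivector \<Rightarrow> 'a \<Rightarrow> 'a cvec \<Rightarrow> 'a tvec"
  where "sharp M \<pi> x \<xi> = (\<lambda>f. if smooth_near M x f then \<pi> x \<xi> (differential M x f) else 0)"

definition characteristic_distribution ::
    "('a, 'e::euclidean_space) manifold \<Rightarrow> 'a bivector \<Rightarrow> 'a \<Rightarrow> 'a tvec set"
  where "characteristic_distribution M \<pi> x = sharp M \<pi> x ` cotangent_space M x"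

definition poisson_submersion ::
    "('a, 'e::euclidean_space) manifold \<Rightarrow> 'a bivector \<Rightarrow>
     ('b, 'f::euclidean_space) manifold \<Rightarrow> 'b bivector \<Rightarrow> ('a \<Rightarrow> 'b) \<Rightarrow> bool" where
  "poisson_submersion S \<pi>S M \<pi>M p \<longleftrightarrow>
     poisson_manifold S \<pi>S \<and> poisson_manifold M \<pi>M \<and> submersion S M p \<and>
     (\<forall>x\<in>carrier S. \<forall>\<xi>\<in>cotangent_space M (p x). \<forall>\<eta>\<in>cotangent_space M (p x).
        \<pi>S x (pullback S M p x \<xi>) (pullback S M p x \<eta>) = \<pi>M (p x) \<xi> \<eta>)"


section \<open>Poisson-Dirac submanifolds\<close>

definition graph ::
    "('a, 'e::euclidean_space) manifold \<Rightarrow> 'a bivector \<Rightarrow> 'a \<Rightarrow> ('a tvec \<times> 'a cvec) set"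
  where "graph M \<pi> x = {(sharp M \<pi> x \<xi>, \<xi>) | \<xi>. \<xi> \<in> cotangent_space M x}"

definition pullback_graph ::
    "('a, 'e::euclidean_space) manifold \<Rightarrow> ('a, 'e) manifold \<Rightarrow> 'a bivector \<Rightarrow> 'a
      \<Rightarrow> ('a tvec \<times> 'a cvec) set"
  where "pullback_graph X M \<pi> x =
    {(u, pullback X M id x \<xi>) | u \<xi>.
       u \<in> tangent_space X x \<and> \<xi> \<in> cotangent_space M x \<and> pushforward M id x u = sharp M \<pi> x \<xi>}"

definition poisson_dirac_submanifold ::
    "('a, 'e::euclidean_space) manifold \<Rightarrow> ('a, 'e) manifold \<Rightarrow> 'a bivector \<Rightarrow> bool" where
  "poisson_dirac_submanifold X M \<pi> \<longleftrightarrow>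
     embedded_submanifold X M \<and>
     (\<exists>\<pi>X. smooth_bivector X \<pi>X \<and> (\<forall>x\<in>carrier X. pullback_graph X M \<pi> x = graph X \<pi>X x))"

text \<open>
  The smooth structure making a subset an embedded submanifold is unique when it exists, so
  the existential quantifier merely names the one carried by the fibre.
\<close>

definition has_poisson_fibres ::
    "('a, 'e::euclidean_space) manifold \<Rightarrow> 'a bivector \<Rightarrow> ('b, 'f::euclidean_space) manifold
      \<Rightarrow> ('a \<Rightarrow> 'b) \<Rightarrow> bool" where
  "has_poisson_fibres S \<pi>S M p \<longleftrightarrow>
     (\<forall>m\<in>carrier M. \<exists>X :: ('a, 'e) manifold.
        carrier X = {x \<in> carrier S. p x = m} \<and> poisson_dirac_submanifold X S \<pi>S)"


section \<open>Symplectic leaves\<close>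

text \<open>
  Two points lie in the same symplectic leaf iff they can be joined by a piecewise smooth curve
  each segment of which is an integral curve of a locally defined Hamiltonian vector field.
  Reversing time and replacing the Hamiltonian by its negative shows that this relation is symmetric.
\<close>

definition hamiltonian_curve ::
    "('a, 'e::euclidean_space) manifold \<Rightarrow> 'a bivector \<Rightarrow> 'a set \<Rightarrow> ('a \<Rightarrow> real) \<Rightarrow>
     real \<Rightarrow> real \<Rightarrow> (real \<Rightarrow> 'a) \<Rightarrow> bool" where
  "hamiltonian_curve M \<pi> U h a b \<gamma> \<longleftrightarrow>
     smooth_fun M U h \<and> a \<le> b \<and> \<gamma> ` {a..b} \<subseteq> U \<and>
     continuous_map (top_of_set {a..b}) (mtop M) \<gamma> \<and>
     (\<forall>t\<in>{a..b}. \<forall>f. smooth_near M (\<gamma> t) f \<longrightarrow>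
        ((f \<circ> \<gamma>) has_real_derivative sharp M \<pi> (\<gamma> t) (differential M (\<gamma> t) h) f)
          (at t within {a..b}))"

definition hamiltonian_step ::
    "('a, 'e::euclidean_space) manifold \<Rightarrow> 'a bivector \<Rightarrow> 'a \<Rightarrow> 'a \<Rightarrow> bool" where
  "hamiltonian_step M \<pi> x y \<longleftrightarrow>
     (\<exists>U h a b \<gamma>. hamiltonian_curve M \<pi> U h a b \<gamma> \<and> \<gamma> a = x \<and> \<gamma> b = y)"

definition symplectic_leaves :: "('a, 'e::euclidean_space) manifold \<Rightarrow> 'a bivector \<Rightarrow> 'a set set" where
  "symplectic_leaves M \<pi> = {{y. (hamiltonian_step M \<pi>)\<^sup>*\<^sup>* x y} | x. x \<in> carrier M}"

end

theory Submission
  imports Defs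
begin

text \<open>
  In a chart in which the submersion becomes the projection \<open>C\<close>, let \<open>P\<close> and \<open>Q\<close> be the matrices of
  \<open>\<pi>S\<close> at \<open>x\<close> and of \<open>\<pi>M\<close> at \<open>p x\<close>, so that \<open>C P C\<^sup>T = Q\<close>. Condition (c) says \<open>im (C P) \<subseteq> im Q\<close>,
  which is equivalent to \<open>ker Q \<subseteq> ker (P C\<^sup>T)\<close>. A covector \<open>\<eta> \<in> ker Q\<close> gives a vector \<open>P C\<^sup>T \<eta>\<close> tangent
  to the fibre and paired with the zero covector of the fibre in the pulled back graph; hence the
  pulled back graph is the graph of a bivector iff all these vectors vanish. This is (a) iff (c).

  For the leaves, no splitting theorem is needed. Near a point \<open>q0\<close> the horizontal lift \<open>H\<close>
  of the image of \<open>Pi q0\<close> into the image of \<open>Pi z\<close> defines radial curves which fill out a plaque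
  through each point of the rank of \<open>q0\<close>; by the Jacobi identity \<open>H\<close> is flat there, so that plaques are
  tangent to the characteristic distribution, consist of points of one leaf, and contain every curve
  that meets them and is tangent to the distribution along points of this rank.
  Given (c), a Hamiltonian curve upstairs has an image whose distance to a plaque satisfies a Gronwall
  inequality, so the image stays in one leaf. Conversely, if (c) fails at \<open>x\<close> while (b) holds,
  some Hamiltonian curve through \<open>x\<close> has an image that lies in one leaf but is transverse to its
  plaques, and so meets each plaque at countably many times only; as a leaf has countably
  many plaques near \<open>p x\<close>, an interval would be countable.
\<close>

section \<open>Smooth calculus on open sets: products, compositions, operator-valued maps and their
  inverses\<close>

section \<open>Calculus of smooth maps\<close>

text \<open>The obstacle is that leaves are mere reachability classes without manifold structure,
  while the rank of \<open>\<pi>M\<close> may jump arbitrarily close to a leaf. Both directions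
  between (b) and (c) therefore rest on one function, the deviation
  \<open>y - phi q (y - q)\<close>: it compares \<open>y\<close> with the point of the plaque of
  \<open>q\<close> that has the same orthogonal projection to \<open>R\<close>, the image of
  \<open>Pi q0\<close>. The derivative of \<open>phi q\<close> is \<open>H\<close> itself, so the
  derivative of the deviation along a curve is the part of the velocity that fails to be horizontal
  at that plaque point. For (b) this part is bounded by the deviation, for (c) it is non-zero at a
  zero of the deviation. That \<open>phi q\<close> has derivative \<open>H\<close> uses flatness of
  \<open>H\<close> along the radial curves, hence \<open>D = 0\<close> there. This propagates from
  \<open>q\<close> because \<open>D\<close> obeys a homogeneous linear equation along horizontal
  curves. Ranks also have to be constant on a whole leaf before its plaques can be counted; this is
  the argument from (c) to (b) applied to the identity map of \<open>M\<close>.\<close>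

abbreviation "Ck \<equiv> Ck_on UNIV"
abbreviation "smooth \<equiv> smooth_on UNIV"

lemma differentiable_cong_within:
  assumes "\<And>x. x \<in> U \<Longrightarrow> f x = g x" "x \<in> U"
  shows "f differentiable (at x within U) \<longleftrightarrow> g differentiable (at x within U)"
  and "frechet_derivative f (at x within U) = frechet_derivative g (at x within U)"
proof -
  have "(f has_derivative D) (at x within U) \<longleftrightarrow> (g has_derivative D) (at x within U)" for D
    using assms by (metis has_derivative_transform)
  then show "f differentiable (at x within U) \<longleftrightarrow> g differentiable (at x within U)"
   and "frechet_derivative f (at x within U) = frechet_derivative g (at x within U)"
    by (auto simp: differentiable_def frechet_derivative_def)
qed

lemma Ck_on_cong:
  assumes "\<And>x. x \<in> U \<Longrightarrow> f x = g x"
  shows "Ck_on E k U f \<longleftrightarrow> Ck_on E k U g"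
  using assms
proof (induction k arbitrary: f g)
  case 0
  then show ?case by (simp cong: continuous_on_cong)
next
  case (Suc k)
  have "Ck_on E k U (\<lambda>x. frechet_derivative f (at x within U) v) \<longleftrightarrow>
        Ck_on E k U (\<lambda>x. frechet_derivative g (at x within U) v)" for v
    by (rule Suc.IH) (simp add: differentiable_cong_within(2)[OF Suc.prems])
  then show ?case
    by (simp add: differentiable_cong_within(1)[of U f g, OF Suc.prems])
qed

lemma smooth_on_cong: "(\<And>x. x \<in> U \<Longrightarrow> f x = g x) \<Longrightarrow> smooth_on E U f \<longleftrightarrow> smooth_on E U g"
  unfolding smooth_on_def using Ck_on_cong by metis

lemma Ck_SucI:
  assumes "open U" "\<And>x. x \<in> U \<Longrightarrow> (f has_derivative f' x) (at x)"
    and "\<And>v. Ck k U (\<lambda>x. f' x v)"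
  shows "Ck (Suc k) U f"
proof -
  have "frechet_derivative f (at x within U) = f' x" if "x \<in> U" for x
    using assms that by (metis at_within_open frechet_derivative_at)
  then have "Ck k U (\<lambda>x. frechet_derivative f (at x within U) v)" for v
    using assms(3)[of v] by (subst Ck_on_cong[where g = "\<lambda>x. f' x v"]) auto
  moreover have "f differentiable (at x within U)" if "x \<in> U" for x
    using assms that by (metis at_within_open differentiableI)
  ultimately show ?thesis by simp
qed

lemma Ck_SucD:
  assumes "Ck (Suc k) U f" "open U"
  shows "\<And>x. x \<in> U \<Longrightarrow> (f has_derivative frechet_derivative f (at x)) (at x)"
    and "Ck k U (\<lambda>x. frechet_derivative f (at x) v)"
proof -
  show "(f has_derivative frechet_derivative f (at x)) (at x)" if "x \<in> U" for x
    using assms that by (metis Ck_on.simps(2) at_within_open frechet_derivative_works)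
  have "Ck k U (\<lambda>x. frechet_derivative f (at x within U) v)"
    using assms by simp
  then show "Ck k U (\<lambda>x. frechet_derivative f (at x) v)"
    using Ck_on_cong[of U "\<lambda>x. frechet_derivative f (at x within U) v" "\<lambda>x. frechet_derivative f (at x) v"]
      at_within_open[OF _ assms(2)] by auto
qed

lemma Ck_continuous: "Ck k U f \<Longrightarrow> open U \<Longrightarrow> continuous_on U f"
  by (cases k) (auto intro!: differentiable_imp_continuous_on simp: differentiable_on_def)

lemma Ck_pred: "open U \<Longrightarrow> Ck (Suc k) U f \<Longrightarrow> Ck k U f"
proof (induction k arbitrary: f)
  case 0
  then show ?case using Ck_continuous[of "Suc 0"] by simp
next
  case (Suc k)
  show ?case
    by (rule Ck_SucI[OF Suc.prems(1) Ck_SucD(1)[OF Suc.prems(2,1)]])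
       (use Suc Ck_SucD(2)[OF Suc.prems(2,1)] in auto)
qed

lemma Ck_subset: "open U \<Longrightarrow> open V \<Longrightarrow> V \<subseteq> U \<Longrightarrow> Ck k U f \<Longrightarrow> Ck k V f"
proof (induction k arbitrary: f)
  case 0
  then show ?case by (auto intro: continuous_on_subset)
next
  case (Suc k)
  show ?case
    by (rule Ck_SucI[OF Suc.prems(2)])
       (use Suc Ck_SucD[OF Suc.prems(4,1)] in auto)
qed

lemma Ck_local:
  assumes "open U" "\<And>x. x \<in> U \<Longrightarrow> \<exists>V. open V \<and> x \<in> V \<and> V \<subseteq> U \<and> Ck k V f"
  shows "Ck k U f"
  using assms(2)
proof (induction k arbitrary: f)
  case 0
  have "continuous (at x) f" if "x \<in> U" for x
    using 0[OF that] by (auto simp: continuous_on_eq_continuous_at)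
  then show ?case using assms(1) by (auto simp: continuous_on_eq_continuous_at)
next
  case (Suc k)
  have "(f has_derivative frechet_derivative f (at x)) (at x)" if "x \<in> U" for x
    using Suc.prems[OF that] Ck_SucD(1) by metis
  moreover have "Ck k U (\<lambda>x. frechet_derivative f (at x) v)" for v
  proof (rule Suc.IH)
    fix x assume "x \<in> U"
    from Suc.prems[OF this] obtain V where "open V" "x \<in> V" "V \<subseteq> U" "Ck (Suc k) V f" by blast
    then show "\<exists>V. open V \<and> x \<in> V \<and> V \<subseteq> U \<and> Ck k V (\<lambda>x. frechet_derivative f (at x) v)"
      using Ck_SucD(2) by blast
  qed
  ultimately show ?case by (intro Ck_SucI[OF assms(1)])
qed

lemma Ck_const: "open U \<Longrightarrow> Ck k U (\<lambda>x. c)"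
proof (induction k arbitrary: c)
  case (Suc k)
  show ?case by (rule Ck_SucI[where f' = "\<lambda>x v. 0"]) (use Suc in auto)
qed auto

lemma Ck_linear:
  assumes "open U" "bounded_linear f"
  shows "Ck k U f"
proof (cases k)
  case 0
  then show ?thesis using assms(2) by (simp add: linear_continuous_on)
next
  case (Suc k')
  show ?thesis unfolding Suc
    by (rule Ck_SucI[OF assms(1) bounded_linear_imp_has_derivative[OF assms(2)]])
       (rule Ck_const[OF assms(1)])
qed

lemma Ck_add: "open U \<Longrightarrow> Ck k U f \<Longrightarrow> Ck k U g \<Longrightarrow> Ck k U (\<lambda>x. f x + g x)"
proof (induction k arbitrary: f g)
  case 0
  then show ?case by (auto intro: continuous_intros)
next
  case (Suc k)
  show ?case
    by (rule Ck_SucI[OF Suc.prems(1)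
        has_derivative_add[OF Ck_SucD(1)[OF Suc.prems(2,1)] Ck_SucD(1)[OF Suc.prems(3,1)]]])
      (use Suc Ck_SucD(2)[OF Suc.prems(2,1)] Ck_SucD(2)[OF Suc.prems(3,1)] in auto)
qed

lemma Ck_sum:
  "open U \<Longrightarrow> (\<And>i. i \<in> I \<Longrightarrow> Ck k U (f i)) \<Longrightarrow> Ck k U (\<lambda>x. \<Sum>i\<in>I. f i x)"
  by (induction I rule: infinite_finite_induct) (auto simp: Ck_const intro: Ck_add)

lemma Ck_bilinear:
  assumes op: "bounded_bilinear op" and "open U"
  shows "Ck k U f \<Longrightarrow> Ck k U g \<Longrightarrow> Ck k U (\<lambda>x. op (f x) (g x))"
proof (induction k arbitrary: f g)
  case 0
  then show ?case by (auto intro: bounded_bilinear.continuous_on[OF op])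
next
  case (Suc k)
  note df = Ck_SucD[OF Suc.prems(1) assms(2)] and dg = Ck_SucD[OF Suc.prems(2) assms(2)]
  note fg = Ck_pred[OF assms(2) Suc.prems(1)] Ck_pred[OF assms(2) Suc.prems(2)]
  have "Ck k U (\<lambda>x. op (f x) (frechet_derivative g (at x) v) + op (frechet_derivative f (at x) v) (g x))" for v
    by (rule Ck_add[OF assms(2) Suc.IH[OF fg(1) dg(2)] Suc.IH[OF df(2) fg(2)]])
  note this' = this
  show ?case
    by (rule Ck_SucI[OF assms(2) bounded_bilinear.FDERIV[OF op df(1) dg(1)]]) (assumption | rule this')+
qed

lemma Ck_linear_compose:
  assumes h: "bounded_linear h" and "open U"
  shows "Ck k U f \<Longrightarrow> Ck k U (\<lambda>x. h (f x))"
proof (induction k arbitrary: f)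
  case 0
  then show ?case by (auto intro: bounded_linear.continuous_on[OF h])
next
  case (Suc k)
  show ?case
    by (rule Ck_SucI[OF assms(2) bounded_linear.has_derivative[OF h Ck_SucD(1)[OF Suc.prems assms(2)]]])
      (use Suc.IH Ck_SucD(2)[OF Suc.prems assms(2)] in auto)
qed

lemma Ck_compose:
  fixes f :: "'e::euclidean_space \<Rightarrow> 'f::euclidean_space" and g :: "'f \<Rightarrow> 'g::real_normed_vector"
  assumes "open U" "open V" "f ` U \<subseteq> V"
  shows "Ck k U f \<Longrightarrow> Ck k V g \<Longrightarrow> Ck k U (\<lambda>x. g (f x))"
proof (induction k arbitrary: g)
  case 0
  then show ?case using assms(3) by (auto intro: continuous_on_compose2)
next
  case (Suc k)
  note df = Ck_SucD[OF Suc.prems(1) assms(1)] and dg = Ck_SucD[OF Suc.prems(2) assms(2)]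
  \<comment> \<open>\<open>Ck_on\<close> only speaks of derivatives in a fixed direction, whereas
    the chain rule evaluates the derivative of \<open>g\<close> in the moving direction
    \<open>frechet_derivative f (at x) v\<close>. Expanding this direction in the basis leaves fixed
    directions, to which the induction hypothesis applies.\<close>
  let ?h = "\<lambda>x v. \<Sum>b\<in>Basis. (frechet_derivative f (at x) v \<bullet> b) *\<^sub>R frechet_derivative g (at (f x)) b"
  have 1: "((\<lambda>x. g (f x)) has_derivative ?h x) (at x)" if x: "x \<in> U" for x
  proof -
    have fx: "f x \<in> V" using x assms(3) by auto
    have "?h x = (\<lambda>v. frechet_derivative g (at (f x)) (frechet_derivative f (at x) v))"
    proof
      fix v
      interpret bounded_linear "frechet_derivative g (at (f x))"
        using dg(1)[OF fx] by (rule has_derivative_bounded_linear)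
      have "frechet_derivative g (at (f x)) (\<Sum>b\<in>Basis. (frechet_derivative f (at x) v \<bullet> b) *\<^sub>R b) = ?h x v"
        by (simp add: sum scaleR)
      then show "?h x v = frechet_derivative g (at (f x)) (frechet_derivative f (at x) v)"
        by (simp add: euclidean_representation)
    qed
    with has_derivative_compose[OF df(1)[OF x] dg(1)[OF fx]] show ?thesis by simp
  qed
  have 2: "Ck k U (\<lambda>x. ?h x v)" for v
  proof (intro Ck_sum[OF assms(1)] Ck_bilinear[OF bounded_bilinear_scaleR assms(1)])
    fix b
    show "Ck k U (\<lambda>x. frechet_derivative f (at x) v \<bullet> b)"
      by (rule Ck_linear_compose[OF bounded_linear_inner_left assms(1) df(2)])
    show "Ck k U (\<lambda>x. frechet_derivative g (at (f x)) b)"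
      by (rule Suc.IH[OF Ck_pred[OF assms(1) Suc.prems(1)] dg(2)])
  qed
  show ?case by (rule Ck_SucI[OF assms(1) 1 2])
qed

lemma smooth_compose:
  fixes f :: "'e::euclidean_space \<Rightarrow> 'f::euclidean_space" and g :: "'f \<Rightarrow> 'g::real_normed_vector"
  assumes "open U" "open V" "f ` U \<subseteq> V" "smooth U f" "smooth V g"
  shows "smooth U (\<lambda>x. g (f x))"
  using assms Ck_compose unfolding smooth_on_def by blast

lemma smooth_const: "open U \<Longrightarrow> smooth U (\<lambda>x. c)"
  and smooth_linear: "open U \<Longrightarrow> bounded_linear f \<Longrightarrow> smooth U f"
  and smooth_add: "open U \<Longrightarrow> smooth U f \<Longrightarrow> smooth U g \<Longrightarrow> smooth U (\<lambda>x. f x + g x)"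
  and smooth_sum: "open U \<Longrightarrow> (\<And>i. i \<in> I \<Longrightarrow> smooth U (h i)) \<Longrightarrow> smooth U (\<lambda>x. \<Sum>i\<in>I. h i x)"
  and smooth_subset: "open U \<Longrightarrow> open V \<Longrightarrow> V \<subseteq> U \<Longrightarrow> smooth U f \<Longrightarrow> smooth V f"
  unfolding smooth_on_def
  by (simp_all add: Ck_const Ck_linear Ck_add Ck_sum Ck_subset)

lemma smooth_bilinear:
  "bounded_bilinear op \<Longrightarrow> open U \<Longrightarrow> smooth U f \<Longrightarrow> smooth U g \<Longrightarrow> smooth U (\<lambda>x. op (f x) (g x))"
  unfolding smooth_on_def by (simp add: Ck_bilinear)

lemma smooth_linear_compose:
  "bounded_linear h \<Longrightarrow> open U \<Longrightarrow> smooth U f \<Longrightarrow> smooth U (\<lambda>x. h (f x))"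
  unfolding smooth_on_def by (simp add: Ck_linear_compose)

lemma smooth_scaleR: "open U \<Longrightarrow> smooth U f \<Longrightarrow> smooth U g \<Longrightarrow> smooth U (\<lambda>x. f x *\<^sub>R g x)"
  by (rule smooth_bilinear[OF bounded_bilinear_scaleR])

lemma smooth_mult:
  fixes f :: "_ \<Rightarrow> real"
  shows "open U \<Longrightarrow> smooth U f \<Longrightarrow> smooth U g \<Longrightarrow> smooth U (\<lambda>x. f x * g x)"
  by (rule smooth_bilinear[OF bounded_bilinear_mult])

lemma smooth_inner: "open U \<Longrightarrow> smooth U f \<Longrightarrow> smooth U g \<Longrightarrow> smooth U (\<lambda>x. f x \<bullet> g x)"
  by (rule smooth_bilinear[OF bounded_bilinear_inner])

lemma smooth_ident: "open U \<Longrightarrow> smooth U (\<lambda>x. x)"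
  by (rule smooth_linear) (auto simp: bounded_linear_ident)

lemma smooth_uminus: "open U \<Longrightarrow> smooth U f \<Longrightarrow> smooth U (\<lambda>x. - f x)"
  by (rule smooth_linear_compose[OF bounded_linear_minus[OF bounded_linear_ident]])

lemma smooth_diff: "open U \<Longrightarrow> smooth U f \<Longrightarrow> smooth U g \<Longrightarrow> smooth U (\<lambda>x. f x - g x)"
  using smooth_add[of U f "\<lambda>x. - g x"] smooth_uminus[of U g] by simp

lemma smooth_blinfun_apply:
  "open U \<Longrightarrow> smooth U F \<Longrightarrow> smooth U f \<Longrightarrow> smooth U (\<lambda>x. blinfun_apply (F x) (f x))"
  by (rule smooth_bilinear[OF bounded_bilinear_blinfun_apply])

lemma smooth_blinfun_compose:
  "open U \<Longrightarrow> smooth U F \<Longrightarrow> smooth U G \<Longrightarrow> smooth U (\<lambda>x. F x o\<^sub>L G x)"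
  by (rule smooth_bilinear[OF bounded_bilinear_blinfun_compose])

lemma smooth_local:
  assumes "open U" "\<And>x. x \<in> U \<Longrightarrow> \<exists>V. open V \<and> x \<in> V \<and> V \<subseteq> U \<and> smooth V f"
  shows "smooth U f"
  unfolding smooth_on_def using assms(2) by (intro allI Ck_local[OF assms(1)]) (meson smooth_on_def)

lemma smooth_has_derivative:
  assumes "smooth U f" "open U" "x \<in> U"
  shows "(f has_derivative frechet_derivative f (at x)) (at x)"
  using Ck_SucD(1)[of 0 U f x] assms unfolding smooth_on_def by blast

lemma smooth_derivative:
  assumes "smooth U f" "open U"
  shows "smooth U (\<lambda>x. frechet_derivative f (at x) v)"
  unfolding smooth_on_def
proof
  fix k
  have "Ck (Suc k) U f" using assms by (simp only: smooth_on_def)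
  then show "Ck k U (\<lambda>x. frechet_derivative f (at x) v)" by (rule Ck_SucD(2)[OF _ assms(2)])
qed

lemma smooth_continuous: "smooth U f \<Longrightarrow> open U \<Longrightarrow> continuous_on U f"
  unfolding smooth_on_def by (meson Ck_continuous)

lemma Ck_componentwise:
  fixes f :: "'e::euclidean_space \<Rightarrow> 'f::euclidean_space"
  assumes "open U" "\<And>b. b \<in> Basis \<Longrightarrow> Ck k U (\<lambda>x. f x \<bullet> b)"
  shows "Ck k U f"
proof -
  have "Ck k U (\<lambda>x. \<Sum>b\<in>Basis. (f x \<bullet> b) *\<^sub>R b)"
    by (intro Ck_sum Ck_linear_compose[OF bounded_linear_scaleR_left] assms)
  then show ?thesis by (simp add: euclidean_representation)
qed

lemma smooth_componentwise:
  fixes f :: "'e::euclidean_space \<Rightarrow> 'f::euclidean_space"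
  assumes "open U" "\<And>b. b \<in> Basis \<Longrightarrow> smooth U (\<lambda>x. f x \<bullet> b)"
  shows "smooth U f"
  using assms Ck_componentwise unfolding smooth_on_def by blast

text \<open>The tensor of \<open>w\<close> with the functional \<open>b \<bullet> _\<close>. Sums of
  these reconstruct an operator from its values on the basis, which reduces smoothness of
  operator-valued maps to that of vector-valued ones.\<close>

definition rank1_blinfun :: "'e::euclidean_space \<Rightarrow> 'f::real_normed_vector \<Rightarrow> 'e \<Rightarrow>\<^sub>L 'f"
  where "rank1_blinfun b w = blinfun_scaleR_left w o\<^sub>L blinfun_inner_left b"

lemma rank1_blinfun_apply [simp]: "rank1_blinfun b w x = (b \<bullet> x) *\<^sub>R w"
  by (simp add: rank1_blinfun_def inner_commute)

lemma bounded_linear_rank1: "bounded_linear (rank1_blinfun b)"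
  unfolding rank1_blinfun_def
  by (intro bounded_linear_intros bounded_linear_blinfun_scaleR_left)

lemma blinfun_rank1_sum:
  fixes F :: "'e::euclidean_space \<Rightarrow>\<^sub>L 'f::real_normed_vector"
  shows "(\<Sum>b\<in>Basis. rank1_blinfun b (F b)) = F"
proof (rule blinfun_eqI)
  fix x
  have "F (\<Sum>b\<in>Basis. (x \<bullet> b) *\<^sub>R b) = (\<Sum>b\<in>Basis. (b \<bullet> x) *\<^sub>R F b)"
    by (simp add: blinfun.sum_right blinfun.scaleR_right inner_commute)
  then show "(\<Sum>b\<in>Basis. rank1_blinfun b (F b)) x = F x"
    by (simp add: blinfun.sum_left euclidean_representation)
qed

lemma smooth_blinfunI:
  fixes F :: "'d::euclidean_space \<Rightarrow> ('e::euclidean_space \<Rightarrow>\<^sub>L 'f::real_normed_vector)"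
  assumes "open U" "\<And>v. v \<in> Basis \<Longrightarrow> smooth U (\<lambda>x. F x v)"
  shows "smooth U F"
proof -
  have "smooth U (\<lambda>x. \<Sum>b\<in>Basis. rank1_blinfun b (F x b))"
    by (intro smooth_sum smooth_linear_compose[OF bounded_linear_rank1] assms)
  then show ?thesis by (simp add: blinfun_rank1_sum)
qed

lemma blinfun_of_linear:
  fixes f :: "'a::euclidean_space \<Rightarrow> 'b::real_normed_vector"
  shows "linear f \<Longrightarrow> blinfun_apply (Blinfun f) = f"
  by (simp add: bounded_linear_Blinfun_apply linear_conv_bounded_linear)

text \<open>The derivative as a point of a normed space, so that continuity, boundedness and
  smoothness of the derivative can be stated.\<close>

definition Dop :: "('e::euclidean_space \<Rightarrow> 'f::real_normed_vector) \<Rightarrow> 'e \<Rightarrow> ('e \<Rightarrow>\<^sub>L 'f)"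
  where "Dop f x = Blinfun (frechet_derivative f (at x))"

lemma Dop_eq: "(f has_derivative f') (at x) \<Longrightarrow> blinfun_apply (Dop f x) = f'"
  unfolding Dop_def
  by (metis bounded_linear_Blinfun_apply frechet_derivative_at has_derivative_bounded_linear)

lemma Dop_apply:
  "smooth U f \<Longrightarrow> open U \<Longrightarrow> x \<in> U \<Longrightarrow> blinfun_apply (Dop f x) = frechet_derivative f (at x)"
  using Dop_eq smooth_has_derivative by blast

lemma has_derivative_Dop:
  "smooth U f \<Longrightarrow> open U \<Longrightarrow> x \<in> U \<Longrightarrow> (f has_derivative Dop f x) (at x)"
  by (simp add: Dop_apply smooth_has_derivative)

lemma smooth_Dop: "smooth U f \<Longrightarrow> open U \<Longrightarrow> smooth U (Dop f)"
proof (rule smooth_blinfunI)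
  fix v :: 'a assume a: "smooth U f" "open U"
  show "smooth U (\<lambda>x. Dop f x v)"
    using smooth_derivative[OF a, of v] by (subst smooth_on_cong[of U]) (auto simp: Dop_apply[OF a])
qed

text \<open>The identity \<open>B y - B x = - B y (A y - A x) B x\<close> first gives continuity of
  \<open>B\<close> and then the derivative \<open>- B A' B\<close>. As this expression only involves
  \<open>B\<close> and \<open>A'\<close>, class C^k of \<open>B\<close> implies class
  C^(k+1).\<close>

lemma smooth_inverse_blinfun:
  fixes A :: "'d::euclidean_space \<Rightarrow> ('e::euclidean_space \<Rightarrow>\<^sub>L 'e)" and B :: "'d \<Rightarrow> ('e \<Rightarrow>\<^sub>L 'e)"
  assumes U: "open U" and A: "smooth U A"
    and BA: "\<And>x. x \<in> U \<Longrightarrow> B x o\<^sub>L A x = id_blinfun" and AB: "\<And>x. x \<in> U \<Longrightarrow> A x o\<^sub>L B x = id_blinfun"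
  shows "smooth U B"
proof -
  have diff: "B y - B x = - (B y o\<^sub>L (A y - A x) o\<^sub>L B x)" if "x \<in> U" "y \<in> U" for x y
  proof (rule blinfun_eqI)
    fix v
    have "B y (A y (B x v)) = B x v" using BA[OF that(2)] by (metis blinfun_apply_blinfun_compose blinfun_apply_id_blinfun id_apply)
    moreover have "A x (B x v) = v" using AB[OF that(1)] by (metis blinfun_apply_blinfun_compose blinfun_apply_id_blinfun id_apply)
    ultimately show "(B y - B x) v = (- (B y o\<^sub>L (A y - A x) o\<^sub>L B x)) v"
      by (simp add: blinfun.diff_left blinfun.diff_right blinfun.minus_left)
  qed
  have contA: "continuous_on U A" by (rule smooth_continuous[OF A U])
  have contB: "continuous (at x) B" if x: "x \<in> U" for x
  proof -
    \<comment> \<open>For \<open>y\<close> with \<open>norm (A y - A x)\<close> below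
      \<open>1 / (2 * (c + 1))\<close> the identity yields
      \<open>norm (B y) \<le> c + norm (B y) / 2\<close>, hence the local bound
      \<open>2 * c\<close>.\<close>
    define c where "c = norm (B x)"
    have "continuous (at x) A" using contA U x continuous_on_eq_continuous_at by blast
    then have *: "((\<lambda>y. norm (A y - A x)) \<longlongrightarrow> 0) (at x)"
      by (simp add: continuous_at LIM_zero_iff tendsto_norm_zero)
    have "\<forall>\<^sub>F y in at x. norm (A y - A x) < 1 / (2 * (c + 1))"
      by (rule order_tendstoD(2)[OF *]) (auto simp: c_def add_nonneg_pos)
    moreover have "\<forall>\<^sub>F y in at x. y \<in> U" using U x eventually_at_topological by blast
    ultimately have ev: "\<forall>\<^sub>F y in at x. norm (B y - B x) \<le> 2 * c * c * norm (A y - A x)"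
    proof eventually_elim
      case (elim y)
      define d where "d = norm (A y - A x)"
      have c0: "0 \<le> c" and d0: "0 \<le> d" by (auto simp: c_def d_def)
      have "norm (B y - B x) \<le> norm (B y o\<^sub>L (A y - A x)) * norm (B x)"
        unfolding diff[OF x elim(2)] norm_minus_cancel by (rule norm_blinfun_compose)
      also have "\<dots> \<le> (norm (B y) * d) * c"
        unfolding c_def d_def by (intro mult_right_mono norm_blinfun_compose) auto
      finally have 1: "norm (B y - B x) \<le> norm (B y) * (d * c)" by (simp add: mult_ac)
      have "d * c \<le> 1 / (2 * (c + 1)) * c" using elim(1) c0 unfolding d_def by (intro mult_right_mono) auto
      also have "\<dots> \<le> 1/2" using c0 by (auto simp: field_simps)
      finally have dc: "d * c \<le> 1/2" .
      have "norm (B y) \<le> c + norm (B y - B x)" using norm_triangle_ineq2[of "B y" "B x"] by (simp add: c_def)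
      also have "\<dots> \<le> c + norm (B y) * (1/2)" using 1 mult_left_mono[OF dc, of "norm (B y)"] by auto
      finally have "norm (B y) \<le> 2 * c" by simp
      then have "norm (B y) * (d * c) \<le> (2 * c) * (d * c)" using c0 d0 by (intro mult_right_mono) auto
      with 1 show ?case unfolding d_def by (simp add: mult_ac)
    qed
    have "((\<lambda>y. 2 * c * c * norm (A y - A x)) \<longlongrightarrow> 0) (at x)"
      using tendsto_mult_right_zero[OF *] by blast
    then have "((\<lambda>y. B y - B x) \<longlongrightarrow> 0) (at x)" by (rule Lim_null_comparison[OF ev])
    then show ?thesis by (simp add: continuous_at LIM_zero_iff)
  qed
  have derB: "(B has_derivative (\<lambda>v. - (B x o\<^sub>L Dop A x v o\<^sub>L B x))) (at x)" if x: "x \<in> U" for x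
  proof -
    have 1: "(A has_derivative Dop A x) (at x)" by (rule has_derivative_Dop[OF A U x])
    have "((\<lambda>y. - (B x o\<^sub>L (A y - A x) o\<^sub>L B x)) has_derivative (\<lambda>v. - (B x o\<^sub>L Dop A x v o\<^sub>L B x))) (at x)"
      by (auto intro!: derivative_eq_intros 1 bounded_linear.has_derivative[of "\<lambda>F. F o\<^sub>L B x"]
          bounded_linear.has_derivative[of "\<lambda>F. B x o\<^sub>L F"] bounded_linear_intros)
    \<comment> \<open>The remainder is a product of \<open>B y - B x\<close>, which tends to zero,
      and a factor containing \<open>A y - A x\<close>, which is of first order.\<close>
    moreover have "((\<lambda>y. B y - B x + (B x o\<^sub>L (A y - A x) o\<^sub>L B x)) has_derivative (\<lambda>v. 0)) (at x)"
    proof -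
      have h1: "((\<lambda>y. (B y - B x) o\<^sub>L ((A y - A x) o\<^sub>L B x)) has_derivative (\<lambda>v. 0)) (at x)"
      proof -
        obtain K where K: "\<forall>\<^sub>F y in at x. norm (A y - A x) \<le> K * norm (y - x)"
        proof -
          obtain K where K: "\<And>v. norm (Dop A x v) \<le> norm v * K"
            using bounded_linear.pos_bounded[OF blinfun.bounded_linear_right[of "Dop A x"]] by blast
          have "\<forall>\<^sub>F y in at x. norm (A y - A x - Dop A x (y - x)) \<le> 1 * norm (y - x)"
            using 1 unfolding has_derivative_within_alt2 by (meson zero_less_one)
          then have "\<forall>\<^sub>F y in at x. norm (A y - A x) \<le> (1 + K) * norm (y - x)"
          proof eventually_elim
            case (elim y)
            show ?case using norm_triangle_sub[of "A y - A x" "Dop A x (y - x)"] K[of "y - x"] elim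
              by (auto simp: algebra_simps)
          qed
          then show ?thesis using that by blast
        qed
        define K' where "K' = (\<bar>K\<bar> + 1) * (norm (B x) + 1)"
        have K': "K' > 0" by (simp add: K'_def add_nonneg_pos)
        show ?thesis unfolding has_derivative_within_alt2
        proof (intro conjI allI impI)
          fix e :: real assume "0 < e"
          have "((\<lambda>y. B y - B x) \<longlongrightarrow> 0) (at x)" using contB[OF x] by (simp add: continuous_at LIM_zero_iff)
          then have "\<forall>\<^sub>F y in at x. norm (B y - B x) < e / K'"
            using K' \<open>0 < e\<close> order_tendstoD(2)[OF tendsto_norm_zero] by fastforce
          with K show "\<forall>\<^sub>F y in at x. norm (((B y - B x) o\<^sub>L ((A y - A x) o\<^sub>L B x)) - ((B x - B x) o\<^sub>L ((A x - A x) o\<^sub>L B x)) - 0) \<le> e * norm (y - x)"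
          proof eventually_elim
            case (elim y)
            have "norm ((A y - A x) o\<^sub>L B x) \<le> norm (A y - A x) * norm (B x)" by (rule norm_blinfun_compose)
            also have "\<dots> \<le> ((\<bar>K\<bar> + 1) * norm (y - x)) * (norm (B x) + 1)"
              using elim(1) by (intro mult_mono) (auto intro!: order.trans[OF elim(1)] mult_right_mono)
            also have "\<dots> = K' * norm (y - x)" by (simp add: K'_def)
            finally have 2: "norm ((A y - A x) o\<^sub>L B x) \<le> K' * norm (y - x)" .
            have "norm ((B y - B x) o\<^sub>L ((A y - A x) o\<^sub>L B x)) \<le> norm (B y - B x) * norm ((A y - A x) o\<^sub>L B x)"
              by (rule norm_blinfun_compose)
            also have "\<dots> \<le> (e / K') * (K' * norm (y - x))"
              using elim(2) 2 K' \<open>0 < e\<close> by (intro mult_mono) auto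
            finally show ?case using K' by simp
          qed
        qed simp
      qed
      have h2: "\<forall>\<^sub>F y in nhds x. B y - B x + (B x o\<^sub>L (A y - A x) o\<^sub>L B x) = - ((B y - B x) o\<^sub>L ((A y - A x) o\<^sub>L B x))"
      proof -
        have "\<forall>\<^sub>F y in nhds x. y \<in> U" using U x eventually_nhds by blast
        then show ?thesis
        proof eventually_elim
          case (elim y)
          show ?case
          proof (rule blinfun_eqI)
            fix v
            have "B y v - B x v = - B y (A y (B x v) - A x (B x v))"
              using arg_cong[OF diff[OF x elim], of "\<lambda>F. blinfun_apply F v"]
              by (simp add: blinfun.diff_left blinfun.minus_left)
            then show "(B y - B x + (B x o\<^sub>L (A y - A x) o\<^sub>L B x)) v
                = (- ((B y - B x) o\<^sub>L ((A y - A x) o\<^sub>L B x))) v"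
              by (simp add: blinfun.diff_left blinfun.minus_left blinfun.add_left blinfun.diff_right)
          qed
        qed
      qed
      have "\<forall>\<^sub>F y in at x. (B y - B x) o\<^sub>L ((A y - A x) o\<^sub>L B x) = - (B y - B x + (B x o\<^sub>L (A y - A x) o\<^sub>L B x))"
        unfolding eventually_at_filter using h2 by (rule eventually_mono) (simp only: minus_minus simp_thms)
      from has_derivative_minus[OF has_derivative_transform_eventually[OF h1 this]] show ?thesis
        by (simp only: minus_minus minus_zero diff_self bounded_bilinear.zero_left[OF bounded_bilinear_blinfun_compose]
            bounded_bilinear.zero_right[OF bounded_bilinear_blinfun_compose]
            add_0_left UNIV_I simp_thms True_implies_equals)
    qed
    ultimately have "((\<lambda>y. - (B x o\<^sub>L (A y - A x) o\<^sub>L B x) + (B y - B x + (B x o\<^sub>L (A y - A x) o\<^sub>L B x)) + B x)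
        has_derivative (\<lambda>v. - (B x o\<^sub>L Dop A x v o\<^sub>L B x) + 0 + 0)) (at x)"
      by (intro has_derivative_add has_derivative_const)
    then show ?thesis by simp
  qed
  have "Ck k U B" for k
  proof (induction k)
    case 0
    then show ?case using contB U by (simp add: continuous_on_eq_continuous_at)
  next
    case (Suc k)
    have "Ck k U (\<lambda>x. Dop A x v)" for v
      using smooth_linear_compose[OF _ U smooth_Dop[OF A U], of "\<lambda>F. F v"]
      by (simp add: smooth_on_def blinfun.bounded_linear_left)
    then show ?case
      by (intro Ck_SucI[OF U derB] Ck_linear_compose[OF bounded_linear_minus[OF bounded_linear_ident] U]
          Ck_bilinear[OF bounded_bilinear_blinfun_compose U] Suc)
  qed
  then show ?thesis by (simp add: smooth_on_def)
qed

section \<open>Smoothness relative to a subspace, reduced to open sets by orthogonal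
  projection\<close>

subsection \<open>Orthogonal projections and smoothness relative to a subspace\<close>

definition ONB :: "'e::euclidean_space set \<Rightarrow> 'e set" where
  "ONB E = (SOME B. B \<subseteq> E \<and> pairwise orthogonal B \<and> (\<forall>x\<in>B. norm x = 1) \<and> finite B \<and> span B = E)"

definition proj :: "'e::euclidean_space set \<Rightarrow> 'e \<Rightarrow> 'e" where
  "proj E x = (\<Sum>b\<in>ONB E. (x \<bullet> b) *\<^sub>R b)"

context
  fixes E :: "'e::euclidean_space set"
  assumes E: "subspace E"
begin

lemma ONB: "ONB E \<subseteq> E" "pairwise orthogonal (ONB E)" "x \<in> ONB E \<Longrightarrow> norm x = 1"
  "finite (ONB E)" "span (ONB E) = E"
proof -
  obtain B where "B \<subseteq> E" "pairwise orthogonal B" "\<And>x. x \<in> B \<Longrightarrow> norm x = 1" "independent B" "span B = E"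
    using orthonormal_basis_subspace[OF E] by metis
  then have "\<exists>B. B \<subseteq> E \<and> pairwise orthogonal B \<and> (\<forall>x\<in>B. norm x = 1) \<and> finite B \<and> span B = E"
    using independent_imp_finite by blast
  from someI_ex[OF this]
  show "ONB E \<subseteq> E" "pairwise orthogonal (ONB E)" "x \<in> ONB E \<Longrightarrow> norm x = 1"
    "finite (ONB E)" "span (ONB E) = E"
    by (auto simp: ONB_def)
qed

lemma proj_in: "proj E x \<in> E"
  unfolding proj_def using ONB(1) E by (intro subspace_sum[OF E]) (auto intro: subspace_scale[OF E])

lemma linear_proj: "linear (proj E)"
  unfolding proj_def by (rule linearI) (auto simp: inner_add_left scaleR_add_left sum.distrib scaleR_sum_right)

lemma proj_ONB: "b \<in> ONB E \<Longrightarrow> proj E b = b"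
proof -
  assume b: "b \<in> ONB E"
  have "proj E b = (\<Sum>c\<in>ONB E. if c = b then b else 0)"
    unfolding proj_def
  proof (rule sum.cong)
    fix c assume "c \<in> ONB E"
    then show "(b \<bullet> c) *\<^sub>R c = (if c = b then b else 0)"
      using ONB(2) ONB(3)[OF b] b by (auto simp: pairwise_def orthogonal_def norm_eq_1)
  qed simp
  then show ?thesis using b ONB(4) by simp
qed

lemma proj_id: "x \<in> E \<Longrightarrow> proj E x = x"
  using linear_eq_on_span[OF linear_proj linear_id, of "ONB E" x] proj_ONB ONB(5) by auto

lemma proj_proj [simp]: "proj E (proj E x) = proj E x"
  by (rule proj_id[OF proj_in])

lemma proj_sym: "proj E x \<bullet> y = x \<bullet> proj E y"
  unfolding proj_def by (simp add: inner_sum_left inner_sum_right mult.commute inner_commute)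

lemma proj_norm_le: "norm (proj E x) \<le> norm x"
proof -
  have "proj E x \<bullet> proj E x = x \<bullet> proj E x" by (simp add: proj_sym)
  then have "norm (proj E x) ^ 2 \<le> norm x * norm (proj E x)"
    by (metis norm_cauchy_schwarz power2_norm_eq_inner)
  then show ?thesis by (auto simp: power2_eq_square mult_le_cancel_right)
qed

lemma bounded_linear_proj: "bounded_linear (proj E)"
  using linear_proj by (simp add: linear_conv_bounded_linear)

lemma continuous_on_proj: "continuous_on U (proj E)"
  by (rule linear_continuous_on[OF bounded_linear_proj])

lemma open_proj_vimage:
  assumes "openin (top_of_set E) U" shows "open (proj E -` U)"
proof -
  obtain T where "open T" "U = E \<inter> T" using assms by (auto simp: openin_open)
  then have "proj E -` U = proj E -` T" using proj_in by auto
  then show ?thesis using \<open>open T\<close> continuous_on_proj[of UNIV] by (metis open_vimage)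
qed

text \<open>Composing with the projection extends \<open>f\<close> to an open set, constantly in the
  normal directions. Its derivative along \<open>v\<close> is that of \<open>f\<close> along
  \<open>proj E v\<close>, and directions in \<open>E\<close> are the only ones tested by
  \<open>Ck_on E\<close>.\<close>

lemma Ck_on_proj_iff:
  assumes U: "openin (top_of_set E) U"
  shows "Ck_on E k U f \<longleftrightarrow> Ck k (proj E -` U) (\<lambda>x. f (proj E x))"
proof (induction k arbitrary: f)
  case 0
  have "U \<subseteq> E" using U openin_imp_subset by blast
  have "continuous_on U f" if "continuous_on (proj E -` U) (\<lambda>x. f (proj E x))"
  proof -
    have "continuous_on U (\<lambda>x. f (proj E x))"
      by (rule continuous_on_subset[OF that]) (use \<open>U \<subseteq> E\<close> in \<open>auto simp: proj_id subsetD\<close>)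
    then show ?thesis using \<open>U \<subseteq> E\<close> by (subst continuous_on_cong[where g = "\<lambda>x. f (proj E x)"]) (auto simp: proj_id subsetD)
  qed
  moreover have "continuous_on (proj E -` U) (\<lambda>x. f (proj E x))" if "continuous_on U f"
    using that by (rule continuous_on_compose2[OF _ continuous_on_proj]) auto
  ultimately show ?case by auto
next
  case (Suc k)
  let ?V = "proj E -` U" and ?F = "\<lambda>x. f (proj E x)"
  have V: "open ?V" by (rule open_proj_vimage[OF U])
  have UE: "U \<subseteq> E" using U openin_imp_subset by blast
  have UV: "U \<subseteq> ?V" using UE proj_id by auto
  have IH: "(\<forall>v\<in>E. Ck_on E k U (\<lambda>x. frechet_derivative f (at x within U) v)) \<longleftrightarrow>
     (\<forall>v. Ck k ?V (\<lambda>x. frechet_derivative f (at (proj E x) within U) (proj E v)))"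
  proof safe
    fix v assume *: "\<forall>v\<in>E. Ck_on E k U (\<lambda>x. frechet_derivative f (at x within U) v)"
    show "Ck k ?V (\<lambda>x. frechet_derivative f (at (proj E x) within U) (proj E v))"
      using *[rule_format, OF proj_in] by (simp only: Suc.IH)
  next
    fix v assume *: "\<forall>v. Ck k ?V (\<lambda>x. frechet_derivative f (at (proj E x) within U) (proj E v))" and "v \<in> E"
    show "Ck_on E k U (\<lambda>x. frechet_derivative f (at x within U) v)"
      using *[rule_format, of v] by (simp only: Suc.IH proj_id[OF \<open>v \<in> E\<close>])
  qed
  have 1: "(?F has_derivative (\<lambda>v. D (proj E v))) (at x)"
    if "(f has_derivative D) (at (proj E x) within U)" "x \<in> ?V" for D x
  proof -
    have "(proj E has_derivative proj E) (at x within ?V)"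
      using bounded_linear_imp_has_derivative[OF bounded_linear_proj] .
    moreover have "(f has_derivative D) (at (proj E x) within proj E ` ?V)"
      by (rule has_derivative_subset[OF that(1)]) auto
    ultimately have "(?F has_derivative (\<lambda>v. D (proj E v))) (at x within ?V)"
      by (rule has_derivative_in_compose)
    then show ?thesis unfolding at_within_open[OF that(2) V] .
  qed
  have 2: "(f has_derivative D) (at x within U)" if "(?F has_derivative D) (at x)" "x \<in> U" for D x
    using has_derivative_transform[of x U f ?F D] has_derivative_at_withinI[OF that(1)] that(2) UE
    by (auto simp: proj_id subsetD)
  have d: "(\<forall>x\<in>U. f differentiable (at x within U)) \<longleftrightarrow> (\<forall>x\<in>?V. ?F differentiable (at x))"
  proof safe
    fix x assume "\<forall>x\<in>U. f differentiable (at x within U)" "proj E x \<in> U"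
    then show "?F differentiable (at x)" using 1[of _ x] unfolding differentiable_def by blast
  next
    fix x assume "\<forall>x\<in>?V. ?F differentiable (at x)" "x \<in> U"
    then show "f differentiable (at x within U)" using 2[of _ x] UV unfolding differentiable_def by blast
  qed
  have "frechet_derivative ?F (at x) v = frechet_derivative f (at (proj E x) within U) (proj E v)"
    if "\<forall>x\<in>U. f differentiable (at x within U)" "x \<in> ?V" for x v
  proof -
    have "(f has_derivative frechet_derivative f (at (proj E x) within U)) (at (proj E x) within U)"
      using that frechet_derivative_works by blast
    from 1[OF this that(2)] show ?thesis by (metis frechet_derivative_at)
  qed
  then have "(\<forall>x\<in>U. f differentiable (at x within U)) \<Longrightarrow>
     Ck k ?V (\<lambda>x. frechet_derivative ?F (at x) v) \<longleftrightarrow>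
     Ck k ?V (\<lambda>x. frechet_derivative f (at (proj E x) within U) (proj E v))" for v
    by (intro Ck_on_cong)
  moreover have "Ck (Suc k) ?V ?F \<longleftrightarrow> (\<forall>x\<in>?V. ?F differentiable (at x)) \<and> (\<forall>v. Ck k ?V (\<lambda>x. frechet_derivative ?F (at x) v))"
    using Ck_SucD[OF _ V, of k ?F] Ck_SucI[OF V, of ?F "\<lambda>x. frechet_derivative ?F (at x)" k]
    unfolding differentiable_def by (meson differentiableI frechet_derivative_works)
  ultimately show ?case using IH d by (auto simp del: Ck_on.simps(2) simp: Ck_on.simps(2)[of E])
qed

lemma smooth_on_proj_iff:
  assumes "openin (top_of_set E) U"
  shows "smooth_on E U f \<longleftrightarrow> smooth (proj E -` U) (\<lambda>x. f (proj E x))"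
  unfolding smooth_on_def using Ck_on_proj_iff[OF assms] by blast

lemma smooth_on_restrict:
  assumes "smooth W f" "open W" "U \<subseteq> W" "openin (top_of_set E) U"
  shows "smooth_on E U f"
  unfolding smooth_on_proj_iff[OF assms(4)]
  by (rule smooth_compose[OF _ assms(2) _ smooth_linear assms(1)])
    (use assms(3) open_proj_vimage[OF assms(4)] bounded_linear_proj in auto)

end

section \<open>Lipschitz and Taylor bounds, Hadamard's lemma, inverse functions\<close>

subsection \<open>Local estimates\<close>

lemma smooth_lipschitz_on:
  fixes f :: "'e::euclidean_space \<Rightarrow> 'f::real_normed_vector"
  assumes f: "smooth U f" and U: "open U" and K: "compact K" "convex K" "K \<subseteq> U"
  obtains L where "0 \<le> L" "\<And>x y. x \<in> K \<Longrightarrow> y \<in> K \<Longrightarrow> norm (f y - f x) \<le> L * norm (y - x)"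
proof -
  have "continuous_on K (Dop f)"
    using smooth_continuous[OF smooth_Dop[OF f U] U] K(3) continuous_on_subset by blast
  then have "bounded (Dop f ` K)" using K(1) compact_continuous_image compact_imp_bounded by blast
  then obtain L where L: "0 < L" "\<And>x. x \<in> K \<Longrightarrow> norm (Dop f x) \<le> L"
    by (auto simp: bounded_pos)
  have "norm (f y - f x) \<le> L * norm (y - x)" if "x \<in> K" "y \<in> K" for x y
  proof (rule differentiable_bound[OF K(2) _ _ that(2,1)])
    show "(f has_derivative Dop f z) (at z within K)" if "z \<in> K" for z
      using has_derivative_Dop[OF f U] that K(3) has_derivative_at_withinI by blast
    show "onorm (Dop f z) \<le> L" if "z \<in> K" for z
      using L(2)[OF that] by (simp add: norm_blinfun.rep_eq)
  qed
  then show ?thesis using that[of L] L(1) by auto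
qed

lemma smooth_taylor2:
  fixes f :: "'e::euclidean_space \<Rightarrow> 'f::real_normed_vector"
  assumes f: "smooth U f" and U: "open U" and K: "compact K" "convex K" "K \<subseteq> U"
  obtains C where "0 \<le> C" "\<And>x y. x \<in> K \<Longrightarrow> y \<in> K \<Longrightarrow> norm (f y - f x - Dop f x (y - x)) \<le> C * norm (y - x) ^ 2"
proof -
  obtain L where L: "0 \<le> L" "\<And>x y. x \<in> K \<Longrightarrow> y \<in> K \<Longrightarrow> norm (Dop f y - Dop f x) \<le> L * norm (y - x)"
    using smooth_lipschitz_on[OF smooth_Dop[OF f U] U K] by metis
  have "norm (f y - f x - Dop f x (y - x)) \<le> L * norm (y - x) ^ 2" if xy: "x \<in> K" "y \<in> K" for x y
  proof -
    \<comment> \<open>Subtracting the linear part at \<open>x\<close> leaves a map whose derivative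
      on the segment is \<open>Dop f z - Dop f x\<close>, of size at most the Lipschitz constant of
      \<open>Dop f\<close> times the length of the segment.\<close>
    let ?g = "\<lambda>z. f z - Dop f x z"
    let ?S = "closed_segment x y"
    have S: "?S \<subseteq> K" using xy K(2) by (simp add: closed_segment_subset)
    have "norm (?g y - ?g x) \<le> (L * norm (y - x)) * norm (y - x)"
    proof (rule differentiable_bound[of ?S _ "\<lambda>z. blinfun_apply (Dop f z - Dop f x)"])
      show "convex ?S" by simp
      show "(?g has_derivative (Dop f z - Dop f x)) (at z within ?S)" if "z \<in> ?S" for z
      proof -
        have "(f has_derivative Dop f z) (at z within ?S)"
          using has_derivative_Dop[OF f U, of z] that S K(3) has_derivative_at_withinI by blast
        from has_derivative_diff[OF this bounded_linear_imp_has_derivative[OF blinfun.bounded_linear_right]]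
        have "((\<lambda>z. f z - Dop f x z) has_derivative (\<lambda>v. Dop f z v - Dop f x v)) (at z within ?S)" .
        then show ?thesis by (simp add: blinfun.diff_left[abs_def])
      qed
      show "onorm (Dop f z - Dop f x) \<le> L * norm (y - x)" if "z \<in> ?S" for z
      proof -
        have "norm (Dop f z - Dop f x) \<le> L * norm (z - x)" using L(2)[of x z] xy S that by auto
        also have "\<dots> \<le> L * norm (y - x)" using L(1) segment_bound(1)[OF that] by (intro mult_left_mono) auto
        finally show ?thesis by (simp add: norm_blinfun.rep_eq)
      qed
    qed auto
    then show ?thesis by (simp add: blinfun.diff_right algebra_simps power2_eq_square)
  qed
  then show ?thesis using that L(1) by blast
qed

subsection \<open>Hadamard's lemma\<close>

text \<open>The weight \<open>t ^ n\<close> closes the family under differentiation: the inner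
  derivative of \<open>x0 + t *\<^sub>R (y - x0)\<close> contributes one more factor
  \<open>t\<close>. Smoothness then follows by an induction over all \<open>n\<close> and
  \<open>F\<close> at once.\<close>

lemma radial_integral_has_derivative:
  fixes F :: "'e::euclidean_space \<Rightarrow> real"
  assumes F: "smooth (ball x0 r) F" and y: "y \<in> ball x0 r"
  shows "((\<lambda>y. integral {0..1} (\<lambda>t. t ^ n * F (x0 + t *\<^sub>R (y - x0)))) has_derivative
    (\<lambda>v. integral {0..1} (\<lambda>t. t ^ Suc n * frechet_derivative F (at (x0 + t *\<^sub>R (y - x0))) v))) (at y)"
proof -
  let ?B = "ball x0 r" and ?p = "\<lambda>y t. x0 + t *\<^sub>R (y - x0)"
  have p: "?p y t \<in> ?B" if "y \<in> ?B" "t \<in> cbox 0 1" for y and t :: real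
  proof -
    have "dist x0 (?p y t) = \<bar>t\<bar> * dist x0 y" by (simp add: dist_norm norm_minus_commute)
    also have "\<dots> \<le> 1 * dist x0 y" using that by (intro mult_right_mono) auto
    finally show ?thesis using that by auto
  qed
  have contF: "continuous_on ?B F" using smooth_continuous[OF F] by simp
  have contDF: "continuous_on ?B (Dop F)" using smooth_continuous[OF smooth_Dop[OF F]] by simp
  let ?fx = "\<lambda>y t. (t ^ Suc n) *\<^sub>R Dop F (?p y t)"
  have 1: "((\<lambda>y. t ^ n * F (?p y t)) has_derivative ?fx y t) (at y within ?B)"
    if "y \<in> ?B" "t \<in> cbox 0 1" for y t
  proof -
    have "((\<lambda>y. ?p y t) has_derivative (\<lambda>v. t *\<^sub>R v)) (at y within ?B)"
      by (auto intro!: derivative_eq_intros)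
    moreover have "(F has_derivative Dop F (?p y t)) (at (?p y t))"
      by (rule has_derivative_Dop[OF F]) (use p[OF that] in auto)
    ultimately have "((\<lambda>y. F (?p y t)) has_derivative (\<lambda>v. Dop F (?p y t) (t *\<^sub>R v))) (at y within ?B)"
      by (rule has_derivative_compose)
    then have "((\<lambda>y. t ^ n * F (?p y t)) has_derivative (\<lambda>v. t ^ n * Dop F (?p y t) (t *\<^sub>R v))) (at y within ?B)"
      by (rule has_derivative_mult_right)
    moreover have "(\<lambda>v. t ^ n * Dop F (?p y t) (t *\<^sub>R v)) = blinfun_apply (?fx y t)"
      by (auto simp: blinfun.scaleR_right blinfun.scaleR_left)
    ultimately show ?thesis by simp
  qed
  have "continuous_on (cbox 0 1) (\<lambda>t. F (?p y t))" if "y \<in> ?B" for y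
    by (rule continuous_on_compose2[OF contF]) (use p[OF that] in \<open>auto intro!: continuous_intros\<close>)
  then have 2: "(\<lambda>t. t ^ n * F (?p y t)) integrable_on cbox 0 1" if "y \<in> ?B" for y
    by (intro integrable_continuous continuous_on_mult continuous_on_power continuous_on_id) (use that in auto)
  have "continuous_on (?B \<times> cbox 0 1) (\<lambda>z. Dop F (?p (fst z) (snd z)))"
    by (rule continuous_on_compose2[OF contDF]) (use p in \<open>auto intro!: continuous_intros simp del: mem_ball\<close>)
  then have 3: "continuous_on (?B \<times> cbox 0 1) (\<lambda>(y, t). ?fx y t)"
    unfolding split_beta by (intro continuous_on_scaleR continuous_on_power continuous_on_snd continuous_on_id)
  have 4: "continuous_on (cbox 0 1) (\<lambda>t. Dop F (?p y t))"
    by (rule continuous_on_compose2[OF contDF]) (use p[OF y] in \<open>auto intro!: continuous_intros simp del: mem_ball\<close>)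
  have "((\<lambda>y. integral (cbox 0 1) (\<lambda>t. t ^ n * F (?p y t))) has_derivative integral (cbox 0 1) (?fx y)) (at y within ?B)"
    using leibniz_rule[OF 1 2 3 y] by simp
  moreover have "blinfun_apply (integral (cbox 0 1) (?fx y)) = (\<lambda>v. integral {0..1} (\<lambda>t. t ^ Suc n * frechet_derivative F (at (?p y t)) v))"
  proof
    fix v
    have "?fx y integrable_on cbox 0 1"
      by (intro integrable_continuous continuous_on_scaleR continuous_on_power continuous_on_id 4)
    then have "integral (cbox 0 1) (?fx y) v = integral (cbox 0 1) (\<lambda>t. ?fx y t v)"
      by (rule blinfun_apply_integral)
    also have "\<dots> = integral {0..1} (\<lambda>t. t ^ Suc n * frechet_derivative F (at (?p y t)) v)"
      using p[OF y] by (auto intro!: integral_cong simp: blinfun.scaleR_left Dop_apply[OF F])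
    finally show "integral (cbox 0 1) (?fx y) v = integral {0..1} (\<lambda>t. t ^ Suc n * frechet_derivative F (at (?p y t)) v)" .
  qed
  ultimately show ?thesis using at_within_open[OF y open_ball] by simp
qed

lemma smooth_radial_integral:
  fixes F :: "'e::euclidean_space \<Rightarrow> real"
  assumes "smooth (ball x0 r) F"
  shows "smooth (ball x0 r) (\<lambda>y. integral {0..1} (\<lambda>t. t ^ n * F (x0 + t *\<^sub>R (y - x0))))"
proof -
  have "Ck k (ball x0 r) (\<lambda>y. integral {0..1} (\<lambda>t. t ^ n * F (x0 + t *\<^sub>R (y - x0))))"
    if "smooth (ball x0 r) F" for k n and F :: "'e \<Rightarrow> real"
    using that
  proof (induction k arbitrary: F n)
    case 0
    show ?case unfolding Ck_on.simps(1)
      by (rule continuous_at_imp_continuous_on)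
        (rule ballI, rule has_derivative_continuous, rule radial_integral_has_derivative[OF 0])
  next
    case (Suc k)
    show ?case
      by (rule Ck_SucI[OF open_ball radial_integral_has_derivative[OF Suc.prems]])
        (assumption, rule Suc.IH[OF smooth_derivative[OF Suc.prems open_ball]])
  qed
  then show ?thesis using assms by (auto simp: smooth_on_def)
qed

text \<open>Integrating the derivative of \<open>F\<close> along the radius from \<open>x0\<close>
  to \<open>y\<close> makes the coordinates of \<open>y - x0\<close> appear as factors. The
  decomposition is what forces an abstract derivation to be a directional derivative.\<close>

lemma hadamard:
  fixes F :: "'e::euclidean_space \<Rightarrow> real"
  assumes F: "smooth (ball x0 r) F" and r: "0 < r"
  obtains g where "\<And>b. smooth (ball x0 r) (g b)" "\<And>b. g b x0 = frechet_derivative F (at x0) b"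
    "\<And>y. y \<in> ball x0 r \<Longrightarrow> F y = F x0 + (\<Sum>b\<in>Basis. ((y - x0) \<bullet> b) * g b y)"
proof
  let ?p = "\<lambda>y t. x0 + t *\<^sub>R (y - x0)"
  define g where "g = (\<lambda>b y. integral {0..1} (\<lambda>t. t ^ 0 * frechet_derivative F (at (?p y t)) b))"
  show "smooth (ball x0 r) (g b)" for b
    unfolding g_def by (rule smooth_radial_integral[OF smooth_derivative[OF F open_ball]])
  show "g b x0 = frechet_derivative F (at x0) b" for b by (simp add: g_def)
  fix y assume y: "y \<in> ball x0 r"
  have p: "?p y t \<in> ball x0 r" if "t \<in> {0..1}" for t :: real
  proof -
    have "dist x0 (?p y t) = \<bar>t\<bar> * dist x0 y" by (simp add: dist_norm norm_minus_commute)
    also have "\<dots> \<le> 1 * dist x0 y" using that by (intro mult_right_mono) auto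
    finally show ?thesis using y by auto
  qed
  have D: "(F has_derivative frechet_derivative F (at (?p y t))) (at (?p y t))" if "t \<in> {0..1}" for t
    by (rule smooth_has_derivative[OF F open_ball p[OF that]])
  have contD: "continuous_on (ball x0 r) (\<lambda>z. frechet_derivative F (at z) b)" for b
    using smooth_continuous[OF smooth_derivative[OF F open_ball] open_ball] .
  have "((\<lambda>t. F (?p y t)) has_vector_derivative frechet_derivative F (at (?p y t)) (y - x0)) (at t within {0..1})"
    if "t \<in> {0..1}" for t
  proof -
    have "(?p y has_derivative (\<lambda>s. s *\<^sub>R (y - x0))) (at t within {0..1})" by (auto intro!: derivative_eq_intros)
    from has_derivative_compose[OF this D[OF that]] show ?thesis
      unfolding has_vector_derivative_def
      using linear_cmul[OF has_derivative_linear[OF D[OF that]]] by simp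
  qed
  then have "((\<lambda>t. frechet_derivative F (at (?p y t)) (y - x0)) has_integral (F (?p y 1) - F (?p y 0))) {0..1}"
    by (intro fundamental_theorem_of_calculus) auto
  then have "F y - F x0 = integral {0..1} (\<lambda>t. frechet_derivative F (at (?p y t)) (y - x0))"
    by (simp add: integral_unique)
  also have "\<dots> = integral {0..1} (\<lambda>t. \<Sum>b\<in>Basis. ((y - x0) \<bullet> b) * frechet_derivative F (at (?p y t)) b)"
  proof (rule integral_cong)
    fix t :: real assume "t \<in> {0..1}"
    interpret linear "frechet_derivative F (at (?p y t))"
      using has_derivative_linear[OF D[OF \<open>t \<in> _\<close>]] .
    have "frechet_derivative F (at (?p y t)) (\<Sum>b\<in>Basis. ((y - x0) \<bullet> b) *\<^sub>R b) =
       (\<Sum>b\<in>Basis. ((y - x0) \<bullet> b) * frechet_derivative F (at (?p y t)) b)"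
      by (simp only: sum scaleR real_scaleR_def)
    then show "frechet_derivative F (at (?p y t)) (y - x0) = (\<Sum>b\<in>Basis. ((y - x0) \<bullet> b) * frechet_derivative F (at (?p y t)) b)"
      by (simp only: euclidean_representation)
  qed
  also have "\<dots> = (\<Sum>b\<in>Basis. integral {0..1} (\<lambda>t. ((y - x0) \<bullet> b) * frechet_derivative F (at (?p y t)) b))"
  proof (rule integral_sum)
    fix b :: 'e
    have "continuous_on {0..1} (\<lambda>t. frechet_derivative F (at (?p y t)) b)"
      by (rule continuous_on_compose2[OF contD]) (use p in \<open>auto intro!: continuous_intros simp del: mem_ball\<close>)
    then show "(\<lambda>t. ((y - x0) \<bullet> b) * frechet_derivative F (at (?p y t)) b) integrable_on {0..1}"
      by (intro integrable_continuous_real continuous_on_mult continuous_on_const)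
  qed simp
  also have "\<dots> = (\<Sum>b\<in>Basis. ((y - x0) \<bullet> b) * g b y)"
    by (simp add: g_def)
  finally show "F y = F x0 + (\<Sum>b\<in>Basis. ((y - x0) \<bullet> b) * g b y)" by simp
qed

subsection \<open>The smooth inverse function theorem\<close>

lemma linear_blinfun_apply: "linear (blinfun_apply F)"
  by (rule bounded_linear.linear[OF blinfun.bounded_linear_right])

text \<open>The derivative of \<open>g\<close> at \<open>y\<close> is the inverse of
  \<open>Dop f (g y)\<close>, a smooth function of \<open>g y\<close>. Hence every degree of
  differentiability of \<open>g\<close> yields the next one.\<close>

theorem smooth_inverse_function:
  fixes f :: "'e::euclidean_space \<Rightarrow> 'e"
  assumes f: "smooth U f" and U: "open U" and x0: "x0 \<in> U" and inj: "\<And>v. Dop f x0 v = 0 \<Longrightarrow> v = 0"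
  obtains W V g where "open W" "W \<subseteq> U" "x0 \<in> W" "open V" "homeomorphism W V f g" "smooth V g"
proof -
  have "inj (Dop f x0)" using inj linear_injective_0[of "Dop f x0"] linear_blinfun_apply by auto
  then obtain h where h: "linear h" "h \<circ> Dop f x0 = id"
    using linear_injective_left_inverse[of "Dop f x0"] linear_blinfun_apply by auto
  have inv0: "Blinfun h o\<^sub>L Dop f x0 = id_blinfun"
    by (rule blinfun_eqI) (use h in \<open>simp add: blinfun_of_linear pointfree_idE\<close>)
  have contD: "continuous_on U (Dop f)" using smooth_continuous[OF smooth_Dop[OF f U] U] .
  obtain W V g g' where W: "open W" "W \<subseteq> U" "x0 \<in> W" and V: "open V" and hom: "homeomorphism W V f g"
    and g: "\<And>y. y \<in> V \<Longrightarrow> (g has_derivative g' y) (at y)"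
    and g': "\<And>y. y \<in> V \<Longrightarrow> g' y = inv (Dop f (g y))" and bij: "\<And>y. y \<in> V \<Longrightarrow> bij (Dop f (g y))"
    using inverse_function_theorem[OF U has_derivative_Dop[OF f U] contD x0 inv0] by metis
  define B where "B x = Blinfun (inv (Dop f x))" for x
  have bijW: "bij (Dop f x)" if "x \<in> W" for x
    using bij[of "f x"] hom that unfolding homeomorphism_def by auto
  have lin: "linear (inv (Dop f x))" if "x \<in> W" for x
  proof -
    have "f x \<in> V" "g (f x) = x" using hom that unfolding homeomorphism_def by auto
    then show ?thesis using has_derivative_linear[OF g[of "f x"]] g'[of "f x"] by simp
  qed
  have Bapp: "B x v = inv (Dop f x) v" if "x \<in> W" for x v
    by (simp add: B_def blinfun_of_linear[OF lin[OF that]])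
  have "smooth W B"
  proof (rule smooth_inverse_blinfun[OF W(1) smooth_subset[OF U W(1,2) smooth_Dop[OF f U]]])
    fix x assume x: "x \<in> W"
    show "B x o\<^sub>L Dop f x = id_blinfun" "Dop f x o\<^sub>L B x = id_blinfun"
      using bijW[OF x] by (auto intro!: blinfun_eqI simp: Bapp[OF x] bij_is_inj bij_is_surj surj_f_inv_f)
  qed
  have gV: "g y \<in> W" if "y \<in> V" for y using hom that unfolding homeomorphism_def by auto
  have "Ck k V g" for k
  proof (induction k)
    case 0
    then show ?case using hom by (simp add: homeomorphism_def)
  next
    case (Suc k)
    have "Ck k V (\<lambda>y. g' y v)" for v
    proof -
      have "Ck k V (\<lambda>y. B (g y))"
        by (rule Ck_compose[OF V W(1) _ Suc]) (use gV \<open>smooth W B\<close> in \<open>auto simp: smooth_on_def\<close>)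
      then have "Ck k V (\<lambda>y. B (g y) v)"
        by (rule Ck_linear_compose[OF blinfun.bounded_linear_left V])
      then show ?thesis using Ck_on_cong[of V "\<lambda>y. B (g y) v" "\<lambda>y. g' y v"] by (simp add: Bapp gV g')
    qed
    then show ?case by (intro Ck_SucI[OF V g])
  qed
  then show ?thesis using that W V hom by (auto simp: smooth_on_def)
qed

section \<open>Manifolds in charts: smooth functions, tangent vectors as derivations,
  covectors\<close>

section \<open>Charts and tangent spaces\<close>

context
  fixes M :: "('a, 'e::euclidean_space) manifold"
  assumes M: "smooth_manifold M"
begin

lemma subspace_model: "subspace (model M)"
  using M by (simp add: smooth_manifold_def)

lemma chart_props:
  assumes "(V, \<psi>) \<in> charts M"
  shows "openin (mtop M) V" "openin (top_of_set (model M)) (\<psi> ` V)"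
    "homeomorphic_map (subtopology (mtop M) V) (top_of_set (\<psi> ` V)) \<psi>" "inj_on \<psi> V"
    "V \<subseteq> carrier M"
proof -
  show 1: "openin (mtop M) V" "openin (top_of_set (model M)) (\<psi> ` V)"
    and 2: "homeomorphic_map (subtopology (mtop M) V) (top_of_set (\<psi> ` V)) \<psi>"
    using M assms by (auto simp: smooth_manifold_def)
  show 3: "V \<subseteq> carrier M" using openin_subset[OF 1(1)] by (simp add: carrier_def)
  show "inj_on \<psi> V" using homeomorphic_imp_injective_map[OF 2] 3
    by (simp add: carrier_def Int_absorb1)
qed

lemma chart_cover:
  assumes "x \<in> carrier M" obtains V \<psi> where "(V, \<psi>) \<in> charts M" "x \<in> V"
proof -
  have "carrier M = (\<Union>(U, \<phi>) \<in> charts M. U)" using M by (simp add: smooth_manifold_def)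
  then show ?thesis using that assms by auto
qed

lemma chart_transition:
  "(U, \<phi>) \<in> charts M \<Longrightarrow> (V, \<psi>) \<in> charts M \<Longrightarrow> smooth_on (model M) (\<phi> ` (U \<inter> V)) (\<psi> \<circ> inv_into U \<phi>)"
proof -
  assume c: "(U, \<phi>) \<in> charts M" "(V, \<psi>) \<in> charts M"
  have "\<forall>(U, \<phi>) \<in> charts M. \<forall>(V, \<psi>) \<in> charts M.
        smooth_on (model M) (\<phi> ` (U \<inter> V)) (\<psi> \<circ> inv_into U \<phi>)"
    using M by (simp add: smooth_manifold_def)
  from bspec[OF this c(1), simplified, THEN bspec, OF c(2)] show ?thesis by simp
qed

lemma chart_open_image:
  assumes c: "(V, \<psi>) \<in> charts M" and W: "openin (mtop M) W"
  shows "openin (top_of_set (model M)) (\<psi> ` (W \<inter> V))"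
proof -
  note p = chart_props[OF c]
  have "open_map (subtopology (mtop M) V) (top_of_set (\<psi> ` V)) \<psi>"
    using homeomorphic_imp_open_map[OF p(3)] .
  moreover have "openin (subtopology (mtop M) V) (W \<inter> V)"
    using W by (simp add: openin_subtopology_Int)
  ultimately have "openin (top_of_set (\<psi> ` V)) (\<psi> ` (W \<inter> V))" by (simp add: open_map_def)
  then show ?thesis using openin_trans p(2) by blast
qed

lemma chart_continuous:
  assumes c: "(V, \<psi>) \<in> charts M" and G: "open G"
  shows "openin (mtop M) {y \<in> V. \<psi> y \<in> G}"
proof -
  note p = chart_props[OF c]
  have "openin (subtopology (mtop M) V) {y \<in> topspace (subtopology (mtop M) V). \<psi> y \<in> G \<inter> \<psi> ` V}"
    by (rule openin_continuous_map_preimage[OF homeomorphic_imp_continuous_map[OF p(3)]])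
      (use G in \<open>auto simp: openin_open\<close>)
  also have "{y \<in> topspace (subtopology (mtop M) V). \<psi> y \<in> G \<inter> \<psi> ` V} = {y \<in> V. \<psi> y \<in> G}"
    using p(5) by (auto simp: carrier_def)
  finally show ?thesis using p(1) openin_trans_full by blast
qed

lemma smooth_fun_iff:
  "smooth_fun M W f \<longleftrightarrow> openin (mtop M) W \<and> (\<forall>(V, \<psi>) \<in> charts M.
     smooth (proj (model M) -` \<psi> ` (W \<inter> V)) (\<lambda>z. f (inv_into V \<psi> (proj (model M) z))))"
proof (cases "openin (mtop M) W")
  case True
  have "smooth_on (model M) (\<psi> ` (W \<inter> V)) (f \<circ> inv_into V \<psi>) \<longleftrightarrow>
    smooth (proj (model M) -` \<psi> ` (W \<inter> V)) (\<lambda>z. f (inv_into V \<psi> (proj (model M) z)))"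
    if "(V, \<psi>) \<in> charts M" for V \<psi>
    unfolding o_def by (rule smooth_on_proj_iff[OF subspace_model chart_open_image[OF that True]])
  with True show ?thesis unfolding smooth_fun_def by blast
qed (simp add: smooth_fun_def)

lemma smooth_fun_cong:
  assumes "smooth_fun M W f" "\<And>y. y \<in> W \<Longrightarrow> f y = g y"
  shows "smooth_fun M W g"
proof -
  have "smooth_on (model M) (\<psi> ` (W \<inter> V)) (g \<circ> inv_into V \<psi>)" if c: "(V, \<psi>) \<in> charts M" for V \<psi>
  proof -
    have "smooth_on (model M) (\<psi> ` (W \<inter> V)) (f \<circ> inv_into V \<psi>)"
      using assms(1) c by (auto simp: smooth_fun_def)
    then show ?thesis
      by (subst smooth_on_cong[of _ _ "f \<circ> inv_into V \<psi>"])
        (use assms(2) chart_props(4)[OF c] in \<open>auto simp: inv_into_f_f\<close>)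
  qed
  then show ?thesis using assms(1) by (auto simp: smooth_fun_def)
qed

lemma smooth_fun_subset:
  assumes f: "smooth_fun M W f" and W': "openin (mtop M) W'" "W' \<subseteq> W"
  shows "smooth_fun M W' f"
proof -
  have W: "openin (mtop M) W" using f by (simp add: smooth_fun_def)
  have "smooth (proj (model M) -` \<psi> ` (W' \<inter> V)) (\<lambda>z. f (inv_into V \<psi> (proj (model M) z)))"
    if c: "(V, \<psi>) \<in> charts M" for V \<psi>
    by (rule smooth_subset[of "proj (model M) -` \<psi> ` (W \<inter> V)"])
      (use open_proj_vimage[OF subspace_model chart_open_image[OF c W]]
          open_proj_vimage[OF subspace_model chart_open_image[OF c W'(1)]] f W' c
        in \<open>auto simp: smooth_fun_iff\<close>)
  then show ?thesis using W' by (auto simp: smooth_fun_iff)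
qed

lemma smooth_fun_local:
  assumes W: "openin (mtop M) W" and loc: "\<And>x. x \<in> W \<Longrightarrow> \<exists>W'. x \<in> W' \<and> smooth_fun M W' f"
  shows "smooth_fun M W f"
proof -
  have "smooth (proj (model M) -` \<psi> ` (W \<inter> V)) (\<lambda>z. f (inv_into V \<psi> (proj (model M) z)))"
    if c: "(V, \<psi>) \<in> charts M" for V \<psi>
  proof (rule smooth_local)
    show "open (proj (model M) -` \<psi> ` (W \<inter> V))"
      by (rule open_proj_vimage[OF subspace_model chart_open_image[OF c W]])
    fix z assume "z \<in> proj (model M) -` \<psi> ` (W \<inter> V)"
    then obtain y where y: "proj (model M) z = \<psi> y" "y \<in> W" "y \<in> V" by auto
    obtain W' where W': "y \<in> W'" "smooth_fun M W' f" using loc[OF y(2)] by blast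
    have "smooth_fun M (W' \<inter> W) f"
      by (rule smooth_fun_subset[OF W'(2)]) (use W' W in \<open>auto simp: smooth_fun_def\<close>)
    then show "\<exists>N. open N \<and> z \<in> N \<and> N \<subseteq> proj (model M) -` \<psi> ` (W \<inter> V) \<and>
      smooth N (\<lambda>z. f (inv_into V \<psi> (proj (model M) z)))"
      using y W' c open_proj_vimage[OF subspace_model chart_open_image[OF c], of "W' \<inter> W"]
      by (intro exI[of _ "proj (model M) -` \<psi> ` (W' \<inter> W \<inter> V)"]) (auto simp: smooth_fun_iff)
  qed
  then show ?thesis using W by (auto simp: smooth_fun_iff)
qed

end

text \<open>
  A chart in a normalised form: the model space is extended to an open subset of the whole
  Euclidean space, so that the inverse \<open>\<kappa>\<close> of the chart becomes constant in the directions
  orthogonal to \<open>model M\<close>. All charts compatible with the atlas are admitted.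
\<close>

locale pchart =
  fixes M :: "('a, 'e::euclidean_space) manifold"
    and U :: "'a set" and \<phi> :: "'a \<Rightarrow> 'e" and \<kappa> :: "'e \<Rightarrow> 'a" and \<Omega> :: "'e set"
  assumes M: "smooth_manifold M" and openU: "openin (mtop M) U" and open\<Omega>: "open \<Omega>"
    and phi_in: "y \<in> U \<Longrightarrow> \<phi> y \<in> \<Omega>" and kappa_phi: "y \<in> U \<Longrightarrow> \<kappa> (\<phi> y) = y"
    and kappa_in: "z \<in> \<Omega> \<Longrightarrow> \<kappa> z \<in> U" and phi_kappa: "z \<in> \<Omega> \<Longrightarrow> \<phi> (\<kappa> z) = proj (model M) z"
    and open_kappa: "openin (mtop M) W \<Longrightarrow> open {z\<in>\<Omega>. \<kappa> z \<in> W}"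
    and open_phi: "open G \<Longrightarrow> openin (mtop M) {y\<in>U. \<phi> y \<in> G}"
    and smooth_kappa: "smooth_fun M W f \<Longrightarrow> smooth {z\<in>\<Omega>. \<kappa> z \<in> W} (\<lambda>z. f (\<kappa> z))"
    and smooth_phi: "open G \<Longrightarrow> smooth G F \<Longrightarrow> smooth_fun M {y\<in>U. \<phi> y \<in> G} (\<lambda>y. F (\<phi> y))"

lemma chart_pchart:
  assumes M: "smooth_manifold M" and c: "(V, \<psi>) \<in> charts M"
  shows "pchart M V \<psi> (\<lambda>z. inv_into V \<psi> (proj (model M) z)) (proj (model M) -` \<psi> ` V)"
proof -
  let ?E = "model M"
  let ?k = "\<lambda>z. inv_into V \<psi> (proj ?E z)"
  note p = chart_props[OF M c] and E = subspace_model[OF M]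
  have VE: "\<psi> ` V \<subseteq> ?E" using p(2) openin_imp_subset by blast
  have inv: "inv_into V \<psi> (\<psi> y) = y" if "y \<in> V" for y using p(4) that by simp
  have inE: "proj ?E (\<psi> y) = \<psi> y" if "y \<in> V" for y using VE that proj_id[OF E] by auto
  have set_eq: "{z \<in> proj ?E -` \<psi> ` V. ?k z \<in> W} = proj ?E -` \<psi> ` (W \<inter> V)" for W
    using inv by auto
  show ?thesis
  proof
    show "smooth_manifold M" "openin (mtop M) V" by fact+
    show "open (proj ?E -` \<psi> ` V)" by (rule open_proj_vimage[OF E p(2)])
    show "\<psi> y \<in> proj ?E -` \<psi> ` V" "?k (\<psi> y) = y" if "y \<in> V" for y
      using that inE inv by auto
    show "?k z \<in> V" "\<psi> (?k z) = proj ?E z" if "z \<in> proj ?E -` \<psi> ` V" for z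
      using that inv by auto
    show "open {z \<in> proj ?E -` \<psi> ` V. ?k z \<in> W}" if "openin (mtop M) W" for W
      unfolding set_eq by (rule open_proj_vimage[OF E chart_open_image[OF M c that]])
    show "openin (mtop M) {y \<in> V. \<psi> y \<in> G}" if "open G" for G
      by (rule chart_continuous[OF M c that])
    show "smooth {z \<in> proj ?E -` \<psi> ` V. ?k z \<in> W} (\<lambda>z. f (?k z))" if "smooth_fun M W f" for W f
      using that c unfolding set_eq smooth_fun_iff[OF M] by auto
    show "smooth_fun M {y \<in> V. \<psi> y \<in> G} (\<lambda>y. F (\<psi> y))" if G: "open G" "smooth G F" for G F
    proof -
      let ?W = "{y \<in> V. \<psi> y \<in> G}"
      have W: "openin (mtop M) ?W" by (rule chart_continuous[OF M c G(1)])
      have "smooth (proj ?E -` \<theta> ` (?W \<inter> V')) (\<lambda>z. F (\<psi> (inv_into V' \<theta> (proj ?E z))))"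
        if c': "(V', \<theta>) \<in> charts M" for V' \<theta>
      proof -
        let ?N = "proj ?E -` \<theta> ` (V' \<inter> V)" and ?N' = "proj ?E -` \<theta> ` (?W \<inter> V')"
        have o: "openin (top_of_set ?E) (\<theta> ` (V' \<inter> V))"
          using chart_open_image[OF M c' p(1)] by (simp add: Int_commute)
        have T: "smooth ?N (\<lambda>z. \<psi> (inv_into V' \<theta> (proj ?E z)))"
          using chart_transition[OF M c' c] smooth_on_proj_iff[OF E o, of "\<psi> \<circ> inv_into V' \<theta>"]
          by (simp only: o_def)
        have oN': "open ?N'" by (rule open_proj_vimage[OF E chart_open_image[OF M c' W]])
        have "smooth ?N' (\<lambda>z. \<psi> (inv_into V' \<theta> (proj ?E z)))"
          by (rule smooth_subset[OF open_proj_vimage[OF E o] oN' _ T]) auto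
        moreover have "(\<lambda>z. \<psi> (inv_into V' \<theta> (proj ?E z))) ` ?N' \<subseteq> G"
          using chart_props(4)[OF M c'] by auto
        ultimately show ?thesis using smooth_compose[OF oN' G(1) _ _ G(2)] by blast
      qed
      then show ?thesis using W by (auto simp: smooth_fun_iff[OF M])
    qed
  qed
qed

lemma pchart_exists:
  assumes "smooth_manifold M" "x \<in> carrier M"
  obtains U \<phi> \<kappa> \<Omega> where "pchart M U \<phi> \<kappa> \<Omega>" "x \<in> U"
  using chart_cover[OF assms] chart_pchart[OF assms(1)] by metis

context pchart begin

abbreviation "E \<equiv> model M"

lemmas subE = subspace_model[OF M]

lemma U_carrier: "x \<in> U \<Longrightarrow> x \<in> carrier M"
  using openin_subset[OF openU] by (auto simp: carrier_def)

lemma phi_E: "y \<in> U \<Longrightarrow> \<phi> y \<in> E"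
  using phi_kappa[OF phi_in] kappa_phi proj_in[OF subE] by metis

lemma proj_phi: "y \<in> U \<Longrightarrow> proj E (\<phi> y) = \<phi> y"
  by (rule proj_id[OF subE phi_E])

lemma proj_Omega: "z \<in> \<Omega> \<Longrightarrow> proj E z \<in> \<Omega>"
  using phi_in[OF kappa_in] phi_kappa by metis

lemma kappa_proj: "z \<in> \<Omega> \<Longrightarrow> \<kappa> (proj E z) = \<kappa> z"
  using kappa_phi[OF kappa_in] phi_kappa by metis

lemma phi_kappa_E: "z \<in> \<Omega> \<Longrightarrow> z \<in> E \<Longrightarrow> \<phi> (\<kappa> z) = z"
  using phi_kappa proj_id[OF subE] by metis

text \<open>One chart suffices: \<open>smooth_phi\<close> carries a smooth function of the
  coordinates back to the manifold, where smoothness refers to all charts.\<close>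

lemma smooth_near_iff:
  assumes x: "x \<in> U"
  shows "smooth_near M x f \<longleftrightarrow> (\<exists>G. open G \<and> \<phi> x \<in> G \<and> G \<subseteq> \<Omega> \<and> smooth G (\<lambda>z. f (\<kappa> z)))"
proof
  assume "smooth_near M x f"
  then obtain W where W: "x \<in> W" "smooth_fun M W f" by (auto simp: smooth_near_def)
  then have "openin (mtop M) W" by (simp add: smooth_fun_def)
  then show "\<exists>G. open G \<and> \<phi> x \<in> G \<and> G \<subseteq> \<Omega> \<and> smooth G (\<lambda>z. f (\<kappa> z))"
    using smooth_kappa[OF W(2)] open_kappa W x phi_in kappa_phi
    by (intro exI[of _ "{z\<in>\<Omega>. \<kappa> z \<in> W}"]) auto
next
  assume "\<exists>G. open G \<and> \<phi> x \<in> G \<and> G \<subseteq> \<Omega> \<and> smooth G (\<lambda>z. f (\<kappa> z))"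
  then obtain G where G: "open G" "\<phi> x \<in> G" "smooth G (\<lambda>z. f (\<kappa> z))" by blast
  have "smooth_fun M {y\<in>U. \<phi> y \<in> G} f"
    by (rule smooth_fun_cong[OF M smooth_phi[OF G(1,3)]]) (simp add: kappa_phi)
  then show "smooth_near M x f" using x G(2) unfolding smooth_near_def
    by (intro exI[of _ "{y\<in>U. \<phi> y \<in> G}"]) simp
qed

lemma smooth_near_phi:
  assumes "x \<in> U" "open G" "\<phi> x \<in> G" "smooth G F"
  shows "smooth_near M x (\<lambda>y. F (\<phi> y))"
  using smooth_phi[OF assms(2,4)] assms(1,3) unfolding smooth_near_def
  by (intro exI[of _ "{y\<in>U. \<phi> y \<in> G}"]) simp

lemma smooth_near_coord: "x \<in> U \<Longrightarrow> smooth_near M x (\<lambda>y. \<phi> y \<bullet> a)"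
  by (rule smooth_near_phi[of _ UNIV]) (auto intro!: smooth_linear bounded_linear_inner_left)

lemma smooth_fun_coord: "smooth_fun M U (\<lambda>y. \<phi> y \<bullet> a)"
  using smooth_phi[OF open_UNIV smooth_linear[OF open_UNIV bounded_linear_inner_left[of a]]] by simp

lemma smooth_near_diff:
  assumes "x \<in> U" "smooth_near M x f"
  shows "((\<lambda>z. f (\<kappa> z)) has_derivative frechet_derivative (\<lambda>z. f (\<kappa> z)) (at (\<phi> x))) (at (\<phi> x))"
  using assms smooth_near_iff smooth_has_derivative by blast

lemma smooth_near_const: "x \<in> U \<Longrightarrow> smooth_near M x (\<lambda>y. c)"
  unfolding smooth_near_iff using open\<Omega> phi_in smooth_const by blast

lemma smooth_near_add:
  assumes "x \<in> U" "smooth_near M x f" "smooth_near M x g"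
  shows "smooth_near M x (\<lambda>y. f y + g y)" and "smooth_near M x (\<lambda>y. f y * g y)"
proof -
  obtain G where G: "open G" "\<phi> x \<in> G" "G \<subseteq> \<Omega>" "smooth G (\<lambda>z. f (\<kappa> z))"
    using assms smooth_near_iff by blast
  obtain H where H: "open H" "\<phi> x \<in> H" "H \<subseteq> \<Omega>" "smooth H (\<lambda>z. g (\<kappa> z))"
    using assms smooth_near_iff by blast
  have o: "open (G \<inter> H)" using G H by auto
  have "smooth (G \<inter> H) (\<lambda>z. f (\<kappa> z))" "smooth (G \<inter> H) (\<lambda>z. g (\<kappa> z))"
    using smooth_subset[OF G(1) o _ G(4)] smooth_subset[OF H(1) o _ H(4)] by auto
  from smooth_add[OF o this] smooth_mult[OF o this]
  show "smooth_near M x (\<lambda>y. f y + g y)" "smooth_near M x (\<lambda>y. f y * g y)"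
    unfolding smooth_near_iff[OF assms(1)] using G H o by blast+
qed

lemma smooth_near_cong:
  assumes "x \<in> U" "smooth_near M x f" "openin (mtop M) W" "x \<in> W" "\<And>y. y \<in> W \<Longrightarrow> f y = g y"
  shows "smooth_near M x g"
proof -
  obtain W' where W': "x \<in> W'" "smooth_fun M W' f" using assms by (auto simp: smooth_near_def)
  then have "smooth_fun M (W \<inter> W') f"
    using assms(3) by (intro smooth_fun_subset[OF M W'(2)]) (auto simp: smooth_fun_def)
  then have "smooth_fun M (W \<inter> W') g" using assms(5) smooth_fun_cong[OF M] by blast
  then show ?thesis using W' assms(4) by (auto simp: smooth_near_def)
qed

text \<open>The derivation along the coordinate vector \<open>w\<close>. The default value 0 is the
  one prescribed by \<open>tangent_space\<close>, which makes equality of tangent vectors equality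
  of functions.\<close>

definition tv :: "'a \<Rightarrow> 'e \<Rightarrow> 'a tvec" where
  "tv x w = (\<lambda>f. if smooth_near M x f then frechet_derivative (\<lambda>z. f (\<kappa> z)) (at (\<phi> x)) w else 0)"

lemma tv_eqI:
  assumes "x \<in> U" "smooth_near M x f" "((\<lambda>z. f (\<kappa> z)) has_derivative D) (at (\<phi> x))"
  shows "tv x w f = D w"
  using assms by (simp add: tv_def frechet_derivative_at[OF assms(3), symmetric])

lemma tv_add: "x \<in> U \<Longrightarrow> tv x (u + w) = (\<lambda>f. tv x u f + tv x w f)"
  by (auto simp: tv_def fun_eq_iff linear_add[OF has_derivative_linear[OF smooth_near_diff]])

lemma tv_scale: "x \<in> U \<Longrightarrow> tv x (c *\<^sub>R u) = (\<lambda>f. c * tv x u f)"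
  by (auto simp: tv_def fun_eq_iff linear_cmul[OF has_derivative_linear[OF smooth_near_diff]])

lemma tv_zero: "x \<in> U \<Longrightarrow> tv x 0 = (\<lambda>f. 0)"
  using tv_scale[of x 0 0] by simp

text \<open>In the extended chart \<open>f (\<kappa> z)\<close> is constant normally to
  \<open>E\<close>, so normal components are invisible. Accordingly \<open>tv x\<close> determines a
  vector only up to projection, and representatives are taken in \<open>E\<close>.\<close>

lemma tv_proj:
  assumes x: "x \<in> U" shows "tv x (proj E w) = tv x w"
proof
  fix f
  show "tv x (proj E w) f = tv x w f"
  proof (cases "smooth_near M x f")
    case True
    let ?D = "frechet_derivative (\<lambda>z. f (\<kappa> z)) (at (\<phi> x))"
    have D: "((\<lambda>z. f (\<kappa> z)) has_derivative ?D) (at (proj E (\<phi> x)))"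
      using smooth_near_diff[OF x True] by (simp add: proj_phi[OF x])
    have "((\<lambda>z. f (\<kappa> (proj E z))) has_derivative (\<lambda>v. ?D (proj E v))) (at (\<phi> x))"
      by (rule has_derivative_compose[OF bounded_linear_imp_has_derivative[OF bounded_linear_proj[OF subE]] D])
    then have "((\<lambda>z. f (\<kappa> z)) has_derivative (\<lambda>v. ?D (proj E v))) (at (\<phi> x))"
      by (rule has_derivative_transform_within_open[OF _ open\<Omega> phi_in[OF x]]) (simp add: kappa_proj)
    then show ?thesis using tv_eqI[OF x True] smooth_near_diff[OF x True] by metis
  qed (simp add: tv_def)
qed

lemma tv_coord:
  assumes x: "x \<in> U" shows "tv x w (\<lambda>y. \<phi> y \<bullet> a) = proj E w \<bullet> a"
proof (rule tv_eqI[OF x smooth_near_coord[OF x]])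
  have "((\<lambda>z. proj E z \<bullet> a) has_derivative (\<lambda>w. proj E w \<bullet> a)) (at (\<phi> x))"
    by (intro bounded_linear_imp_has_derivative bounded_linear_compose[OF bounded_linear_inner_left]
       bounded_linear_proj[OF subE])
  then show "((\<lambda>z. \<phi> (\<kappa> z) \<bullet> a) has_derivative (\<lambda>w. proj E w \<bullet> a)) (at (\<phi> x))"
    by (rule has_derivative_transform_within_open[OF _ open\<Omega> phi_in[OF x]]) (simp add: phi_kappa)
qed

lemma tv_inj:
  assumes "x \<in> U" "tv x u = tv x w" shows "proj E u = proj E w"
  using tv_coord[OF assms(1)] assms(2) by (metis vector_eq_rdot)

lemma tv_in:
  assumes x: "x \<in> U" shows "tv x w \<in> tangent_space M x"
  unfolding tangent_space_def mem_Collect_eq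
proof (intro conjI allI impI)
  fix f g W assume a: "smooth_near M x f \<and> smooth_near M x g \<and> openin (mtop M) W \<and> x \<in> W \<and> (\<forall>y\<in>W. f y = g y)"
  let ?G = "{z\<in>\<Omega>. \<kappa> z \<in> W}"
  have G: "open ?G" "\<phi> x \<in> ?G" using open_kappa a x phi_in kappa_phi by auto
  have "((\<lambda>z. g (\<kappa> z)) has_derivative frechet_derivative (\<lambda>z. f (\<kappa> z)) (at (\<phi> x))) (at (\<phi> x))"
    by (rule has_derivative_transform_within_open[OF smooth_near_diff[OF x] G]) (use a in auto)
  then show "tv x w f = tv x w g" using tv_eqI[OF x] smooth_near_diff[OF x] a by metis
next
  fix f g assume a: "smooth_near M x f \<and> smooth_near M x g"
  note d = smooth_near_diff[OF x conjunct1[OF a]] smooth_near_diff[OF x conjunct2[OF a]]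
  show "tv x w (\<lambda>y. f y + g y) = tv x w f + tv x w g"
    using tv_eqI[OF x smooth_near_add(1)[OF x] has_derivative_add[OF d]] a by (simp add: tv_def)
  show "tv x w (\<lambda>y. f y * g y) = f x * tv x w g + g x * tv x w f"
    using tv_eqI[OF x smooth_near_add(2)[OF x] has_derivative_mult[OF d]] a kappa_phi[OF x] by (simp add: tv_def)
next
  fix c f assume a: "smooth_near M x f"
  show "tv x w (\<lambda>y. c * f y) = c * tv x w f"
    using tv_eqI[OF x smooth_near_add(2)[OF x smooth_near_const[OF x]] has_derivative_mult_right[OF smooth_near_diff[OF x a]]]
      a by (simp add: tv_def)
qed (simp add: tv_def)

lemma tangent_vectorD:
  assumes v: "v \<in> tangent_space M x" and x: "x \<in> U"
  shows "\<not> smooth_near M x f \<Longrightarrow> v f = 0"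
    and "smooth_near M x f \<Longrightarrow> smooth_near M x g \<Longrightarrow> openin (mtop M) W \<Longrightarrow> x \<in> W \<Longrightarrow>
        (\<And>y. y \<in> W \<Longrightarrow> f y = g y) \<Longrightarrow> v f = v g"
    and "smooth_near M x f \<Longrightarrow> smooth_near M x g \<Longrightarrow> v (\<lambda>y. f y + g y) = v f + v g"
    and "smooth_near M x f \<Longrightarrow> v (\<lambda>y. c * f y) = c * v f"
    and "smooth_near M x f \<Longrightarrow> smooth_near M x g \<Longrightarrow> v (\<lambda>y. f y * g y) = f x * v g + g x * v f"
    and "v (\<lambda>y. c) = 0"
proof -
  show 1: "smooth_near M x f \<Longrightarrow> v (\<lambda>y. c * f y) = c * v f" for c f
    using v unfolding tangent_space_def by blast
  show 2: "smooth_near M x f \<Longrightarrow> smooth_near M x g \<Longrightarrow> v (\<lambda>y. f y * g y) = f x * v g + g x * v f" for f g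
    using v unfolding tangent_space_def by blast
  have "v (\<lambda>y. 1 * 1) = 1 * v (\<lambda>y. 1) + 1 * v (\<lambda>y. 1)" by (rule 2; rule smooth_near_const[OF x])
  then have "v (\<lambda>y. 1) = 0" by simp
  then show "v (\<lambda>y. c) = 0" using 1[OF smooth_near_const[OF x], of c 1] by simp
qed (use v in \<open>unfold tangent_space_def; blast\<close>)+

lemma tangent_sum:
  assumes v: "v \<in> tangent_space M x" and x: "x \<in> U" and "finite I" "\<And>i. i \<in> I \<Longrightarrow> smooth_near M x (f i)"
  shows "smooth_near M x (\<lambda>y. \<Sum>i\<in>I. f i y) \<and> v (\<lambda>y. \<Sum>i\<in>I. f i y) = (\<Sum>i\<in>I. v (f i))"
  using assms(3,4)
proof (induction I rule: finite_induct)
  case empty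
  then show ?case using smooth_near_const[OF x] tangent_vectorD(6)[OF v x] by simp
next
  case (insert i I)
  then show ?case
    using smooth_near_add(1)[OF x, of "f i" "\<lambda>y. \<Sum>i\<in>I. f i y"]
      tangent_vectorD(3)[OF v x, of "f i" "\<lambda>y. \<Sum>i\<in>I. f i y"] by simp
qed

text \<open>Hadamard's lemma writes \<open>f\<close> near \<open>x\<close> as a constant plus
  products of \<open>?h b\<close>, which vanish at \<open>x\<close>, with smooth factors. By the
  Leibniz rule \<open>v\<close> only sees the values of these factors at \<open>x\<close>, and those
  are the partial derivatives of \<open>f\<close>.\<close>

lemma tangent_eq_tv:
  assumes v: "v \<in> tangent_space M x" and x: "x \<in> U"
  shows "v = tv x (\<Sum>b\<in>Basis. v (\<lambda>y. \<phi> y \<bullet> b) *\<^sub>R b)"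
proof
  fix f
  show "v f = tv x (\<Sum>b\<in>Basis. v (\<lambda>y. \<phi> y \<bullet> b) *\<^sub>R b) f"
  proof (cases "smooth_near M x f")
    case f: True
    let ?F = "\<lambda>z. f (\<kappa> z)" and ?D = "frechet_derivative (\<lambda>z. f (\<kappa> z)) (at (\<phi> x))"
    obtain G where G: "open G" "\<phi> x \<in> G" "G \<subseteq> \<Omega>" "smooth G ?F"
      using f smooth_near_iff[OF x] by blast
    obtain r where r: "0 < r" "ball (\<phi> x) r \<subseteq> G" using G by (meson open_contains_ball)
    let ?B = "ball (\<phi> x) r"
    obtain g where g: "\<And>b. smooth ?B (g b)" "\<And>b. g b (\<phi> x) = ?D b"
      "\<And>z. z \<in> ?B \<Longrightarrow> ?F z = ?F (\<phi> x) + (\<Sum>b\<in>Basis. ((z - \<phi> x) \<bullet> b) * g b z)"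
      using hadamard[OF smooth_subset[OF G(1) open_ball r(2) G(4)] r(1)] by metis
    let ?h = "\<lambda>b y. (\<phi> y - \<phi> x) \<bullet> b"
    have sh: "smooth_near M x (?h b)" for b
      using smooth_near_add(1)[OF x smooth_near_coord[OF x, of b] smooth_near_const[OF x, of "- (\<phi> x \<bullet> b)"]]
      by (simp add: inner_diff_left)
    have vh: "v (?h b) = v (\<lambda>y. \<phi> y \<bullet> b)" for b
      using tangent_vectorD(3)[OF v x smooth_near_coord[OF x, of b] smooth_near_const[OF x, of "- (\<phi> x \<bullet> b)"]]
        tangent_vectorD(6)[OF v x] by (simp add: inner_diff_left)
    have sg: "smooth_near M x (\<lambda>y. g b (\<phi> y))" for b
      by (rule smooth_near_phi[OF x open_ball _ g(1)]) (use r in auto)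
    note shg = smooth_near_add(2)[OF x sh sg]
    have vhg: "v (\<lambda>y. ?h b y * g b (\<phi> y)) = ?D b * v (\<lambda>y. \<phi> y \<bullet> b)" for b
      using tangent_vectorD(5)[OF v x sh sg, of b b] by (simp add: vh g(2))
    let ?S = "\<lambda>y. \<Sum>b\<in>Basis. ?h b y * g b (\<phi> y)"
    have S: "smooth_near M x ?S" "v ?S = (\<Sum>b\<in>Basis. ?D b * v (\<lambda>y. \<phi> y \<bullet> b))"
      using tangent_sum[OF v x finite_Basis, of "\<lambda>b y. ?h b y * g b (\<phi> y)", OF shg] vhg by auto
    have "v f = v (\<lambda>y. f x + ?S y)"
    proof (rule tangent_vectorD(2)[OF v x f])
      show "smooth_near M x (\<lambda>y. f x + ?S y)" by (rule smooth_near_add(1)[OF x smooth_near_const[OF x] S(1)])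
      show "openin (mtop M) {y\<in>U. \<phi> y \<in> ?B}" by (rule open_phi[OF open_ball])
      show "x \<in> {y\<in>U. \<phi> y \<in> ?B}" using x r by auto
      show "f y = f x + ?S y" if "y \<in> {y\<in>U. \<phi> y \<in> ?B}" for y
        using g(3)[of "\<phi> y"] that kappa_phi x by auto
    qed
    also have "\<dots> = (\<Sum>b\<in>Basis. ?D b * v (\<lambda>y. \<phi> y \<bullet> b))"
      using tangent_vectorD(3)[OF v x smooth_near_const[OF x] S(1)] tangent_vectorD(6)[OF v x] S(2) by simp
    also have "\<dots> = ?D (\<Sum>b\<in>Basis. v (\<lambda>y. \<phi> y \<bullet> b) *\<^sub>R b)"
      by (simp add: linear_sum[OF has_derivative_linear[OF smooth_near_diff[OF x f]]]
          linear_cmul[OF has_derivative_linear[OF smooth_near_diff[OF x f]]] mult.commute)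
    finally show ?thesis using f by (simp add: tv_def)
  qed (simp add: tangent_vectorD(1)[OF v x] tv_def)
qed

lemma tangent_obtain:
  assumes "v \<in> tangent_space M x" "x \<in> U"
  obtains w where "w \<in> E" "v = tv x w"
  using tangent_eq_tv[OF assms] tv_proj[OF assms(2)] proj_in[OF subE] by metis

lemma tangent_add:
  assumes "u \<in> tangent_space M x" "v \<in> tangent_space M x" "x \<in> U"
  shows "(\<lambda>f. u f + v f) \<in> tangent_space M x" "(\<lambda>f. c * v f) \<in> tangent_space M x"
proof -
  obtain u' v' where "u = tv x u'" "v = tv x v'"
    using tangent_obtain[OF assms(1,3)] tangent_obtain[OF assms(2,3)] by metis
  then have "(\<lambda>f. u f + v f) = tv x (u' + v')" "(\<lambda>f. c * v f) = tv x (c *\<^sub>R v')"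
    by (simp_all add: tv_add[OF assms(3)] tv_scale[OF assms(3)])
  then show "(\<lambda>f. u f + v f) \<in> tangent_space M x" "(\<lambda>f. c * v f) \<in> tangent_space M x"
    using tv_in[OF assms(3)] by metis+
qed

subsection \<open>Covectors\<close>

lemma differential_in: "x \<in> U \<Longrightarrow> differential M x f \<in> cotangent_space M x"
  unfolding cotangent_space_def differential_def by (simp add: tangent_add)

definition dphi :: "'a \<Rightarrow> 'e \<Rightarrow> 'a cvec" where
  "dphi x a = differential M x (\<lambda>y. \<phi> y \<bullet> a)"

lemma dphi_in: "x \<in> U \<Longrightarrow> dphi x a \<in> cotangent_space M x"
  unfolding dphi_def by (rule differential_in)

lemma dphi_tv: "x \<in> U \<Longrightarrow> dphi x a (tv x w) = proj E w \<bullet> a"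
  unfolding dphi_def differential_def by (simp add: tv_in tv_coord)

lemma cotangent_eqI:
  assumes x: "x \<in> U" and "\<xi> \<in> cotangent_space M x" "\<eta> \<in> cotangent_space M x"
    and "\<And>w. w \<in> E \<Longrightarrow> \<xi> (tv x w) = \<eta> (tv x w)"
  shows "\<xi> = \<eta>"
proof
  fix v
  show "\<xi> v = \<eta> v"
  proof (cases "v \<in> tangent_space M x")
    case True
    then show ?thesis using tangent_obtain[OF _ x] assms(4) by metis
  qed (use assms(2,3) in \<open>auto simp: cotangent_space_def\<close>)
qed

lemma cotangentD:
  assumes "\<xi> \<in> cotangent_space M x" "x \<in> U"
  shows "\<xi> (tv x (u + w)) = \<xi> (tv x u) + \<xi> (tv x w)" "\<xi> (tv x (c *\<^sub>R w)) = c * \<xi> (tv x w)"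
  using assms tv_in[OF assms(2)] by (auto simp: cotangent_space_def tv_add tv_scale)

lemma cotangent_closed:
  assumes "\<xi> \<in> cotangent_space M x" "\<eta> \<in> cotangent_space M x"
  shows "(\<lambda>v. \<xi> v + \<eta> v) \<in> cotangent_space M x" "(\<lambda>v. c * \<xi> v) \<in> cotangent_space M x"
  using assms by (auto simp: cotangent_space_def algebra_simps)

lemma cotangent_obtain:
  assumes xi: "\<xi> \<in> cotangent_space M x" and x: "x \<in> U"
  obtains a where "a \<in> E" "\<xi> = dphi x a"
proof
  let ?l = "\<lambda>w. \<xi> (tv x w)"
  have lin: "linear ?l" by (rule linearI) (auto simp: cotangentD[OF xi x])
  let ?a = "\<Sum>b\<in>Basis. ?l b *\<^sub>R b"
  have l: "?l w = w \<bullet> ?a" for w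
  proof -
    have "?l w = ?l (\<Sum>b\<in>Basis. (w \<bullet> b) *\<^sub>R b)" by (simp add: euclidean_representation)
    also have "\<dots> = (\<Sum>b\<in>Basis. (w \<bullet> b) * ?l b)" by (simp only: linear_sum[OF lin] linear_cmul[OF lin] real_scaleR_def)
    finally show ?thesis by (simp add: inner_sum_right mult.commute)
  qed
  show "proj E ?a \<in> E" by (rule proj_in[OF subE])
  show "\<xi> = dphi x (proj E ?a)"
  proof (rule cotangent_eqI[OF x xi dphi_in[OF x]])
    fix w assume "w \<in> E"
    then show "\<xi> (tv x w) = dphi x (proj E ?a) (tv x w)"
      using l[of w] by (simp add: dphi_tv[OF x] proj_sym[OF subE, symmetric] proj_id[OF subE])
  qed
qed

lemma dphi_add: "x \<in> U \<Longrightarrow> dphi x (a + b) = (\<lambda>v. dphi x a v + dphi x b v)"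
  by (rule cotangent_eqI[OF _ dphi_in cotangent_closed(1)[OF dphi_in dphi_in]])
    (auto simp: dphi_tv inner_add_right)

lemma dphi_scale: "x \<in> U \<Longrightarrow> dphi x (c *\<^sub>R a) = (\<lambda>v. c * dphi x a v)"
  by (rule cotangent_eqI[OF _ dphi_in cotangent_closed(2)[OF dphi_in dphi_in]])
    (auto simp: dphi_tv)

lemma dphi_proj: "x \<in> U \<Longrightarrow> dphi x (proj E a) = dphi x a"
  by (rule cotangent_eqI[OF _ dphi_in dphi_in]) (auto simp: dphi_tv proj_sym[OF subE, symmetric] proj_proj[OF subE])

lemma dphi_inj:
  assumes x: "x \<in> U" and "dphi x a = dphi x b" shows "proj E a = proj E b"
proof -
  have "w \<bullet> proj E a = w \<bullet> proj E b" for w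
    using dphi_tv[OF x, of a w] dphi_tv[OF x, of b w] assms(2) by (simp add: proj_sym[OF subE])
  then show ?thesis by (metis vector_eq_ldot)
qed

definition grad :: "('a \<Rightarrow> real) \<Rightarrow> 'e \<Rightarrow> 'e" where
  "grad f z = (\<Sum>b\<in>Basis. frechet_derivative (\<lambda>z. f (\<kappa> z)) (at z) b *\<^sub>R b)"

lemma grad_works:
  assumes "((\<lambda>z. f (\<kappa> z)) has_derivative D) (at z)"
  shows "D w = w \<bullet> grad f z"
proof -
  have D: "D = frechet_derivative (\<lambda>z. f (\<kappa> z)) (at z)" by (rule frechet_derivative_at[OF assms])
  have lin: "linear D" using has_derivative_linear[OF assms] .
  have "D w = D (\<Sum>b\<in>Basis. (w \<bullet> b) *\<^sub>R b)" by (simp add: euclidean_representation)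
  also have "\<dots> = (\<Sum>b\<in>Basis. (w \<bullet> b) * D b)" by (simp only: linear_sum[OF lin] linear_cmul[OF lin] real_scaleR_def)
  finally show ?thesis by (simp add: D grad_def inner_sum_right mult.commute)
qed

lemma tv_grad: "x \<in> U \<Longrightarrow> smooth_near M x f \<Longrightarrow> tv x w f = w \<bullet> grad f (\<phi> x)"
  using grad_works[where f = f, OF smooth_near_diff] by (simp add: tv_def)

lemma differential_eq:
  assumes x: "x \<in> U" and f: "smooth_near M x f"
  shows "differential M x f = dphi x (grad f (\<phi> x))"
proof (rule cotangent_eqI[OF x differential_in[OF x] dphi_in[OF x]])
  fix w assume "w \<in> E"
  then show "differential M x f (tv x w) = dphi x (grad f (\<phi> x)) (tv x w)"
    by (simp add: dphi_tv[OF x] proj_id[OF subE] differential_def tv_in[OF x] tv_grad[OF x f])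
qed

lemma smooth_grad:
  assumes "smooth G (\<lambda>z. f (\<kappa> z))" "open G" shows "smooth G (grad f)"
  unfolding grad_def
  by (intro smooth_sum smooth_scaleR smooth_derivative smooth_const assms)

end

section \<open>Bivectors as antisymmetric matrices depending smoothly on the chart point\<close>

subsection \<open>Bivectors in a chart\<close>

locale bichart = pchart M U \<phi> \<kappa> \<Omega>
  for M :: "('a, 'e::euclidean_space) manifold" and U \<phi> \<kappa> \<Omega> +
  fixes \<pi> :: "'a bivector"
  assumes biv: "smooth_bivector M \<pi>"
begin

lemma biv_props:
  assumes "x \<in> U" "\<xi> \<in> cotangent_space M x" "\<eta> \<in> cotangent_space M x"
  shows "\<pi> x \<xi> \<eta> = - \<pi> x \<eta> \<xi>"
    and "\<zeta> \<in> cotangent_space M x \<Longrightarrow> \<pi> x (\<lambda>v. \<xi> v + \<zeta> v) \<eta> = \<pi> x \<xi> \<eta> + \<pi> x \<zeta> \<eta>"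
    and "\<pi> x (\<lambda>v. c * \<xi> v) \<eta> = c * \<pi> x \<xi> \<eta>"
  using biv assms U_carrier[OF assms(1)] unfolding smooth_bivector_def by blast+

definition bmat :: "'a \<Rightarrow> 'e \<Rightarrow> 'e \<Rightarrow> real" where
  "bmat x a b = \<pi> x (dphi x a) (dphi x b)"

lemma bmat_antisym: "x \<in> U \<Longrightarrow> bmat x a b = - bmat x b a"
  unfolding bmat_def by (rule biv_props(1)[OF _ dphi_in dphi_in])

lemma bmat_add: "x \<in> U \<Longrightarrow> bmat x (a + c) b = bmat x a b + bmat x c b"
  unfolding bmat_def by (simp add: dphi_add biv_props(2) dphi_in)

lemma bmat_scale: "x \<in> U \<Longrightarrow> bmat x (c *\<^sub>R a) b = c * bmat x a b"
  unfolding bmat_def by (simp add: dphi_scale biv_props(3) dphi_in)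

lemma bmat_linear2: assumes x: "x \<in> U" shows "linear (bmat x a)"
proof (rule linearI)
  show "bmat x a (b + c) = bmat x a b + bmat x a c" for b c
    using bmat_add[OF x, of b c a] bmat_antisym[OF x, of a] by (metis add.inverse_inverse minus_add_distrib)
  show "bmat x a (r *\<^sub>R b) = r *\<^sub>R bmat x a b" for r b
    using bmat_scale[OF x, of r b a] bmat_antisym[OF x, of a] by (metis mult_minus_right real_scaleR_def)
qed

text \<open>Under the identifications \<open>dphi\<close> and \<open>tv\<close> this operator is the
  sharp map of the bivector, see \<open>sharp_dphi\<close>.\<close>

definition Pi :: "'e \<Rightarrow> ('e \<Rightarrow>\<^sub>L 'e)" where
  "Pi z = Blinfun (\<lambda>a. \<Sum>b\<in>Basis. bmat (\<kappa> z) a b *\<^sub>R b)"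

lemma Pi_apply: assumes "z \<in> \<Omega>" shows "Pi z a = (\<Sum>b\<in>Basis. bmat (\<kappa> z) a b *\<^sub>R b)"
proof -
  have "linear (\<lambda>a. \<Sum>b\<in>Basis. bmat (\<kappa> z) a b *\<^sub>R b)"
    by (rule linearI) (simp_all add: bmat_add[OF kappa_in[OF assms]] bmat_scale[OF kappa_in[OF assms]]
        scaleR_add_left sum.distrib scaleR_sum_right)
  then show ?thesis by (simp add: Pi_def blinfun_of_linear)
qed

lemma Pi_inner: assumes z: "z \<in> \<Omega>" shows "Pi z a \<bullet> c = \<pi> (\<kappa> z) (dphi (\<kappa> z) a) (dphi (\<kappa> z) c)"
proof -
  have lin: "linear (bmat (\<kappa> z) a)" by (rule bmat_linear2[OF kappa_in[OF z]])
  have "bmat (\<kappa> z) a c = bmat (\<kappa> z) a (\<Sum>b\<in>Basis. (c \<bullet> b) *\<^sub>R b)" by (simp add: euclidean_representation)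
  also have "\<dots> = (\<Sum>b\<in>Basis. (c \<bullet> b) * bmat (\<kappa> z) a b)"
    by (simp only: linear_sum[OF lin] linear_cmul[OF lin] real_scaleR_def)
  also have "\<dots> = Pi z a \<bullet> c"
    by (simp add: Pi_apply[OF z] inner_sum_left mult.commute inner_commute[of c])
  finally show ?thesis by (simp add: bmat_def)
qed

lemma Pi_antisym: assumes z: "z \<in> \<Omega>" shows "Pi z a \<bullet> b = - (Pi z b \<bullet> a)"
  unfolding Pi_inner[OF z] using kappa_in[OF z] by (intro biv_props(1) dphi_in)

lemma Pi_proj_arg: "z \<in> \<Omega> \<Longrightarrow> Pi z (proj E a) = Pi z a"
proof -
  assume z: "z \<in> \<Omega>"
  have "Pi z (proj E a) \<bullet> c = Pi z a \<bullet> c" for c by (simp add: Pi_inner[OF z] dphi_proj[OF kappa_in[OF z]])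
  then show ?thesis by (metis vector_eq_rdot)
qed

lemma Pi_in_E: "z \<in> \<Omega> \<Longrightarrow> Pi z a \<in> E"
proof -
  assume z: "z \<in> \<Omega>"
  have "proj E (Pi z a) \<bullet> c = Pi z a \<bullet> c" for c
    by (simp add: proj_sym[OF subE] Pi_inner[OF z] dphi_proj[OF kappa_in[OF z]])
  then have "proj E (Pi z a) = Pi z a" by (metis vector_eq_rdot)
  then show ?thesis by (metis proj_in[OF subE])
qed

lemma Pi_proj: "z \<in> \<Omega> \<Longrightarrow> Pi (proj E z) = Pi z"
  by (simp add: Pi_def kappa_proj)

lemma smooth_bracket:
  "smooth_fun M W f \<Longrightarrow> smooth_fun M W g \<Longrightarrow> smooth_fun M W (poisson_bracket M \<pi> f g)"
  using biv unfolding smooth_bivector_def by blast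

lemma smooth_Pi: "smooth \<Omega> Pi"
proof (rule smooth_blinfunI[OF open\<Omega>], rule smooth_componentwise[OF open\<Omega>])
  fix a b :: 'e
  have "smooth {z\<in>\<Omega>. \<kappa> z \<in> U} (\<lambda>z. poisson_bracket M \<pi> (\<lambda>y. \<phi> y \<bullet> a) (\<lambda>y. \<phi> y \<bullet> b) (\<kappa> z))"
    by (rule smooth_kappa[OF smooth_bracket[OF smooth_fun_coord smooth_fun_coord]])
  moreover have "{z\<in>\<Omega>. \<kappa> z \<in> U} = \<Omega>" using kappa_in by auto
  ultimately show "smooth \<Omega> (\<lambda>z. Pi z a \<bullet> b)"
    by (subst smooth_on_cong[of \<Omega> _ "\<lambda>z. poisson_bracket M \<pi> (\<lambda>y. \<phi> y \<bullet> a) (\<lambda>y. \<phi> y \<bullet> b) (\<kappa> z)"])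
      (simp_all add: Pi_inner poisson_bracket_def dphi_def)
qed

lemma sharp_dphi:
  assumes x: "x \<in> U" shows "sharp M \<pi> x (dphi x a) = tv x (Pi (\<phi> x) a)"
proof
  fix f
  show "sharp M \<pi> x (dphi x a) f = tv x (Pi (\<phi> x) a) f"
  proof (cases "smooth_near M x f")
    case True
    then show ?thesis
      by (simp add: sharp_def differential_eq[OF x True] tv_grad[OF x True] Pi_inner[OF phi_in[OF x]] kappa_phi[OF x])
  qed (simp add: sharp_def tv_def)
qed

lemma sharp_differential:
  assumes "x \<in> U" "smooth_near M x f"
  shows "sharp M \<pi> x (differential M x f) = tv x (Pi (\<phi> x) (grad f (\<phi> x)))"
  by (simp add: differential_eq[OF assms] sharp_dphi[OF assms(1)])

lemma characteristic_eq:
  assumes x: "x \<in> U" shows "characteristic_distribution M \<pi> x = tv x ` range (Pi (\<phi> x))"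
proof
  show "characteristic_distribution M \<pi> x \<subseteq> tv x ` range (Pi (\<phi> x))"
    unfolding characteristic_distribution_def using cotangent_obtain[OF _ x] sharp_dphi[OF x] by blast
  show "tv x ` range (Pi (\<phi> x)) \<subseteq> characteristic_distribution M \<pi> x"
  proof safe
    fix a
    show "tv x (Pi (\<phi> x) a) \<in> characteristic_distribution M \<pi> x"
      unfolding characteristic_distribution_def sharp_dphi[OF x, symmetric] by (rule imageI[OF dphi_in[OF x]])
  qed
qed

lemma tv_in_characteristic_iff:
  assumes x: "x \<in> U" and w: "w \<in> E"
  shows "tv x w \<in> characteristic_distribution M \<pi> x \<longleftrightarrow> w \<in> range (Pi (\<phi> x))"
proof
  assume "tv x w \<in> characteristic_distribution M \<pi> x"
  then obtain a where "tv x w = tv x (Pi (\<phi> x) a)" unfolding characteristic_eq[OF x] by auto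
  from tv_inj[OF x this] show "w \<in> range (Pi (\<phi> x))"
    using proj_id[OF subE w] proj_id[OF subE Pi_in_E[OF phi_in[OF x]]] by auto
qed (auto simp: characteristic_eq[OF x])

lemma Dop_Pi_proj:
  assumes z: "z \<in> \<Omega>" shows "Dop Pi z v = Dop Pi (proj E z) (proj E v)"
proof -
  have "((\<lambda>z. Pi (proj E z)) has_derivative (\<lambda>v. Dop Pi (proj E z) (proj E v))) (at z)"
    by (rule has_derivative_compose[OF bounded_linear_imp_has_derivative[OF bounded_linear_proj[OF subE]]
      has_derivative_Dop[OF smooth_Pi open\<Omega> proj_Omega[OF z]]])
  then have "(Pi has_derivative (\<lambda>v. Dop Pi (proj E z) (proj E v))) (at z)"
    by (rule has_derivative_transform_within_open[OF _ open\<Omega> z]) (simp add: Pi_proj)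
  from Dop_eq[OF this] show ?thesis by simp
qed

text \<open>This is the Jacobi identity for three linear coordinate functions: the inner bracket is
  the matrix entry \<open>Pi z b \<bullet> c\<close>, and bracketing it with the function of
  \<open>a\<close> differentiates it along \<open>Pi z a\<close>.\<close>

lemma Jacobi:
  assumes poi: "poisson_manifold M \<pi>" and z: "z \<in> \<Omega>"
  shows "Dop Pi z (Pi z a) b \<bullet> c + Dop Pi z (Pi z b) c \<bullet> a + Dop Pi z (Pi z c) a \<bullet> b = 0"
proof -
  let ?x = "\<kappa> z" and ?f = "\<lambda>a y. \<phi> y \<bullet> a"
  \<comment> \<open>The point \<open>\<kappa> z\<close> has coordinates \<open>proj E z\<close>, not
    \<open>z\<close>; since \<open>Pi\<close> is constant in the normal directions, the result
    transfers to \<open>z\<close> by \<open>Dop_Pi_proj\<close>.\<close>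
  let ?z = "proj E z"
  have x: "?x \<in> U" by (rule kappa_in[OF z])
  have px: "\<phi> ?x = ?z" by (rule phi_kappa[OF z])
  have "poisson_bracket M \<pi> (?f a) (poisson_bracket M \<pi> (?f b) (?f c)) ?x = Dop Pi z (Pi z a) b \<bullet> c" for a b c
  proof -
    let ?g = "poisson_bracket M \<pi> (?f b) (?f c)"
    have g: "smooth_near M ?x ?g"
      using smooth_bracket[OF smooth_fun_coord smooth_fun_coord] x unfolding smooth_near_def by blast
    have "((\<lambda>z. Pi z b \<bullet> c) has_derivative (\<lambda>v. Dop Pi ?z v b \<bullet> c)) (at ?z)"
      by (intro has_derivative_inner_left bounded_linear.has_derivative[OF blinfun.bounded_linear_left]
        has_derivative_Dop[OF smooth_Pi open\<Omega> proj_Omega[OF z]])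
    then have "((\<lambda>z. ?g (\<kappa> z)) has_derivative (\<lambda>v. Dop Pi ?z v b \<bullet> c)) (at ?z)"
      by (rule has_derivative_transform_within_open[OF _ open\<Omega> proj_Omega[OF z]])
        (simp add: Pi_inner poisson_bracket_def dphi_def)
    then have "tv ?x w ?g = Dop Pi ?z w b \<bullet> c" for w
      using tv_eqI[OF x g] px by simp
    moreover have "poisson_bracket M \<pi> (?f a) ?g ?x = sharp M \<pi> ?x (dphi ?x a) ?g"
      using g by (simp add: poisson_bracket_def sharp_def dphi_def)
    ultimately show ?thesis
      using sharp_dphi[OF x, of a] px Pi_proj[OF z] Dop_Pi_proj[OF z, of "Pi z a"]
        proj_id[OF subE Pi_in_E[OF z]] by simp
  qed
  moreover have "poisson_bracket M \<pi> (?f a) (poisson_bracket M \<pi> (?f b) (?f c)) ?x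
    + poisson_bracket M \<pi> (?f b) (poisson_bracket M \<pi> (?f c) (?f a)) ?x
    + poisson_bracket M \<pi> (?f c) (poisson_bracket M \<pi> (?f a) (?f b)) ?x = 0"
    using poi smooth_fun_coord x unfolding poisson_manifold_def by blast
  ultimately show ?thesis by simp
qed

end

section \<open>Smooth maps in charts and the local normal form of submersions\<close>

subsection \<open>Smooth maps in charts\<close>

lemma smooth_map_compose_fun:
  assumes S: "smooth_manifold S" and M: "smooth_manifold M" and p: "smooth_map S M p" and f: "smooth_fun M W f"
  shows "smooth_fun S {x \<in> carrier S. p x \<in> W} (\<lambda>x. f (p x))"
proof (rule smooth_fun_local[OF S])
  have W: "openin (mtop M) W" using f by (simp add: smooth_fun_def)
  have cont: "continuous_map (mtop S) (mtop M) p" using p by (simp add: smooth_map_def)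
  show "openin (mtop S) {x \<in> carrier S. p x \<in> W}"
    unfolding carrier_def by (rule openin_continuous_map_preimage[OF cont W])
  fix x assume x: "x \<in> {x \<in> carrier S. p x \<in> W}"
  then have px: "p x \<in> carrier M" using cont by (auto simp: carrier_def continuous_map_def)
  obtain U \<phi> where c: "(U, \<phi>) \<in> charts S" "x \<in> U" using chart_cover[OF S] x by blast
  obtain V \<psi> where d: "(V, \<psi>) \<in> charts M" "p x \<in> V" using chart_cover[OF M px] by blast
  let ?k = "\<lambda>z. inv_into U \<phi> (proj (model S) z)" and ?O = "proj (model S) -` \<phi> ` U"
  let ?l = "\<lambda>z. inv_into V \<psi> (proj (model M) z)" and ?O' = "proj (model M) -` \<psi> ` V"
  interpret s: pchart S U \<phi> ?k ?O by (rule chart_pchart[OF S c(1)])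
  interpret m: pchart M V \<psi> ?l ?O' by (rule chart_pchart[OF M d(1)])
  let ?Y = "{x \<in> U. p x \<in> V}"
  have Y: "openin (mtop S) ?Y"
  proof -
    have "openin (mtop S) (U \<inter> {x \<in> topspace (mtop S). p x \<in> V})"
      by (intro openin_Int s.openU openin_continuous_map_preimage[OF cont m.openU])
    moreover have "U \<inter> {x \<in> topspace (mtop S). p x \<in> V} = ?Y"
      using openin_subset[OF s.openU] by auto
    ultimately show ?thesis by simp
  qed
  have "smooth_on (model S) (\<phi> ` ?Y) (\<psi> \<circ> p \<circ> inv_into U \<phi>)"
  proof -
    have "\<forall>(U, \<phi>) \<in> charts S. \<forall>(V, \<psi>) \<in> charts M.
        smooth_on (model S) (\<phi> ` {x \<in> U. p x \<in> V}) (\<psi> \<circ> p \<circ> inv_into U \<phi>)"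
      using p by (simp add: smooth_map_def)
    from bspec[OF this c(1), simplified, THEN bspec, OF d(1)] show ?thesis by simp
  qed
  moreover have YU: "?Y \<inter> U = ?Y" by auto
  ultimately have sm: "smooth (proj (model S) -` \<phi> ` ?Y) (\<lambda>z. \<psi> (p (?k z)))"
    using smooth_on_proj_iff[OF s.subE, of "\<phi> ` ?Y" "\<psi> \<circ> p \<circ> inv_into U \<phi>"] chart_open_image[OF S c(1) Y]
    by (simp add: o_def)
  have oY: "open (proj (model S) -` \<phi> ` ?Y)"
    using open_proj_vimage[OF s.subE, of "\<phi> ` ?Y"] chart_open_image[OF S c(1) Y] YU by simp
  let ?N = "{z\<in>?O'. ?l z \<in> W}"
  have N: "open ?N" "smooth ?N (\<lambda>z. f (?l z))" by (rule m.open_kappa[OF W], rule m.smooth_kappa[OF f])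
  let ?G = "{z \<in> proj (model S) -` \<phi> ` ?Y. \<psi> (p (?k z)) \<in> ?N}"
  have G: "open ?G"
  proof -
    have "?G = (\<lambda>z. \<psi> (p (?k z))) -` ?N \<inter> proj (model S) -` \<phi> ` ?Y" by auto
    then show ?thesis using continuous_open_preimage[OF smooth_continuous[OF sm oY] oY N(1)] by (simp add: Int_commute)
  qed
  have "smooth ?G (\<lambda>z. f (?l (\<psi> (p (?k z)))))"
    by (rule smooth_compose[OF G N(1) _ smooth_subset[OF oY G _ sm] N(2)]) auto
  then have 1: "smooth_fun S {y\<in>U. \<phi> y \<in> ?G} (\<lambda>y. f (?l (\<psi> (p (?k (\<phi> y))))))"
    using s.smooth_phi[OF G] by blast
  have "smooth_fun S {y\<in>U. \<phi> y \<in> ?G} (\<lambda>y. f (p y))"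
  proof (rule smooth_fun_cong[OF S 1])
    fix y assume y: "y \<in> {y\<in>U. \<phi> y \<in> ?G}"
    then have k: "?k (\<phi> y) = y" using s.kappa_phi by blast
    have "proj (model S) (\<phi> y) \<in> \<phi> ` ?Y" using y by blast
    then have "\<phi> y \<in> \<phi> ` ?Y" using s.proj_phi y by simp
    then obtain y' where y': "\<phi> y = \<phi> y'" "y' \<in> ?Y" by blast
    then have "y = y'" using inj_onD[OF chart_props(4)[OF S c(1)]] y by blast
    then have "y \<in> ?Y" using y' by simp
    then show "f (?l (\<psi> (p (?k (\<phi> y))))) = f (p y)" unfolding k using m.kappa_phi by simp
  qed
  moreover have "x \<in> {y\<in>U. \<phi> y \<in> ?G}"
  proof -
    have "?k (\<phi> x) = x" by (rule s.kappa_phi[OF c(2)])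
    then show ?thesis using c(2) d(2) x m.phi_in[OF d(2)] m.kappa_phi[OF d(2)] s.proj_phi[OF c(2)] by auto
  qed
  ultimately show "\<exists>W'. x \<in> W' \<and> smooth_fun S W' (\<lambda>x. f (p x))"
    by (intro exI[of _ "{y\<in>U. \<phi> y \<in> ?G}"] conjI)
qed

locale chart_map = s: pchart S U \<phi> \<kappa> \<Omega> + m: pchart M V \<psi> \<mu> \<Theta>
  for S :: "('a, 'e::euclidean_space) manifold" and U \<phi> \<kappa> \<Omega>
    and M :: "('b, 'f::euclidean_space) manifold" and V \<psi> \<mu> \<Theta> +
  fixes p :: "'a \<Rightarrow> 'b"
  assumes p: "smooth_map S M p"
begin

lemma p_near: "smooth_near M (p x) f \<Longrightarrow> x \<in> carrier S \<Longrightarrow> smooth_near S x (\<lambda>x. f (p x))"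
proof -
  assume "smooth_near M (p x) f" and x: "x \<in> carrier S"
  then obtain W where W: "p x \<in> W" "smooth_fun M W f" by (auto simp: smooth_near_def)
  show ?thesis unfolding smooth_near_def
    by (rule exI[of _ "{x \<in> carrier S. p x \<in> W}"]) (use W x smooth_map_compose_fun[OF s.M m.M p W(2)] in simp)
qed

definition phat :: "'e \<Rightarrow> 'f" where "phat z = \<psi> (p (\<kappa> z))"

definition dom :: "'e set" where "dom = {z\<in>\<Omega>. p (\<kappa> z) \<in> V}"

lemma dom_eq: "dom = {z\<in>\<Omega>. \<kappa> z \<in> {x \<in> carrier S. p x \<in> V}}"
  unfolding dom_def using s.kappa_in s.U_carrier by auto

lemma open_dom: "open dom"
  unfolding dom_eq
proof (rule s.open_kappa)
  show "openin (mtop S) {x \<in> carrier S. p x \<in> V}"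
    unfolding carrier_def using p m.openU by (intro openin_continuous_map_preimage) (auto simp: smooth_map_def)
qed

lemma smooth_phat: "smooth dom phat"
proof (rule smooth_componentwise[OF open_dom])
  fix b :: 'f
  have "smooth_fun M {y\<in>V. \<psi> y \<in> UNIV} (\<lambda>y. \<psi> y \<bullet> b)"
    by (rule m.smooth_phi) (auto intro!: smooth_linear bounded_linear_inner_left)
  then have "smooth_fun S {x \<in> carrier S. p x \<in> V} (\<lambda>x. \<psi> (p x) \<bullet> b)"
    using smooth_map_compose_fun[OF s.M m.M p] by simp
  from s.smooth_kappa[OF this] show "smooth dom (\<lambda>z. phat z \<bullet> b)" by (simp add: phat_def dom_eq)
qed

lemma phi_dom: "x \<in> U \<Longrightarrow> p x \<in> V \<Longrightarrow> \<phi> x \<in> dom"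
  by (simp add: dom_def s.phi_in s.kappa_phi)

lemma phat_phi: "x \<in> U \<Longrightarrow> phat (\<phi> x) = \<psi> (p x)"
  by (simp add: phat_def s.kappa_phi)

lemma pushforward_tv:
  assumes x: "x \<in> U" "p x \<in> V"
  shows "pushforward M p x (s.tv x w) = m.tv (p x) (Dop phat (\<phi> x) w)"
proof
  fix f
  show "pushforward M p x (s.tv x w) f = m.tv (p x) (Dop phat (\<phi> x) w) f"
  proof (cases "smooth_near M (p x) f")
    case f: True
    have "(phat has_derivative Dop phat (\<phi> x)) (at (\<phi> x))"
      by (rule has_derivative_Dop[OF smooth_phat open_dom phi_dom[OF x]])
    moreover have "((\<lambda>z. f (\<mu> z)) has_derivative frechet_derivative (\<lambda>z. f (\<mu> z)) (at (\<psi> (p x)))) (at (phat (\<phi> x)))"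
      unfolding phat_phi[OF x(1)] by (rule m.smooth_near_diff[OF x(2) f])
    ultimately have "((\<lambda>z. f (\<mu> (phat z))) has_derivative
       (\<lambda>w. frechet_derivative (\<lambda>z. f (\<mu> z)) (at (\<psi> (p x))) (Dop phat (\<phi> x) w))) (at (\<phi> x))"
      by (rule has_derivative_compose)
    then have "((\<lambda>z. f (p (\<kappa> z))) has_derivative
       (\<lambda>w. frechet_derivative (\<lambda>z. f (\<mu> z)) (at (\<psi> (p x))) (Dop phat (\<phi> x) w))) (at (\<phi> x))"
      by (rule has_derivative_transform_within_open[OF _ open_dom phi_dom[OF x]])
        (simp add: phat_def dom_def m.kappa_phi)
    from s.tv_eqI[OF x(1) p_near[OF f s.U_carrier[OF x(1)]] this]
    show ?thesis using f by (simp add: pushforward_def m.tv_def o_def)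
  qed (simp add: pushforward_def m.tv_def)
qed

end

section \<open>Linearising charts of submersions\<close>

text \<open>A change of coordinates commuting with the projection onto the model keeps the inverse
  chart constant in the normal directions, which is what \<open>phi_kappa\<close> expresses.\<close>

lemma pchart_diffeo:
  assumes "pchart M U \<phi> \<kappa> \<Omega>" and x0: "x0 \<in> U" and N: "open N" "N \<subseteq> \<Omega>" "\<phi> x0 \<in> N"
    and T: "smooth N T" "\<And>z. z \<in> N \<Longrightarrow> T (proj (model M) z) = proj (model M) (T z)"
    and inj: "\<And>v. Dop T (\<phi> x0) v = 0 \<Longrightarrow> v = 0"
  obtains U' \<kappa>' \<Omega>' where "pchart M U' (\<lambda>y. T (\<phi> y)) \<kappa>' \<Omega>'" "x0 \<in> U'" "U' \<subseteq> U" "\<And>y. y \<in> U' \<Longrightarrow> \<phi> y \<in> N"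
proof -
  interpret pchart M U \<phi> \<kappa> \<Omega> by fact
  obtain W V g where W: "open W" "W \<subseteq> N" "\<phi> x0 \<in> W" "open V" and hom: "homeomorphism W V T g" and g: "smooth V g"
    using smooth_inverse_function[OF T(1) N(1,3) inj] by metis
  have gT: "g (T z) = z" "T z \<in> V" if "z \<in> W" for z using hom that by (auto simp: homeomorphism_def)
  have Tg: "T (g z) = z" "g z \<in> W" if "z \<in> V" for z using hom that by (auto simp: homeomorphism_def)
  \<comment> \<open>The centre lies in the model and the projection does not increase norms, so the
    ball is mapped into itself by the projection; this keeps \<open>\<kappa> (g z)\<close> inside
    the new chart domain.\<close>
  obtain r where r: "0 < r" "ball (\<phi> x0) r \<subseteq> W" using W by (meson open_contains_ball)
  let ?B = "ball (\<phi> x0) r"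
  have B\<Omega>: "?B \<subseteq> \<Omega>" using r W N by blast
  have projB: "proj E z \<in> ?B" if "z \<in> ?B" for z
  proof -
    have "norm (proj E (z - \<phi> x0)) \<le> norm (z - \<phi> x0)" by (rule proj_norm_le[OF subE])
    moreover have "proj E (z - \<phi> x0) = proj E z - \<phi> x0"
      by (simp add: linear_diff[OF linear_proj[OF subE]] proj_phi[OF x0])
    ultimately show ?thesis using that by (simp add: dist_norm norm_minus_commute)
  qed
  have contg: "continuous_on V g" by (rule smooth_continuous[OF g W(4)])
  have openg: "open {z\<in>V. g z \<in> G}" if "open G" for G
    using continuous_open_preimage[OF contg W(4) that] by (simp add: vimage_def Int_def)
  have openT: "open {z\<in>?B. T z \<in> G}" if "open G" for G
  proof -
    have "continuous_on ?B T" using smooth_continuous[OF T(1) N(1)] continuous_on_subset r W by blast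
    from continuous_open_preimage[OF this open_ball that] show ?thesis by (simp add: vimage_def Int_def)
  qed
  let ?O = "{z\<in>V. g z \<in> ?B}" and ?U = "{y\<in>U. \<phi> y \<in> ?B}" and ?k = "\<lambda>z. \<kappa> (g z)"
  have "pchart M ?U (\<lambda>y. T (\<phi> y)) ?k ?O"
  proof
    show "smooth_manifold M" by (rule M)
    show "openin (mtop M) ?U" by (rule open_phi[OF open_ball])
    show "open ?O" by (rule openg[OF open_ball])
    show "T (\<phi> y) \<in> ?O" "?k (T (\<phi> y)) = y" if "y \<in> ?U" for y
      using that gT r kappa_phi by auto
    show "?k z \<in> ?U" if "z \<in> ?O" for z
    proof -
      have "g z \<in> ?B" using that by simp
      then show ?thesis using kappa_in[of "g z"] phi_kappa[of "g z"] projB[of "g z"] B\<Omega> by auto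
    qed
    show "T (\<phi> (?k z)) = proj E z" if "z \<in> ?O" for z
    proof -
      have "g z \<in> ?B" "z \<in> V" using that by auto
      then have "\<phi> (?k z) = proj E (g z)" "g z \<in> N" using phi_kappa B\<Omega> r W by blast+
      then show ?thesis using T(2) Tg \<open>z \<in> V\<close> by simp
    qed
    show "open {z\<in>?O. ?k z \<in> W0}" if "openin (mtop M) W0" for W0
    proof -
      have "open {z\<in>V. g z \<in> ?B \<inter> {u\<in>\<Omega>. \<kappa> u \<in> W0}}"
        by (rule openg) (use open_kappa[OF that] in auto)
      also have "{z\<in>V. g z \<in> ?B \<inter> {u\<in>\<Omega>. \<kappa> u \<in> W0}} = {z\<in>?O. ?k z \<in> W0}" using B\<Omega> by auto
      finally show ?thesis .
    qed
    show "openin (mtop M) {y\<in>?U. T (\<phi> y) \<in> G}" if "open G" for G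
    proof -
      have "openin (mtop M) {y\<in>U. \<phi> y \<in> {z\<in>?B. T z \<in> G}}" by (rule open_phi[OF openT[OF that]])
      also have "{y\<in>U. \<phi> y \<in> {z\<in>?B. T z \<in> G}} = {y\<in>?U. T (\<phi> y) \<in> G}" by auto
      finally show ?thesis .
    qed
    show "smooth {z\<in>?O. ?k z \<in> W0} (\<lambda>z. f (?k z))" if "smooth_fun M W0 f" for W0 f
    proof -
      have W0: "openin (mtop M) W0" using that by (simp add: smooth_fun_def)
      let ?A = "{u\<in>\<Omega>. \<kappa> u \<in> W0}"
      have A: "open ?A" "smooth ?A (\<lambda>z. f (\<kappa> z))" by (rule open_kappa[OF W0], rule smooth_kappa[OF that])
      have eq: "{z\<in>?O. ?k z \<in> W0} = {z\<in>V. g z \<in> ?B \<inter> ?A}" using B\<Omega> by auto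
      have o: "open {z\<in>?O. ?k z \<in> W0}" unfolding eq by (rule openg) (use A in auto)
      show ?thesis
        by (rule smooth_compose[OF o A(1) _ smooth_subset[OF W(4) o _ g] A(2)]) (use B\<Omega> in auto)
    qed
    show "smooth_fun M {y\<in>?U. T (\<phi> y) \<in> G} (\<lambda>y. F (T (\<phi> y)))" if G: "open G" "smooth G F" for G F
    proof -
      have o: "open {z\<in>?B. T z \<in> G}" by (rule openT[OF G(1)])
      have "smooth {z\<in>?B. T z \<in> G} (\<lambda>z. F (T z))"
        by (rule smooth_compose[OF o G(1) _ smooth_subset[OF N(1) o _ T(1)] G(2)]) (use r W in auto)
      from smooth_phi[OF o this] have "smooth_fun M {y\<in>U. \<phi> y \<in> {z\<in>?B. T z \<in> G}} (\<lambda>y. F (T (\<phi> y)))" .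
      also have "{y\<in>U. \<phi> y \<in> {z\<in>?B. T z \<in> G}} = {y\<in>?U. T (\<phi> y) \<in> G}" by auto
      finally show ?thesis .
    qed
  qed
  then show ?thesis by (rule that) (use x0 r W in auto)
qed

text \<open>Since \<open>p\<close> is affine in these coordinates, its differential is the same
  operator \<open>C\<close> at all points of the chart, and fibres are pieces of parallel affine
  subspaces.\<close>

locale linear_chart_map = chart_map S U \<phi> \<kappa> \<Omega> M V \<psi> \<mu> \<Theta> p
  for S :: "('a, 'e::euclidean_space) manifold" and U \<phi> \<kappa> \<Omega>
    and M :: "('b, 'f::euclidean_space) manifold" and V \<psi> \<mu> \<Theta> and p :: "'a \<Rightarrow> 'b" +
  fixes C :: "'e \<Rightarrow>\<^sub>L 'f" and c0 :: 'f
  assumes p_in: "y \<in> U \<Longrightarrow> p y \<in> V"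
    and p_lin: "y \<in> U \<Longrightarrow> \<psi> (p y) = c0 + C (\<phi> y)"
    and C_proj: "C (proj (model S) z) = C z"
    and C_range: "range C = model M"
begin

lemma phat_eq: "z \<in> \<Omega> \<Longrightarrow> phat z = c0 + C z"
  by (simp add: phat_def p_lin s.kappa_in s.phi_kappa C_proj)

lemma pushforward_C:
  assumes x: "x \<in> U" shows "pushforward M p x (s.tv x w) = m.tv (p x) (C w)"
proof -
  have "((\<lambda>z. c0 + C z) has_derivative blinfun_apply C) (at (\<phi> x))"
    by (intro derivative_eq_intros bounded_linear_imp_has_derivative blinfun.bounded_linear_right) auto
  then have "(phat has_derivative blinfun_apply C) (at (\<phi> x))"
    by (rule has_derivative_transform_within_open[OF _ s.open\<Omega> s.phi_in[OF x]]) (simp add: phat_eq)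
  from Dop_eq[OF this] show ?thesis by (simp add: pushforward_tv[OF x p_in[OF x]])
qed

end

text \<open>The submersion theorem with a prescribed kernel. Fixing \<open>K\<close> beforehand
  matters because the charts at different points of one fibre must restrict to charts of the fibre
  with a common model space.\<close>

lemma linear_chart_map_exists:
  assumes S: "smooth_manifold S" and M: "smooth_manifold M" and p: "submersion S M p"
    and x0: "x0 \<in> carrier S" and K: "subspace K" "K \<subseteq> model S" "dim K + dim (model M) = dim (model S)"
  obtains U \<phi> \<kappa> \<Omega> V \<psi> \<mu> \<Theta> C c0 where "linear_chart_map S U \<phi> \<kappa> \<Omega> M V \<psi> \<mu> \<Theta> p C c0" "x0 \<in> U"
    "\<And>y. y \<in> U \<Longrightarrow> p y = p x0 \<longleftrightarrow> \<phi> y \<in> K" "K = {u \<in> model S. C u = 0}" "\<phi> x0 = 0"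
proof -
  have sm: "smooth_map S M p" and sub: "pushforward M p x0 ` tangent_space S x0 = tangent_space M (p x0)"
    using p x0 by (auto simp: submersion_def)
  have px0: "p x0 \<in> carrier M" using sm x0 by (auto simp: smooth_map_def continuous_map_def carrier_def)
  obtain U \<phi> \<kappa> \<Omega> where s: "pchart S U \<phi> \<kappa> \<Omega>" "x0 \<in> U" using pchart_exists[OF S x0] .
  obtain V \<psi> \<mu> \<Theta> where m: "pchart M V \<psi> \<mu> \<Theta>" "p x0 \<in> V" using pchart_exists[OF M px0] .
  interpret chart_map S U \<phi> \<kappa> \<Omega> M V \<psi> \<mu> \<Theta> p
    using s m sm by (auto simp: chart_map_def chart_map_axioms_def)
  let ?E = "model S" and ?F = "model M"
  have x0d: "\<phi> x0 \<in> dom" by (rule phi_dom[OF s(2) m(2)])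
  have projdom: "proj ?E z \<in> dom \<and> phat (proj ?E z) = phat z" if "z \<in> dom" for z
    using that by (auto simp: dom_def phat_def s.proj_Omega s.kappa_proj)
  have phatF: "proj ?F (phat z) = phat z" if "z \<in> dom" for z
    using that by (auto simp: dom_def phat_def m.proj_phi)
  define D where "D = Dop phat (\<phi> x0)"
  have derD: "(phat has_derivative D) (at (\<phi> x0))"
    unfolding D_def by (rule has_derivative_Dop[OF smooth_phat open_dom x0d])
  have D_proj: "D (proj ?E w) = D w" for w
  proof -
    have "(phat has_derivative D) (at (proj ?E (\<phi> x0)))" using derD by (simp add: s.proj_phi[OF s(2)])
    then have "((\<lambda>z. phat (proj ?E z)) has_derivative (\<lambda>w. D (proj ?E w))) (at (\<phi> x0))"
      by (rule has_derivative_compose[OF bounded_linear_imp_has_derivative[OF bounded_linear_proj[OF s.subE]]])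
    then have "(phat has_derivative (\<lambda>w. D (proj ?E w))) (at (\<phi> x0))"
      by (rule has_derivative_transform_within_open[OF _ open_dom x0d]) (simp add: projdom)
    from has_derivative_unique[OF this derD] show ?thesis by metis
  qed
  have D_in: "D w \<in> ?F" for w
  proof -
    have "((\<lambda>z. proj ?F (phat z)) has_derivative (\<lambda>w. proj ?F (D w))) (at (\<phi> x0))"
      by (rule bounded_linear.has_derivative[OF bounded_linear_proj[OF m.subE] derD])
    then have "(phat has_derivative (\<lambda>w. proj ?F (D w))) (at (\<phi> x0))"
      by (rule has_derivative_transform_within_open[OF _ open_dom x0d]) (simp add: phatF)
    from has_derivative_unique[OF this derD] show ?thesis by (metis proj_in[OF m.subE])
  qed
  have D_surj: "\<exists>u\<in>?E. D u = w" if "w \<in> ?F" for w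
  proof -
    have "m.tv (p x0) w \<in> pushforward M p x0 ` tangent_space S x0"
      unfolding sub by (rule m.tv_in[OF m(2)])
    then obtain v where v: "v \<in> tangent_space S x0" "m.tv (p x0) w = pushforward M p x0 v" by blast
    obtain u where u: "u \<in> ?E" "v = s.tv x0 u" using s.tangent_obtain[OF v(1) s(2)] .
    have "m.tv (p x0) w = m.tv (p x0) (D u)"
      using v(2) u(2) pushforward_tv[OF s(2) m(2)] by (simp add: D_def)
    from m.tv_inj[OF m(2) this] show ?thesis using u(1) proj_id[OF m.subE] that D_in by metis
  qed
  define N where "N = {u \<in> ?E. D u = 0}"
  have subN: "subspace N"
    unfolding N_def using s.subE by (auto simp: subspace_def blinfun.add_right blinfun.scaleR_right)
  define N' where "N' = {y \<in> ?E. \<forall>x\<in>N. orthogonal x y}"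
  define K' where "K' = {y \<in> ?E. \<forall>x\<in>K. orthogonal x y}"
  have subN': "subspace N'" and subK': "subspace K'"
    unfolding N'_def K'_def using s.subE by (auto simp: subspace_def orthogonal_clauses)
  have dimN: "dim N' + dim N = dim ?E" and dimK: "dim K' + dim K = dim ?E"
    unfolding N'_def K'_def
    by (rule dim_subspace_orthogonal_to_vectors; use subN K s.subE in \<open>auto simp: N_def\<close>)+
  have "D ` N' = ?F"
  proof
    show "D ` N' \<subseteq> ?F" using D_in by auto
    show "?F \<subseteq> D ` N'"
    proof
      fix w assume "w \<in> ?F"
      then obtain u where u: "u \<in> ?E" "D u = w" using D_surj by blast
      have n: "proj N u \<in> N" by (rule proj_in[OF subN])
      then have "D (u - proj N u) = w" using u by (simp add: N_def blinfun.diff_right)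
      moreover have "u - proj N u \<in> N'"
      proof -
        have "orthogonal x (u - proj N u)" if "x \<in> N" for x
          using proj_sym[OF subN, of x u] proj_id[OF subN that] by (simp add: orthogonal_def inner_diff_right)
        then show ?thesis using u(1) n subspace_diff[OF s.subE] by (auto simp: N'_def N_def)
      qed
      ultimately show "w \<in> D ` N'" by blast
    qed
  qed
  moreover have "inj_on D N'"
  proof (rule inj_onI)
    fix a b assume ab: "a \<in> N'" "b \<in> N'" "D a = D b"
    then have 1: "a - b \<in> N'" using subspace_diff[OF subN'] by blast
    then have "a - b \<in> N" using ab(3) by (auto simp: N_def N'_def blinfun.diff_right)
    then have "orthogonal (a - b) (a - b)" using 1 unfolding N'_def by blast
    then show "a = b" by (simp add: orthogonal_self)
  qed
  moreover have "span N' = N'" using subN' by (rule span_eq_iff[THEN iffD2])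
  ultimately have "dim ?F = dim N'"
    using dim_image_eq[OF linear_blinfun_apply, of D N'] by metis
  then have dims: "dim N = dim K" "dim ?F = dim K'" using dimN dimK K(3) by auto
  obtain B0 where B0: "linear B0" "B0 ` N = K" "\<And>x. x \<in> N \<Longrightarrow> norm (B0 x) = norm x"
    using isometries_subspaces[OF subN K(1) dims(1)] by metis
  obtain A A' where A: "linear A" "linear A'" "A ` ?F = K'" "A' ` K' = ?F"
     "\<And>x. x \<in> ?F \<Longrightarrow> A' (A x) = x" "\<And>x. x \<in> K' \<Longrightarrow> A (A' x) = x"
    using isometries_subspaces[OF m.subE subK' dims(2)] by metis
  define B where "B w = B0 (proj N w)" for w
  have linB: "linear B" unfolding B_def using linear_compose[OF linear_proj[OF subN] B0(1)] by (simp add: o_def)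
  have BK: "B w \<in> K" for w using B0(2) proj_in[OF subN] by (auto simp: B_def)
  have NE: "proj N (proj ?E w) = proj N w" for w
  proof -
    have "proj N (proj ?E w) \<bullet> c = proj N w \<bullet> c" for c
    proof -
      have "proj N c \<in> ?E" using proj_in[OF subN, of c] by (simp add: N_def)
      then show ?thesis by (simp add: proj_sym[OF subN] proj_sym[OF s.subE] proj_id[OF s.subE])
    qed
    then show ?thesis by (metis vector_eq_rdot)
  qed
  \<comment> \<open>The first summand carries the value of \<open>p\<close> into the complement
    \<open>K'\<close> by an isometry, the second carries the kernel \<open>N\<close> of the
    differential onto \<open>K\<close>, and the third is the identity on directions normal to the
    model, without which \<open>T\<close> would not be invertible on the whole space.\<close>
  define T where "T z = A (phat z - \<psi> (p x0)) + B (z - \<phi> x0) + (z - proj ?E z)" for z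
  have bl: "bounded_linear A" "bounded_linear B" "bounded_linear (proj ?E)"
    using A(1) linB linear_proj[OF s.subE] by (simp_all add: linear_conv_bounded_linear)
  have smT: "smooth dom T"
    unfolding T_def
    by (rule smooth_add[OF open_dom smooth_add[OF open_dom
        smooth_linear_compose[OF bl(1) open_dom smooth_diff[OF open_dom smooth_phat smooth_const[OF open_dom]]]
        smooth_linear_compose[OF bl(2) open_dom smooth_diff[OF open_dom smooth_ident[OF open_dom] smooth_const[OF open_dom]]]]
        smooth_diff[OF open_dom smooth_ident[OF open_dom] smooth_linear[OF open_dom bl(3)]]])
  have AinK': "A w \<in> K'" if "w \<in> ?F" for w using A(3) that by auto
  have phatd: "phat z - \<psi> (p x0) \<in> ?F" if "z \<in> dom" for z
    using phatF[OF that] m.phi_E[OF m(2)] proj_in[OF m.subE] subspace_diff[OF m.subE] by metis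
  have K'E: "K' \<subseteq> ?E" by (auto simp: K'_def)
  have T_proj: "T (proj ?E z) = proj ?E (T z)" if z: "z \<in> dom" for z
  proof -
    have "B (proj ?E z - \<phi> x0) = B (z - \<phi> x0)"
      by (simp add: B_def linear_diff[OF linear_proj[OF subN]] NE)
    then have "T (proj ?E z) = A (phat z - \<psi> (p x0)) + B (z - \<phi> x0)"
      using projdom[OF z] by (simp add: T_def proj_proj[OF s.subE])
    moreover have "A (phat z - \<psi> (p x0)) \<in> ?E" "B (z - \<phi> x0) \<in> ?E"
      using AinK'[OF phatd[OF z]] K'E BK K(2) by auto
    ultimately show ?thesis
      by (simp add: T_def linear_add[OF linear_proj[OF s.subE]] linear_diff[OF linear_proj[OF s.subE]]
        proj_id[OF s.subE] proj_proj[OF s.subE])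
  qed
  have Tder: "(T has_derivative (\<lambda>w. A (D w) + B w + (w - proj ?E w))) (at (\<phi> x0))"
  proof -
    have 1: "((\<lambda>z. A (phat z - \<psi> (p x0))) has_derivative (\<lambda>w. A (D w - 0))) (at (\<phi> x0))"
      by (intro bounded_linear.has_derivative[OF bl(1)] has_derivative_diff derD has_derivative_const)
    have 2: "((\<lambda>z. B (z - \<phi> x0)) has_derivative (\<lambda>w. B (w - 0))) (at (\<phi> x0))"
      by (intro bounded_linear.has_derivative[OF bl(2)] has_derivative_diff has_derivative_ident has_derivative_const)
    have 3: "((\<lambda>z. z - proj ?E z) has_derivative (\<lambda>w. w - proj ?E w)) (at (\<phi> x0))"
      by (intro has_derivative_diff has_derivative_ident bounded_linear_imp_has_derivative bl)
    from has_derivative_add[OF has_derivative_add[OF 1 2] 3] show ?thesis by (simp add: T_def[abs_def])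
  qed
  have injT: "v = 0" if "Dop T (\<phi> x0) v = 0" for v
  proof -
    have z: "A (D v) + B v + (v - proj ?E v) = 0" using that Dop_eq[OF Tder] by simp
    have a: "A (D v) \<in> K'" "B v \<in> K" using AinK' D_in BK by auto
    have "proj ?E (A (D v) + B v + (v - proj ?E v)) = A (D v) + B v"
      using a K'E K(2) by (simp add: linear_add[OF linear_proj[OF s.subE]] linear_diff[OF linear_proj[OF s.subE]]
        proj_id[OF s.subE] proj_proj[OF s.subE] subsetD)
    then have s0: "A (D v) + B v = 0" using z linear_0[OF linear_proj[OF s.subE]] by simp
    then have vE: "v = proj ?E v" using z by simp
    have "orthogonal (B v) (A (D v))" using a by (auto simp: K'_def)
    moreover have "A (D v) = - B v" using s0 by (simp add: add_eq_0_iff2)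
    ultimately have "B v = 0" by (simp add: orthogonal_def)
    then have "A (D v) = 0" using s0 by simp
    then have "D v = 0" using A(5)[OF D_in] linear_0[OF A(2)] by metis
    then have "v \<in> N" using vE proj_in[OF s.subE] by (metis (mono_tags, lifting) N_def mem_Collect_eq)
    then have "norm v = norm (B v)" using B0(3) proj_id[OF subN] by (simp add: B_def)
    then show ?thesis using \<open>B v = 0\<close> by simp
  qed
  obtain U' \<kappa>' \<Omega>' where U': "pchart S U' (\<lambda>y. T (\<phi> y)) \<kappa>' \<Omega>'" "x0 \<in> U'" "U' \<subseteq> U" "\<And>y. y \<in> U' \<Longrightarrow> \<phi> y \<in> dom"
    using pchart_diffeo[OF s open_dom _ x0d smT T_proj injT] by (auto simp: dom_def)
  define P where "P w = w - proj K w" for w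
  have linP: "linear P" unfolding P_def using linear_compose_sub[OF linear_ident linear_proj[OF K(1)]] by (simp add: id_def)
  \<comment> \<open>On the model, \<open>P\<close> is the projection onto \<open>K'\<close> along
    \<open>K\<close>. It removes the summand \<open>B\<close> of \<open>T\<close>, and
    \<open>A'\<close> undoes \<open>A\<close>, so \<open>C (T (\<phi> y))\<close> is the
    displacement of \<open>\<psi> (p y)\<close>.\<close>
  define C where "C = Blinfun (\<lambda>z. A' (P (proj ?E z)))"
  have C: "C z = A' (P (proj ?E z))" for z
  proof -
    have "linear (\<lambda>z. A' (P (proj ?E z)))"
      using linear_compose[OF linear_compose[OF linear_proj[OF s.subE] linP] A(2)] by (simp add: o_def)
    then show ?thesis by (simp add: C_def blinfun_of_linear)
  qed
  have PK': "P w = w" if "w \<in> K'" for w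
  proof -
    have "proj K w \<bullet> w = 0" using that proj_in[OF K(1), of w] by (simp add: K'_def orthogonal_def)
    then have "proj K w \<bullet> proj K w = 0" by (metis inner_commute proj_proj[OF K(1)] proj_sym[OF K(1)])
    then show ?thesis by (simp add: P_def)
  qed
  have PK: "P w = 0" if "w \<in> K" for w using proj_id[OF K(1) that] by (simp add: P_def)
  have PE: "P w \<in> K'" if "w \<in> ?E" for w
  proof -
    have "orthogonal x (w - proj K w)" if "x \<in> K" for x
      using proj_sym[OF K(1), of x w] proj_id[OF K(1) that] by (simp add: orthogonal_def inner_diff_right)
    then show ?thesis using that proj_in[OF K(1), of w] K(2) subspace_diff[OF s.subE] by (auto simp: K'_def P_def)
  qed
  have TU: "T (\<phi> y) = A (\<psi> (p y) - \<psi> (p x0)) + B (\<phi> y - \<phi> x0) \<and> \<psi> (p y) - \<psi> (p x0) \<in> ?F \<and> p y \<in> V" if "y \<in> U'" for y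
  proof -
    have "y \<in> U" "\<phi> y \<in> dom" using U' that by auto
    moreover have "p y \<in> V" using calculation by (simp add: dom_def s.kappa_phi)
    ultimately show ?thesis
      using phatd[of "\<phi> y"] phat_phi[of y] by (simp add: T_def s.proj_phi)
  qed
  have CT: "\<psi> (p y) = \<psi> (p x0) + C (T (\<phi> y))" if "y \<in> U'" for y
  proof -
    note t = TU[OF that]
    have "proj ?E (T (\<phi> y)) = T (\<phi> y)"
      using t AinK' K'E BK K(2) by (metis (no_types, lifting) proj_id[OF s.subE] subsetD subspace_add[OF s.subE])
    then have "C (T (\<phi> y)) = A' (A (\<psi> (p y) - \<psi> (p x0)))"
      using t by (simp add: C linear_add[OF linP] PK[OF BK] PK'[OF AinK'])
    then show ?thesis using t A(5) by simp
  qed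
  have "linear_chart_map S U' (\<lambda>y. T (\<phi> y)) \<kappa>' \<Omega>' M V \<psi> \<mu> \<Theta> p C (\<psi> (p x0))"
  proof -
    have "chart_map S U' (\<lambda>y. T (\<phi> y)) \<kappa>' \<Omega>' M V \<psi> \<mu> \<Theta> p"
      using U'(1) m(1) sm by (auto simp: chart_map_def chart_map_axioms_def)
    moreover have "C (proj ?E z) = C z" for z by (simp add: C proj_proj[OF s.subE])
    moreover have "range C = ?F"
    proof
      show "range C \<subseteq> ?F" using A(4) PE proj_in[OF s.subE] by (auto simp: C)
      show "?F \<subseteq> range C"
      proof
        fix w assume w: "w \<in> ?F"
        have "C (A w) = w"
          using AinK'[OF w] K'E by (simp add: C proj_id[OF s.subE] subsetD PK' A(5)[OF w])
        then show "w \<in> range C" by (metis rangeI)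
      qed
    qed
    ultimately show ?thesis using TU CT by (simp add: linear_chart_map_def linear_chart_map_axioms_def)
  qed
  moreover have "p y = p x0 \<longleftrightarrow> T (\<phi> y) \<in> K" if y: "y \<in> U'" for y
  proof
    note t = TU[OF y]
    assume "p y = p x0"
    then show "T (\<phi> y) \<in> K" using t BK linear_0[OF A(1)] by simp
  next
    note t = TU[OF y]
    assume "T (\<phi> y) \<in> K"
    then have a: "A (\<psi> (p y) - \<psi> (p x0)) \<in> K"
      using t BK subspace_diff[OF K(1), of "T (\<phi> y)" "B (\<phi> y - \<phi> x0)"] by simp
    have "A (\<psi> (p y) - \<psi> (p x0)) \<in> K'" using t AinK' by simp
    then have "A (\<psi> (p y) - \<psi> (p x0)) = 0" using a by (auto simp: K'_def orthogonal_self)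
    then have "\<psi> (p y) = \<psi> (p x0)" using t A(5)[of "\<psi> (p y) - \<psi> (p x0)"] linear_0[OF A(2)] by simp
    then show "p y = p x0" using t m(2) m.kappa_phi by metis
  qed
  moreover have "K = {u \<in> ?E. C u = 0}"
  proof safe
    fix u assume "u \<in> K"
    then show "u \<in> ?E" "C u = 0" using K(2) by (auto simp: C proj_id[OF s.subE] PK linear_0[OF A(2)])
  next
    fix u assume u: "u \<in> ?E" "C u = 0"
    then have "A' (P u) = 0" by (simp add: C proj_id[OF s.subE])
    then have "P u = 0" using A(6)[OF PE[OF u(1)]] linear_0[OF A(1)] by simp
    then show "u \<in> K" using proj_in[OF K(1), of u] by (simp add: P_def)
  qed
  moreover have "T (\<phi> x0) = 0" using TU[OF U'(2)] by (simp add: linear_0[OF A(1)] linear_0[OF linB])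
  ultimately show ?thesis using that[of U' "\<lambda>y. T (\<phi> y)"] U'(2) by blast
qed

lemma submersion_dim_le:
  assumes "smooth_manifold S" "smooth_manifold M" "submersion S M p" "x0 \<in> carrier S"
  shows "dim (model M) \<le> dim (model S)"
proof -
  have sm: "smooth_map S M p" and sub: "pushforward M p x0 ` tangent_space S x0 = tangent_space M (p x0)"
    using assms by (auto simp: submersion_def)
  have px0: "p x0 \<in> carrier M" using sm assms(4) by (auto simp: smooth_map_def continuous_map_def carrier_def)
  obtain U \<phi> \<kappa> \<Omega> where s: "pchart S U \<phi> \<kappa> \<Omega>" "x0 \<in> U" using pchart_exists[OF assms(1,4)] .
  obtain V \<psi> \<mu> \<Theta> where m: "pchart M V \<psi> \<mu> \<Theta>" "p x0 \<in> V" using pchart_exists[OF assms(2) px0] .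
  interpret chart_map S U \<phi> \<kappa> \<Omega> M V \<psi> \<mu> \<Theta> p
    using s m sm by (auto simp: chart_map_def chart_map_axioms_def)
  let ?l = "\<lambda>u. proj (model M) (Dop phat (\<phi> x0) u)"
  have "model M \<subseteq> ?l ` model S"
  proof
    fix w assume w: "w \<in> model M"
    have "m.tv (p x0) w \<in> pushforward M p x0 ` tangent_space S x0"
      unfolding sub by (rule m.tv_in[OF m(2)])
    then obtain v where v: "v \<in> tangent_space S x0" "m.tv (p x0) w = pushforward M p x0 v" by blast
    obtain u where u: "u \<in> model S" "v = s.tv x0 u" using s.tangent_obtain[OF v(1) s(2)] .
    have "m.tv (p x0) w = m.tv (p x0) (Dop phat (\<phi> x0) u)"
      using v(2) u(2) pushforward_tv[OF s(2) m(2)] by simp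
    from m.tv_inj[OF m(2) this] show "w \<in> ?l ` model S" using u(1) proj_id[OF m.subE w] by auto
  qed
  then have "dim (model M) \<le> dim (?l ` model S)" by (rule dim_subset)
  also have "\<dots> \<le> dim (model S)"
    using dim_image_le[OF linear_compose[OF linear_blinfun_apply linear_proj[OF m.subE]], of "Dop phat (\<phi> x0)"]
    by (simp add: o_def)
  finally show ?thesis .
qed

section \<open>The characteristic condition as a kernel condition on matrices\<close>

section \<open>Poisson submersions in linearising charts\<close>

definition bladj :: "('e::euclidean_space \<Rightarrow>\<^sub>L 'f::euclidean_space) \<Rightarrow> ('f \<Rightarrow>\<^sub>L 'e)" where
  "bladj F = Blinfun (adjoint (blinfun_apply F))"

lemma bladj_inner: "bladj F a \<bullet> x = a \<bullet> F x"
proof -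
  have "bladj F a = adjoint (blinfun_apply F) a"
    by (simp add: bladj_def blinfun_of_linear adjoint_linear linear_blinfun_apply)
  then show ?thesis by (metis adjoint_works inner_commute linear_blinfun_apply)
qed

text \<open>In finite dimension a subspace is its own double orthogonal complement, so inclusion of
  ranges is reversed inclusion of annihilators.\<close>

lemma range_subset_iff_kernel:
  fixes A :: "'e::euclidean_space \<Rightarrow>\<^sub>L 'f::euclidean_space" and B :: "'g::euclidean_space \<Rightarrow>\<^sub>L 'f"
  shows "range A \<subseteq> range B \<longleftrightarrow> (\<forall>\<eta>. (\<forall>b. B b \<bullet> \<eta> = 0) \<longrightarrow> (\<forall>a. A a \<bullet> \<eta> = 0))"
proof
  assume "range A \<subseteq> range B"
  then show "\<forall>\<eta>. (\<forall>b. B b \<bullet> \<eta> = 0) \<longrightarrow> (\<forall>a. A a \<bullet> \<eta> = 0)" by (metis rangeE range_subsetD)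
next
  assume R: "\<forall>\<eta>. (\<forall>b. B b \<bullet> \<eta> = 0) \<longrightarrow> (\<forall>a. A a \<bullet> \<eta> = 0)"
  let ?R = "range B"
  have sub: "subspace ?R" using linear_subspace_image[OF linear_blinfun_apply subspace_UNIV] .
  show "range A \<subseteq> ?R"
  proof safe
    fix a
    let ?d = "A a - proj ?R (A a)"
    have "B b \<bullet> ?d = 0" for b
      using proj_sym[OF sub, of "B b" "A a"] proj_id[OF sub, of "B b"] by (simp add: inner_diff_right)
    then have "A a \<bullet> ?d = 0" "proj ?R (A a) \<bullet> ?d = 0" using R proj_in[OF sub, of "A a"] by auto
    then have "?d \<bullet> ?d = 0" by (simp add: inner_diff_left)
    then have "A a = proj ?R (A a)" by simp
    then show "A a \<in> ?R" using proj_in[OF sub] by metis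
  qed
qed

locale poisson_chart_map = linear_chart_map S U \<phi> \<kappa> \<Omega> M V \<psi> \<mu> \<Theta> p C c0 +
    sb: bichart S U \<phi> \<kappa> \<Omega> \<pi>S + mb: bichart M V \<psi> \<mu> \<Theta> \<pi>M
  for S :: "('a, 'e::euclidean_space) manifold" and U \<phi> \<kappa> \<Omega>
    and M :: "('b, 'f::euclidean_space) manifold" and V \<psi> \<mu> \<Theta> and p :: "'a \<Rightarrow> 'b"
    and C :: "'e \<Rightarrow>\<^sub>L 'f" and c0 :: 'f and \<pi>S :: "'a bivector" and \<pi>M :: "'b bivector" +
  assumes compat: "x \<in> carrier S \<Longrightarrow> \<xi> \<in> cotangent_space M (p x) \<Longrightarrow> \<eta> \<in> cotangent_space M (p x) \<Longrightarrow>
      \<pi>S x (pullback S M p x \<xi>) (pullback S M p x \<eta>) = \<pi>M (p x) \<xi> \<eta>"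
begin

abbreviation "PS x \<equiv> sb.Pi (\<phi> x)"
abbreviation "PM x \<equiv> mb.Pi (\<psi> (p x))"
abbreviation "Ct \<equiv> bladj C"

lemma C_in: "C w \<in> model M" using C_range by blast

lemma Ct_in: "Ct \<eta> \<in> model S"
proof -
  have "proj (model S) (Ct \<eta>) \<bullet> w = Ct \<eta> \<bullet> w" for w
    by (simp add: proj_sym[OF s.subE] bladj_inner C_proj)
  then have "proj (model S) (Ct \<eta>) = Ct \<eta>" by (metis vector_eq_rdot)
  then show ?thesis by (metis proj_in[OF s.subE])
qed

lemma pullback_dphi:
  assumes x: "x \<in> U" shows "pullback S M p x (m.dphi (p x) \<eta>) = s.dphi x (Ct \<eta>)"
proof
  fix v
  show "pullback S M p x (m.dphi (p x) \<eta>) v = s.dphi x (Ct \<eta>) v"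
  proof (cases "v \<in> tangent_space S x")
    case True
    obtain w where w: "w \<in> model S" "v = s.tv x w" using s.tangent_obtain[OF True x] .
    show ?thesis using True
      by (simp add: pullback_def w(2) pushforward_C[OF x] m.dphi_tv[OF p_in[OF x]] s.dphi_tv[OF x]
          proj_id[OF m.subE C_in] proj_id[OF s.subE w(1)] inner_commute[of w] bladj_inner inner_commute[of \<eta>])
  qed (simp add: pullback_def s.dphi_def differential_def)
qed

lemma CPC: assumes x: "x \<in> U" shows "C (PS x (Ct \<eta>)) = PM x \<eta>"
proof -
  have "C (PS x (Ct \<eta>)) \<bullet> \<beta> = PM x \<eta> \<bullet> \<beta>" for \<beta>
  proof -
    have "C (PS x (Ct \<eta>)) \<bullet> \<beta> = PS x (Ct \<eta>) \<bullet> Ct \<beta>" by (metis bladj_inner inner_commute)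
    also have "\<dots> = \<pi>S x (s.dphi x (Ct \<eta>)) (s.dphi x (Ct \<beta>))"
      by (simp add: sb.Pi_inner[OF s.phi_in[OF x]] s.kappa_phi[OF x])
    also have "\<dots> = \<pi>M (p x) (m.dphi (p x) \<eta>) (m.dphi (p x) \<beta>)"
      unfolding pullback_dphi[OF x, symmetric]
      by (rule compat[OF s.U_carrier[OF x] m.dphi_in[OF p_in[OF x]] m.dphi_in[OF p_in[OF x]]])
    also have "\<dots> = PM x \<eta> \<bullet> \<beta>"
      by (simp add: mb.Pi_inner[OF m.phi_in[OF p_in[OF x]]] m.kappa_phi[OF p_in[OF x]])
    finally show ?thesis .
  qed
  then show ?thesis by (metis vector_eq_rdot)
qed

lemma characteristic_iff_range:
  assumes x: "x \<in> U"
  shows "pushforward M p x ` characteristic_distribution S \<pi>S x \<subseteq> characteristic_distribution M \<pi>M (p x)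
    \<longleftrightarrow> range (C o\<^sub>L PS x) \<subseteq> range (PM x)"
proof -
  have "pushforward M p x (s.tv x (PS x a)) \<in> characteristic_distribution M \<pi>M (p x) \<longleftrightarrow> C (PS x a) \<in> range (PM x)" for a
    unfolding pushforward_C[OF x] by (rule mb.tv_in_characteristic_iff[OF p_in[OF x] C_in])
  then show ?thesis unfolding sb.characteristic_eq[OF x] by (auto simp: image_subset_iff)
qed

text \<open>By antisymmetry the annihilator of the range of \<open>PM x\<close> is its kernel, and
  the annihilator of the range of \<open>C o\<^sub>L PS x\<close> is the kernel of
  \<open>PS x o\<^sub>L Ct\<close>.\<close>

lemma range_iff_kernel:
  assumes x: "x \<in> U"
  shows "range (C o\<^sub>L PS x) \<subseteq> range (PM x) \<longleftrightarrow> (\<forall>\<eta>. PM x \<eta> = 0 \<longrightarrow> PS x (Ct \<eta>) = 0)"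
proof -
  have 1: "(\<forall>b. PM x b \<bullet> \<eta> = 0) \<longleftrightarrow> PM x \<eta> = 0" for \<eta>
  proof -
    have "PM x b \<bullet> \<eta> = - (PM x \<eta> \<bullet> b)" for b by (rule mb.Pi_antisym[OF m.phi_in[OF p_in[OF x]]])
    then show ?thesis by (metis inner_eq_zero_iff inner_zero_left neg_equal_0_iff_equal)
  qed
  have 2: "(\<forall>a. (C o\<^sub>L PS x) a \<bullet> \<eta> = 0) \<longleftrightarrow> PS x (Ct \<eta>) = 0" for \<eta>
  proof -
    have "(C o\<^sub>L PS x) a \<bullet> \<eta> = - (PS x (Ct \<eta>) \<bullet> a)" for a
    proof -
      have "(C o\<^sub>L PS x) a \<bullet> \<eta> = PS x a \<bullet> Ct \<eta>"
        by (simp add: inner_commute[of "C _"] inner_commute[of "PS x a"] bladj_inner)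
      then show ?thesis by (rule trans) (rule sb.Pi_antisym[OF s.phi_in[OF x]])
    qed
    then show ?thesis by (metis inner_eq_zero_iff inner_zero_left neg_equal_0_iff_equal)
  qed
  show ?thesis unfolding range_subset_iff_kernel 1 2 ..
qed

end

lemma poisson_chart_map_exists:
  assumes ps: "poisson_submersion S \<pi>S M \<pi>M p"
    and x0: "x0 \<in> carrier S" and K: "subspace K" "K \<subseteq> model S" "dim K + dim (model M) = dim (model S)"
  obtains U \<phi> \<kappa> \<Omega> V \<psi> \<mu> \<Theta> C c0 where "poisson_chart_map S U \<phi> \<kappa> \<Omega> M V \<psi> \<mu> \<Theta> p C c0 \<pi>S \<pi>M" "x0 \<in> U"
    "\<And>y. y \<in> U \<Longrightarrow> p y = p x0 \<longleftrightarrow> \<phi> y \<in> K" "K = {u \<in> model S. C u = 0}" "\<phi> x0 = 0"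
proof -
  have S: "smooth_manifold S" "smooth_bivector S \<pi>S" and M: "smooth_manifold M" "smooth_bivector M \<pi>M"
    and sub: "submersion S M p"
    and comp: "\<And>x \<xi> \<eta>. x \<in> carrier S \<Longrightarrow> \<xi> \<in> cotangent_space M (p x) \<Longrightarrow> \<eta> \<in> cotangent_space M (p x) \<Longrightarrow>
      \<pi>S x (pullback S M p x \<xi>) (pullback S M p x \<eta>) = \<pi>M (p x) \<xi> \<eta>"
    using ps unfolding poisson_submersion_def poisson_manifold_def by simp_all
  obtain U \<phi> \<kappa> \<Omega> V \<psi> \<mu> \<Theta> C c0 where l: "linear_chart_map S U \<phi> \<kappa> \<Omega> M V \<psi> \<mu> \<Theta> p C c0"
    and r: "x0 \<in> U" "\<And>y. y \<in> U \<Longrightarrow> p y = p x0 \<longleftrightarrow> \<phi> y \<in> K" "K = {u \<in> model S. C u = 0}" "\<phi> x0 = 0"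
    using linear_chart_map_exists[OF S(1) M(1) sub x0 K] by blast
  interpret linear_chart_map S U \<phi> \<kappa> \<Omega> M V \<psi> \<mu> \<Theta> p C c0 by (rule l)
  have "poisson_chart_map S U \<phi> \<kappa> \<Omega> M V \<psi> \<mu> \<Theta> p C c0 \<pi>S \<pi>M"
    using l S M comp s.pchart_axioms m.pchart_axioms
    by (simp add: poisson_chart_map_def poisson_chart_map_axioms_def bichart_def bichart_axioms_def)
  then show ?thesis using r that by blast
qed

lemma complement_dim_exists:
  assumes ps: "poisson_submersion S \<pi>S M \<pi>M p" and x0: "x0 \<in> carrier S"
  obtains K where "subspace K" "K \<subseteq> model S" "dim K + dim (model M) = dim (model S)"
proof -
  have S: "smooth_manifold S" and M: "smooth_manifold M" and sub: "submersion S M p"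
    using ps by (auto simp: poisson_submersion_def poisson_manifold_def)
  have "dim (model M) \<le> dim (model S)" by (rule submersion_dim_le[OF S M sub x0])
  moreover obtain K where "subspace K" "K \<subseteq> span (model S)" "dim K = dim (model S) - dim (model M)"
    using choose_subspace_of_subspace[of "dim (model S) - dim (model M)" "model S"] by auto
  ultimately show ?thesis
    using that[of K] subspace_model[OF S] by (simp add: span_eq_iff[THEN iffD2])
qed

section \<open>From Poisson fibres to the characteristic condition\<close>

section \<open>Poisson fibres and the kernel condition\<close>

context linear_chart_map
begin

text \<open>
  A curve in the fibre through \<open>x\<close> with velocity \<open>w\<close> is, in a chart of \<open>X\<close>, a curve \<open>b\<close> with
  \<open>|b(t) - b(0)| = O(t)\<close> because the inclusion is an immersion; hence \<open>w\<close> lies in the closed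
  subspace of vectors tangent to \<open>X\<close>.
\<close>

lemma kernel_tangent_to_fibre:
  assumes X: "embedded_submanifold X S" and F: "carrier X = {y \<in> carrier S. p y = p x}"
    and x: "x \<in> U" and w: "w \<in> model S" "C w = 0"
  shows "s.tv x w \<in> pushforward S id x ` tangent_space X x"
proof -
  have Xm: "smooth_manifold X" and top: "mtop X = subtopology (mtop S) (carrier X)"
    and sm: "smooth_map X S id" and inj: "\<And>x. x \<in> carrier X \<Longrightarrow> inj_on (pushforward S id x) (tangent_space X x)"
    using X by (auto simp: embedded_submanifold_def)
  have xX: "x \<in> carrier X" using F s.U_carrier[OF x] by simp
  obtain UX \<theta> \<kappa>X \<Omega>X where xc: "pchart X UX \<theta> \<kappa>X \<Omega>X" "x \<in> UX" using pchart_exists[OF Xm xX] .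
  interpret i: chart_map X UX \<theta> \<kappa>X \<Omega>X S U \<phi> \<kappa> \<Omega> id
    using xc(1) s.pchart_axioms sm by (simp add: chart_map_def chart_map_axioms_def)
  have xid: "id x \<in> U" using x by simp
  let ?L = "Dop i.phat (\<theta> x)"
  have injL: "u = 0" if "u \<in> model X" "?L u = 0" for u
  proof -
    have "pushforward S id x (i.s.tv x u) = pushforward S id x (i.s.tv x 0)"
      by (simp add: i.pushforward_tv[OF xc(2) xid] that(2) blinfun.zero_right)
    then have "i.s.tv x u = i.s.tv x 0"
      using inj[OF xX] i.s.tv_in[OF xc(2)] by (meson inj_onD)
    from i.s.tv_inj[OF xc(2) this] show ?thesis
      using proj_id[OF i.s.subE that(1)] linear_0[OF linear_proj[OF i.s.subE]] by simp
  qed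
  obtain c where c: "0 < c" "\<And>u. u \<in> model X \<Longrightarrow> c * norm u \<le> norm (?L u)"
    using injective_imp_isometric[OF closed_subspace[OF i.s.subE] i.s.subE blinfun.bounded_linear_right, of ?L] injL
    by (metis mult.commute)
  have der: "(i.phat has_derivative ?L) (at (\<theta> x))"
    by (rule has_derivative_Dop[OF i.smooth_phat i.open_dom i.phi_dom[OF xc(2) xid]])
  \<comment> \<open>The bound \<open>\<epsilon> \<le> c / 2\<close> lets the error
    \<open>\<epsilon> * norm ?b\<close> be absorbed by the lower bound \<open>c * norm ?b\<close> of
    the immersion; what remains is \<open>norm ?b \<le> 2 / c * (t * norm w)\<close>.\<close>
  have approx: "\<exists>u\<in>model X. norm (w - ?L u) \<le> \<epsilon> * (2 / c * norm w)" if \<epsilon>: "0 < \<epsilon>" "\<epsilon> \<le> c / 2" for \<epsilon>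
  proof -
    obtain \<delta> where \<delta>: "0 < \<delta>" "\<And>b. norm (b - \<theta> x) < \<delta> \<Longrightarrow>
        norm (i.phat b - i.phat (\<theta> x) - ?L (b - \<theta> x)) \<le> \<epsilon> * norm (b - \<theta> x)"
      using der \<epsilon>(1) unfolding has_derivative_at_alt by blast
    let ?Y = "{y\<in>UX. \<theta> y \<in> ball (\<theta> x) \<delta>}"
    \<comment> \<open>Here the topology of the submanifold matters: the chart neighbourhood in
      \<open>X\<close> is the trace of an open set of \<open>S\<close>, so points of the fibre that
      are close to \<open>x\<close> in \<open>S\<close> do lie in the chart of
      \<open>X\<close>.\<close>
    have "openin (mtop X) ?Y" by (rule i.s.open_phi[OF open_ball])
    then obtain G where G: "openin (mtop S) G" "?Y = G \<inter> carrier X"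
      unfolding top by (auto simp: openin_subtopology)
    \<comment> \<open>As \<open>C w = 0\<close> and \<open>p\<close> is affine in the chart, this
      straight line stays in the fibre.\<close>
    let ?l = "\<lambda>t::real. \<phi> x + t *\<^sub>R w"
    have "open {z\<in>\<Omega>. \<kappa> z \<in> G}" by (rule s.open_kappa[OF G(1)])
    then have "open (?l -` {z\<in>\<Omega>. \<kappa> z \<in> G})"
      by (intro open_vimage) (auto intro!: continuous_intros)
    moreover have "0 \<in> ?l -` {z\<in>\<Omega>. \<kappa> z \<in> G}"
    proof -
      have "x \<in> ?Y" using xc(2) \<delta>(1) by simp
      then have "x \<in> G" using G(2) by blast
      then show ?thesis using s.phi_in[OF x] s.kappa_phi[OF x] by simp
    qed
    ultimately obtain r where r: "0 < r" "ball 0 r \<subseteq> ?l -` {z\<in>\<Omega>. \<kappa> z \<in> G}"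
      by (meson open_contains_ball)
    define t where "t = r / 2"
    have t: "0 < t" "?l t \<in> {z\<in>\<Omega>. \<kappa> z \<in> G}"
      using r(1) subsetD[OF r(2), of t] by (simp_all add: t_def)
    let ?y = "\<kappa> (?l t)"
    have l\<Omega>: "?l t \<in> \<Omega>" using t(2) by simp
    have yU: "?y \<in> U" by (rule s.kappa_in[OF l\<Omega>])
    have phiy: "\<phi> ?y = ?l t"
      using s.phi_kappa[OF l\<Omega>] s.phi_E[OF x] w(1) proj_id[OF s.subE]
        subspace_add[OF s.subE] subspace_scale[OF s.subE] by metis
    have "\<psi> (p ?y) = \<psi> (p x)"
      by (simp add: p_lin[OF yU] p_lin[OF x] phiy blinfun.add_right blinfun.scaleR_right w(2))
    then have "p ?y = p x" using m.kappa_phi p_in yU x by metis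
    then have "?y \<in> carrier X" using F s.U_carrier[OF yU] by simp
    then have "?y \<in> ?Y" using G(2) t(2) by blast
    then have yX: "?y \<in> UX" and d: "norm (\<theta> ?y - \<theta> x) < \<delta>" by (auto simp: dist_norm norm_minus_commute)
    let ?b = "\<theta> ?y - \<theta> x"
    have bE: "?b \<in> model X" using i.s.phi_E[OF yX] i.s.phi_E[OF xc(2)] subspace_diff[OF i.s.subE] by blast
    have "i.phat (\<theta> ?y) - i.phat (\<theta> x) = t *\<^sub>R w"
      using i.phat_phi[OF yX] i.phat_phi[OF xc(2)] phiy by simp
    then have e: "norm (t *\<^sub>R w - ?L ?b) \<le> \<epsilon> * norm ?b" using \<delta>(2)[OF d] by simp
    have "c * norm ?b \<le> norm (?L ?b)" by (rule c(2)[OF bE])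
    also have "\<dots> \<le> norm (t *\<^sub>R w) + norm (t *\<^sub>R w - ?L ?b)"
      using norm_triangle_sub[of "?L ?b" "t *\<^sub>R w"] by (simp add: norm_minus_commute)
    also have "\<dots> \<le> t * norm w + (c / 2) * norm ?b"
      using order.trans[OF e mult_right_mono[OF \<epsilon>(2) norm_ge_zero]] t(1) by simp
    finally have "c / 2 * norm ?b \<le> t * norm w" by simp
    then have nb: "norm ?b \<le> 2 / c * (t * norm w)" using c(1) by (simp add: field_simps)
    have "w - ?L ((1 / t) *\<^sub>R ?b) = (1 / t) *\<^sub>R (t *\<^sub>R w - ?L ?b)"
      by (subst blinfun.scaleR_right) (use t(1) in \<open>simp add: scaleR_diff_right\<close>)
    then have "norm (w - ?L ((1 / t) *\<^sub>R ?b)) = (1 / t) * norm (t *\<^sub>R w - ?L ?b)" using t(1) by simp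
    also have "\<dots> \<le> (1 / t) * (\<epsilon> * (2 / c * (t * norm w)))"
      using e nb \<epsilon>(1) t(1) by (intro mult_left_mono order.trans[OF e]) auto
    also have "\<dots> = \<epsilon> * (2 / c * norm w)" using t(1) by simp
    finally show ?thesis using subspace_scale[OF i.s.subE bE] by blast
  qed
  \<comment> \<open>The limit is taken through approximation: each \<open>\<epsilon>\<close> gives
    only one tangent vector near \<open>w\<close>, and finite-dimensional subspaces are
    closed.\<close>
  have "w \<in> closure (?L ` model X)"
    unfolding closure_approachable
  proof (intro allI impI)
    fix r :: real assume r: "0 < r"
    let ?e = "min (c / 2) (r / (2 * (2 / c * norm w + 1)))"
    have pos: "2 / c * norm w + 1 > 0" using c(1) by (simp add: add_nonneg_pos)
    have e: "0 < ?e" using r c(1) pos by simp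
    have e2: "?e \<le> c / 2" by (rule min.cobounded1)
    obtain u where u: "u \<in> model X" "norm (w - ?L u) \<le> ?e * (2 / c * norm w)" using approx[OF e e2] by blast
    have "?e * (2 / c * norm w) \<le> (r / (2 * (2 / c * norm w + 1))) * (2 / c * norm w + 1)"
      using c(1) r pos by (intro mult_mono) auto
    also have "\<dots> = r / 2"
    proof -
      have "(r / (2 * q)) * q = r / 2" if "q > 0" for q using that by simp
      from this[OF pos] show ?thesis .
    qed
    finally have "dist (?L u) w < r" using u(2) r by (simp add: dist_norm norm_minus_commute)
    then show "\<exists>y\<in>?L ` model X. dist y w < r" using u(1) by blast
  qed
  moreover have "closed (?L ` model X)"
    by (rule closed_subspace[OF linear_subspace_image[OF linear_blinfun_apply i.s.subE]])
  ultimately obtain u where "u \<in> model X" "w = ?L u" by auto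
  then have "s.tv x w = pushforward S id x (i.s.tv x u)"
    by (simp add: i.pushforward_tv[OF xc(2) xid])
  then show ?thesis using i.s.tv_in[OF xc(2)] by blast
qed

text \<open>Functions of the form \<open>f o p\<close> are constant on the fibre, and derivations
  vanish on constants.\<close>

lemma fibre_tangent_kernel:
  assumes X: "embedded_submanifold X S" and F: "carrier X = {y \<in> carrier S. p y = p x}"
    and x: "x \<in> U" and v: "v \<in> tangent_space X x" and w: "w \<in> model S" "pushforward S id x v = s.tv x w"
  shows "C w = 0"
proof -
  have Xm: "smooth_manifold X" and sm: "smooth_map X S id"
    using X by (auto simp: embedded_submanifold_def)
  have xX: "x \<in> carrier X" using F s.U_carrier[OF x] by simp
  obtain UX \<theta> \<kappa>X \<Omega>X where xc: "pchart X UX \<theta> \<kappa>X \<Omega>X" "x \<in> UX" using pchart_exists[OF Xm xX] .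
  interpret xp: pchart X UX \<theta> \<kappa>X \<Omega>X by (rule xc(1))
  have "m.tv (p x) (C w) f = 0" for f
  proof (cases "smooth_near M (p x) f")
    case True
    have eq: "f (p x) = (f \<circ> p) y" if "y \<in> UX" for y
      using that F xp.U_carrier[OF that] by simp
    have near: "smooth_near X x (f \<circ> p)"
      by (rule xp.smooth_near_cong[OF xc(2) xp.smooth_near_const[OF xc(2)] xp.openU xc(2) eq])
    have "m.tv (p x) (C w) f = s.tv x w (f \<circ> p)"
      using pushforward_C[OF x, of w] True by (metis pushforward_def)
    also have "\<dots> = v (f \<circ> p)"
      using p_near[OF True s.U_carrier[OF x]] w(2)[symmetric] by (simp add: pushforward_def o_def)
    also have "\<dots> = v (\<lambda>y. f (p x))"
      using xp.tangent_vectorD(2)[OF v xc(2) xp.smooth_near_const[OF xc(2)] near xp.openU xc(2) eq] by (rule sym)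
    also have "\<dots> = 0" by (rule xp.tangent_vectorD(6)[OF v xc(2)])
    finally show ?thesis .
  qed (simp add: m.tv_def)
  then have "m.tv (p x) (C w) = m.tv (p x) 0" by (auto simp: m.tv_zero[OF p_in[OF x]])
  from m.tv_inj[OF p_in[OF x] this] show ?thesis
    using proj_id[OF m.subE, of "C w"] C_range linear_0[OF linear_proj[OF m.subE]] by (metis rangeI)
qed

end

lemma (in poisson_chart_map) poisson_dirac_imp_kernel:
  assumes X: "poisson_dirac_submanifold X S \<pi>S" and F: "carrier X = {y \<in> carrier S. p y = p x}"
    and x: "x \<in> U" and \<eta>: "PM x \<eta> = 0"
  shows "PS x (Ct \<eta>) = 0"
proof -
  obtain \<pi>X where emb: "embedded_submanifold X S" and biX: "smooth_bivector X \<pi>X"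
    and gr: "\<And>x. x \<in> carrier X \<Longrightarrow> pullback_graph X S \<pi>S x = graph X \<pi>X x"
    using X by (auto simp: poisson_dirac_submanifold_def)
  have Xm: "smooth_manifold X" using emb by (simp add: embedded_submanifold_def)
  have xX: "x \<in> carrier X" using F s.U_carrier[OF x] by simp
  obtain UX \<theta> \<kappa>X \<Omega>X where xc: "pchart X UX \<theta> \<kappa>X \<Omega>X" "x \<in> UX" using pchart_exists[OF Xm xX] .
  interpret xb: bichart X UX \<theta> \<kappa>X \<Omega>X \<pi>X using xc(1) biX by (simp add: bichart_def bichart_axioms_def)
  let ?w = "PS x (Ct \<eta>)"
  have wE: "?w \<in> model S" by (rule sb.Pi_in_E[OF s.phi_in[OF x]])
  have Cw: "C ?w = 0" using CPC[OF x, of \<eta>] \<eta> by simp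
  obtain u where u: "u \<in> tangent_space X x" "pushforward S id x u = s.tv x ?w"
    using kernel_tangent_to_fibre[OF emb F x wE Cw] by (metis imageE)
  let ?\<xi> = "s.dphi x (Ct \<eta>)"
  \<comment> \<open>Vectors tangent to the fibre lie in the kernel of \<open>C\<close>, and
    \<open>Ct \<eta>\<close> annihilates that kernel.\<close>
  have "pullback X S id x ?\<xi> = (\<lambda>v. 0)"
  proof
    fix v
    show "pullback X S id x ?\<xi> v = 0"
    proof (cases "v \<in> tangent_space X x")
      case True
      interpret i: chart_map X UX \<theta> \<kappa>X \<Omega>X S U \<phi> \<kappa> \<Omega> id
        using xc(1) s.pchart_axioms emb by (simp add: chart_map_def chart_map_axioms_def embedded_submanifold_def)
      obtain a where a: "v = xb.tv x a" using xb.tangent_obtain[OF True xc(2)] by metis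
      define b where "b = proj (model S) (Dop i.phat (\<theta> x) a)"
      have b: "b \<in> model S" "pushforward S id x v = s.tv x b"
        using i.pushforward_tv[OF xc(2), of a] x
        by (simp_all add: a b_def s.tv_proj proj_in[OF s.subE])
      have "C b = 0" by (rule fibre_tangent_kernel[OF emb F x True b])
      then have "b \<bullet> Ct \<eta> = 0" by (metis bladj_inner inner_commute inner_zero_left)
      then show ?thesis using True b by (simp add: pullback_def s.dphi_tv[OF x] proj_id[OF s.subE])
    qed (simp add: pullback_def)
  qed
  moreover have "(u, pullback X S id x ?\<xi>) \<in> pullback_graph X S \<pi>S x"
    unfolding pullback_graph_def using u s.dphi_in[OF x] sb.sharp_dphi[OF x] by force
  ultimately have "(u, \<lambda>v. 0) \<in> graph X \<pi>X x" using gr[OF xX] by simp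
  then have "u = sharp X \<pi>X x (\<lambda>v. 0)" by (auto simp: graph_def)
  also have "(\<lambda>v. 0) = xb.dphi x 0" using xb.dphi_scale[OF xc(2), of 0 0] by simp
  also have "sharp X \<pi>X x (xb.dphi x 0) = (\<lambda>f. 0)"
    by (simp add: xb.sharp_dphi[OF xc(2)] blinfun.zero_right xb.tv_zero[OF xc(2)])
  finally have "pushforward S id x u = s.tv x 0" by (auto simp: pushforward_def s.tv_zero[OF x])
  then have "s.tv x ?w = s.tv x 0" using u(2) by simp
  from s.tv_inj[OF x this] show ?thesis
    using proj_id[OF s.subE wE] linear_0[OF linear_proj[OF s.subE]] by simp
qed

theorem poisson_fibres_imp_characteristic:
  assumes ps: "poisson_submersion S \<pi>S M \<pi>M p" and fib: "has_poisson_fibres S \<pi>S M p" and x: "x \<in> carrier S"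
  shows "pushforward M p x ` characteristic_distribution S \<pi>S x \<subseteq> characteristic_distribution M \<pi>M (p x)"
proof -
  obtain K where K: "subspace K" "K \<subseteq> model S" "dim K + dim (model M) = dim (model S)"
    using complement_dim_exists[OF ps x] .
  obtain U \<phi> \<kappa> \<Omega> V \<psi> \<mu> \<Theta> C c0 where c: "poisson_chart_map S U \<phi> \<kappa> \<Omega> M V \<psi> \<mu> \<Theta> p C c0 \<pi>S \<pi>M" "x \<in> U"
    using poisson_chart_map_exists[OF ps x K] by metis
  interpret poisson_chart_map S U \<phi> \<kappa> \<Omega> M V \<psi> \<mu> \<Theta> p C c0 \<pi>S \<pi>M by (rule c(1))
  have "p x \<in> carrier M" by (rule m.U_carrier[OF p_in[OF c(2)]])
  then obtain X :: "('a, 'b) manifold" where X: "carrier X = {y \<in> carrier S. p y = p x}" "poisson_dirac_submanifold X S \<pi>S"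
    using fib unfolding has_poisson_fibres_def by blast
  show ?thesis
    unfolding characteristic_iff_range[OF c(2)] range_iff_kernel[OF c(2)]
    using poisson_dirac_imp_kernel[OF X(2,1) c(2)] by blast
qed

section \<open>From the characteristic condition to Poisson fibres\<close>

section \<open>Submanifolds defined by adapted charts\<close>

lemma pchart_transition:
  assumes a: "pchart M U \<phi> \<kappa> \<Omega>" and b: "pchart M U' \<phi>' \<kappa>' \<Omega>'"
  shows "open {z\<in>\<Omega>. \<kappa> z \<in> U'}" "smooth {z\<in>\<Omega>. \<kappa> z \<in> U'} (\<lambda>z. \<phi>' (\<kappa> z))"
proof -
  interpret a: pchart M U \<phi> \<kappa> \<Omega> by (rule a)
  interpret b: pchart M U' \<phi>' \<kappa>' \<Omega>' by (rule b)
  show o: "open {z\<in>\<Omega>. \<kappa> z \<in> U'}" by (rule a.open_kappa[OF b.openU])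
  show "smooth {z\<in>\<Omega>. \<kappa> z \<in> U'} (\<lambda>z. \<phi>' (\<kappa> z))"
    by (rule smooth_componentwise[OF o]) (rule a.smooth_kappa[OF b.smooth_fun_coord])
qed

context pchart begin

lemma continuous_map_phi: "continuous_map (subtopology (mtop M) U) euclidean \<phi>"
proof -
  have "openin (subtopology (mtop M) U) {y \<in> topspace (subtopology (mtop M) U). \<phi> y \<in> G}" if "open G" for G
  proof -
    have "{y \<in> topspace (subtopology (mtop M) U). \<phi> y \<in> G} = {y\<in>U. \<phi> y \<in> G}"
      using openin_subset[OF openU] by auto
    then show ?thesis using openin_subtopology_Int2[OF open_phi[OF that], of U]
      by (simp add: Int_absorb1 Int_commute inf.absorb2 subset_iff)
  qed
  then show ?thesis by (auto simp: continuous_map_def)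
qed

lemma continuous_map_kappa: "continuous_map (top_of_set \<Omega>) (mtop M) \<kappa>"
proof -
  have "openin (top_of_set \<Omega>) {z \<in> \<Omega>. \<kappa> z \<in> W}" if "openin (mtop M) W" for W
    using open_kappa[OF that] by (intro open_subset) auto
  then show ?thesis
    using kappa_in U_carrier by (auto simp: continuous_map_def carrier_def)
qed

end

locale slice =
  fixes S :: "('a, 'e::euclidean_space) manifold" and F :: "'a set" and K :: "'e set"
  assumes S: "smooth_manifold S" and F: "F \<subseteq> carrier S" and K: "subspace K" "K \<subseteq> model S"
begin

definition adapted :: "'a set \<Rightarrow> ('a \<Rightarrow> 'e) \<Rightarrow> ('e \<Rightarrow> 'a) \<Rightarrow> 'e set \<Rightarrow> bool" where
  "adapted W \<phi> \<kappa> \<Omega> \<longleftrightarrow> pchart S W \<phi> \<kappa> \<Omega> \<and> (\<forall>y\<in>W. y \<in> F \<longleftrightarrow> \<phi> y \<in> K)"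

definition X :: "('a, 'e) manifold" where
  "X = \<lparr>mtop = subtopology (mtop S) F, model = K,
        charts = {(W \<inter> F, \<phi>) | W \<phi>. \<exists>\<kappa> \<Omega>. adapted W \<phi> \<kappa> \<Omega>}\<rparr>"

lemma X_simps [simp]: "mtop X = subtopology (mtop S) F" "model X = K" "carrier X = F"
  using F by (auto simp: X_def carrier_def)

lemma chartsX: "(A, \<phi>) \<in> charts X \<longleftrightarrow> (\<exists>W \<kappa> \<Omega>. A = W \<inter> F \<and> adapted W \<phi> \<kappa> \<Omega>)"
  by (auto simp: X_def)

lemma adapted_image:
  assumes a: "adapted W \<phi> \<kappa> \<Omega>" and N: "openin (mtop S) N"
  shows "\<phi> ` (W \<inter> F \<inter> N) = {z\<in>\<Omega>. \<kappa> z \<in> N} \<inter> K" "openin (top_of_set K) (\<phi> ` (W \<inter> F \<inter> N))"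
    "\<And>z. z \<in> \<Omega> \<Longrightarrow> z \<in> K \<Longrightarrow> \<kappa> z \<in> W \<inter> F \<and> \<phi> (\<kappa> z) = z"
    "\<And>z. z \<in> \<phi> ` (W \<inter> F) \<Longrightarrow> inv_into (W \<inter> F) \<phi> z = \<kappa> z"
proof -
  interpret pchart S W \<phi> \<kappa> \<Omega> using a by (simp add: adapted_def)
  have fk: "y \<in> F \<longleftrightarrow> \<phi> y \<in> K" if "y \<in> W" for y using a that by (simp add: adapted_def)
  show k: "\<kappa> z \<in> W \<inter> F \<and> \<phi> (\<kappa> z) = z" if "z \<in> \<Omega>" "z \<in> K" for z
    using that K kappa_in phi_kappa_E fk by (metis IntI subsetD)
  show eq: "\<phi> ` (W \<inter> F \<inter> N) = {z\<in>\<Omega>. \<kappa> z \<in> N} \<inter> K"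
  proof safe
    fix y assume "y \<in> W" "y \<in> F" "y \<in> N"
    then show "\<phi> y \<in> \<Omega>" "\<kappa> (\<phi> y) \<in> N" "\<phi> y \<in> K" using phi_in kappa_phi fk by auto
  next
    fix z assume "z \<in> \<Omega>" "\<kappa> z \<in> N" "z \<in> K"
    then show "z \<in> \<phi> ` (W \<inter> F \<inter> N)" using k[of z] by (metis IntI image_eqI)
  qed
  show "openin (top_of_set K) (\<phi> ` (W \<inter> F \<inter> N))"
    unfolding eq using open_kappa[OF N] by (metis inf_commute openin_open_Int)
  have "inj_on \<phi> (W \<inter> F)" by (rule inj_on_inverseI[of _ \<kappa>]) (simp add: kappa_phi)
  then show "inv_into (W \<inter> F) \<phi> z = \<kappa> z" if "z \<in> \<phi> ` (W \<inter> F)" for z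
    using that kappa_phi by (auto simp: inv_into_f_f)
qed

lemma adapted_smooth:
  assumes a: "adapted W \<phi> \<kappa> \<Omega>" and b: "pchart S V \<psi> \<mu> \<Theta>"
  shows "smooth_on K (\<phi> ` (W \<inter> F \<inter> V)) (\<lambda>z. \<psi> (inv_into (W \<inter> F) \<phi> z))"
proof -
  have p: "pchart S W \<phi> \<kappa> \<Omega>" using a by (simp add: adapted_def)
  have V: "openin (mtop S) V" using b by (simp add: pchart_def)
  note t = pchart_transition[OF p b]
  have "smooth_on K (\<phi> ` (W \<inter> F \<inter> V)) (\<lambda>z. \<psi> (\<kappa> z))"
    by (rule smooth_on_restrict[OF K(1) t(2,1) _ adapted_image(2)[OF a V]])
      (use adapted_image(1)[OF a V] in auto)
  then show ?thesis
    by (subst smooth_on_cong[where g = "\<lambda>z. \<psi> (\<kappa> z)"]) (use adapted_image(4)[OF a V] in auto)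
qed

lemma adapted_homeo:
  assumes a: "adapted W \<phi> \<kappa> \<Omega>"
  shows "homeomorphic_map (subtopology (mtop S) (W \<inter> F)) (top_of_set (\<phi> ` (W \<inter> F))) \<phi>"
proof -
  interpret pchart S W \<phi> \<kappa> \<Omega> using a by (simp add: adapted_def)
  have T: "topspace (subtopology (mtop S) (W \<inter> F)) = W \<inter> F"
    using F by (auto simp: carrier_def)
  have im: "\<phi> ` (W \<inter> F) \<subseteq> \<Omega>" using phi_in by auto
  have "continuous_map (subtopology (mtop S) (W \<inter> F)) euclidean \<phi>"
    using continuous_map_from_subtopology[OF continuous_map_phi, of F]
    by (simp add: subtopology_subtopology)
  then have "continuous_map (subtopology (mtop S) (W \<inter> F)) (top_of_set (\<phi> ` (W \<inter> F))) \<phi>"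
    by (rule continuous_map_into_subtopology) (simp add: T)
  moreover have "continuous_map (top_of_set (\<phi> ` (W \<inter> F))) (mtop S) \<kappa>"
    using continuous_map_from_subtopology[OF continuous_map_kappa, of "\<phi> ` (W \<inter> F)"] im
    by (simp add: subtopology_subtopology inf.absorb2)
  then have "continuous_map (top_of_set (\<phi> ` (W \<inter> F))) (subtopology (mtop S) (W \<inter> F)) \<kappa>"
    by (rule continuous_map_into_subtopology) (auto simp: kappa_phi)
  ultimately have "homeomorphic_maps (subtopology (mtop S) (W \<inter> F)) (top_of_set (\<phi> ` (W \<inter> F))) \<phi> \<kappa>"
    unfolding homeomorphic_maps_def T by (auto simp: kappa_phi)
  then show ?thesis by (rule homeomorphic_maps_imp_map)
qed

end

locale covered_slice = slice S F K
  for S :: "('a, 'e::euclidean_space) manifold" and F K +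
  assumes cover: "x \<in> F \<Longrightarrow> \<exists>W \<phi> \<kappa> \<Omega>. adapted W \<phi> \<kappa> \<Omega> \<and> x \<in> W"
begin

lemma smooth_manifold_X: "smooth_manifold X"
  unfolding smooth_manifold_def
proof (intro conjI)
  show "Hausdorff_space (mtop X)" "second_countable (mtop X)"
    using S by (auto simp: smooth_manifold_def Hausdorff_space_subtopology second_countable_subtopology)
  show "subspace (model X)" using K by simp
  show "\<forall>(U, \<phi>) \<in> charts X. openin (mtop X) U \<and> openin (top_of_set (model X)) (\<phi> ` U) \<and>
        homeomorphic_map (subtopology (mtop X) U) (top_of_set (\<phi> ` U)) \<phi>"
  proof safe
    fix A \<phi> assume "(A, \<phi>) \<in> charts X"
    then obtain W \<kappa> \<Omega> where a: "A = W \<inter> F" "adapted W \<phi> \<kappa> \<Omega>" by (auto simp: chartsX)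
    then have W: "openin (mtop S) W" by (simp add: adapted_def pchart_def)
    show "openin (mtop X) A" unfolding a X_simps by (metis Int_commute W openin_subtopology_Int2)
    show "openin (top_of_set (model X)) (\<phi> ` A)"
      using adapted_image(2)[OF a(2) W] by (simp add: a(1) Int_absorb1 Int_assoc inf.left_commute Int_commute)
    show "homeomorphic_map (subtopology (mtop X) A) (top_of_set (\<phi> ` A)) \<phi>"
      using adapted_homeo[OF a(2)] by (simp add: a(1) subtopology_subtopology inf.left_commute Int_commute)
  qed
  show "carrier X = (\<Union>(U, \<phi>) \<in> charts X. U)"
  proof
    show "carrier X \<subseteq> (\<Union>(U, \<phi>) \<in> charts X. U)"
    proof
      fix x assume "x \<in> carrier X"
      then have xF: "x \<in> F" by simp
      then obtain W \<phi> \<kappa> \<Omega> where "adapted W \<phi> \<kappa> \<Omega>" "x \<in> W" using cover by blast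
      then have "(W \<inter> F, \<phi>) \<in> charts X" "x \<in> W \<inter> F" using xF by (auto simp: chartsX)
      then show "x \<in> (\<Union>(U, \<phi>) \<in> charts X. U)" by blast
    qed
    show "(\<Union>(U, \<phi>) \<in> charts X. U) \<subseteq> carrier X" by (auto simp: chartsX)
  qed
  show "\<forall>(U, \<phi>) \<in> charts X. \<forall>(V, \<psi>) \<in> charts X.
        smooth_on (model X) (\<phi> ` (U \<inter> V)) (\<psi> \<circ> inv_into U \<phi>)"
  proof safe
    fix A \<phi> B \<psi> assume "(A, \<phi>) \<in> charts X" "(B, \<psi>) \<in> charts X"
    then obtain W \<kappa> \<Omega> V \<mu> \<Theta> where a: "A = W \<inter> F" "adapted W \<phi> \<kappa> \<Omega>" and b: "B = V \<inter> F" "adapted V \<psi> \<mu> \<Theta>"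
      by (auto simp: chartsX)
    have "smooth_on K (\<phi> ` (W \<inter> F \<inter> V)) (\<lambda>z. \<psi> (inv_into (W \<inter> F) \<phi> z))"
      by (rule adapted_smooth[OF a(2) conjunct1[OF b(2)[unfolded adapted_def]]])
    moreover have "W \<inter> F \<inter> V = A \<inter> B" using a b by auto
    ultimately show "smooth_on (model X) (\<phi> ` (A \<inter> B)) (\<psi> \<circ> inv_into A \<phi>)" by (simp add: a(1) o_def)
  qed
qed

lemma smooth_map_X: "smooth_map X S id"
  unfolding smooth_map_def
proof (intro conjI)
  show "continuous_map (mtop X) (mtop S) id" by (simp add: continuous_map_id_subt)
  show "\<forall>(U, \<phi>) \<in> charts X. \<forall>(V, \<psi>) \<in> charts S.
        smooth_on (model X) (\<phi> ` {x \<in> U. id x \<in> V}) (\<psi> \<circ> id \<circ> inv_into U \<phi>)"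
  proof safe
    fix A \<phi> V \<psi> assume "(A, \<phi>) \<in> charts X" and v: "(V, \<psi>) \<in> charts S"
    then obtain W \<kappa> \<Omega> where a: "A = W \<inter> F" "adapted W \<phi> \<kappa> \<Omega>" by (auto simp: chartsX)
    have "{x \<in> A. id x \<in> V} = W \<inter> F \<inter> V" using a by auto
    then show "smooth_on (model X) (\<phi> ` {x \<in> A. id x \<in> V}) (\<psi> \<circ> id \<circ> inv_into A \<phi>)"
      using adapted_smooth[OF a(2) chart_pchart[OF S v]] by (simp add: a(1) o_def)
  qed
qed

definition kapX :: "'a set \<Rightarrow> ('a \<Rightarrow> 'e) \<Rightarrow> 'e \<Rightarrow> 'a" where
  "kapX W \<phi> z = inv_into (W \<inter> F) \<phi> (proj K z)"

definition OmX :: "'a set \<Rightarrow> ('a \<Rightarrow> 'e) \<Rightarrow> 'e set" where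
  "OmX W \<phi> = proj K -` \<phi> ` (W \<inter> F)"

lemma pchart_X:
  assumes "adapted W \<phi> \<kappa> \<Omega>" shows "pchart X (W \<inter> F) \<phi> (kapX W \<phi>) (OmX W \<phi>)"
proof -
  have "(W \<inter> F, \<phi>) \<in> charts X" using assms by (auto simp: chartsX)
  from chart_pchart[OF smooth_manifold_X this] show ?thesis by (simp add: kapX_def[abs_def] OmX_def)
qed

text \<open>With the same map \<open>\<phi>\<close> as chart of the fibre and of \<open>S\<close>,
  the inclusion is represented by the projection onto \<open>K\<close>.\<close>

lemma pushforward_X:
  assumes a: "adapted W \<phi> \<kappa> \<Omega>" and x: "x \<in> W" "x \<in> F"
  shows "pushforward S id x (pchart.tv X \<phi> (kapX W \<phi>) x w) = pchart.tv S \<phi> \<kappa> x (proj K w)"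
proof -
  have p: "pchart S W \<phi> \<kappa> \<Omega>" using a by (simp add: adapted_def)
  interpret chart_map X "W \<inter> F" \<phi> "kapX W \<phi>" "OmX W \<phi>" S W \<phi> \<kappa> \<Omega> id
    using p pchart_X[OF a] smooth_map_X by (simp add: chart_map_def chart_map_axioms_def)
  have xWF: "x \<in> W \<inter> F" using x by simp
  have "(phat has_derivative proj K) (at (\<phi> x))"
  proof (rule has_derivative_transform_within_open[OF _ s.open\<Omega> s.phi_in[OF xWF]])
    show "(proj K has_derivative proj K) (at (\<phi> x))"
      by (rule bounded_linear_imp_has_derivative[OF bounded_linear_proj[OF K(1)]])
    show "proj K z = phat z" if "z \<in> OmX W \<phi>" for z
      using s.phi_kappa[OF that] by (simp add: phat_def)
  qed
  from Dop_eq[OF this] show ?thesis using pushforward_tv[OF xWF] x by simp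
qed

lemma embedded_X: "embedded_submanifold X S"
  unfolding embedded_submanifold_def
proof (intro conjI ballI)
  fix x assume "x \<in> carrier X"
  then have x: "x \<in> F" by simp
  obtain W \<phi> \<kappa> \<Omega> where a: "adapted W \<phi> \<kappa> \<Omega>" "x \<in> W" using cover[OF x] by blast
  interpret i: pchart X "W \<inter> F" \<phi> "kapX W \<phi>" "OmX W \<phi>" by (rule pchart_X[OF a(1)])
  interpret s: pchart S W \<phi> \<kappa> \<Omega> using a by (simp add: adapted_def)
  have xWF: "x \<in> W \<inter> F" using a x by simp
  show "inj_on (pushforward S id x) (tangent_space X x)"
  proof (rule inj_onI)
    fix u v assume "u \<in> tangent_space X x" "v \<in> tangent_space X x" and eq: "pushforward S id x u = pushforward S id x v"
    then obtain a' b' where ab: "a' \<in> K" "u = i.tv x a'" "b' \<in> K" "v = i.tv x b'"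
      using i.tangent_obtain[OF _ xWF] by (metis X_simps(2))
    have "s.tv x a' = s.tv x b'"
      using eq ab pushforward_X[OF a(1,2) x] by (simp add: proj_id[OF K(1)])
    from s.tv_inj[OF a(2) this] have "a' = b'" using ab K(2) proj_id[OF s.subE] by (metis subsetD)
    then show "u = v" using ab by simp
  qed
qed (use smooth_manifold_X smooth_map_X F in auto)

end

lemma generalized_inverse_exists:
  fixes B :: "'f::euclidean_space \<Rightarrow>\<^sub>L 'g::euclidean_space"
  obtains R :: "'g \<Rightarrow>\<^sub>L 'f" where "\<And>v. v \<in> range B \<Longrightarrow> B (R v) = v"
proof -
  obtain g where "linear g" "\<forall>v\<in>range B. B (g v) = v"
    using linear_exists_right_inverse_on[OF linear_blinfun_apply subspace_UNIV, of B] by auto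
  then show ?thesis using that[of "Blinfun g"] blinfun_of_linear[of g] by metis
qed

text \<open>
  In a chart adapted to the fibre, the bivector induced on the fibre is
  \<open>P (1 - C\<^sup>T R C P)\<close>, where \<open>P\<close> is the matrix of \<open>\<pi>S\<close>, \<open>C\<close> that of the differential of \<open>p\<close>, and
  \<open>R\<close> is a generalised inverse of the matrix of \<open>\<pi>M\<close> at the base point, which does
  not vary along the fibre.
\<close>

locale poisson_fibre = covered_slice S F K
  for S :: "('a, 'e::euclidean_space) manifold" and F K +
  fixes M :: "('b, 'f::euclidean_space) manifold" and p :: "'a \<Rightarrow> 'b" and m :: 'b
    and \<pi>S :: "'a bivector" and \<pi>M :: "'b bivector"
  assumes Fdef: "F = {x \<in> carrier S. p x = m}"
    and pcover: "x \<in> F \<Longrightarrow> \<exists>U \<phi> \<kappa> \<Omega> V \<psi> \<mu> \<Theta> C c0.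
       poisson_chart_map S U \<phi> \<kappa> \<Omega> M V \<psi> \<mu> \<Theta> p C c0 \<pi>S \<pi>M \<and> x \<in> U \<and>
       adapted U \<phi> \<kappa> \<Omega> \<and> K = {u \<in> model S. C u = 0}"
    and char: "\<And>x. x \<in> carrier S \<Longrightarrow> pushforward M p x ` characteristic_distribution S \<pi>S x
       \<subseteq> characteristic_distribution M \<pi>M (p x)"
begin

text \<open>The bivector is read off from the pulled back graph itself, without reference to a
  chart, so nothing has to be glued; charts only enter to prove uniqueness of the vector and
  smoothness.\<close>

definition uvec :: "'a \<Rightarrow> 'a cvec \<Rightarrow> 'a tvec" where
  "uvec x \<alpha> = (THE u. (u, \<alpha>) \<in> pullback_graph X S \<pi>S x)"

definition piX :: "'a bivector" where
  "piX x \<alpha> \<beta> = \<beta> (uvec x \<alpha>)"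

end

locale poisson_fibre_chart = poisson_fibre S F K M p m \<pi>S \<pi>M +
   poisson_chart_map S U \<phi> \<kappa> \<Omega> M V \<psi> \<mu> \<Theta> p C c0 \<pi>S \<pi>M
  for S :: "('a, 'e::euclidean_space) manifold" and F K
    and M :: "('b, 'f::euclidean_space) manifold" and p :: "'a \<Rightarrow> 'b" and m :: 'b and \<pi>S \<pi>M
    and U \<phi> \<kappa> \<Omega> V \<psi> \<mu> \<Theta> C c0 +
  assumes adp: "adapted U \<phi> \<kappa> \<Omega>" and Keq: "K = {u \<in> model S. C u = 0}"
begin

sublocale i: pchart X "U \<inter> F" \<phi> "kapX U \<phi>" "OmX U \<phi>" by (rule pchart_X[OF adp])

definition R :: "'f \<Rightarrow>\<^sub>L 'f" where
  "R = (SOME R :: 'f \<Rightarrow>\<^sub>L 'f. \<forall>v \<in> range (mb.Pi (\<psi> m)). mb.Pi (\<psi> m) (R v) = v)"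

lemma R: "v \<in> range (mb.Pi (\<psi> m)) \<Longrightarrow> mb.Pi (\<psi> m) (R v) = v"
proof -
  have "\<exists>R. \<forall>v \<in> range (mb.Pi (\<psi> m)). mb.Pi (\<psi> m) (blinfun_apply R v) = v"
    using generalized_inverse_exists[of "mb.Pi (\<psi> m)"] by metis
  from someI_ex[OF this] show "v \<in> range (mb.Pi (\<psi> m)) \<Longrightarrow> ?thesis" unfolding R_def by blast
qed

text \<open>Corrects a covector by an element of the range of \<open>Ct\<close>. This does not
  change its restriction to the fibre, and the correction is chosen such that the Hamiltonian vector
  of the new covector becomes tangent to the fibre.\<close>

definition Q :: "'e \<Rightarrow> ('e \<Rightarrow>\<^sub>L 'e)" where
  "Q z = id_blinfun - (Ct o\<^sub>L (R o\<^sub>L (C o\<^sub>L sb.Pi z)))"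

definition T :: "'e \<Rightarrow> ('e \<Rightarrow>\<^sub>L 'e)" where "T z = sb.Pi z o\<^sub>L Q z"

lemma smooth_T: "smooth \<Omega> T"
  unfolding T_def Q_def
  by (intro smooth_blinfun_compose smooth_diff smooth_const s.open\<Omega> sb.smooth_Pi)

context
  fixes x assumes xU: "x \<in> U" and xF: "x \<in> F"
begin

lemma px: "p x = m" using xF Fdef by simp

lemma xUF: "x \<in> U \<inter> F" using xU xF by simp

lemma Q_inner: "k \<in> K \<Longrightarrow> k \<bullet> Q (\<phi> x) a = k \<bullet> a"
  unfolding Q_def Keq by (simp add: blinfun.diff_left inner_diff_right inner_commute[of k] bladj_inner)

text \<open>Applying \<open>C\<close> gives \<open>C P a - (C P C^T) R (C P a)\<close>. By the
  characteristic condition \<open>C P a\<close> lies in the range of \<open>PM x = C P C^T\<close>,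
  where \<open>R\<close> is a right inverse, so the difference vanishes.\<close>

lemma T_in_K: "T (\<phi> x) a \<in> K"
proof -
  have "C (PS x a) \<in> range (PM x)"
    using char[OF s.U_carrier[OF xU]] unfolding characteristic_iff_range[OF xU] by auto
  then have "PM x (R (C (PS x a))) = C (PS x a)" using R px by simp
  then have "C (T (\<phi> x) a) = 0"
    by (simp add: T_def Q_def blinfun.diff_left blinfun.diff_right CPC[OF xU])
  then show ?thesis unfolding Keq using sb.Pi_in_E[OF s.phi_in[OF xU]] by (simp add: T_def)
qed

lemma pullback_dphiX: "pullback X S id x (s.dphi x b) = i.dphi x b"
proof
  fix v
  show "pullback X S id x (s.dphi x b) v = i.dphi x b v"
  proof (cases "v \<in> tangent_space X x")
    case True
    obtain w where w: "w \<in> K" "v = i.tv x w" using i.tangent_obtain[OF True xUF] by auto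
    show ?thesis using True w K(2)
      by (simp add: pullback_def pushforward_X[OF adp xU xF] s.dphi_tv[OF xU] i.dphi_tv[OF xUF]
          proj_id[OF K(1)] proj_id[OF s.subE] subsetD)
  qed (simp add: pullback_def i.dphi_def differential_def)
qed

lemma graph_T: "(i.tv x (T (\<phi> x) a), i.dphi x a) \<in> pullback_graph X S \<pi>S x"
proof -
  have "i.dphi x (Q (\<phi> x) a) = i.dphi x a"
  proof (rule i.cotangent_eqI[OF xUF i.dphi_in[OF xUF] i.dphi_in[OF xUF]])
    fix w assume "w \<in> model X"
    then show "i.dphi x (Q (\<phi> x) a) (i.tv x w) = i.dphi x a (i.tv x w)"
      using Q_inner[of w a] by (simp add: i.dphi_tv[OF xUF] proj_id[OF K(1)])
  qed
  then have "pullback X S id x (s.dphi x (Q (\<phi> x) a)) = i.dphi x a" by (simp add: pullback_dphiX)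
  moreover have "pushforward S id x (i.tv x (T (\<phi> x) a)) = sharp S \<pi>S x (s.dphi x (Q (\<phi> x) a))"
    using T_in_K[of a] by (simp add: pushforward_X[OF adp xU xF] proj_id[OF K(1)] sb.sharp_dphi[OF xU] T_def)
  ultimately show ?thesis
    unfolding pullback_graph_def using i.tv_in[OF xUF] s.dphi_in[OF xU] by force
qed

text \<open>The orthogonal complement of the kernel of \<open>C\<close> is the range of its
  adjoint.\<close>

lemma orthogonal_K_range:
  assumes c: "c \<in> model S" "\<And>k. k \<in> K \<Longrightarrow> k \<bullet> c = 0"
  obtains \<eta> where "c = Ct \<eta>"
proof -
  let ?R = "range Ct"
  have sub: "subspace ?R" using linear_subspace_image[OF linear_blinfun_apply subspace_UNIV] .
  let ?d = "c - proj ?R c"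
  have perp: "\<eta> \<bullet> C ?d = 0" for \<eta>
    using proj_sym[OF sub, of "Ct \<eta>" c] proj_id[OF sub, of "Ct \<eta>"]
    by (simp add: bladj_inner[symmetric] inner_diff_right)
  have "C ?d = 0" using perp[of "C ?d"] by simp
  moreover have "?d \<in> model S"
    using c(1) proj_in[OF sub, of c] Ct_in subspace_diff[OF s.subE] by auto
  ultimately have "?d \<in> K" by (simp add: Keq)
  then have "?d \<bullet> c = 0" by (rule c(2))
  moreover have "?d \<bullet> proj ?R c = 0"
    using proj_sym[OF sub, of c "proj ?R c"] unfolding inner_diff_left proj_proj[OF sub] by simp
  ultimately have "?d \<bullet> ?d = 0" by (simp add: inner_diff_right)
  then have "c = proj ?R c" by simp
  then have "c \<in> ?R" using proj_in[OF sub] by metis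
  then show ?thesis using that by blast
qed

text \<open>Two covectors with the same restriction to the fibre differ by some
  \<open>Ct \<eta>\<close>. The difference of the two vectors is then
  \<open>PS x (Ct \<eta>)\<close> and tangent to the fibre, so applying \<open>C\<close> shows
  \<open>PM x \<eta> = 0\<close>, and the kernel condition makes the difference vanish.\<close>

lemma graph_unique:
  assumes "(u, \<alpha>) \<in> pullback_graph X S \<pi>S x" "(u', \<alpha>) \<in> pullback_graph X S \<pi>S x"
  shows "u = u'"
proof -
  have "\<exists>w b. w \<in> K \<and> b \<in> model S \<and> u = i.tv x w \<and> w = PS x b \<and> \<alpha> = i.dphi x b"
    if "(u, \<alpha>) \<in> pullback_graph X S \<pi>S x" for u
  proof -
    obtain \<xi> where \<xi>: "u \<in> tangent_space X x" "\<xi> \<in> cotangent_space S x" "pushforward S id x u = sharp S \<pi>S x \<xi>"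
      "\<alpha> = pullback X S id x \<xi>" using \<open>(u, \<alpha>) \<in> _\<close> unfolding pullback_graph_def by blast
    obtain b where b: "b \<in> model S" "\<xi> = s.dphi x b" using s.cotangent_obtain[OF \<xi>(2) xU] .
    obtain w where w: "w \<in> K" "u = i.tv x w" using i.tangent_obtain[OF \<xi>(1) xUF] by auto
    have "s.tv x w = s.tv x (PS x b)"
      using \<xi>(3) w b by (simp add: pushforward_X[OF adp xU xF] sb.sharp_dphi[OF xU] proj_id[OF K(1)])
    from s.tv_inj[OF xU this] have "w = PS x b"
      using w(1) K(2) sb.Pi_in_E[OF s.phi_in[OF xU]] proj_id[OF s.subE] by (metis subsetD)
    then show ?thesis using w b \<xi>(4) pullback_dphiX by blast
  qed
  then obtain w b w' b' where w: "w \<in> K" "b \<in> model S" "u = i.tv x w" "w = PS x b" "\<alpha> = i.dphi x b"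
    and w': "w' \<in> K" "b' \<in> model S" "u' = i.tv x w'" "w' = PS x b'" "\<alpha> = i.dphi x b'"
    using assms by meson
  have eqd: "i.dphi x b = i.dphi x b'" using w(5) w'(5) by metis
  have "proj K b = proj K b'" using i.dphi_inj[OF xUF eqd] unfolding X_simps .
  then have "k \<bullet> (b - b') = 0" if "k \<in> K" for k
    using proj_sym[OF K(1), of k b] proj_sym[OF K(1), of k b'] proj_id[OF K(1) that] by (simp add: inner_diff_right)
  then obtain \<eta> where \<eta>: "b - b' = Ct \<eta>"
    using orthogonal_K_range[of "b - b'"] w(2) w'(2) subspace_diff[OF s.subE] by blast
  have "w - w' = PS x (Ct \<eta>)" using w w' \<eta> by (simp add: blinfun.diff_right[symmetric])
  moreover have "w - w' \<in> K" using w w' subspace_diff[OF K(1)] by blast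
  ultimately have "PM x \<eta> = 0" using CPC[OF xU, of \<eta>] by (simp add: Keq)
  then have "PS x (Ct \<eta>) = 0"
    using char[OF s.U_carrier[OF xU]] unfolding characteristic_iff_range[OF xU] range_iff_kernel[OF xU] by blast
  then show ?thesis using \<open>w - w' = _\<close> w w' by simp
qed

lemma uvec_eq: "(u, \<alpha>) \<in> pullback_graph X S \<pi>S x \<Longrightarrow> uvec x \<alpha> = u"
  unfolding uvec_def using graph_unique by blast

lemma uvec_dphi: "uvec x (i.dphi x a) = i.tv x (T (\<phi> x) a)"
  by (rule uvec_eq[OF graph_T])

lemma piX_dphi: "piX x (i.dphi x a) (i.dphi x c) = T (\<phi> x) a \<bullet> c"
  by (simp add: piX_def uvec_dphi i.dphi_tv[OF xUF] proj_id[OF K(1) T_in_K])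

lemma T_antisym: "T (\<phi> x) a \<bullet> c = - (T (\<phi> x) c \<bullet> a)"
proof -
  \<comment> \<open>The vector \<open>T (\<phi> x) a\<close> lies in \<open>K\<close>, on which
    pairing with \<open>c\<close> and with \<open>Q (\<phi> x) c\<close> agree. The resulting
    expression is manifestly antisymmetric.\<close>
  have 1: "T (\<phi> x) a \<bullet> c = PS x (Q (\<phi> x) a) \<bullet> Q (\<phi> x) c" for a c
    using Q_inner[OF T_in_K, of a c] by (simp add: T_def)
  show ?thesis unfolding 1 by (rule sb.Pi_antisym[OF s.phi_in[OF xU]])
qed

lemma graph_eq: "pullback_graph X S \<pi>S x = graph X piX x"
proof -
  have sharp: "sharp X piX x \<alpha> = uvec x \<alpha>" if \<alpha>: "\<alpha> \<in> cotangent_space X x" for \<alpha>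
  proof
    fix f
    obtain a where a: "\<alpha> = i.dphi x a" using i.cotangent_obtain[OF \<alpha> xUF] by metis
    have "uvec x \<alpha> \<in> tangent_space X x" unfolding a uvec_dphi by (rule i.tv_in[OF xUF])
    moreover have "uvec x \<alpha> f = 0" if "\<not> smooth_near X x f" using that by (simp add: a uvec_dphi i.tv_def)
    ultimately show "sharp X piX x \<alpha> f = uvec x \<alpha> f" by (auto simp: sharp_def piX_def differential_def)
  qed
  show ?thesis
  proof
    show "graph X piX x \<subseteq> pullback_graph X S \<pi>S x"
    proof
      fix z assume "z \<in> graph X piX x"
      then obtain \<alpha> where \<alpha>: "\<alpha> \<in> cotangent_space X x" "z = (sharp X piX x \<alpha>, \<alpha>)" by (auto simp: graph_def)
      obtain a where a: "\<alpha> = i.dphi x a" using i.cotangent_obtain[OF \<alpha>(1) xUF] by metis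
      show "z \<in> pullback_graph X S \<pi>S x" unfolding \<alpha>(2) sharp[OF \<alpha>(1)] unfolding a uvec_dphi by (rule graph_T)
    qed
    show "pullback_graph X S \<pi>S x \<subseteq> graph X piX x"
    proof
      fix z assume z: "z \<in> pullback_graph X S \<pi>S x"
      then obtain u \<xi> where "z = (u, pullback X S id x \<xi>)" "\<xi> \<in> cotangent_space S x" by (auto simp: pullback_graph_def)
      moreover from this obtain b where "\<xi> = s.dphi x b" using s.cotangent_obtain[OF _ xU] by metis
      ultimately have zz: "z = (u, i.dphi x b)" by (simp add: pullback_dphiX)
      then have "u = sharp X piX x (i.dphi x b)" using z sharp[OF i.dphi_in[OF xUF]] uvec_eq by metis
      then show "z \<in> graph X piX x" unfolding graph_def using zz i.dphi_in[OF xUF] by blast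
    qed
  qed
qed

lemma piX_bilinear:
  assumes "\<xi> \<in> cotangent_space X x" "\<eta> \<in> cotangent_space X x"
  shows "piX x \<xi> \<eta> = - piX x \<eta> \<xi>"
    and "\<zeta> \<in> cotangent_space X x \<Longrightarrow> piX x (\<lambda>v. \<xi> v + \<zeta> v) \<eta> = piX x \<xi> \<eta> + piX x \<zeta> \<eta>"
    and "piX x (\<lambda>v. c * \<xi> v) \<eta> = c * piX x \<xi> \<eta>"
proof -
  obtain a where a: "\<xi> = i.dphi x a" using i.cotangent_obtain[OF assms(1) xUF] by metis
  obtain b where b: "\<eta> = i.dphi x b" using i.cotangent_obtain[OF assms(2) xUF] by metis
  show "piX x \<xi> \<eta> = - piX x \<eta> \<xi>" unfolding a b piX_dphi by (rule T_antisym)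
  show "piX x (\<lambda>v. c * \<xi> v) \<eta> = c * piX x \<xi> \<eta>"
    unfolding a b i.dphi_scale[OF xUF, symmetric] piX_dphi by (simp add: blinfun.scaleR_right)
  assume "\<zeta> \<in> cotangent_space X x"
  then obtain d where d: "\<zeta> = i.dphi x d" using i.cotangent_obtain[OF _ xUF] by metis
  show "piX x (\<lambda>v. \<xi> v + \<zeta> v) \<eta> = piX x \<xi> \<eta> + piX x \<zeta> \<eta>"
    unfolding a b d i.dphi_add[OF xUF, symmetric] piX_dphi by (simp add: blinfun.add_right inner_add_left)
qed

end

lemma smooth_bracket_X:
  assumes x: "x \<in> U" "x \<in> F" and f: "smooth_fun X W f" and g: "smooth_fun X W g" and xW: "x \<in> W"
  shows "\<exists>W'. x \<in> W' \<and> smooth_fun X W' (poisson_bracket X piX f g)"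
proof -
  have W: "openin (mtop X) W" using f by (simp add: smooth_fun_def)
  let ?GW = "{z\<in>OmX U \<phi>. kapX U \<phi> z \<in> W}"
  let ?G = "?GW \<inter> \<Omega>"
  have G0: "open ?GW" by (rule i.open_kappa[OF W])
  have G: "open ?G" using G0 s.open\<Omega> by (simp only: open_Int)
  have sf: "smooth ?G (i.grad f)" "smooth ?G (i.grad g)"
    using i.smooth_grad[OF smooth_subset[OF G0 G _ i.smooth_kappa[OF f]] G]
      i.smooth_grad[OF smooth_subset[OF G0 G _ i.smooth_kappa[OF g]] G] by auto
  let ?H = "\<lambda>z. T z (i.grad f z) \<bullet> i.grad g z"
  have "smooth ?G ?H"
    by (intro smooth_inner smooth_blinfun_apply sf G smooth_subset[OF s.open\<Omega> G _ smooth_T]) auto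
  from i.smooth_phi[OF G this] have 1: "smooth_fun X {y\<in>U \<inter> F. \<phi> y \<in> ?G} (\<lambda>y. ?H (\<phi> y))" .
  have "smooth_fun X {y\<in>U \<inter> F. \<phi> y \<in> ?G} (poisson_bracket X piX f g)"
  proof (rule smooth_fun_cong[OF i.M 1])
    fix y assume y: "y \<in> {y\<in>U \<inter> F. \<phi> y \<in> ?G}"
    then have yU: "y \<in> U" "y \<in> F" "y \<in> U \<inter> F" by auto
    have "y \<in> W" using y i.kappa_phi[OF yU(3)] by auto
    then have n: "smooth_near X y f" "smooth_near X y g" using f g unfolding smooth_near_def by blast+
    show "?H (\<phi> y) = poisson_bracket X piX f g y"
      by (simp add: poisson_bracket_def i.differential_eq[OF yU(3)] n piX_dphi[OF yU(1,2)])
  qed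
  moreover have "x \<in> {y\<in>U \<inter> F. \<phi> y \<in> ?G}"
    using x xW i.phi_in i.kappa_phi s.phi_in by auto
  ultimately show ?thesis by (intro exI[of _ "{y\<in>U \<inter> F. \<phi> y \<in> ?G}"] conjI)
qed

end

context poisson_fibre begin

lemma fibre_chart:
  assumes "x \<in> F"
  obtains U \<phi> \<kappa> \<Omega> V \<psi> \<mu> \<Theta> C c0 where "poisson_fibre_chart S F K M p m \<pi>S \<pi>M U \<phi> \<kappa> \<Omega> V \<psi> \<mu> \<Theta> C c0" "x \<in> U"
proof -
  obtain U \<phi> \<kappa> \<Omega> V \<psi> \<mu> \<Theta> C c0 where
       "poisson_chart_map S U \<phi> \<kappa> \<Omega> M V \<psi> \<mu> \<Theta> p C c0 \<pi>S \<pi>M" "x \<in> U"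
       "adapted U \<phi> \<kappa> \<Omega>" "K = {u \<in> model S. C u = 0}"
    using pcover[OF assms] by blast
  then show ?thesis using that poisson_fibre_axioms
    by (simp add: poisson_fibre_chart_def poisson_fibre_chart_axioms_def)
qed

lemma smooth_bivector_piX: "smooth_bivector X piX"
  unfolding smooth_bivector_def
proof (intro conjI ballI allI impI)
  fix x \<xi> \<eta> assume x: "x \<in> carrier X" and "\<xi> \<in> cotangent_space X x" "\<eta> \<in> cotangent_space X x"
  then have xF: "x \<in> F" by simp
  obtain U \<phi> \<kappa> \<Omega> V \<psi> \<mu> \<Theta> C c0 where c: "poisson_fibre_chart S F K M p m \<pi>S \<pi>M U \<phi> \<kappa> \<Omega> V \<psi> \<mu> \<Theta> C c0" "x \<in> U"
    using fibre_chart[OF xF] .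
  interpret poisson_fibre_chart S F K M p m \<pi>S \<pi>M U \<phi> \<kappa> \<Omega> V \<psi> \<mu> \<Theta> C c0 by (rule c(1))
  note b = piX_bilinear[OF c(2) xF \<open>\<xi> \<in> _\<close> \<open>\<eta> \<in> _\<close>]
  show "piX x \<xi> \<eta> = - piX x \<eta> \<xi>" by (rule b(1))
  show "piX x (\<lambda>v. \<xi> v + \<zeta> v) \<eta> = piX x \<xi> \<eta> + piX x \<zeta> \<eta>" if "\<zeta> \<in> cotangent_space X x" for \<zeta>
    by (rule b(2)[OF that])
  show "piX x (\<lambda>v. c * \<xi> v) \<eta> = c * piX x \<xi> \<eta>" for c by (rule b(3))
next
  fix W f g assume fg: "smooth_fun X W f \<and> smooth_fun X W g"
  then have W: "openin (mtop X) W" by (simp add: smooth_fun_def)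
  show "smooth_fun X W (poisson_bracket X piX f g)"
  proof (rule smooth_fun_local[OF smooth_manifold_X W])
    fix x assume xW: "x \<in> W"
    then have xF: "x \<in> F" using openin_subset[OF W] by auto
    obtain U \<phi> \<kappa> \<Omega> V \<psi> \<mu> \<Theta> C c0 where c: "poisson_fibre_chart S F K M p m \<pi>S \<pi>M U \<phi> \<kappa> \<Omega> V \<psi> \<mu> \<Theta> C c0" "x \<in> U"
      using fibre_chart[OF xF] .
    interpret poisson_fibre_chart S F K M p m \<pi>S \<pi>M U \<phi> \<kappa> \<Omega> V \<psi> \<mu> \<Theta> C c0 by (rule c(1))
    show "\<exists>W'. x \<in> W' \<and> smooth_fun X W' (poisson_bracket X piX f g)"
      by (rule smooth_bracket_X[OF c(2) xF _ _ xW]) (use fg in auto)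
  qed
qed

lemma poisson_dirac_X: "poisson_dirac_submanifold X S \<pi>S"
  unfolding poisson_dirac_submanifold_def
proof (intro conjI exI[of _ piX] embedded_X smooth_bivector_piX ballI)
  fix x assume "x \<in> carrier X"
  then have xF: "x \<in> F" by simp
  obtain U \<phi> \<kappa> \<Omega> V \<psi> \<mu> \<Theta> C c0 where c: "poisson_fibre_chart S F K M p m \<pi>S \<pi>M U \<phi> \<kappa> \<Omega> V \<psi> \<mu> \<Theta> C c0" "x \<in> U"
    using fibre_chart[OF xF] .
  interpret poisson_fibre_chart S F K M p m \<pi>S \<pi>M U \<phi> \<kappa> \<Omega> V \<psi> \<mu> \<Theta> C c0 by (rule c(1))
  show "pullback_graph X S \<pi>S x = graph X piX x" by (rule graph_eq[OF c(2) xF])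
qed

end

theorem characteristic_imp_poisson_fibres:
  assumes ps: "poisson_submersion S \<pi>S M \<pi>M p"
    and char: "\<And>x. x \<in> carrier S \<Longrightarrow> pushforward M p x ` characteristic_distribution S \<pi>S x
       \<subseteq> characteristic_distribution M \<pi>M (p x)"
  shows "has_poisson_fibres S \<pi>S M p"
  unfolding has_poisson_fibres_def
proof
  fix m assume "m \<in> carrier M"
  let ?F = "{x \<in> carrier S. p x = m}"
  have S: "smooth_manifold S" using ps by (simp add: poisson_submersion_def poisson_manifold_def)
  obtain K where KK: "subspace K" "K \<subseteq> model S" "?F \<noteq> {} \<Longrightarrow> dim K + dim (model M) = dim (model S)"
  \<comment> \<open>A submersion need not be onto. Over a point outside the image any subspace
    serves as model of the empty fibre; \<open>S\<close> might be empty, in which case no subspace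
    of the right dimension is provided.\<close>
  proof (cases "?F = {}")
    case True
    then show ?thesis using that[of "{0}"] subspace_0[OF subspace_model[OF S]] by simp
  next
    case False
    then obtain x0 where "x0 \<in> carrier S" by blast
    then show ?thesis using complement_dim_exists[OF ps] that by metis
  qed
  interpret slice S ?F K by unfold_locales (use S KK in auto)
  have pc: "\<exists>U \<phi> \<kappa> \<Omega> V \<psi> \<mu> \<Theta> C c0.
       poisson_chart_map S U \<phi> \<kappa> \<Omega> M V \<psi> \<mu> \<Theta> p C c0 \<pi>S \<pi>M \<and> x \<in> U \<and>
       adapted U \<phi> \<kappa> \<Omega> \<and> K = {u \<in> model S. C u = 0}" if x: "x \<in> ?F" for x
  proof -
    have xS: "x \<in> carrier S" and px: "p x = m" using x by auto
    have "dim K + dim (model M) = dim (model S)" using KK(3) x by blast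
    then obtain U \<phi> \<kappa> \<Omega> V \<psi> \<mu> \<Theta> C c0 where c: "poisson_chart_map S U \<phi> \<kappa> \<Omega> M V \<psi> \<mu> \<Theta> p C c0 \<pi>S \<pi>M" "x \<in> U"
      "\<And>y. y \<in> U \<Longrightarrow> p y = p x \<longleftrightarrow> \<phi> y \<in> K" "K = {u \<in> model S. C u = 0}"
      by (rule poisson_chart_map_exists[OF ps xS KK(1,2)]) blast
    interpret poisson_chart_map S U \<phi> \<kappa> \<Omega> M V \<psi> \<mu> \<Theta> p C c0 \<pi>S \<pi>M by (rule c(1))
    have "adapted U \<phi> \<kappa> \<Omega>"
      unfolding adapted_def using s.pchart_axioms c(3) px s.U_carrier by auto
    then show ?thesis using c(1,2,4) by blast
  qed
  have "poisson_fibre S ?F K M p m \<pi>S \<pi>M"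
  proof (unfold_locales)
    fix x assume "x \<in> ?F"
    from pc[OF this] show "\<exists>W \<phi> \<kappa> \<Omega>. adapted W \<phi> \<kappa> \<Omega> \<and> x \<in> W" by blast
  qed (use pc char in auto)
  then interpret poisson_fibre S ?F K M p m \<pi>S \<pi>M .
  show "\<exists>X :: ('a, 'b) manifold. carrier X = ?F \<and> poisson_dirac_submanifold X S \<pi>S"
    using poisson_dirac_X X_simps(3) by blast
qed

section \<open>Gronwall estimates and existence of integral curves\<close>

section \<open>Ordinary differential equations\<close>

lemma vector_derivative_bound:
  fixes f :: "real \<Rightarrow> 'a::real_normed_vector"
  assumes f: "\<And>t. t \<in> {a..b} \<Longrightarrow> (f has_vector_derivative f' t) (at t within {a..b})"
    and B: "\<And>t. t \<in> {a..b} \<Longrightarrow> norm (f' t) \<le> B" and st: "s \<in> {a..b}" "t \<in> {a..b}"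
  shows "norm (f t - f s) \<le> B * \<bar>t - s\<bar>"
proof -
  have "norm (f t - f s) \<le> B * norm (t - s)"
  proof (rule differentiable_bound[OF _ _ _ st(2,1)])
    show "convex {a..b}" by simp
    show "(f has_derivative (\<lambda>h. h *\<^sub>R f' x)) (at x within {a..b})" if "x \<in> {a..b}" for x
      using f[OF that] by (simp add: has_vector_derivative_def)
    show "onorm (\<lambda>h. h *\<^sub>R f' x) \<le> B" if "x \<in> {a..b}" for x
      by (rule onorm_le) (use mult_right_mono[OF B[OF that] abs_ge_zero] in \<open>simp add: mult.commute\<close>)
  qed
  then show ?thesis by simp
qed

lemma derivative_in_subspace:
  fixes k :: "real \<Rightarrow> 'e::euclidean_space"
  assumes E: "subspace E" and k0: "k a \<in> E" and X: "\<And>t. t \<in> {a..b} \<Longrightarrow> X t \<in> E"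
    and der: "\<And>t. t \<in> {a..b} \<Longrightarrow> (k has_vector_derivative X t) (at t within {a..b})"
    and t: "t \<in> {a..b}"
  shows "k t \<in> E"
proof -
  let ?f = "\<lambda>t. k t - proj E (k t)"
  have "norm (?f t - ?f a) \<le> 0 * \<bar>t - a\<bar>"
  proof (rule vector_derivative_bound[of a b ?f "\<lambda>t. X t - proj E (X t)"])
    show "(?f has_vector_derivative X s - proj E (X s)) (at s within {a..b})" if "s \<in> {a..b}" for s
      by (intro has_vector_derivative_diff der that
          bounded_linear.has_vector_derivative[OF bounded_linear_proj[OF E]])
  qed (use t X in \<open>auto simp: proj_id[OF E]\<close>)
  then have "k t = proj E (k t)" using proj_id[OF E k0] by simp
  then show ?thesis using proj_in[OF E] by metis
qed

text \<open>At the point \<open>m\<close> where the norm is maximal, the mean value bound reads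
  \<open>norm (f m) \<le> (C * norm (f m) + \<epsilon>) * (b - a)\<close>. On an interval this short
  the first term is at most half of the left side.\<close>

lemma gronwall_short:
  fixes f :: "real \<Rightarrow> 'a::real_normed_vector"
  assumes f: "\<And>t. t \<in> {a..b} \<Longrightarrow> (f has_vector_derivative f' t) (at t within {a..b})"
    and B: "\<And>t. t \<in> {a..b} \<Longrightarrow> norm (f' t) \<le> C * norm (f t) + \<epsilon>"
    and s: "s \<in> {a..b}" "f s = 0" and C: "0 \<le> C" "C * (b - a) \<le> 1 / 2" and \<epsilon>: "0 \<le> \<epsilon>"
    and t: "t \<in> {a..b}"
  shows "norm (f t) \<le> 2 * \<epsilon> * (b - a)"
proof -
  have "continuous_on {a..b} f"
    using f has_vector_derivative_continuous by (metis continuous_on_eq_continuous_within)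
  then have "continuous_on {a..b} (\<lambda>t. norm (f t))" by (rule continuous_on_norm)
  moreover have "{a..b} \<noteq> {}" using t by auto
  ultimately obtain m where m: "m \<in> {a..b}" "\<And>x. x \<in> {a..b} \<Longrightarrow> norm (f x) \<le> norm (f m)"
    using continuous_attains_sup[of "{a..b}" "\<lambda>t. norm (f t)"] by auto
  have "norm (f m - f s) \<le> (C * norm (f m) + \<epsilon>) * \<bar>m - s\<bar>"
  proof (rule vector_derivative_bound[OF f _ s(1) m(1)])
    fix x assume x: "x \<in> {a..b}"
    have "norm (f' x) \<le> C * norm (f x) + \<epsilon>" by (rule B[OF x])
    also have "\<dots> \<le> C * norm (f m) + \<epsilon>" using mult_left_mono[OF m(2)[OF x] C(1)] by simp
    finally show "norm (f' x) \<le> C * norm (f m) + \<epsilon>" .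
  qed
  also have "\<dots> \<le> (C * norm (f m) + \<epsilon>) * (b - a)"
    using m(1) s(1) C(1) \<epsilon> by (intro mult_left_mono) auto
  also have "\<dots> = C * (b - a) * norm (f m) + \<epsilon> * (b - a)" by (simp add: algebra_simps)
  also have "\<dots> \<le> 1 / 2 * norm (f m) + \<epsilon> * (b - a)"
    using mult_right_mono[OF C(2), of "norm (f m)"] by simp
  finally have "norm (f m) \<le> 2 * \<epsilon> * (b - a)" using s(2) by simp
  then show ?thesis using m(2)[OF t] by simp
qed

lemma has_vector_derivative_subset:
  "(f has_vector_derivative f') (at x within S) \<Longrightarrow> T \<subseteq> S \<Longrightarrow> (f has_vector_derivative f') (at x within T)"
  unfolding has_vector_derivative_def by (rule has_derivative_subset)

text \<open>Near each time vanishing at one point is equivalent to vanishing at any other, and the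
  interval is connected. No sign or size of \<open>C\<close> is prescribed, hence the absolute
  values below.\<close>

lemma gronwall_zero:
  fixes f :: "real \<Rightarrow> 'a::real_normed_vector"
  assumes f: "\<And>t. t \<in> {a..b} \<Longrightarrow> (f has_vector_derivative f' t) (at t within {a..b})"
    and B: "\<And>t. t \<in> {a..b} \<Longrightarrow> norm (f' t) \<le> C * norm (f t)"
    and s: "s \<in> {a..b}" "f s = 0" and t: "t \<in> {a..b}"
  shows "f t = 0"
proof (rule connected_equivalence_relation[of "{a..b}" s t "\<lambda>x y. f x = 0 \<longleftrightarrow> f y = 0", THEN iffD1])
  fix r assume r: "r \<in> {a..b}"
  \<comment> \<open>A window of length at most \<open>2 * h\<close> meets the requirement of
    \<open>gronwall_short\<close>, as \<open>\<bar>C\<bar> * (2 * h) \<le> 1 / 2\<close>.\<close>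
  define h where "h = 1 / (4 * (\<bar>C\<bar> + 1))"
  have h: "0 < h" by (simp add: h_def)
  let ?J = "{max a (r - h)..min b (r + h)}"
  have zero: "f y = 0" if "u \<in> ?J" "f u = 0" "y \<in> ?J" for u y
  proof -
    have sub: "?J \<subseteq> {a..b}" by auto
    have "norm (f y) \<le> 2 * 0 * (min b (r + h) - max a (r - h))"
    proof (rule gronwall_short[of "max a (r - h)" "min b (r + h)" f f' "\<bar>C\<bar>" 0 u])
      show "(f has_vector_derivative f' x) (at x within ?J)" if "x \<in> ?J" for x
        using has_vector_derivative_subset[OF f sub] that sub by blast
      show "norm (f' x) \<le> \<bar>C\<bar> * norm (f x) + 0" if "x \<in> ?J" for x
        using B[of x] that sub mult_right_mono[of C "\<bar>C\<bar>" "norm (f x)"] by fastforce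
      have "\<bar>C\<bar> * (min b (r + h) - max a (r - h)) \<le> \<bar>C\<bar> * (2 * h)" by (intro mult_left_mono) auto
      also have "\<dots> \<le> 1 / 2" by (simp add: h_def field_simps)
      finally show "\<bar>C\<bar> * (min b (r + h) - max a (r - h)) \<le> 1 / 2" .
    qed (use that in auto)
    then show ?thesis by simp
  qed
  have rJ: "r \<in> ?J" using r h by auto
  show "\<exists>T. openin (top_of_set {a..b}) T \<and> r \<in> T \<and> (\<forall>x\<in>T. (f r = 0) = (f x = 0))"
  proof (intro exI conjI ballI)
    show "openin (top_of_set {a..b}) ({a..b} \<inter> {r - h<..<r + h})" by (rule openin_open_Int) simp
    show "r \<in> {a..b} \<inter> {r - h<..<r + h}" using r h by auto
    fix x assume "x \<in> {a..b} \<inter> {r - h<..<r + h}"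
    then have "x \<in> ?J" by auto
    then show "(f r = 0) = (f x = 0)" using zero rJ by blast
  qed
qed (use s t in auto)

lemma picard_lindelof:
  fixes F :: "'e::euclidean_space \<Rightarrow> 'e"
  assumes T: "0 < T" and R: "0 \<le> R"
    and B: "\<And>y. y \<in> cball q R \<Longrightarrow> norm (F y) \<le> B" "B * T \<le> R"
    and L: "\<And>y z. y \<in> cball q R \<Longrightarrow> z \<in> cball q R \<Longrightarrow> norm (F y - F z) \<le> L * norm (y - z)" "L * T < 1" "0 \<le> L"
  obtains c where "c 0 = q" "\<And>t. t \<in> {-T..T} \<Longrightarrow> c t \<in> cball q R"
    "\<And>t. t \<in> {-T..T} \<Longrightarrow> (c has_vector_derivative F (c t)) (at t within {-T..T})"
proof -
  \<comment> \<open>Clamping time to the interval turns its curves into bounded continuous functions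
    on the whole line, a complete metric space on which Banach's fixed point theorem is
    applied.\<close>
  define cl where "cl t = max (- T) (min T t)" for t :: real
  have cl: "cl t \<in> {-T..T}" "t \<in> {-T..T} \<Longrightarrow> cl t = t" for t using T by (auto simp: cl_def)
  have contcl: "continuous_on UNIV cl" unfolding cl_def by (intro continuous_intros)
  have contF: "continuous_on (cball q R) F"
  proof (rule continuous_onI)
    fix x e assume x: "x \<in> cball q R" and e: "(0::real) < e"
    have "dist (F y) (F x) \<le> e" if "y \<in> cball q R" "dist y x < e / (L + 1)" for y
    proof -
      have "dist (F y) (F x) \<le> L * dist y x" using L(1)[OF that(1) x] by (simp add: dist_norm)
      also have "\<dots> \<le> (L + 1) * (e / (L + 1))" using that(2) L(3) by (intro mult_mono) auto
      finally show ?thesis using L(3) by simp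
    qed
    then show "\<exists>d>0. \<forall>x'\<in>cball q R. dist x' x < d \<longrightarrow> dist (F x') (F x) \<le> e"
      using e L(3) by (intro exI[of _ "e / (L + 1)"]) auto
  qed
  \<comment> \<open>The difference of two integrals represents the integral from 0 to
    \<open>t\<close> for negative \<open>t\<close> as well.\<close>
  define I where "I u t = integral {-T..t} (\<lambda>s. F (u s)) - integral {-T..0} (\<lambda>s. F (u s))" for u and t :: real
  have I: "(I u has_vector_derivative F (u t)) (at t within {-T..T})"
    if "continuous_on {-T..T} u" "\<And>t. u t \<in> cball q R" "t \<in> {-T..T}" for u t
  proof -
    have "continuous_on {-T..T} (\<lambda>s. F (u s))"
      by (rule continuous_on_compose2[OF contF that(1)]) (use that(2) in auto)
    from integral_has_vector_derivative[OF this that(3)]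
    have "((\<lambda>t. integral {-T..t} (\<lambda>s. F (u s)) - integral {-T..0} (\<lambda>s. F (u s)))
        has_vector_derivative F (u t) - 0) (at t within {-T..T})"
      by (intro has_vector_derivative_diff has_vector_derivative_const)
    then show ?thesis by (simp add: I_def[abs_def])
  qed
  have I0: "I u 0 = 0" for u by (simp add: I_def)
  have T0: "0 \<in> {-T..T}" using T by simp
  define S where "S = PiC (UNIV::real set) (\<lambda>_. cball q R)"
  have S: "u \<in> S \<longleftrightarrow> (\<forall>t. apply_bcontfun u t \<in> cball q R)" for u by (auto simp: S_def mem_PiC_iff Pi_iff)
  have contu: "continuous_on A (apply_bcontfun u)" for u :: "real \<Rightarrow>\<^sub>C 'e" and A
    using continuous_on_apply_bcontfun continuous_on_subset by blast
  define G where "G u = Bcontfun (\<lambda>t. q + I (apply_bcontfun u) (cl t))" for u :: "real \<Rightarrow>\<^sub>C 'e"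
  have Ibound: "norm (I (apply_bcontfun u) t) \<le> R" if u: "u \<in> S" "t \<in> {-T..T}" for u t
  proof -
    have u': "\<And>t. apply_bcontfun u t \<in> cball q R" using u S by blast
    have B0: "0 \<le> B" using B(1)[OF u'] norm_ge_zero order.trans by blast
    have "norm (I (apply_bcontfun u) t - I (apply_bcontfun u) 0) \<le> B * \<bar>t - 0\<bar>"
      by (rule vector_derivative_bound[OF I[OF contu u'] B(1)[OF u'] T0 u(2)])
    also have "\<dots> \<le> B * T" using u(2) B0 by (intro mult_left_mono) auto
    finally show ?thesis using B(2) I0 by simp
  qed
  have G: "apply_bcontfun (G u) = (\<lambda>t. q + I (apply_bcontfun u) (cl t))" if u: "u \<in> S" for u
  proof -
    have u': "\<And>t. apply_bcontfun u t \<in> cball q R" using u S by blast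
    have "continuous_on {-T..T} (I (apply_bcontfun u))"
      using I[OF contu u'] has_vector_derivative_continuous by (metis continuous_on_eq_continuous_within)
    then have "continuous_on UNIV (\<lambda>t. I (apply_bcontfun u) (cl t))"
      by (rule continuous_on_compose2[OF _ contcl]) (use cl in auto)
    then have "continuous_on UNIV (\<lambda>t. q + I (apply_bcontfun u) (cl t))" by (intro continuous_intros)
    moreover have "q + I (apply_bcontfun u) (cl t) \<in> cball q R" for t
      using Ibound[OF u cl(1)] by (simp add: dist_norm)
    ultimately have "(\<lambda>t. q + I (apply_bcontfun u) (cl t)) \<in> bcontfun"
      unfolding bcontfun_def by (auto intro!: bounded_subset[OF bounded_cball[of q R]])
    then show ?thesis by (simp add: G_def Bcontfun_inverse)
  qed
  have "\<exists>!u\<in>S. G u = u"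
  proof (rule Banach_fix[of S "L * T"])
    show "complete S" unfolding complete_eq_closed S_def by (rule closed_PiC) simp
    have "const_bcontfun q \<in> S" using R by (simp add: S)
    then show "S \<noteq> {}" by blast
    show "0 \<le> L * T" "L * T < 1" using L T by auto
    show "G ` S \<subseteq> S"
      using Ibound[OF _ cl(1)] by (auto simp: S G dist_norm)
    show "dist (G u) (G v) \<le> L * T * dist u v" if uv: "u \<in> S" "v \<in> S" for u v
    proof (rule dist_bound)
      fix t
      have u': "\<And>t. apply_bcontfun u t \<in> cball q R" and v': "\<And>t. apply_bcontfun v t \<in> cball q R" using uv S by blast+
      have 1: "norm ((I (apply_bcontfun u) (cl t) - I (apply_bcontfun v) (cl t)) - (I (apply_bcontfun u) 0 - I (apply_bcontfun v) 0)) \<le> (L * dist u v) * \<bar>cl t - 0\<bar>"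
      proof (rule vector_derivative_bound[OF _ _ T0 cl(1)])
        show "((\<lambda>t. I (apply_bcontfun u) t - I (apply_bcontfun v) t) has_vector_derivative
          F (apply_bcontfun u s) - F (apply_bcontfun v s)) (at s within {-T..T})" if "s \<in> {-T..T}" for s
          by (intro has_vector_derivative_diff I contu u' v' that)
        show "norm (F (apply_bcontfun u s) - F (apply_bcontfun v s)) \<le> L * dist u v" for s
        proof -
          have "norm (F (apply_bcontfun u s) - F (apply_bcontfun v s)) \<le> L * norm (apply_bcontfun u s - apply_bcontfun v s)"
            by (rule L(1)[OF u' v'])
          also have "\<dots> \<le> L * dist u v"
            using dist_bounded[of u s v] L(3) by (intro mult_left_mono) (auto simp: dist_norm)
          finally show ?thesis .
        qed
      qed
      also have "\<dots> \<le> (L * dist u v) * T" using cl(1)[of t] L(3) by (intro mult_left_mono) auto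
      finally show "dist (apply_bcontfun (G u) t) (apply_bcontfun (G v) t) \<le> L * T * dist u v"
        by (simp add: G uv I0 dist_norm mult_ac)
    qed
  qed
  then obtain u where u: "u \<in> S" "G u = u" by blast
  let ?c = "apply_bcontfun u"
  have u': "\<And>t. ?c t \<in> cball q R" using u S by blast
  have eq: "?c t = q + I ?c (cl t)" for t using G[OF u(1)] u(2) by metis
  show ?thesis
  proof (rule that[of ?c])
    show "?c 0 = q" using eq[of 0] cl(2)[OF T0] I0 by simp
    show "?c t \<in> cball q R" for t by (rule u')
    fix t assume t: "t \<in> {-T..T}"
    have "((\<lambda>t. q + I ?c t) has_vector_derivative 0 + F (?c t)) (at t within {-T..T})"
      by (intro has_vector_derivative_add has_vector_derivative_const I contu u' t)
    then have "((\<lambda>t. q + I ?c t) has_vector_derivative F (?c t)) (at t within {-T..T})" by simp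
    then show "(?c has_vector_derivative F (?c t)) (at t within {-T..T})"
      by (rule has_vector_derivative_transform[OF t, rotated]) (simp add: eq[symmetric] cl(2) eq)
  qed
qed

text \<open>The derivative of the curve is \<open>F\<close> evaluated along it, so each degree of
  differentiability gives the next.\<close>

lemma smooth_integral_curve:
  fixes F :: "'e::euclidean_space \<Rightarrow> 'e"
  assumes F: "smooth N F" "open N" and c: "\<And>t. t \<in> {a<..<b} \<Longrightarrow> c t \<in> N"
    and der: "\<And>t. t \<in> {a<..<b} \<Longrightarrow> (c has_vector_derivative F (c t)) (at t)"
  shows "smooth {a<..<b} c"
proof -
  have "Ck k {a<..<b} c" for k
  proof (induction k)
    case 0
    have "isCont c t" if "t \<in> {a<..<b}" for t
      using has_vector_derivative_continuous[OF der[OF that]] .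
    then show ?case by (simp add: continuous_at_imp_continuous_on)
  next
    case (Suc k)
    have 1: "Ck k {a<..<b} (\<lambda>t. F (c t))"
      by (rule Ck_compose[OF _ F(2) _ Suc]) (use c F(1) in \<open>auto simp: smooth_on_def\<close>)
    show ?case
    proof (rule Ck_SucI[OF open_greaterThanLessThan])
      show "(c has_derivative (\<lambda>h. h *\<^sub>R F (c t))) (at t)" if "t \<in> {a<..<b}" for t
        using der[OF that] by (simp add: has_vector_derivative_def)
      show "Ck k {a<..<b} (\<lambda>t. v *\<^sub>R F (c t))" for v
        by (rule Ck_linear_compose[OF bounded_linear_scaleR_right _ 1]) simp
    qed
  qed
  then show ?thesis by (simp add: smooth_on_def)
qed

lemma local_integral_curve:
  fixes F :: "'e::euclidean_space \<Rightarrow> 'e"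
  assumes F: "smooth N F" "open N" and q: "q \<in> N"
  obtains \<epsilon> c where "0 < \<epsilon>" "c 0 = q" "\<And>t. t \<in> {0..\<epsilon>} \<Longrightarrow> c t \<in> N"
    "\<And>t. t \<in> {0..\<epsilon>} \<Longrightarrow> (c has_vector_derivative F (c t)) (at t within {0..\<epsilon>})"
proof -
  obtain R where R: "0 < R" "cball q R \<subseteq> N" using F(2) q open_contains_cball by blast
  obtain L where L: "0 \<le> L" "\<And>x y. x \<in> cball q R \<Longrightarrow> y \<in> cball q R \<Longrightarrow> norm (F y - F x) \<le> L * norm (y - x)"
    using smooth_lipschitz_on[OF F compact_cball convex_cball R(2)] by metis
  have "bounded (F ` cball q R)"
    using compact_imp_bounded[OF compact_continuous_image[OF continuous_on_subset[OF smooth_continuous[OF F] R(2)] compact_cball]] .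
  then obtain B where B: "0 < B" "\<And>y. y \<in> cball q R \<Longrightarrow> norm (F y) \<le> B" by (auto simp: bounded_pos)
  \<comment> \<open>The first bound keeps the curve in the ball of radius \<open>R\<close>, the
    second makes the integral operator a contraction.\<close>
  define T where "T = min (R / B) (1 / (2 * (L + 1)))"
  have T: "0 < T" using R(1) B(1) L(1) by (simp add: T_def)
  have "B * T \<le> B * (R / B)" using B(1) by (intro mult_left_mono) (auto simp: T_def)
  then have BT: "B * T \<le> R" using B(1) by simp
  have "L * T \<le> L * (1 / (2 * (L + 1)))" using L(1) by (intro mult_left_mono) (auto simp: T_def)
  also have "\<dots> < 1" using L(1) by (auto simp: field_simps)
  finally have LT: "L * T < 1" .
  obtain c where c: "c 0 = q" "\<And>t. t \<in> {-T..T} \<Longrightarrow> c t \<in> cball q R"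
    "\<And>t. t \<in> {-T..T} \<Longrightarrow> (c has_vector_derivative F (c t)) (at t within {-T..T})"
    using picard_lindelof[OF T less_imp_le[OF R(1)] B(2) BT L(2) LT L(1)] by blast
  show ?thesis
  proof (rule that[of T c, OF T c(1)])
    show "c t \<in> N" if "t \<in> {0..T}" for t using c(2)[of t] R(2) that by auto
    show "(c has_vector_derivative F (c t)) (at t within {0..T})" if "t \<in> {0..T}" for t
      by (rule has_vector_derivative_subset[OF c(3)]) (use that in auto)
  qed
qed

section \<open>Horizontal lift, flatness on the rank locus, and plaques near a point\<close>

section \<open>Plaques of the symplectic foliation\<close>

lemma bounded_linear_rank1_left: "bounded_linear (\<lambda>b. rank1_blinfun b w)"
  unfolding rank1_blinfun_def
  by (intro bounded_linear_intros bounded_linear_blinfun_inner_left)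

text \<open>
  \<open>R\<close> is the image of \<open>Pi q0\<close> and \<open>P\<close> the projection onto it. For \<open>z\<close> near \<open>q0\<close>, \<open>H z\<close> lifts vectors of
  \<open>R\<close> to the image of \<open>Pi z\<close>, and \<open>D z\<close> measures the part of \<open>Pi z\<close> that is not horizontal;
  it vanishes iff \<open>Pi z\<close> has the rank of \<open>Pi q0\<close>. The invertible operator \<open>A z\<close> extends the restriction
  of \<open>P Pi z\<close> to \<open>R\<close>.
\<close>

locale local_poisson =
  fixes \<Omega> :: "'f::euclidean_space set" and Pi :: "'f \<Rightarrow> ('f \<Rightarrow>\<^sub>L 'f)" and q0 :: 'f
  assumes open\<Omega>: "open \<Omega>" and smooth_Pi: "smooth \<Omega> Pi" and q0: "q0 \<in> \<Omega>"
    and antisym: "z \<in> \<Omega> \<Longrightarrow> Pi z a \<bullet> b = - (Pi z b \<bullet> a)"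
    and Jac: "z \<in> \<Omega> \<Longrightarrow>
      Dop Pi z (Pi z a) b \<bullet> c + Dop Pi z (Pi z b) c \<bullet> a + Dop Pi z (Pi z c) a \<bullet> b = 0"
begin

text \<open>With \<open>b\<close> fixed, the derivative of \<open>Pi\<close> applied to
  \<open>b\<close>, as an operator in the direction of differentiation; \<open>Lt\<close> is its
  transpose. They are needed as operators because they become coefficients of a linear equation for
  \<open>D\<close>.\<close>

definition Lb :: "'f \<Rightarrow> 'f \<Rightarrow> ('f \<Rightarrow>\<^sub>L 'f)" where
  "Lb z b = (\<Sum>i\<in>Basis. rank1_blinfun i (Dop Pi z i b))"

definition Lt :: "'f \<Rightarrow> 'f \<Rightarrow> ('f \<Rightarrow>\<^sub>L 'f)" where
  "Lt z b = (\<Sum>i\<in>Basis. rank1_blinfun (Dop Pi z i b) i)"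

lemma Lb: "Lb z b v = Dop Pi z v b"
proof -
  have "Dop Pi z v b = Dop Pi z (\<Sum>i\<in>Basis. (v \<bullet> i) *\<^sub>R i) b" by (simp add: euclidean_representation)
  also have "\<dots> = Lb z b v"
    by (simp add: Lb_def blinfun.sum_left blinfun.sum_right blinfun.scaleR_right blinfun.scaleR_left inner_commute[of v])
  finally show ?thesis by simp
qed

lemma Lt: "Lt z b a \<bullet> v = Dop Pi z v b \<bullet> a"
proof -
  have "Dop Pi z v b \<bullet> a = (\<Sum>i\<in>Basis. (i \<bullet> v) *\<^sub>R Dop Pi z i b) \<bullet> a"
    unfolding Lb[of z b v, symmetric] by (simp add: Lb_def blinfun.sum_left)
  then show ?thesis by (simp add: Lt_def blinfun.sum_left inner_sum_left mult.commute)
qed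

lemma Dop_antisym:
  assumes z: "z \<in> \<Omega>" shows "Dop Pi z v a \<bullet> b = - (Dop Pi z v b \<bullet> a)"
proof -
  have d: "((\<lambda>z. Pi z a \<bullet> b) has_derivative (\<lambda>v. Dop Pi z v a \<bullet> b)) (at z)" for a b
    by (intro has_derivative_inner_left bounded_linear.has_derivative[OF blinfun.bounded_linear_left]
        has_derivative_Dop[OF smooth_Pi open\<Omega> z])
  have "((\<lambda>z. Pi z a \<bullet> b) has_derivative (\<lambda>v. - (Dop Pi z v b \<bullet> a))) (at z)"
    by (rule has_derivative_transform_within_open[OF has_derivative_minus[OF d[of b a]] open\<Omega> z])
      (rule antisym[symmetric])
  from has_derivative_unique[OF d this] show ?thesis by metis
qed

text \<open>The Jacobi identity with the test vector \<open>c\<close> removed by antisymmetry and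
  transposition. It expresses the derivative of \<open>Pi\<close> along a Hamiltonian direction as
  \<open>Lb o Pi + Pi o Lt\<close>, where each summand has a factor \<open>Pi\<close>; this is the
  only form in which the Jacobi identity is used from here on.\<close>

lemma Jacobi_solved:
  assumes z: "z \<in> \<Omega>"
  shows "Dop Pi z (Pi z b) a = Dop Pi z (Pi z a) b + Pi z (Lt z b a)"
proof -
  have "Dop Pi z (Pi z b) a \<bullet> c = (Dop Pi z (Pi z a) b + Pi z (Lt z b a)) \<bullet> c" for c
  proof -
    have "Pi z (Lt z b a) \<bullet> c = - (Pi z c \<bullet> Lt z b a)" by (rule antisym[OF z])
    also have "\<dots> = - (Dop Pi z (Pi z c) b \<bullet> a)" by (simp add: inner_commute[of _ "Lt z b a"] Lt)
    finally have "Pi z (Lt z b a) \<bullet> c = - (Dop Pi z (Pi z c) b \<bullet> a)" .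
    moreover have "Dop Pi z (Pi z a) c \<bullet> b = - (Dop Pi z (Pi z a) b \<bullet> c)" by (rule Dop_antisym[OF z])
    ultimately show ?thesis using Jac[OF z, of b a c] by (simp add: inner_add_left)
  qed
  then show ?thesis by (metis vector_eq_rdot)
qed

definition R :: "'f set" where "R = range (Pi q0)"

lemma subR: "subspace R"
  unfolding R_def using linear_subspace_image[OF linear_blinfun_apply subspace_UNIV] .

definition P :: "'f \<Rightarrow>\<^sub>L 'f" where "P = Blinfun (proj R)"

lemma P: "P v = proj R v" by (simp add: P_def blinfun_of_linear linear_proj[OF subR])

lemma P_simps [simp]: "P (P v) = P v" by (simp add: P proj_proj[OF subR])

lemma P_sym: "P a \<bullet> b = a \<bullet> P b" by (simp add: P proj_sym[OF subR])

definition A :: "'f \<Rightarrow> ('f \<Rightarrow>\<^sub>L 'f)" where "A z = (P o\<^sub>L Pi z o\<^sub>L P) + (id_blinfun - P)"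

lemma smooth_A: "smooth \<Omega> A"
  unfolding A_def[abs_def]
  by (intro smooth_add smooth_blinfun_compose smooth_const open\<Omega> smooth_Pi)

text \<open>A vector killed by \<open>A q0\<close> lies both in the range and in the kernel of
  \<open>Pi q0\<close>, and for an antisymmetric operator these are orthogonal.\<close>

lemma A_q0_inj: assumes "A q0 v = 0" shows "v = 0"
proof -
  have PPi: "P (Pi q0 w) = Pi q0 w" for w using proj_id[OF subR, of "Pi q0 w"] by (simp add: P R_def)
  have z: "Pi q0 (P v) + (v - P v) = 0" using assms by (simp add: A_def blinfun.add_left blinfun.diff_left PPi)
  then have "P (Pi q0 (P v) + (v - P v)) = 0" by (simp add: blinfun.zero_right)
  then have p0: "Pi q0 (P v) = 0" by (simp add: blinfun.add_right blinfun.diff_right PPi)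
  then have v: "v = P v" using z by simp
  then have "v \<in> R" by (metis P proj_in[OF subR])
  then obtain a where a: "v = Pi q0 a" by (auto simp: R_def)
  have "v \<bullet> v = Pi q0 a \<bullet> v" using a by simp
  also have "\<dots> = - (Pi q0 v \<bullet> a)" by (rule antisym[OF q0])
  also have "\<dots> = 0" using p0 v by simp
  finally show ?thesis by simp
qed

definition cA :: real where
  "cA = (SOME c. 0 < c \<and> (\<forall>v. c * norm v \<le> norm (A q0 v)))"

lemma cA: "0 < cA" "cA * norm v \<le> norm (A q0 v)"
proof -
  have "\<exists>c. 0 < c \<and> (\<forall>v. c * norm v \<le> norm (A q0 v))"
    using injective_imp_isometric[OF closed_UNIV subspace_UNIV blinfun.bounded_linear_right, of "A q0"] A_q0_inj by auto
  from someI_ex[OF this] show "0 < cA" "cA * norm v \<le> norm (A q0 v)" by (simp_all add: cA_def)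
qed

text \<open>A perturbation of \<open>A q0\<close> smaller than its lower bound \<open>cA\<close> is
  still injective.\<close>

definition \<Omega>1 :: "'f set" where "\<Omega>1 = {z\<in>\<Omega>. norm (A z - A q0) < cA}"

lemma \<Omega>1: "open \<Omega>1" "q0 \<in> \<Omega>1" "\<Omega>1 \<subseteq> \<Omega>"
proof -
  have "continuous_on \<Omega> (\<lambda>z. norm (A z - A q0))"
    by (intro continuous_intros smooth_continuous[OF smooth_A open\<Omega>])
  from continuous_open_preimage[OF this open\<Omega>, of "{..<cA}"]
  show "open \<Omega>1" by (simp add: \<Omega>1_def vimage_def Int_def)
qed (use q0 cA in \<open>auto simp: \<Omega>1_def\<close>)

lemma A_bij: assumes z: "z \<in> \<Omega>1" shows "bij (A z)"
proof -
  have "v = 0" if "A z v = 0" for v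
  proof (rule ccontr)
    assume v: "v \<noteq> 0"
    have "cA * norm v \<le> norm (A q0 v)" by (rule cA)
    also have "A q0 v = - ((A z - A q0) v)" using that by (simp add: blinfun.diff_left)
    also have "norm \<dots> \<le> norm (A z - A q0) * norm v" unfolding norm_minus_cancel by (rule norm_blinfun)
    also have "\<dots> < cA * norm v" using z v by (simp add: \<Omega>1_def)
    finally show False by simp
  qed
  then have "inj (A z)" using linear_injective_0[OF linear_blinfun_apply] by blast
  then show ?thesis using linear_injective_imp_surjective[OF linear_blinfun_apply, of "A z"] by (simp add: bij_def)
qed

definition Ainv :: "'f \<Rightarrow> ('f \<Rightarrow>\<^sub>L 'f)" where "Ainv z = Blinfun (inv (A z))"

lemma Ainv: assumes z: "z \<in> \<Omega>1" shows "A z (Ainv z v) = v" "Ainv z (A z v) = v"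
proof -
  obtain g where g: "linear g" "g \<circ> A z = id"
    using linear_injective_left_inverse[OF linear_blinfun_apply bij_is_inj[OF A_bij[OF z]]] by blast
  have "inv (A z) = g"
    using g(2) bij_is_surj[OF A_bij[OF z]] by (metis inv_unique_comp bij_def o_inv_distrib comp_assoc comp_id id_comp surj_iff A_bij[OF z])
  then have "Ainv z v = inv (A z) v" for v using g(1) by (simp add: Ainv_def blinfun_of_linear)
  then show "A z (Ainv z v) = v" "Ainv z (A z v) = v"
    using A_bij[OF z] by (simp_all add: bij_is_inj bij_is_surj surj_f_inv_f)
qed

text \<open>\<open>J z e\<close> is the covector in \<open>R\<close> whose Hamiltonian vector at
  \<open>z\<close> has the same projection to \<open>R\<close> as \<open>e\<close>; that Hamiltonian
  vector is the horizontal lift \<open>H z e\<close>.\<close>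

definition J :: "'f \<Rightarrow> ('f \<Rightarrow>\<^sub>L 'f)" where "J z = Ainv z o\<^sub>L P"
definition H :: "'f \<Rightarrow> ('f \<Rightarrow>\<^sub>L 'f)" where "H z = Pi z o\<^sub>L J z"
definition D :: "'f \<Rightarrow> ('f \<Rightarrow>\<^sub>L 'f)" where "D z = Pi z - (H z o\<^sub>L Pi z)"

lemma smooth1: "smooth \<Omega>1 Pi" "smooth \<Omega>1 J" "smooth \<Omega>1 H" "smooth \<Omega>1 D"
proof -
  show 1: "smooth \<Omega>1 Pi" by (rule smooth_subset[OF open\<Omega> \<Omega>1(1,3) smooth_Pi])
  have "smooth \<Omega>1 Ainv"
    by (rule smooth_inverse_blinfun[OF \<Omega>1(1) smooth_subset[OF open\<Omega> \<Omega>1(1,3) smooth_A]])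
      (auto intro!: blinfun_eqI simp: Ainv)
  then show 2: "smooth \<Omega>1 J" unfolding J_def[abs_def]
    by (intro smooth_blinfun_compose smooth_const \<Omega>1)
  show 3: "smooth \<Omega>1 H" unfolding H_def[abs_def] by (intro smooth_blinfun_compose 1 2 \<Omega>1)
  show "smooth \<Omega>1 D" unfolding D_def[abs_def] by (intro smooth_diff smooth_blinfun_compose 1 3 \<Omega>1)
qed

context fixes z assumes z: "z \<in> \<Omega>1" begin

lemma z\<Omega>: "z \<in> \<Omega>" using z \<Omega>1 by blast

lemma J_props: "P (J z v) = J z v" "P (Pi z (J z v)) = P v"
proof -
  let ?b = "J z v"
  have e: "P (Pi z (P ?b)) + (?b - P ?b) = P v"
    using Ainv(1)[OF z, of "P v"] by (simp add: J_def A_def blinfun.add_left blinfun.diff_left)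
  then have "P (P (Pi z (P ?b)) + (?b - P ?b)) = P (P v)" by simp
  then have 1: "P (Pi z (P ?b)) = P v" by (simp add: blinfun.add_right blinfun.diff_right)
  then show 2: "P ?b = ?b" using e by simp
  show "P (Pi z ?b) = P v" using 1 2 by simp
qed

lemma J_P: "J z (P v) = J z v" by (simp add: J_def)

lemma H_props: "P (H z v) = P v" "H z (P v) = H z v" "H z (H z v) = H z v"
proof -
  show 1: "P (H z v) = P v" for v by (simp add: H_def J_props)
  show 2: "H z (P v) = H z v" for v by (simp add: H_def J_P)
  show "H z (H z v) = H z v" using 1 2 by metis
qed

text \<open>Antisymmetry of \<open>Pi z\<close> in disguise, since \<open>J z e\<close> lies in
  \<open>R\<close> and \<open>P e\<close> is the projection of \<open>Pi z (J z e)\<close>. It makes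
  the radial curves Hamiltonian in \<open>plaque_step\<close>.\<close>

lemma J_orth: "J z e \<bullet> P e = 0"
proof -
  have "J z e \<bullet> P e = J z e \<bullet> P (Pi z (J z e))" by (simp add: J_props)
  also have "\<dots> = Pi z (J z e) \<bullet> J z e" by (metis P_sym J_props(1) inner_commute)
  also have "\<dots> = 0" using antisym[OF z\<Omega>, of "J z e" "J z e"] by simp
  finally show ?thesis .
qed

lemma D_zero_iff: "D z = 0 \<longleftrightarrow> (\<forall>a. Pi z a = H z (Pi z a))"
proof -
  have "D z = 0 \<longleftrightarrow> (\<forall>a. D z a = 0)" by (metis blinfun_eqI blinfun.zero_left)
  then show ?thesis by (simp add: D_def blinfun.diff_left)
qed

lemma range_H: "range (H z) \<subseteq> range (Pi z)" by (auto simp: H_def)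

lemma dim_range_H: "dim (range (H z)) = dim R"
proof -
  have "range (H z) = H z ` R"
  proof
    show "range (H z) \<subseteq> H z ` R"
    proof safe
      fix v
      have "H z v = H z (P v)" by (simp only: H_props(2))
      moreover have "P v \<in> R" by (simp add: P proj_in[OF subR])
      ultimately show "H z v \<in> H z ` R" by blast
    qed
  qed blast
  moreover have "inj_on (H z) R"
  proof (rule inj_onI)
    fix a b assume "a \<in> R" "b \<in> R" "H z a = H z b"
    then show "a = b" using H_props(1)[of a] H_props(1)[of b] by (simp add: P proj_id[OF subR])
  qed
  moreover have "span R = R" using subR by (rule span_eq_iff[THEN iffD2])
  ultimately show ?thesis using dim_image_eq[OF linear_blinfun_apply, of "H z" R] by metis
qed

text \<open>The range of \<open>H z\<close> is contained in that of \<open>Pi z\<close> and always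
  has dimension \<open>dim R\<close>. Hence the rank cannot drop on \<open>\<Omega>1\<close>, and
  \<open>D\<close> detects exactly where it grows.\<close>

lemma D_zero_iff_rank: "D z = 0 \<longleftrightarrow> dim (range (Pi z)) = dim R"
proof -
  have sub: "subspace (range (Pi z))" "subspace (range (H z))"
    using linear_subspace_image[OF linear_blinfun_apply subspace_UNIV] by blast+
  have "D z = 0 \<longleftrightarrow> range (Pi z) = range (H z)"
  proof
    assume "D z = 0"
    then show "range (Pi z) = range (H z)" using range_H D_zero_iff by (metis image_subsetI rangeI subset_antisym)
  next
    assume "range (Pi z) = range (H z)"
    then have "\<exists>b. Pi z a = H z b" for a by (metis rangeE rangeI)
    then show "D z = 0" unfolding D_zero_iff using H_props(3) by metis
  qed
  also have "\<dots> \<longleftrightarrow> dim (range (Pi z)) = dim R"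
  proof
    assume "range (Pi z) = range (H z)"
    then show "dim (range (Pi z)) = dim R" by (simp only: dim_range_H)
  next
    assume "dim (range (Pi z)) = dim R"
    then show "range (Pi z) = range (H z)"
      using subspace_dim_equal[OF sub(2,1) range_H] dim_range_H by simp
  qed
  finally show ?thesis .
qed

lemma range_eq: "D z = 0 \<Longrightarrow> v \<in> range (Pi z) \<Longrightarrow> H z v = v"
  using D_zero_iff by auto

lemma der: "(Pi has_derivative Dop Pi z) (at z)" "(J has_derivative Dop J z) (at z)"
   "(H has_derivative Dop H z) (at z)" "(D has_derivative Dop D z) (at z)"
  by (rule has_derivative_Dop[OF _ \<Omega>1(1) z]; rule smooth1)+

lemma Dop_H: "Dop H z v = (Pi z o\<^sub>L Dop J z v) + (Dop Pi z v o\<^sub>L J z)"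
  using Dop_eq[OF bounded_bilinear.FDERIV[OF bounded_bilinear_blinfun_compose der(1,2)]]
  by (simp add: H_def[abs_def])

lemma Dop_D: "Dop D z v = Dop Pi z v - ((H z o\<^sub>L Dop Pi z v) + (Dop H z v o\<^sub>L Pi z))"
  using Dop_eq[OF has_derivative_diff[OF der(1) bounded_bilinear.FDERIV[OF bounded_bilinear_blinfun_compose der(3,1)]]]
  by (simp add: D_def[abs_def])

lemma Dop_HH: "(H z o\<^sub>L Dop H z v) + (Dop H z v o\<^sub>L H z) = Dop H z v"
proof -
  have "(H has_derivative (\<lambda>v. (H z o\<^sub>L Dop H z v) + (Dop H z v o\<^sub>L H z))) (at z)"
    by (rule has_derivative_transform_within_open[OF
        bounded_bilinear.FDERIV[OF bounded_bilinear_blinfun_compose der(3,3)] \<Omega>1(1) z])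
      (auto intro!: blinfun_eqI simp: local_poisson.H_props[OF local_poisson_axioms])
  from fun_cong[OF has_derivative_unique[OF this der(3)], of v] show ?thesis .
qed

lemma P_Dop_H: "P (Dop H z v e) = 0"
proof -
  have "((\<lambda>y. P (H y e)) has_derivative (\<lambda>v. P (Dop H z v e))) (at z)"
    by (intro bounded_linear.has_derivative[OF blinfun.bounded_linear_right]
        bounded_linear.has_derivative[OF blinfun.bounded_linear_left] der)
  then have "((\<lambda>y. P e) has_derivative (\<lambda>v. P (Dop H z v e))) (at z)"
    by (rule has_derivative_transform_within_open[OF _ \<Omega>1(1) z]) (rule local_poisson.H_props[OF local_poisson_axioms])
  from has_derivative_unique[OF this has_derivative_const] show ?thesis by metis
qed

text \<open>
  The bracket of two horizontal fields is vertical, and on the rank \<open>dim R\<close> locus it is also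
  tangent to the image of \<open>Pi\<close>, which is horizontal there.
\<close>

lemma flat:
  assumes "D z = 0" shows "Dop H z (H z d) e = Dop H z (H z e) d"
proof -
  let ?X = "Dop H z (H z d) e - Dop H z (H z e) d"
  let ?a = "J z e" and ?b = "J z d"
  have "Dop H z (H z d) e = Pi z (Dop J z (H z d) e) + Dop Pi z (Pi z ?b) ?a"
    "Dop H z (H z e) d = Pi z (Dop J z (H z e) d) + Dop Pi z (Pi z ?a) ?b"
    by (simp_all add: Dop_H blinfun.add_left H_def)
  then have "?X = Pi z (Dop J z (H z d) e - Dop J z (H z e) d + Lt z ?b ?a)"
    by (simp add: Jacobi_solved[OF z\<Omega>, of ?b ?a] blinfun.add_right blinfun.diff_right)
  then have "?X = H z ?X" using range_eq[OF assms] by (metis rangeI)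
  also have "\<dots> = H z (P ?X)" by (simp add: H_props)
  also have "\<dots> = 0" by (simp add: blinfun.diff_right P_Dop_H blinfun.zero_right)
  finally show ?thesis by simp
qed

text \<open>Along Hamiltonian directions the derivative of \<open>D\<close> is homogeneous linear in
  \<open>D\<close>, with a left and a right coefficient that stay bounded on compact sets. It holds
  on all of \<open>\<Omega>1\<close>, which is what lets Gronwall's inequality show that zeros of
  \<open>D\<close> propagate.\<close>

lemma Dop_D_hamiltonian:
  fixes b :: 'f
  defines "v \<equiv> Pi z b"
  shows "Dop D z v = (D z o\<^sub>L (Lt z b - (((Lt z b o\<^sub>L J z) + Dop J z v) o\<^sub>L Pi z)))
      + ((((id_blinfun - H z) o\<^sub>L Lb z b) - Dop H z v) o\<^sub>L D z)"
proof -
  have Pi': "Dop Pi z v a = Lb z b (Pi z a) + Pi z (Lt z b a)" for a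
    unfolding v_def Lb by (rule Jacobi_solved[OF z\<Omega>])
  have D: "D z a = Pi z a - H z (Pi z a)" for a by (simp add: D_def blinfun.diff_left)
  have H': "Dop H z v a = Pi z (Dop J z v a) + Lb z b (Pi z (J z a)) + Pi z (Lt z b (J z a))" for a
    by (simp add: Dop_H blinfun.add_left Pi')
  have HH': "Dop H z v (H z a) = Dop H z v a - H z (Dop H z v a)" for a
    using arg_cong[OF Dop_HH[of v], of "\<lambda>F. blinfun_apply F a"]
    by (simp add: blinfun.add_left eq_diff_eq add.commute)
  show ?thesis
  proof (rule blinfun_eqI)
    fix a
    let ?w = "Pi z a"
    \<comment> \<open>Differentiating \<open>H H = H\<close> turns \<open>Dop H z v (H z w)\<close>
      into \<open>(1 - H) (Dop H z v w)\<close>, and \<open>1 - H\<close> sends every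
      \<open>Pi z\<close> to \<open>D z\<close>. The remaining \<open>Lb\<close> term cancels
      against the one in the derivative of \<open>Pi\<close>.\<close>
    have 1: "Dop H z v (H z ?w) = D z (Dop J z v ?w) + (Lb z b (H z ?w) - H z (Lb z b (H z ?w))) + D z (Lt z b (J z ?w))"
      unfolding HH' by (simp add: H' D H_def blinfun.add_right)
    have 2: "Dop D z v a = Lb z b ?w - H z (Lb z b ?w) + D z (Lt z b a) - Dop H z v ?w"
      by (simp add: Dop_D blinfun.diff_left blinfun.add_left Pi' D blinfun.add_right)
    have 3: "?w = H z ?w + D z a" by (simp add: D)
    have 4: "Lb z b ?w = Lb z b (H z ?w) + Lb z b (D z a)" "Dop H z v ?w = Dop H z v (H z ?w) + Dop H z v (D z a)"
      using 3 blinfun.add_right by metis+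
    show "Dop D z v a = ((D z o\<^sub>L (Lt z b - (((Lt z b o\<^sub>L J z) + Dop J z v) o\<^sub>L Pi z)))
      + ((((id_blinfun - H z) o\<^sub>L Lb z b) - Dop H z v) o\<^sub>L D z)) a"
      unfolding 2 4 1
      by (simp add: blinfun.add_left blinfun.diff_left blinfun.diff_right blinfun.add_right)
  qed
qed

end

lemma compact_bound:
  fixes f :: "'f \<Rightarrow> 'g::real_normed_vector"
  assumes "smooth \<Omega>1 f" "compact K" "K \<subseteq> \<Omega>1"
  obtains B where "0 < B" "\<And>z. z \<in> K \<Longrightarrow> norm (f z) \<le> B"
proof -
  have "bounded (f ` K)"
    by (rule compact_imp_bounded[OF compact_continuous_image[OF
      continuous_on_subset[OF smooth_continuous[OF assms(1) \<Omega>1(1)] assms(3)] assms(2)]])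
  then show ?thesis using that by (auto simp: bounded_pos)
qed

lemma smooth_Lb: assumes "smooth \<Omega>1 b" shows "smooth \<Omega>1 (\<lambda>z. Lb z (b z))" "smooth \<Omega>1 (\<lambda>z. Lt z (b z))"
proof -
  have 1: "smooth \<Omega>1 (\<lambda>z. Dop Pi z i (b z))" for i
    by (intro smooth_blinfun_apply \<Omega>1(1) assms smooth_Dop[OF smooth1(1)] smooth_const)
  show "smooth \<Omega>1 (\<lambda>z. Lb z (b z))" unfolding Lb_def
    by (intro smooth_sum smooth_linear_compose[OF bounded_linear_rank1] 1 \<Omega>1)
  show "smooth \<Omega>1 (\<lambda>z. Lt z (b z))" unfolding Lt_def
    by (intro smooth_sum smooth_linear_compose[OF bounded_linear_rank1_left] 1 \<Omega>1)
qed

text \<open>At each time the velocity \<open>H (c t) e\<close> is the Hamiltonian vector of the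
  covector \<open>J (c t) e\<close>, so the homogeneous linear equation for \<open>D\<close> applies
  along the curve.\<close>

lemma D_zero_along:
  assumes K: "compact K" "K \<subseteq> \<Omega>1" and cK: "\<And>t. t \<in> {a..b} \<Longrightarrow> c t \<in> K"
    and c: "\<And>t. t \<in> {a..b} \<Longrightarrow> (c has_vector_derivative H (c t) e) (at t within {a..b})"
    and s: "s \<in> {a..b}" "D (c s) = 0" and t: "t \<in> {a..b}"
  shows "D (c t) = 0"
proof -
  let ?b = "\<lambda>z. J z e"
  let ?v = "\<lambda>z. Pi z (?b z)"
  let ?X = "\<lambda>z. Lt z (?b z) - (((Lt z (?b z) o\<^sub>L J z) + Dop J z (?v z)) o\<^sub>L Pi z)"
  let ?Y = "\<lambda>z. ((id_blinfun - H z) o\<^sub>L Lb z (?b z)) - Dop H z (?v z)"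
  have sb: "smooth \<Omega>1 ?b" by (intro smooth_blinfun_apply \<Omega>1(1) smooth1 smooth_const)
  have sv: "smooth \<Omega>1 ?v" by (intro smooth_blinfun_apply \<Omega>1(1) smooth1 sb)
  have X: "smooth \<Omega>1 ?X" and Y: "smooth \<Omega>1 ?Y"
    by (intro smooth_diff smooth_add smooth_blinfun_compose smooth_Lb sb smooth1 \<Omega>1(1)
      smooth_blinfun_apply[OF \<Omega>1(1) _ sv] smooth_Dop smooth_const)+
  obtain BX where BX: "0 < BX" "\<And>z. z \<in> K \<Longrightarrow> norm (?X z) \<le> BX" using compact_bound[OF X K] by blast
  obtain BY where BY: "0 < BY" "\<And>z. z \<in> K \<Longrightarrow> norm (?Y z) \<le> BY" using compact_bound[OF Y K] by blast
  show ?thesis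
  proof (rule gronwall_zero[of a b "\<lambda>t. D (c t)" "\<lambda>t. Dop D (c t) (H (c t) e)" "BX + BY" s t])
    fix t assume t: "t \<in> {a..b}"
    have z: "c t \<in> \<Omega>1" using cK[OF t] K by blast
    show "((\<lambda>t. D (c t)) has_vector_derivative Dop D (c t) (H (c t) e)) (at t within {a..b})"
      using has_derivative_compose[OF c[OF t, unfolded has_vector_derivative_def] der(4)[OF z]]
      by (simp add: has_vector_derivative_def blinfun.scaleR_right)
    have "Dop D (c t) (H (c t) e) = (D (c t) o\<^sub>L ?X (c t)) + (?Y (c t) o\<^sub>L D (c t))"
      using Dop_D_hamiltonian[OF z, of "J (c t) e"] by (simp add: H_def)
    then have "norm (Dop D (c t) (H (c t) e)) \<le> norm (D (c t)) * norm (?X (c t)) + norm (?Y (c t)) * norm (D (c t))"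
      using norm_triangle_le[OF add_mono[OF norm_blinfun_compose norm_blinfun_compose]] by metis
    also have "\<dots> \<le> norm (D (c t)) * BX + BY * norm (D (c t))"
      by (intro add_mono mult_left_mono mult_right_mono BX(2) BY(2) cK t norm_ge_zero)
    finally show "norm (Dop D (c t) (H (c t) e)) \<le> (BX + BY) * norm (D (c t))" by (simp add: algebra_simps)
  qed (use s t in auto)
qed

end

text \<open>The smallness of \<open>\<rho>\<close> has two purposes. A curve of speed at most
  \<open>B * \<rho>\<close> moves by at most \<open>r0\<close> within time 2, so it stays where the
  bounds hold when it starts within \<open>r0\<close> of \<open>q0\<close>. And
  \<open>L * \<rho>\<close> is small enough for the contraction on an interval of radius 2 and for
  \<open>gronwall_short\<close> on the unit interval.\<close>

locale plaque = local_poisson \<Omega> Pi q0 for \<Omega> Pi and q0 :: "'f::euclidean_space" +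
  fixes r0 B L C2 \<rho> :: real
  assumes r0: "0 < r0" "cball q0 (2 * r0) \<subseteq> \<Omega>1"
    and B: "0 < B" "\<And>z. z \<in> cball q0 (2 * r0) \<Longrightarrow> norm (H z) \<le> B"
    and L: "0 < L" "\<And>y z. y \<in> cball q0 (2 * r0) \<Longrightarrow> z \<in> cball q0 (2 * r0) \<Longrightarrow> norm (H y - H z) \<le> L * norm (y - z)"
      "\<And>z. z \<in> cball q0 (2 * r0) \<Longrightarrow> norm (Dop H z) \<le> L"
    and C2: "0 \<le> C2" "\<And>x y. x \<in> cball q0 (2 * r0) \<Longrightarrow> y \<in> cball q0 (2 * r0) \<Longrightarrow>
      norm (H y - H x - Dop H x (y - x)) \<le> C2 * norm (y - x) ^ 2"
    and \<rho>: "0 < \<rho>" "2 * (B * \<rho>) \<le> r0" "2 * (L * \<rho>) \<le> 1 / 2"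

lemma (in local_poisson) plaque_exists:
  obtains r0 B L C2 \<rho> where "plaque \<Omega> Pi q0 r0 B L C2 \<rho>"
proof -
  obtain r where r: "0 < r" "cball q0 r \<subseteq> \<Omega>1" using \<Omega>1 open_contains_cball by blast
  define r0 where "r0 = r / 2"
  have r0: "0 < r0" "cball q0 (2 * r0) \<subseteq> \<Omega>1" using r by (auto simp: r0_def)
  let ?K = "cball q0 (2 * r0)"
  obtain B where B: "0 < B" "\<And>z. z \<in> ?K \<Longrightarrow> norm (H z) \<le> B"
    using compact_bound[OF smooth1(3) compact_cball r0(2)] by metis
  obtain L1 where L1: "0 \<le> L1" "\<And>y z. y \<in> ?K \<Longrightarrow> z \<in> ?K \<Longrightarrow> norm (H z - H y) \<le> L1 * norm (z - y)"
    using smooth_lipschitz_on[OF smooth1(3) \<Omega>1(1) compact_cball convex_cball r0(2)] by metis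
  obtain L2 where L2: "0 < L2" "\<And>z. z \<in> ?K \<Longrightarrow> norm (Dop H z) \<le> L2"
    using compact_bound[OF smooth_Dop[OF smooth1(3) \<Omega>1(1)] compact_cball r0(2)] by metis
  obtain C2 where C2: "0 \<le> C2" "\<And>x y. x \<in> ?K \<Longrightarrow> y \<in> ?K \<Longrightarrow>
      norm (H y - H x - Dop H x (y - x)) \<le> C2 * norm (y - x) ^ 2"
    using smooth_taylor2[OF smooth1(3) \<Omega>1(1) compact_cball convex_cball r0(2)] by metis
  define L where "L = L1 + L2"
  define \<rho> where "\<rho> = min (r0 / (2 * B)) (1 / (4 * L))"
  have L: "0 < L" using L1 L2 by (simp add: L_def)
  have "plaque \<Omega> Pi q0 r0 B L C2 \<rho>"
  proof
    show "norm (H y - H z) \<le> L * norm (y - z)" if "y \<in> ?K" "z \<in> ?K" for y z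
    proof -
      have "L1 * norm (y - z) \<le> L * norm (y - z)" using L2(1) by (intro mult_right_mono) (auto simp: L_def)
      then show ?thesis using L1(2)[OF that(2,1)] by simp
    qed
    show "norm (Dop H z) \<le> L" if "z \<in> ?K" for z using L2(2)[OF that] L1(1) by (simp add: L_def)
    show "0 < \<rho>" using r0 B L by (simp add: \<rho>_def)
    have "B * \<rho> \<le> B * (r0 / (2 * B))" using B(1) by (intro mult_left_mono) (auto simp: \<rho>_def)
    then show "2 * (B * \<rho>) \<le> r0" using B(1) by simp
    have "L * \<rho> \<le> L * (1 / (4 * L))" using L by (intro mult_left_mono) (auto simp: \<rho>_def)
    then show "2 * (L * \<rho>) \<le> 1 / 2" using L by simp
  qed (use r0 B L C2 in auto)
  then show ?thesis by (rule that)
qed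

context plaque begin

abbreviation "K \<equiv> cball q0 (2 * r0)"

text \<open>Time runs through \<open>{-2..2}\<close> although only \<open>{0..1}\<close> is
  travelled: the Hamiltonian built in \<open>plaque_step\<close> must be smooth on a neighbourhood
  of the unit segment.\<close>

definition curve :: "'f \<Rightarrow> 'f \<Rightarrow> real \<Rightarrow> 'f" where
  "curve q e = (SOME c. c 0 = q \<and> (\<forall>t\<in>{-2..2}. c t \<in> cball q r0 \<and>
     (c has_vector_derivative H (c t) e) (at t within {-2..2})))"

definition phi :: "'f \<Rightarrow> 'f \<Rightarrow> 'f" where "phi q e = curve q e 1"

context
  fixes q assumes q: "q \<in> cball q0 r0"
begin

lemma qK: "cball q r0 \<subseteq> K"
proof
  fix z assume "z \<in> cball q r0"
  then show "z \<in> K" using q dist_triangle[of q0 z q] by auto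
qed

lemma curve:
  assumes e: "norm e \<le> \<rho>"
  shows "curve q e 0 = q" "t \<in> {-2..2} \<Longrightarrow> curve q e t \<in> cball q r0"
    "t \<in> {-2..2} \<Longrightarrow> (curve q e has_vector_derivative H (curve q e t) e) (at t within {-2..2})"
proof -
  have *: "norm (F e) \<le> c * \<rho>" if "norm F \<le> c" "0 \<le> c" for F :: "'f \<Rightarrow>\<^sub>L 'f" and c
    using order.trans[OF norm_blinfun mult_mono[OF that(1) e that(2) norm_ge_zero]] .
  have "\<exists>c. c 0 = q \<and> (\<forall>t\<in>{-2..2}. c t \<in> cball q r0 \<and>
     (c has_vector_derivative H (c t) e) (at t within {-2..2}))"
  proof (rule picard_lindelof[of 2 r0 q "\<lambda>z. H z e" "B * \<rho>" "L * \<rho>"])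
    show "norm (H y e) \<le> B * \<rho>" if "y \<in> cball q r0" for y using B(2)[of y] that qK B(1) * by auto
    show "norm (H y e - H z e) \<le> L * \<rho> * norm (y - z)" if "y \<in> cball q r0" "z \<in> cball q r0" for y z
    proof -
      have "norm ((H y - H z) e) \<le> (L * norm (y - z)) * \<rho>"
        using L(2)[of y z] that qK L(1) * by (simp add: subset_iff)
      then show ?thesis by (simp add: blinfun.diff_left mult_ac)
    qed
  qed (use r0 \<rho> L(1) in auto)
  from someI_ex[OF this]
  show "curve q e 0 = q" "t \<in> {-2..2} \<Longrightarrow> curve q e t \<in> cball q r0"
    "t \<in> {-2..2} \<Longrightarrow> (curve q e has_vector_derivative H (curve q e t) e) (at t within {-2..2})"
    unfolding curve_def by blast+
qed

lemma curve_K: "norm e \<le> \<rho> \<Longrightarrow> t \<in> {-2..2} \<Longrightarrow> curve q e t \<in> K"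
  using curve(2) qK by blast

lemma curve_\<Omega>1: "norm e \<le> \<rho> \<Longrightarrow> t \<in> {-2..2} \<Longrightarrow> curve q e t \<in> \<Omega>1"
  using curve_K r0 by blast

text \<open>Horizontal lifts have the projection of the vector they lift, so the projected curve has
  constant velocity. Consequently \<open>phi q e\<close> lies over \<open>P q + P e\<close>, and the
  plaque is a graph over a piece of an affine copy of \<open>R\<close>.\<close>

lemma curve_P:
  assumes e: "norm e \<le> \<rho>" and t: "t \<in> {-2..2}"
  shows "P (curve q e t) = P q + t *\<^sub>R P e"
proof -
  let ?f = "\<lambda>t. P (curve q e t) - t *\<^sub>R P e"
  have "norm (?f t - ?f 0) \<le> 0 * \<bar>t - 0\<bar>"
  proof (rule vector_derivative_bound[of "-2" 2 ?f "\<lambda>t. P (H (curve q e t) e) - P e"])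
    fix s :: real assume s: "s \<in> {-2..2}"
    have "((\<lambda>t. P (curve q e t)) has_vector_derivative P (H (curve q e s) e)) (at s within {-2..2})"
      by (rule bounded_linear.has_vector_derivative[OF blinfun.bounded_linear_right curve(3)[OF e s]])
    moreover have "((\<lambda>t. t *\<^sub>R P e) has_vector_derivative P e) (at s within {-2..2})"
      by (auto intro!: derivative_eq_intros)
    ultimately show "(?f has_vector_derivative P (H (curve q e s) e) - P e) (at s within {-2..2})"
      by (rule has_vector_derivative_diff)
    show "norm (P (H (curve q e s) e) - P e) \<le> 0"
      by (simp add: H_props(1)[OF curve_\<Omega>1[OF e s]])
  qed (use t in auto)
  then show ?thesis by (simp add: curve(1)[OF e] algebra_simps)
qed

lemma curve_D:
  assumes e: "norm e \<le> \<rho>" and t: "t \<in> {-2..2}" and D: "D q = 0"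
  shows "D (curve q e t) = 0"
  by (rule D_zero_along[OF compact_cball[of q0 "2 * r0"] r0(2) curve_K[OF e] curve(3)[OF e], of 0])
    (use t D curve(1)[OF e] in auto)

lemma curve_smooth:
  assumes e: "norm e \<le> \<rho>" shows "smooth {-2<..<2} (curve q e)"
proof (rule smooth_integral_curve[of \<Omega>1 "\<lambda>z. H z e"])
  show "smooth \<Omega>1 (\<lambda>z. H z e)" by (intro smooth_blinfun_apply \<Omega>1 smooth1 smooth_const)
  show "curve q e t \<in> \<Omega>1" if "t \<in> {-2<..<2}" for t using curve_\<Omega>1[OF e] that by auto
  show "(curve q e has_vector_derivative H (curve q e t) e) (at t)" if "t \<in> {-2<..<2}" for t
  proof -
    have "(curve q e has_vector_derivative H (curve q e t) e) (at t within {-2<..<2})"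
      by (rule has_vector_derivative_subset[OF curve(3)[OF e]]) (use that in auto)
    then show ?thesis unfolding at_within_open[OF that open_greaterThanLessThan] .
  qed
qed (rule \<Omega>1)

lemma curve_derivative01:
  assumes "norm e \<le> \<rho>" "t \<in> {0..1}"
  shows "(curve q e has_vector_derivative H (curve q e t) e) (at t within {0..1})"
  by (rule has_vector_derivative_subset[OF curve(3)[OF assms(1)]]) (use assms(2) in auto)

lemma curve_subspace:
  assumes e: "norm e \<le> \<rho>" and t: "t \<in> {0..1}" and E: "subspace E" "q \<in> E" "\<And>z v. z \<in> \<Omega>1 \<Longrightarrow> Pi z v \<in> E"
  shows "curve q e t \<in> E"
proof (rule derivative_in_subspace[OF E(1) _ _ curve_derivative01[OF e] t])
  show "curve q e 0 \<in> E" using curve(1)[OF e] E(2) by simp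
  show "H (curve q e s) e \<in> E" if "s \<in> {0..1}" for s
    unfolding H_def using E(3) curve_\<Omega>1[OF e, of s] that by simp
qed

lemma phi_0: "phi q 0 = q"
proof -
  have e: "norm (0::'f) \<le> \<rho>" using \<rho> by simp
  have "norm (curve q 0 1 - curve q 0 0) \<le> 0 * \<bar>1 - 0\<bar>"
    by (rule vector_derivative_bound[OF curve_derivative01[OF e]]) (auto simp: blinfun.zero_right)
  then show ?thesis using curve(1)[OF e] by (simp add: phi_def)
qed

lemma phi_D: "norm e \<le> \<rho> \<Longrightarrow> D q = 0 \<Longrightarrow> D (phi q e) = 0"
  unfolding phi_def by (rule curve_D) auto

lemma phi_K: "norm e \<le> \<rho> \<Longrightarrow> phi q e \<in> K"
  unfolding phi_def by (rule curve_K) auto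

lemma curve_lipschitz:
  assumes e: "norm e \<le> \<rho>" and ed: "norm (e + d) \<le> \<rho>" and t: "t \<in> {0..1}"
  shows "norm (curve q (e + d) t - curve q e t) \<le> 2 * B * norm d"
proof -
  let ?c = "curve q e" and ?c' = "curve q (e + d)"
  have "norm (?c' t - ?c t) \<le> 2 * (B * norm d) * (1 - 0)"
  proof (rule gronwall_short[of 0 1 "\<lambda>t. ?c' t - ?c t" "\<lambda>t. H (?c' t) (e + d) - H (?c t) e" "L * \<rho>" _ 0])
    fix s :: real assume s: "s \<in> {0..1}"
    show "((\<lambda>t. ?c' t - ?c t) has_vector_derivative H (?c' s) (e + d) - H (?c s) e) (at s within {0..1})"
      by (intro has_vector_derivative_diff curve_derivative01 e ed s)
    have K: "?c s \<in> K" "?c' s \<in> K" using curve_K[OF e] curve_K[OF ed] s by auto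
    have eq: "H (?c' s) (e + d) - H (?c s) e = (H (?c' s) - H (?c s)) (e + d) + H (?c s) d"
      by (simp add: blinfun.diff_left blinfun.add_right)
    have "norm ((H (?c' s) - H (?c s)) (e + d) + H (?c s) d) \<le> norm (H (?c' s) - H (?c s)) * norm (e + d) + norm (H (?c s)) * norm d"
      by (intro norm_triangle_le add_mono norm_blinfun)
    also have "\<dots> \<le> (L * norm (?c' s - ?c s)) * \<rho> + B * norm d"
      using L(1) B(1) by (intro add_mono mult_mono L(2) B(2) K ed) auto
    finally show "norm (H (?c' s) (e + d) - H (?c s) e) \<le> L * \<rho> * norm (?c' s - ?c s) + B * norm d"
      unfolding eq by (simp add: mult_ac)
  qed (use t \<rho> L(1) B(1) curve(1)[OF e] curve(1)[OF ed] in auto)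
  then show ?thesis by simp
qed

text \<open>Flatness makes \<open>s *\<^sub>R H (c s) d\<close> an exact solution of the linearised
  equation along the curve, so what is left after subtracting it satisfies a Gronwall inequality
  with a source quadratic in \<open>d\<close>. The plaque is therefore tangent to the horizontal
  spaces at all of its points, not only along its radii.\<close>

lemma phi_quadratic:
  assumes D: "D q = 0" and e: "norm e \<le> \<rho>" and ed: "norm (e + d) \<le> \<rho>"
  shows "norm (phi q (e + d) - phi q e - H (phi q e) d) \<le> 2 * (4 * C2 * B ^ 2 * \<rho> + 2 * L * B) * norm d ^ 2"
proof -
  let ?c = "curve q e" and ?c' = "curve q (e + d)"
  \<comment> \<open>The subtracted term is the expected first variation of the radial curve; at time
    1 it is the claimed derivative of \<open>phi q\<close> at \<open>e\<close>.\<close>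
  let ?z = "\<lambda>s. ?c' s - ?c s - s *\<^sub>R H (?c s) d"
  let ?z' = "\<lambda>s. H (?c' s) (e + d) - H (?c s) e - (s *\<^sub>R Dop H (?c s) (H (?c s) e) d + H (?c s) d)"
  \<comment> \<open>With \<open>2 * B * norm d\<close> bounding the distance of the two curves, the
    first constant is the Taylor remainder of \<open>H\<close> applied to a vector of norm at most
    \<open>\<rho>\<close>, the second the derivative of \<open>H\<close> along this distance applied
    to \<open>d\<close>.\<close>
  let ?\<epsilon> = "(4 * C2 * B ^ 2 * \<rho> + 2 * L * B) * norm d ^ 2"
  have "norm (?z 1) \<le> 2 * ?\<epsilon> * (1 - 0)"
  proof (rule gronwall_short[of 0 1 ?z ?z' "L * \<rho>" _ 0])
    fix s :: real assume s: "s \<in> {0..1}"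
    have K: "?c s \<in> K" "?c' s \<in> K" and \<Omega>1: "?c s \<in> \<Omega>1" using curve_K[OF e] curve_K[OF ed] curve_\<Omega>1[OF e] s by auto
    have Dc: "D (?c s) = 0" using curve_D[OF e _ D] s by simp
    have "((\<lambda>s. H (?c s) d) has_vector_derivative Dop H (?c s) (H (?c s) e) d) (at s within {0..1})"
    proof -
      have "((\<lambda>s. H (?c s)) has_derivative (\<lambda>h. Dop H (?c s) (h *\<^sub>R H (?c s) e))) (at s within {0..1})"
        by (rule has_derivative_compose[OF curve_derivative01[OF e s, unfolded has_vector_derivative_def] der(3)[OF \<Omega>1]])
      from bounded_linear.has_derivative[OF blinfun.bounded_linear_left this]
      show ?thesis by (simp add: has_vector_derivative_def blinfun.scaleR_right blinfun.scaleR_left)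
    qed
    from has_vector_derivative_scaleR[OF DERIV_ident this]
    have "((\<lambda>s. s *\<^sub>R H (?c s) d) has_vector_derivative s *\<^sub>R Dop H (?c s) (H (?c s) e) d + H (?c s) d) (at s within {0..1})"
      by simp
    then show "(?z has_vector_derivative ?z' s) (at s within {0..1})"
      by (intro has_vector_derivative_diff curve_derivative01 e ed s)
    let ?\<Delta> = "?c' s - ?c s"
    let ?T = "H (?c' s) - H (?c s) - Dop H (?c s) ?\<Delta>"
    have \<Delta>: "?\<Delta> = ?z s + s *\<^sub>R H (?c s) d" by simp
    have f1: "Dop H (?c s) ?\<Delta> e = Dop H (?c s) (?z s) e + s *\<^sub>R Dop H (?c s) (H (?c s) d) e"
      by (subst \<Delta>) (simp only: blinfun.add_right blinfun.add_left blinfun.scaleR_right blinfun.scaleR_left)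
    \<comment> \<open>The only use of flatness: exchanging \<open>d\<close> and \<open>e\<close>
      makes this term cancel the derivative of \<open>s *\<^sub>R H (c s) d\<close>.\<close>
    have fl: "Dop H (?c s) ?\<Delta> e = Dop H (?c s) (?z s) e + s *\<^sub>R Dop H (?c s) (H (?c s) e) d"
      using f1 unfolding flat[OF \<Omega>1 Dc, of d e] .
    have "?z' s = ?T (e + d) + Dop H (?c s) ?\<Delta> e + Dop H (?c s) ?\<Delta> d - s *\<^sub>R Dop H (?c s) (H (?c s) e) d"
      by (simp add: blinfun.diff_left blinfun.add_right)
    then have zeq: "?z' s = ?T (e + d) + Dop H (?c s) (?z s) e + Dop H (?c s) ?\<Delta> d"
      unfolding fl by simp
    have "norm (?T (e + d) + Dop H (?c s) (?z s) e + Dop H (?c s) ?\<Delta> d) \<le> norm (?T (e + d)) + norm (Dop H (?c s) (?z s) e) + norm (Dop H (?c s) ?\<Delta> d)"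
      by (intro norm_triangle_le add_mono order_refl)
    also have "\<dots> \<le> (C2 * (2 * B * norm d) ^ 2) * \<rho> + (L * norm (?z s)) * \<rho> + (L * (2 * B * norm d)) * norm d"
    proof (intro add_mono)
      have \<Delta>b: "norm ?\<Delta> \<le> 2 * B * norm d" by (rule curve_lipschitz[OF e ed s])
      have "norm ?T \<le> C2 * norm ?\<Delta> ^ 2" by (rule C2(2)[OF K])
      also have "\<dots> \<le> C2 * (2 * B * norm d) ^ 2" by (intro mult_left_mono power_mono \<Delta>b C2(1)) auto
      finally show "norm (?T (e + d)) \<le> (C2 * (2 * B * norm d) ^ 2) * \<rho>"
        using C2(1) by (intro order.trans[OF norm_blinfun] mult_mono ed) auto
      have DL: "norm (Dop H (?c s) v) \<le> L * norm v" for v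
        by (intro order.trans[OF norm_blinfun] mult_right_mono L(3) K) auto
      show "norm (Dop H (?c s) (?z s) e) \<le> (L * norm (?z s)) * \<rho>"
        using L(1) by (intro order.trans[OF norm_blinfun] mult_mono DL e) auto
      have "norm (Dop H (?c s) ?\<Delta>) \<le> L * (2 * B * norm d)"
        using L(1) \<Delta>b by (intro order.trans[OF DL] mult_left_mono) auto
      then show "norm (Dop H (?c s) ?\<Delta> d) \<le> (L * (2 * B * norm d)) * norm d"
        by (rule order.trans[OF norm_blinfun mult_right_mono[OF _ norm_ge_zero]])
    qed
    finally have zle: "norm (?T (e + d) + Dop H (?c s) (?z s) e + Dop H (?c s) ?\<Delta> d)
      \<le> (C2 * (2 * B * norm d) ^ 2) * \<rho> + (L * norm (?z s)) * \<rho> + (L * (2 * B * norm d)) * norm d" .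
    have "(C2 * (2 * B * norm d) ^ 2) * \<rho> + (L * n) * \<rho> + (L * (2 * B * norm d)) * norm d = L * \<rho> * n + ?\<epsilon>" for n
      by (simp add: power2_eq_square algebra_simps)
    then show "norm (?z' s) \<le> L * \<rho> * norm (?z s) + ?\<epsilon>"
      using zle unfolding zeq by (simp only:)
  next
    show "0 \<le> ?\<epsilon>" using C2(1) \<rho>(1) L(1) B(1) by simp
  qed (use \<rho> L(1) curve(1)[OF e] curve(1)[OF ed] in auto)
  then show ?thesis by (simp add: phi_def algebra_simps)
qed

lemma phi_has_derivative:
  assumes D: "D q = 0" and e: "norm e < \<rho>"
  shows "(phi q has_derivative H (phi q e)) (at e)"
  unfolding has_derivative_at_alt
proof (intro conjI blinfun.bounded_linear_right allI impI)
  fix \<epsilon> :: real assume \<epsilon>: "0 < \<epsilon>"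
  let ?C = "2 * (4 * C2 * B ^ 2 * \<rho> + 2 * L * B)"
  have C: "0 \<le> ?C" using C2(1) \<rho>(1) L(1) B(1) by simp
  show "\<exists>d>0. \<forall>y. norm (y - e) < d \<longrightarrow> norm (phi q y - phi q e - H (phi q e) (y - e)) \<le> \<epsilon> * norm (y - e)"
  proof (intro exI[of _ "min (\<rho> - norm e) (\<epsilon> / (?C + 1))"] conjI allI impI)
    show "0 < min (\<rho> - norm e) (\<epsilon> / (?C + 1))" using e \<epsilon> C by simp
    fix y assume y: "norm (y - e) < min (\<rho> - norm e) (\<epsilon> / (?C + 1))"
    have "norm (e + (y - e)) \<le> \<rho>" using norm_triangle_ineq[of e "y - e"] y by simp
    from phi_quadratic[OF D less_imp_le[OF e] this]
    have "norm (phi q y - phi q e - H (phi q e) (y - e)) \<le> ?C * norm (y - e) ^ 2" by simp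
    also have "\<dots> = (?C * norm (y - e)) * norm (y - e)" by (simp add: power2_eq_square)
    also have "\<dots> \<le> \<epsilon> * norm (y - e)"
    proof (rule mult_right_mono)
      have "?C * norm (y - e) \<le> (?C + 1) * (\<epsilon> / (?C + 1))" using y C by (intro mult_mono) auto
      then show "?C * norm (y - e) \<le> \<epsilon>" using C by simp
    qed simp
    finally show "norm (phi q y - phi q e - H (phi q e) (y - e)) \<le> \<epsilon> * norm (y - e)" .
  qed
qed

lemma phi_continuous: "D q = 0 \<Longrightarrow> continuous_on (ball 0 \<rho>) (phi q)"
  using phi_has_derivative has_derivative_continuous by (force intro!: continuous_at_imp_continuous_on)

end

text \<open>The quarter of \<open>\<rho>\<close> ensures that any two points of the ball differ by
  less than \<open>\<rho>\<close>, so that \<open>y - q\<close> is an admissible parameter of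
  \<open>phi q\<close>.\<close>

definition \<delta> :: real where "\<delta> = min r0 (\<rho> / 4)"

lemma \<delta>: "0 < \<delta>" using r0 \<rho> by (simp add: \<delta>_def)

lemma ball_\<delta>:
  assumes "q \<in> ball q0 \<delta>"
  shows "q \<in> cball q0 r0" "q \<in> K" "q \<in> \<Omega>1" "y \<in> ball q0 \<delta> \<Longrightarrow> norm (y - q) < \<rho>"
proof -
  show "q \<in> cball q0 r0" "q \<in> K" using assms r0 by (auto simp: \<delta>_def)
  then show "q \<in> \<Omega>1" using r0 by blast
  show "norm (y - q) < \<rho>" if "y \<in> ball q0 \<delta>"
  proof -
    have "dist y q \<le> dist q0 y + dist q0 q" by (metis dist_commute dist_triangle)
    also have "\<dots> < \<rho> / 4 + \<rho> / 4" using that assms by (intro add_strict_mono) (auto simp: \<delta>_def)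
    finally show ?thesis using \<rho>(1) by (simp add: dist_norm)
  qed
qed

text \<open>The point \<open>phi q (y t - q)\<close> lies on the plaque over the same point of
  \<open>R\<close> as \<open>y t\<close>. Since \<open>phi q\<close> has derivative
  \<open>H\<close>, the deviation moves with the non-horizontal part of the velocity, measured at
  the plaque point.\<close>

lemma deviation_derivative:
  assumes q: "q \<in> ball q0 \<delta>" "D q = 0" and y: "y t \<in> ball q0 \<delta>"
    and Y: "(y has_vector_derivative v) (at t within S)"
  shows "((\<lambda>t. y t - phi q (y t - q)) has_vector_derivative v - H (phi q (y t - q)) v) (at t within S)"
proof -
  have "((\<lambda>t. y t - q) has_vector_derivative v - 0) (at t within S)"
    by (intro has_vector_derivative_diff Y has_vector_derivative_const)
  then have "((\<lambda>t. y t - q) has_derivative (\<lambda>h. h *\<^sub>R v)) (at t within S)" by (simp add: has_vector_derivative_def)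
  from has_derivative_compose[OF this phi_has_derivative[OF ball_\<delta>(1)[OF q(1)] q(2) ball_\<delta>(4)[OF q(1) y]]]
  have "((\<lambda>t. phi q (y t - q)) has_vector_derivative H (phi q (y t - q)) v) (at t within S)"
    by (simp add: has_vector_derivative_def blinfun.scaleR_right)
  then show ?thesis by (intro has_vector_derivative_diff Y)
qed

text \<open>Horizontality of the velocity is only demanded up to a multiple of the distance to the
  plaque: replacing \<open>H (y t)\<close> by \<open>H\<close> at the plaque point costs an error of
  the same kind, and Gronwall's inequality tolerates both.\<close>

lemma stay_on_plaque:
  assumes q: "q \<in> ball q0 \<delta>" "D q = 0" and y: "\<And>t. t \<in> {a..b} \<Longrightarrow> y t \<in> ball q0 \<delta>"
    and Y: "\<And>t. t \<in> {a..b} \<Longrightarrow> (y has_vector_derivative Y t) (at t within {a..b})"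
    and BY: "\<And>t. t \<in> {a..b} \<Longrightarrow> norm (Y t) \<le> BY"
    and C: "\<And>t. t \<in> {a..b} \<Longrightarrow> norm (Y t - H (y t) (Y t)) \<le> C * norm (y t - phi q (y t - q))"
    and s: "s \<in> {a..b}" "y s = phi q (y s - q)" and t: "t \<in> {a..b}"
  shows "y t = phi q (y t - q)"
proof -
  have "y t - phi q (y t - q) = 0"
  proof (rule gronwall_zero[OF deviation_derivative[OF q y Y] _ s(1) _ t])
    fix t assume t: "t \<in> {a..b}"
    let ?w = "phi q (y t - q)"
    have w: "?w \<in> K" using phi_K[OF ball_\<delta>(1)[OF q(1)] less_imp_le[OF ball_\<delta>(4)[OF q(1) y[OF t]]]] .
    have "Y t - H ?w (Y t) = (Y t - H (y t) (Y t)) + (H (y t) - H ?w) (Y t)" by (simp add: blinfun.diff_left)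
    also have "norm \<dots> \<le> C * norm (y t - ?w) + (L * norm (y t - ?w)) * BY"
      using L(1) by (intro norm_triangle_le add_mono C t order.trans[OF norm_blinfun] mult_mono L(2) BY
          ball_\<delta>(2)[OF y] w) auto
    finally show "norm (Y t - H ?w (Y t)) \<le> (C + L * BY) * norm (y t - ?w)" by (simp add: algebra_simps)
  qed (use s in auto)
  then show ?thesis by simp
qed

text \<open>At a point of the plaque the deviation vanishes with derivative
  \<open>v - H (y t) v\<close>, which is non-zero, so its zero is isolated.\<close>

lemma transverse_isolated:
  assumes q: "q \<in> ball q0 \<delta>" "D q = 0" and y: "y t \<in> ball q0 \<delta>"
    and Y: "(y has_vector_derivative v) (at t within S)"
    and on: "y t = phi q (y t - q)" and tr: "H (y t) v \<noteq> v"
  shows "\<exists>\<epsilon>>0. \<forall>s\<in>S. 0 < \<bar>s - t\<bar> \<and> \<bar>s - t\<bar> < \<epsilon> \<longrightarrow> y s \<noteq> phi q (y s - q)"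
proof -
  let ?z = "\<lambda>t. y t - phi q (y t - q)"
  let ?v = "v - H (y t) v"
  have z: "(?z has_derivative (\<lambda>h. h *\<^sub>R ?v)) (at t within S)"
    using deviation_derivative[where y = y and t = t and v = v and S = S, OF q y Y] on
    by (simp add: has_vector_derivative_def)
  have v: "0 < norm ?v" using tr by simp
  from z v obtain \<epsilon> where \<epsilon>: "0 < \<epsilon>" "\<And>s. s \<in> S \<Longrightarrow> norm (s - t) < \<epsilon> \<Longrightarrow>
      norm (?z s - ?z t - (s - t) *\<^sub>R ?v) \<le> norm ?v / 2 * norm (s - t)"
    unfolding has_derivative_within_alt by (metis half_gt_zero)
  have "y s \<noteq> phi q (y s - q)" if s: "s \<in> S" "0 < \<bar>s - t\<bar>" "\<bar>s - t\<bar> < \<epsilon>" for s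
  proof
    assume "y s = phi q (y s - q)"
    then have "norm ((s - t) *\<^sub>R ?v) \<le> norm ?v / 2 * \<bar>s - t\<bar>" using \<epsilon>(2)[OF s(1)] s(3) on by simp
    then have "\<bar>s - t\<bar> * norm ?v \<le> \<bar>s - t\<bar> * (norm ?v / 2)" by (simp add: mult.commute)
    then have "norm ?v \<le> norm ?v / 2" using s(2) by (simp only: mult_le_cancel_left_pos)
    then show False using v by simp
  qed
  then show ?thesis using \<epsilon>(1) by blast
qed

end

section \<open>Hamiltonian curves, and plaques as pieces of leaves\<close>

section \<open>Hamiltonian curves and leaves\<close>

lemma hamiltonian_step_refl:
  assumes M: "smooth_manifold M" and x: "x \<in> carrier M"
  shows "hamiltonian_step M \<pi> x x"
proof -
  obtain U \<phi> \<kappa> \<Omega> where c: "pchart M U \<phi> \<kappa> \<Omega>" "x \<in> U" using pchart_exists[OF M x] .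
  interpret pchart M U \<phi> \<kappa> \<Omega> by (rule c(1))
  \<comment> \<open>The time interval is a single point, where any number is a derivative; the
    Hamiltonian is the zero function.\<close>
  have "hamiltonian_curve M \<pi> U (\<lambda>y. \<phi> y \<bullet> 0) 0 0 (\<lambda>t. x)"
    unfolding hamiltonian_curve_def using smooth_fun_coord[of 0] c(2) U_carrier
    by (auto simp: carrier_def has_field_derivative_def has_derivative_within_singleton_iff bounded_linear_mult_right)
  then show ?thesis unfolding hamiltonian_step_def by blast
qed

lemma hamiltonian_step_carrier:
  assumes "hamiltonian_step M \<pi> x y" shows "x \<in> carrier M" "y \<in> carrier M"
proof -
  obtain U h a b \<gamma> where c: "hamiltonian_curve M \<pi> U h a b \<gamma>" "\<gamma> a = x" "\<gamma> b = y"
    using assms unfolding hamiltonian_step_def by blast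
  then have "openin (mtop M) U" "a \<le> b" "\<gamma> ` {a..b} \<subseteq> U" by (auto simp: hamiltonian_curve_def smooth_fun_def)
  then show "x \<in> carrier M" "y \<in> carrier M"
    using c openin_subset[of "mtop M" U] by (auto simp: carrier_def image_subset_iff)
qed

lemma smooth_fun_scale:
  assumes M: "smooth_manifold M" and f: "smooth_fun M W f" shows "smooth_fun M W (\<lambda>y. c * f y)"
proof -
  have W: "openin (mtop M) W" using f by (simp add: smooth_fun_def)
  show ?thesis unfolding smooth_fun_iff[OF M]
  proof (intro conjI W ballI, clarify)
    fix V \<psi> assume c: "(V, \<psi>) \<in> charts M"
    have o: "open (proj (model M) -` \<psi> ` (W \<inter> V))"
      by (rule open_proj_vimage[OF subspace_model[OF M] chart_open_image[OF M c W]])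
    show "smooth (proj (model M) -` \<psi> ` (W \<inter> V)) (\<lambda>z. c * f (inv_into V \<psi> (proj (model M) z)))"
      by (rule smooth_mult[OF o smooth_const[OF o]]) (use f c in \<open>auto simp: smooth_fun_iff[OF M]\<close>)
  qed
qed

lemma sharp_uminus:
  assumes M: "smooth_manifold M" and biv: "smooth_bivector M \<pi>" and x: "x \<in> carrier M" and h: "smooth_near M x h"
  shows "sharp M \<pi> x (differential M x (\<lambda>y. (-1) * h y)) f = - sharp M \<pi> x (differential M x h) f"
proof -
  obtain U \<phi> \<kappa> \<Omega> where c: "pchart M U \<phi> \<kappa> \<Omega>" "x \<in> U" using pchart_exists[OF M x] .
  interpret bichart M U \<phi> \<kappa> \<Omega> \<pi> using c(1) biv by (simp add: bichart_def bichart_axioms_def)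
  have "differential M x (\<lambda>y. (-1) * h y) = (\<lambda>v. (-1) * differential M x h v)"
    using tangent_vectorD(4)[OF _ c(2) h, of _ "-1"] by (auto simp: differential_def)
  then show ?thesis
    using biv_props(3)[OF c(2) differential_in[OF c(2)] differential_in[OF c(2)], of "-1" h f] by (simp add: sharp_def)
qed

lemma hamiltonian_step_sym:
  assumes M: "smooth_manifold M" and biv: "smooth_bivector M \<pi>" and st: "hamiltonian_step M \<pi> x y"
  shows "hamiltonian_step M \<pi> y x"
proof -
  obtain U h a b \<gamma> where c: "hamiltonian_curve M \<pi> U h a b \<gamma>" "\<gamma> a = x" "\<gamma> b = y"
    using st unfolding hamiltonian_step_def by blast
  then have U: "openin (mtop M) U" and h: "smooth_fun M U h" and ab: "a \<le> b" and gU: "\<gamma> ` {a..b} \<subseteq> U"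
    and cont: "continuous_map (top_of_set {a..b}) (mtop M) \<gamma>"
    and der: "\<And>t f. t \<in> {a..b} \<Longrightarrow> smooth_near M (\<gamma> t) f \<Longrightarrow>
        ((f \<circ> \<gamma>) has_real_derivative sharp M \<pi> (\<gamma> t) (differential M (\<gamma> t) h) f) (at t within {a..b})"
    by (auto simp: hamiltonian_curve_def smooth_fun_def)
  let ?g = "\<lambda>t. \<gamma> (- t)" and ?h = "\<lambda>y. (-1) * h y"
  have im: "uminus ` {-b..-a} = {a..b}" by (simp add: image_uminus_atLeastAtMost)
  have "hamiltonian_curve M \<pi> U ?h (-b) (-a) ?g"
    unfolding hamiltonian_curve_def
  proof (intro conjI ballI allI impI)
    show "smooth_fun M U ?h" by (rule smooth_fun_scale[OF M h])
    show "-b \<le> -a" using ab by simp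
    show "?g ` {-b..-a} \<subseteq> U" using gU im by (auto simp: image_subset_iff)
    have "continuous_map (top_of_set {-b..-a}) (top_of_set {a..b}) uminus"
      using im by (auto simp: continuous_on_minus intro!: continuous_intros)
    from continuous_map_compose[OF this cont]
    show "continuous_map (top_of_set {-b..-a}) (mtop M) ?g" by (simp add: o_def)
    fix t f assume t: "t \<in> {-b..-a}" and f: "smooth_near M (\<gamma> (- t)) f"
    have t': "- t \<in> {a..b}" using t by auto
    have gt: "\<gamma> (- t) \<in> U" "\<gamma> (- t) \<in> carrier M"
      using gU t' openin_subset[OF U] by (auto simp: carrier_def image_subset_iff)
    have near: "smooth_near M (\<gamma> (- t)) h" using gt h unfolding smooth_near_def by blast
    have "((f \<circ> \<gamma>) has_real_derivative sharp M \<pi> (\<gamma> (- t)) (differential M (\<gamma> (- t)) h) f) (at (- t) within uminus ` {-b..-a})"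
      unfolding im by (rule der[OF t' f])
    moreover have "(uminus has_real_derivative -1) (at t within {-b..-a})"
      by (auto intro!: derivative_eq_intros)
    ultimately have "((\<lambda>t. (f \<circ> \<gamma>) (- t)) has_real_derivative
        sharp M \<pi> (\<gamma> (- t)) (differential M (\<gamma> (- t)) h) f * (-1)) (at t within {-b..-a})"
      using DERIV_image_chain[of "f \<circ> \<gamma>" _ uminus t "{-b..-a}" "-1"] by (simp add: o_def)
    then show "((f \<circ> ?g) has_real_derivative sharp M \<pi> (\<gamma> (- t)) (differential M (\<gamma> (- t)) ?h) f) (at t within {-b..-a})"
      unfolding sharp_uminus[OF M biv gt(2) near] by (simp add: o_def)
  qed
  then show ?thesis unfolding hamiltonian_step_def using c by (metis minus_minus)
qed

lemma reachable_sym: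
  assumes "smooth_manifold M" "smooth_bivector M \<pi>"
  shows "(hamiltonian_step M \<pi>)\<^sup>*\<^sup>* x y \<Longrightarrow> (hamiltonian_step M \<pi>)\<^sup>*\<^sup>* y x"
  using symp_rtranclp[of "hamiltonian_step M \<pi>"] hamiltonian_step_sym[OF assms] by (auto intro!: sympI dest: sympD)

lemma (in pchart) differential_phi:
  assumes x: "x \<in> U" and G: "open G" "\<phi> x \<in> G" "smooth G F" and F: "(F has_derivative (\<lambda>w. w \<bullet> a)) (at (\<phi> x))"
  shows "differential M x (\<lambda>y. F (\<phi> y)) = dphi x a"
proof (rule cotangent_eqI[OF x differential_in[OF x] dphi_in[OF x]])
  fix w assume w: "w \<in> E"
  have near: "smooth_near M x (\<lambda>y. F (\<phi> y))" by (rule smooth_near_phi[OF x G])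
  have "(F has_derivative (\<lambda>w. w \<bullet> a)) (at (proj E (\<phi> x)))" using F by (simp add: proj_phi[OF x])
  then have "((\<lambda>z. F (proj E z)) has_derivative (\<lambda>w. proj E w \<bullet> a)) (at (\<phi> x))"
    by (rule has_derivative_compose[OF bounded_linear_imp_has_derivative[OF bounded_linear_proj[OF subE]]])
  then have "((\<lambda>z. F (\<phi> (\<kappa> z))) has_derivative (\<lambda>w. proj E w \<bullet> a)) (at (\<phi> x))"
    by (rule has_derivative_transform_within_open[OF _ open\<Omega> phi_in[OF x]]) (simp add: phi_kappa)
  from tv_eqI[OF x near this]
  show "differential M x (\<lambda>y. F (\<phi> y)) (tv x w) = dphi x a (tv x w)"
    by (simp add: differential_def tv_in[OF x] dphi_tv[OF x])
qed

lemma (in bichart) hamiltonian_curve_chart: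
  assumes c: "hamiltonian_curve M \<pi> W h a b \<gamma>" and t: "t \<in> {a..b}" and U: "\<gamma> t \<in> U"
  shows "((\<lambda>t. \<phi> (\<gamma> t)) has_vector_derivative Pi (\<phi> (\<gamma> t)) (grad h (\<phi> (\<gamma> t)))) (at t within {a..b})"
proof -
  have W: "smooth_fun M W h" "\<gamma> t \<in> W" using c t by (auto simp: hamiltonian_curve_def image_subset_iff)
  have near: "smooth_near M (\<gamma> t) h" unfolding smooth_near_def using W by (intro exI[of _ W] conjI)
  have "((\<lambda>t. \<phi> (\<gamma> t) \<bullet> i) has_derivative (\<lambda>s. s *\<^sub>R Pi (\<phi> (\<gamma> t)) (grad h (\<phi> (\<gamma> t))) \<bullet> i)) (at t within {a..b})"
    if "i \<in> Basis" for i
  proof -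
    have n: "smooth_near M (\<gamma> t) (\<lambda>y. \<phi> y \<bullet> i)" by (rule smooth_near_coord[OF U])
    have "(((\<lambda>y. \<phi> y \<bullet> i) \<circ> \<gamma>) has_real_derivative
        sharp M \<pi> (\<gamma> t) (differential M (\<gamma> t) h) (\<lambda>y. \<phi> y \<bullet> i)) (at t within {a..b})"
      using c t n unfolding hamiltonian_curve_def by blast
    moreover have "sharp M \<pi> (\<gamma> t) (differential M (\<gamma> t) h) (\<lambda>y. \<phi> y \<bullet> i) = Pi (\<phi> (\<gamma> t)) (grad h (\<phi> (\<gamma> t))) \<bullet> i"
      by (simp add: sharp_differential[OF U near] tv_coord[OF U] proj_id[OF subE Pi_in_E[OF phi_in[OF U]]])
    moreover have "(*) (P \<bullet> i) = (\<lambda>s. s *\<^sub>R P \<bullet> i)" for P by (auto simp: mult.commute)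
    ultimately show ?thesis unfolding has_field_derivative_def o_def by simp
  qed
  then show ?thesis unfolding has_vector_derivative_def
    by (subst has_derivative_componentwise_within) simp
qed

locale plaque_chart = bichart M V \<psi> \<mu> \<Theta> \<pi>
  for M :: "('b, 'f::euclidean_space) manifold" and V \<psi> \<mu> \<Theta> \<pi> +
  fixes m0 :: 'b and r0 B L C2 \<rho> :: real
  assumes poi: "poisson_manifold M \<pi>" and m0: "m0 \<in> V"
    and plaque: "plaque \<Theta> Pi (\<psi> m0) r0 B L C2 \<rho>"
begin

sublocale pl: plaque \<Theta> Pi "\<psi> m0" r0 B L C2 \<rho> by (rule plaque)

end

lemma (in bichart) plaque_chart_exists:
  assumes poi: "poisson_manifold M \<pi>" and m0: "m0 \<in> U"
  obtains r0 B L C2 \<rho> where "plaque_chart M U \<phi> \<kappa> \<Omega> \<pi> m0 r0 B L C2 \<rho>"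
proof -
  interpret l: local_poisson \<Omega> Pi "\<phi> m0"
    by (rule local_poisson.intro[OF open\<Omega> smooth_Pi phi_in[OF m0] Pi_antisym Jacobi[OF poi]])
  obtain r0 B L C2 \<rho> where "plaque \<Omega> Pi (\<phi> m0) r0 B L C2 \<rho>" using l.plaque_exists .
  then show ?thesis
    using that poi m0 bichart_axioms by (simp add: plaque_chart_def plaque_chart_axioms_def)
qed

context plaque_chart begin

lemma curve_E:
  assumes "m \<in> V" "\<psi> m \<in> cball (\<psi> m0) r0" "norm e \<le> \<rho>" "t \<in> {0..1}"
  shows "pl.curve (\<psi> m) e t \<in> E"
  by (rule pl.curve_subspace[OF assms(2,3,4) subE phi_E[OF assms(1)]]) (use pl.\<Omega>1 Pi_in_E in auto)

text \<open>
  The radial curves of a plaque are integral curves of Hamiltonian vector fields, for the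
  Hamiltonian \<open>h(y) = \<beta>(\<tau>(y)) \<bullet> (y - q)\<close>: along the curve \<open>\<beta>\<close> is orthogonal to the direction of the
  curve, so that the derivative of \<open>\<beta>\<close> does not contribute to that of \<open>h\<close>.
\<close>

lemma plaque_step:
  assumes m: "m \<in> V" and q: "\<psi> m \<in> cball (\<psi> m0) r0" and e: "norm e \<le> \<rho>"
  shows "hamiltonian_step M \<pi> m (\<mu> (pl.phi (\<psi> m) e))"
\<comment> \<open>The function \<tau> below divides by \<open>u \<bullet> u\<close>. If
  \<open>u\<close> vanishes, the lift of \<open>e\<close> is zero and the curve stays at its
  starting point.\<close>
proof (cases "pl.P e = 0")
  case True
  let ?c = "pl.curve (\<psi> m) e"
  have 0: "pl.H (?c t) e = 0" if "t \<in> {0..1}" for t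
    using pl.H_props(2)[OF pl.curve_\<Omega>1[OF q e, of t], of e] True that by (simp add: blinfun.zero_right)
  have "norm (?c 1 - ?c 0) \<le> 0 * \<bar>1 - 0\<bar>"
    by (rule vector_derivative_bound[OF pl.curve_derivative01[OF q e]]) (use 0 in auto)
  then have "pl.phi (\<psi> m) e = \<psi> m" by (simp add: pl.phi_def pl.curve(1)[OF q e])
  then show ?thesis using hamiltonian_step_refl[OF M U_carrier[OF m]] by (simp add: kappa_phi[OF m])
next
  case False
  let ?q = "\<psi> m"
  define c where "c = pl.curve ?q e"
  define u where "u = pl.P e"
  define \<beta> where "\<beta> s = pl.J (c s) e" for s
  \<comment> \<open>By \<open>curve_P\<close> the projection of \<open>c s - ?q\<close> to
    \<open>R\<close> is \<open>s *\<^sub>R u\<close>, so \<tau> recovers the time from the position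
    on the curve.\<close>
  define \<tau> where "\<tau> y = ((y - ?q) \<bullet> u) / (u \<bullet> u)" for y
  define h where "h y = \<beta> (\<tau> y) \<bullet> (y - ?q)" for y
  have uu: "u \<bullet> u \<noteq> 0" using False by (simp add: u_def)
  have Pu: "pl.P u = u" by (simp add: u_def)
  have I: "open {-2<..<2::real}" by simp
  have c\<Omega>: "c s \<in> pl.\<Omega>1" if "s \<in> {-2..2}" for s unfolding c_def by (rule pl.curve_\<Omega>1[OF q e that])
  have smc: "smooth {-2<..<2} c" unfolding c_def by (rule pl.curve_smooth[OF q e])
  have sm\<beta>: "smooth {-2<..<2} \<beta>"
  proof -
    have "smooth {-2<..<2} (\<lambda>s. pl.J (c s))"
      by (rule smooth_compose[OF I pl.\<Omega>1(1) _ smc pl.smooth1(2)]) (use c\<Omega> in auto)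
    then show ?thesis unfolding \<beta>_def[abs_def] by (intro smooth_blinfun_apply I smooth_const)
  qed
  have P\<beta>: "pl.P (\<beta> s) = \<beta> s" and \<beta>u: "\<beta> s \<bullet> u = 0" if "s \<in> {-2..2}" for s
    unfolding \<beta>_def u_def using pl.J_props(1)[OF c\<Omega>[OF that]] pl.J_orth[OF c\<Omega>[OF that]] by auto
  have \<tau>c: "\<tau> (c s) = s" if "s \<in> {-2..2}" for s
  proof -
    have "(c s - ?q) \<bullet> u = pl.P (c s - ?q) \<bullet> u" by (simp add: pl.P_sym Pu)
    also have "pl.P (c s - ?q) = s *\<^sub>R u"
      using pl.curve_P[OF q e that] by (simp add: c_def u_def blinfun.diff_right)
    finally show ?thesis using uu by (simp add: \<tau>_def)
  qed
  let ?G = "{y\<in>\<Theta>. \<tau> y \<in> {-2<..<2}}"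
  have \<tau>lin: "\<tau> y = y \<bullet> (u /\<^sub>R (u \<bullet> u)) - ?q \<bullet> (u /\<^sub>R (u \<bullet> u))" for y
    by (simp add: \<tau>_def inner_diff_left divide_inverse algebra_simps)
  have cont\<tau>: "continuous_on UNIV \<tau>" unfolding \<tau>_def[abs_def] using uu by (intro continuous_intros) auto
  have G: "open ?G"
  proof -
    have "open (\<tau> -` {-2<..<2})" using cont\<tau> by (intro open_vimage) auto
    then show ?thesis using open\<Omega> by (simp add: Collect_conj_eq vimage_def open_Int)
  qed
  have sm\<tau>: "smooth ?G \<tau>"
    by (subst smooth_on_cong[OF \<tau>lin])
      (rule smooth_diff[OF G smooth_linear[OF G bounded_linear_inner_left] smooth_const[OF G]])
  have smh: "smooth ?G h"
    unfolding h_def[abs_def]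
    by (intro smooth_inner G smooth_diff smooth_ident smooth_const smooth_compose[OF G I _ sm\<tau> sm\<beta>]) auto
  have derh: "(h has_derivative (\<lambda>w. w \<bullet> \<beta> s)) (at (c s))" if s: "s \<in> {0..1}" for s
  proof -
    have s2: "s \<in> {-2..2}" "s \<in> {-2<..<2}" using s by auto
    have d\<beta>: "(\<beta> has_derivative Dop \<beta> s) (at s)" by (rule has_derivative_Dop[OF sm\<beta> I s2(2)])
    \<comment> \<open>The derivative of \<beta> inherits two linear constraints from \<beta>: it
      lies in \<open>R\<close> and is orthogonal to \<open>u\<close>. Only the projection
      \<open>s *\<^sub>R u\<close> of \<open>c s - ?q\<close> to \<open>R\<close> therefore enters
      the product.\<close>
    have orth: "Dop \<beta> s 1 \<bullet> (c s - ?q) = 0"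
    proof -
      have "((\<lambda>t. \<beta> t \<bullet> u) has_derivative (\<lambda>h. Dop \<beta> s h \<bullet> u)) (at s)"
        by (intro has_derivative_inner_left d\<beta>)
      then have "((\<lambda>t. 0) has_derivative (\<lambda>h. Dop \<beta> s h \<bullet> u)) (at s)"
        by (rule has_derivative_transform_within_open[OF _ I s2(2)]) (use \<beta>u in auto)
      from fun_cong[OF has_derivative_unique[OF this has_derivative_const], of 1]
      have 1: "Dop \<beta> s 1 \<bullet> u = 0" by simp
      have "((\<lambda>t. pl.P (\<beta> t)) has_derivative (\<lambda>h. pl.P (Dop \<beta> s h))) (at s)"
        by (rule bounded_linear.has_derivative[OF blinfun.bounded_linear_right d\<beta>])
      then have "(\<beta> has_derivative (\<lambda>h. pl.P (Dop \<beta> s h))) (at s)"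
        by (rule has_derivative_transform_within_open[OF _ I s2(2)]) (use P\<beta> in auto)
      from fun_cong[OF has_derivative_unique[OF this d\<beta>], of 1]
      have 2: "pl.P (Dop \<beta> s 1) = Dop \<beta> s 1" by simp
      have "Dop \<beta> s 1 \<bullet> (c s - ?q) = Dop \<beta> s 1 \<bullet> pl.P (c s - ?q)" by (metis 2 pl.P_sym)
      also have "pl.P (c s - ?q) = s *\<^sub>R u"
        using pl.curve_P[OF q e s2(1)] by (simp add: c_def u_def blinfun.diff_right)
      finally show ?thesis using 1 by simp
    qed
    let ?d\<tau> = "\<lambda>w. w \<bullet> (u /\<^sub>R (u \<bullet> u))"
    have "(\<tau> has_derivative ?d\<tau>) (at (c s))"
    proof -
      have "((\<lambda>y. y \<bullet> (u /\<^sub>R (u \<bullet> u)) - ?q \<bullet> (u /\<^sub>R (u \<bullet> u))) has_derivative (\<lambda>w. ?d\<tau> w - 0)) (at (c s))"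
        by (intro has_derivative_diff has_derivative_const bounded_linear_imp_has_derivative bounded_linear_inner_left)
      then have "((\<lambda>y. y \<bullet> (u /\<^sub>R (u \<bullet> u)) - ?q \<bullet> (u /\<^sub>R (u \<bullet> u))) has_derivative ?d\<tau>) (at (c s))"
        unfolding diff_zero .
      then show ?thesis
        by (rule has_derivative_transform_within_open[OF _ open_UNIV UNIV_I]) (rule \<tau>lin[symmetric])
    qed
    moreover have "(\<beta> has_derivative Dop \<beta> s) (at (\<tau> (c s)))" using d\<beta> \<tau>c[OF s2(1)] by simp
    ultimately have d1: "((\<lambda>y. \<beta> (\<tau> y)) has_derivative (\<lambda>w. Dop \<beta> s (?d\<tau> w))) (at (c s))"
      by (rule has_derivative_compose)
    have d2: "((\<lambda>y. y - ?q) has_derivative (\<lambda>w. w - 0)) (at (c s))"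
      by (intro has_derivative_diff has_derivative_ident has_derivative_const)
    have "(h has_derivative (\<lambda>w. \<beta> (\<tau> (c s)) \<bullet> (w - 0) + Dop \<beta> s (?d\<tau> w) \<bullet> (c s - ?q))) (at (c s))"
      unfolding h_def[abs_def] by (rule has_derivative_inner[OF d1 d2])
    moreover have "Dop \<beta> s r \<bullet> (c s - ?q) = 0" for r
    proof -
      have "Dop \<beta> s r = r *\<^sub>R Dop \<beta> s 1" using blinfun.scaleR_right[of "Dop \<beta> s" r 1] by simp
      then show ?thesis using orth by simp
    qed
    ultimately have "(h has_derivative (\<lambda>w. \<beta> s \<bullet> w)) (at (c s))" by (simp add: \<tau>c[OF s2(1)])
    then show ?thesis by (simp add: inner_commute[of "\<beta> s"])
  qed
  let ?g = "\<lambda>t. \<mu> (c t)" and ?W = "{y\<in>V. \<psi> y \<in> ?G}"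
  have cE: "c t \<in> E" if "t \<in> {0..1}" for t unfolding c_def by (rule curve_E[OF m q e that])
  have c\<Theta>: "c t \<in> \<Theta>" if "t \<in> {0..1}" for t using c\<Omega>[of t] that pl.\<Omega>1(3) by auto
  have gV: "?g t \<in> V" "\<psi> (?g t) = c t" if "t \<in> {0..1}" for t
    using kappa_in[OF c\<Theta>[OF that]] phi_kappa_E[OF c\<Theta>[OF that] cE[OF that]] by auto
  have cG: "c t \<in> ?G" if "t \<in> {0..1}" for t using c\<Theta>[OF that] \<tau>c[of t] that by auto
  have "hamiltonian_curve M \<pi> ?W (\<lambda>y. h (\<psi> y)) 0 1 ?g"
    unfolding hamiltonian_curve_def
  proof (intro conjI ballI allI impI)
    show "smooth_fun M ?W (\<lambda>y. h (\<psi> y))" by (rule smooth_phi[OF G smh])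
    show "(0::real) \<le> 1" by simp
    show "?g ` {0..1} \<subseteq> ?W"
    proof safe
      fix t :: real assume "t \<in> {0..1}"
      then show "?g t \<in> V" "\<psi> (?g t) \<in> \<Theta>" "\<tau> (\<psi> (?g t)) \<in> {-2<..<2}"
        using gV[of t] cG[of t] by auto
    qed
    have "continuous_on {0..1} c"
      using pl.curve_derivative01[OF q e] has_vector_derivative_continuous
      unfolding c_def by (metis continuous_on_eq_continuous_within)
    then have "continuous_map (top_of_set {0..1}) (top_of_set \<Theta>) c"
      using c\<Theta> by auto
    from continuous_map_compose[OF this continuous_map_kappa]
    show "continuous_map (top_of_set {0..1}) (mtop M) ?g" by (simp add: o_def)
    fix t :: real and f assume t: "t \<in> {0..1}" and f: "smooth_near M (?g t) f"
    note V = gV(1)[OF t] and pg = gV(2)[OF t]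
    have "differential M (?g t) (\<lambda>y. h (\<psi> y)) = dphi (?g t) (\<beta> t)"
      by (rule differential_phi[OF V G _ smh]) (use cG[OF t] derh[OF t] pg in auto)
    then have sh: "sharp M \<pi> (?g t) (differential M (?g t) (\<lambda>y. h (\<psi> y))) = tv (?g t) (pl.H (c t) e)"
      by (simp add: sharp_dphi[OF V] pg \<beta>_def pl.H_def)
    have "(c has_derivative (\<lambda>s. s *\<^sub>R pl.H (c t) e)) (at t within {0..1})"
      using pl.curve_derivative01[OF q e t] by (simp add: c_def has_vector_derivative_def)
    moreover have "((\<lambda>z. f (\<mu> z)) has_derivative frechet_derivative (\<lambda>z. f (\<mu> z)) (at (c t))) (at (c t))"
      using smooth_near_diff[OF V f] by (simp add: pg)
    ultimately have "((\<lambda>t. f (\<mu> (c t))) has_derivative (\<lambda>s. frechet_derivative (\<lambda>z. f (\<mu> z)) (at (c t)) (s *\<^sub>R pl.H (c t) e))) (at t within {0..1})"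
      by (rule has_derivative_compose)
    moreover have "frechet_derivative (\<lambda>z. f (\<mu> z)) (at (c t)) (s *\<^sub>R w) = tv (?g t) w f * s" for s w
      using linear_cmul[OF has_derivative_linear[OF smooth_near_diff[OF V f]], of s w] f by (simp add: tv_def pg)
    ultimately show "((f \<circ> ?g) has_real_derivative sharp M \<pi> (?g t) (differential M (?g t) (\<lambda>y. h (\<psi> y))) f) (at t within {0..1})"
      unfolding sh by (simp add: has_field_derivative_def o_def)
  qed
  moreover have "?g 0 = m" using pl.curve(1)[OF q e] kappa_phi[OF m] by (simp add: c_def)
  moreover have "?g 1 = \<mu> (pl.phi ?q e)" by (simp add: c_def pl.phi_def)
  ultimately show ?thesis unfolding hamiltonian_step_def by blast
qed

end

section \<open>Rank of the bivector, and images of Hamiltonian curves under the submersion\<close>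

subsection \<open>The rank of the characteristic distribution\<close>

text \<open>The characteristic space consists of functionals on functions, so its dimension is
  measured on coordinate vectors in an arbitrarily chosen chart; \<open>rank_le_chart\<close>, used
  both ways, removes the choice.\<close>

definition char_rank :: "('a, 'e::euclidean_space) manifold \<Rightarrow> 'a bivector \<Rightarrow> 'a \<Rightarrow> nat" where
  "char_rank M \<pi> y = (SOME r. \<exists>U \<phi> \<kappa> \<Omega>. bichart M U \<phi> \<kappa> \<Omega> \<pi> \<and> y \<in> U \<and>
     r = dim (range (blinfun_apply (bichart.Pi M \<phi> \<kappa> \<pi> (\<phi> y)))))"

lemma rank_le_chart:
  assumes 1: "bichart M U1 \<phi>1 \<kappa>1 \<Omega>1 \<pi>" "y \<in> U1" and 2: "bichart M U2 \<phi>2 \<kappa>2 \<Omega>2 \<pi>" "y \<in> U2"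
  shows "dim (range (blinfun_apply (bichart.Pi M \<phi>2 \<kappa>2 \<pi> (\<phi>2 y))))
    \<le> dim (range (blinfun_apply (bichart.Pi M \<phi>1 \<kappa>1 \<pi> (\<phi>1 y))))"
proof -
  interpret a: bichart M U1 \<phi>1 \<kappa>1 \<Omega>1 \<pi> by (rule 1)
  interpret b: bichart M U2 \<phi>2 \<kappa>2 \<Omega>2 \<pi> by (rule 2)
  let ?T = "\<lambda>w. \<Sum>i\<in>Basis. a.tv y w (\<lambda>x. \<phi>2 x \<bullet> i) *\<^sub>R i"
  have lin: "linear ?T"
    by (rule linearI) (simp_all add: a.tv_add[OF 1(2)] a.tv_scale[OF 1(2)] scaleR_add_left sum.distrib scaleR_sum_right)
  have "range (b.Pi (\<phi>2 y)) \<subseteq> ?T ` range (a.Pi (\<phi>1 y))"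
  proof safe
    fix c
    have "b.tv y (b.Pi (\<phi>2 y) c) \<in> a.tv y ` range (a.Pi (\<phi>1 y))"
      using a.characteristic_eq[OF 1(2)] b.characteristic_eq[OF 2(2)] by blast
    then obtain d where d: "b.tv y (b.Pi (\<phi>2 y) c) = a.tv y (a.Pi (\<phi>1 y) d)" by auto
    have eq: "?T (a.Pi (\<phi>1 y) d) = b.Pi (\<phi>2 y) c"
      by (simp add: d[symmetric] b.tv_coord[OF 2(2)] euclidean_representation
          proj_id[OF b.subE b.Pi_in_E[OF b.phi_in[OF 2(2)]]])
    show "b.Pi (\<phi>2 y) c \<in> ?T ` range (a.Pi (\<phi>1 y))"
      unfolding eq[symmetric] by (rule imageI[OF rangeI])
  qed
  then have "dim (range (b.Pi (\<phi>2 y))) \<le> dim (?T ` range (a.Pi (\<phi>1 y)))" by (rule dim_subset)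
  also have "\<dots> \<le> dim (range (a.Pi (\<phi>1 y)))" by (rule dim_image_le[OF lin])
  finally show ?thesis .
qed

lemma (in bichart) char_rank_eq:
  assumes y: "y \<in> U" shows "char_rank M \<pi> y = dim (range (Pi (\<phi> y)))"
  unfolding char_rank_def
proof (rule some_equality)
  show "\<exists>U' \<phi>' \<kappa>' \<Omega>'. bichart M U' \<phi>' \<kappa>' \<Omega>' \<pi> \<and> y \<in> U' \<and>
     dim (range (Pi (\<phi> y))) = dim (range (blinfun_apply (bichart.Pi M \<phi>' \<kappa>' \<pi> (\<phi>' y))))"
    using bichart_axioms y by blast
  fix r assume "\<exists>U' \<phi>' \<kappa>' \<Omega>'. bichart M U' \<phi>' \<kappa>' \<Omega>' \<pi> \<and> y \<in> U' \<and>
     r = dim (range (blinfun_apply (bichart.Pi M \<phi>' \<kappa>' \<pi> (\<phi>' y))))"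
  then obtain U' \<phi>' \<kappa>' \<Omega>' where b: "bichart M U' \<phi>' \<kappa>' \<Omega>' \<pi>" "y \<in> U'"
    and r: "r = dim (range (blinfun_apply (bichart.Pi M \<phi>' \<kappa>' \<pi> (\<phi>' y))))" by blast
  show "r = dim (range (Pi (\<phi> y)))"
    unfolding r using rank_le_chart[OF bichart_axioms y b] rank_le_chart[OF b bichart_axioms y] by (rule antisym)
qed

lemma (in plaque_chart) D_zero_iff_char_rank:
  assumes "y \<in> V" "\<psi> y \<in> pl.\<Omega>1"
  shows "pl.D (\<psi> y) = 0 \<longleftrightarrow> char_rank M \<pi> y = char_rank M \<pi> m0"
  unfolding pl.D_zero_iff_rank[OF assms(2)] char_rank_eq[OF assms(1)] char_rank_eq[OF m0] pl.R_def ..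

subsection \<open>Images of Hamiltonian curves\<close>

text \<open>
  Let \<open>Y\<close> be the velocity of the image curve. Its vertical part \<open>\<Gamma>\<close> is a smooth function on the total
  space that vanishes over the plaque \<open>w\<close> ranges in, so it is bounded by the distance to the plaque.
  (Mere tangency of the image curve to the characteristic distribution would not suffice:
  the curve \<open>(t\<^sup>2, 0)\<close> is tangent to that of \<open>x \<partial>\<^sub>x \<and> \<partial>\<^sub>y\<close>.)
\<close>

lemma hamiltonian_image_local:
  assumes ps: "poisson_submersion S \<pi>S M \<pi>M p"
    and char: "\<And>x. x \<in> carrier S \<Longrightarrow> pushforward M p x ` characteristic_distribution S \<pi>S x
       \<subseteq> characteristic_distribution M \<pi>M (p x)"
    and \<gamma>: "hamiltonian_curve S \<pi>S Uh h a b \<gamma>" and t0: "t0 \<in> {a..b}"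
  shows "\<exists>T. openin (top_of_set {a..b}) T \<and> t0 \<in> T \<and>
    (\<forall>t\<in>T. hamiltonian_step M \<pi>M (p (\<gamma> t0)) (p (\<gamma> t)) \<and>
       char_rank M \<pi>M (p (\<gamma> t)) = char_rank M \<pi>M (p (\<gamma> t0)))"
proof -
  define x0 where "x0 = \<gamma> t0"
  have h: "smooth_fun S Uh h" and Uh: "openin (mtop S) Uh" and gU: "\<And>t. t \<in> {a..b} \<Longrightarrow> \<gamma> t \<in> Uh"
    and cont: "continuous_map (top_of_set {a..b}) (mtop S) \<gamma>"
    using \<gamma> by (auto simp: hamiltonian_curve_def smooth_fun_def)
  have x0h: "x0 \<in> Uh" using gU[OF t0] by (simp add: x0_def)
  have x0S: "x0 \<in> carrier S" using x0h openin_subset[OF Uh] by (auto simp: carrier_def)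
  obtain K where K: "subspace K" "K \<subseteq> model S" "dim K + dim (model M) = dim (model S)"
    using complement_dim_exists[OF ps x0S] .
  obtain U \<phi> \<kappa> \<Omega> V \<psi> \<mu> \<Theta> C c0 where pc: "poisson_chart_map S U \<phi> \<kappa> \<Omega> M V \<psi> \<mu> \<Theta> p C c0 \<pi>S \<pi>M" "x0 \<in> U"
    by (rule poisson_chart_map_exists[OF ps x0S K])
  interpret poisson_chart_map S U \<phi> \<kappa> \<Omega> M V \<psi> \<mu> \<Theta> p C c0 \<pi>S \<pi>M by (rule pc(1))
  have poiM: "poisson_manifold M \<pi>M" using ps by (simp add: poisson_submersion_def)
  have m0: "p x0 \<in> V" by (rule p_in[OF pc(2)])
  obtain r0 B L C2 \<rho> where pq: "plaque_chart M V \<psi> \<mu> \<Theta> \<pi>M (p x0) r0 B L C2 \<rho>"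
    using mb.plaque_chart_exists[OF poiM m0] .
  interpret q: plaque_chart M V \<psi> \<mu> \<Theta> \<pi>M "p x0" r0 B L C2 \<rho> by (rule pq)
  let ?q = "\<psi> (p x0)" and ?kx = "\<phi> x0" and ?\<delta> = "q.pl.\<delta>"
  let ?H = "q.pl.H" and ?phi = "q.pl.phi (\<psi> (p x0))"
  have qb: "?q \<in> ball ?q ?\<delta>" using q.pl.\<delta> by simp
  note qc = q.pl.ball_\<delta>(1)[OF qb]
  have Dq: "q.pl.D ?q = 0" using q.D_zero_iff_char_rank[OF m0 q.pl.ball_\<delta>(3)[OF qb]] by simp
  obtain Cp :: "'d \<Rightarrow>\<^sub>L 'b" where Cp: "\<And>v. v \<in> range C \<Longrightarrow> C (Cp v) = v"
    using generalized_inverse_exists[of C] by metis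
  \<comment> \<open>A right inverse of \<open>C\<close> on the model of \<open>M\<close>, with
    values in the model of \<open>S\<close>: it lifts displacements in the base to displacements in
    the total space.\<close>
  define Cq where "Cq = Blinfun (proj (model S)) o\<^sub>L Cp"
  have Cq: "Cq v \<in> model S" "v \<in> model M \<Longrightarrow> C (Cq v) = v" for v
    using Cp[of v] by (simp_all add: Cq_def blinfun_of_linear linear_proj[OF s.subE] proj_in[OF s.subE] C_proj C_range)
  define Xh where "Xh z = sb.Pi z (s.grad h z)" for z
  define Y where "Y z = C (Xh z)" for z
  define \<Gamma> where "\<Gamma> z = Y z - ?H (c0 + C z) (Y z)" for z
  define N where "N = {z\<in>\<Omega>. \<kappa> z \<in> Uh} \<inter> (\<lambda>z. c0 + C z) -` ball ?q ?\<delta>"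
  have N1: "open {z\<in>\<Omega>. \<kappa> z \<in> Uh}" by (rule s.open_kappa[OF Uh])
  have N: "open N" unfolding N_def
    by (intro open_Int N1 open_vimage open_ball continuous_intros)
  have NU: "N \<subseteq> {z\<in>\<Omega>. \<kappa> z \<in> Uh}" "N \<subseteq> \<Omega>" by (auto simp: N_def)
  have Ck: "c0 + C (\<phi> x) = \<psi> (p x)" if "x \<in> U" for x using p_lin[OF that] by simp
  have k0N: "?kx \<in> N" using x0h qb by (simp add: N_def s.phi_in[OF pc(2)] s.kappa_phi[OF pc(2)] Ck[OF pc(2)])
  have smY: "smooth N Y"
  proof -
    have "smooth N (s.grad h)"
      by (rule s.smooth_grad[OF smooth_subset[OF N1 N NU(1) s.smooth_kappa[OF h]] N])
    then have "smooth N Xh" unfolding Xh_def[abs_def]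
      by (rule smooth_blinfun_apply[OF N smooth_subset[OF s.open\<Omega> N NU(2) sb.smooth_Pi]])
    then show ?thesis unfolding Y_def[abs_def]
      by (rule smooth_linear_compose[OF blinfun.bounded_linear_right N])
  qed
  have sm\<Gamma>: "smooth N \<Gamma>"
  proof -
    have a: "smooth N (\<lambda>z. c0 + C z)"
      by (rule smooth_add[OF N smooth_const[OF N] smooth_linear[OF N blinfun.bounded_linear_right]])
    have im: "(\<lambda>z. c0 + C z) ` N \<subseteq> q.pl.\<Omega>1" using q.pl.ball_\<delta>(3) by (auto simp: N_def)
    have "smooth N (\<lambda>z. ?H (c0 + C z))"
      by (rule smooth_compose[OF N q.pl.\<Omega>1(1) im a q.pl.smooth1(3)])
    from smooth_diff[OF N smY smooth_blinfun_apply[OF N this smY]]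
    show ?thesis by (simp add: \<Gamma>_def[abs_def])
  qed
  obtain r1 where r1: "0 < r1" "cball ?kx r1 \<subseteq> N" using N k0N open_contains_cball by blast
  obtain L\<Gamma> where L\<Gamma>: "0 \<le> L\<Gamma>" "\<And>x y. x \<in> cball ?kx r1 \<Longrightarrow> y \<in> cball ?kx r1 \<Longrightarrow> norm (\<Gamma> y - \<Gamma> x) \<le> L\<Gamma> * norm (y - x)"
    using smooth_lipschitz_on[OF sm\<Gamma> N compact_cball convex_cball r1(2)] by metis
  have "bounded (Y ` cball ?kx r1)"
    by (rule compact_imp_bounded[OF compact_continuous_image[OF continuous_on_subset[OF smooth_continuous[OF smY N] r1(2)] compact_cball]])
  then obtain BY where BY: "\<And>z. z \<in> cball ?kx r1 \<Longrightarrow> norm (Y z) \<le> BY" unfolding bounded_iff by blast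
  define w where "w y = ?phi (y - ?q)" for y
  \<comment> \<open>Bounds the lift of the displacement from the image point to the plaque. On
    \<open>G\<close> it is below \<open>r1 / 2\<close>, as is the distance to \<open>?kx\<close>, so
    the lifted point remains in the ball where \<Gamma> is Lipschitz.\<close>
  define dev where "dev z = norm Cq * norm (w (c0 + C z) - (c0 + C z))" for z
  define G where "G = {z \<in> N \<inter> ball ?kx (r1 / 2). dev z < r1 / 2}"
  have contw: "continuous_on N (\<lambda>z. w (c0 + C z))"
    unfolding w_def
  proof (rule continuous_on_compose2[OF q.pl.phi_continuous[OF qc Dq]])
    show "continuous_on N (\<lambda>z. c0 + C z - ?q)" by (intro continuous_intros)
    show "(\<lambda>z. c0 + C z - ?q) ` N \<subseteq> ball 0 \<rho>"
      using q.pl.ball_\<delta>(4)[OF qb] by (auto simp: N_def)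
  qed
  have G: "open G"
  proof -
    have "continuous_on (N \<inter> ball ?kx (r1 / 2)) dev" unfolding dev_def
      by (intro continuous_intros continuous_on_subset[OF contw]) auto
    from continuous_open_preimage[OF this open_Int[OF N open_ball] open_lessThan[of "r1 / 2"]]
    show ?thesis by (simp add: G_def vimage_def Int_def)
  qed
  have w0: "w ?q = ?q" by (simp add: w_def q.pl.phi_0[OF qc])
  have k0G: "?kx \<in> G" using k0N r1(1) by (simp add: G_def dev_def Ck[OF pc(2)] w0)
  let ?W = "{x\<in>U. \<phi> x \<in> G}"
  have "openin (top_of_set {a..b}) {t \<in> topspace (top_of_set {a..b}). \<gamma> t \<in> ?W}"
    by (rule openin_continuous_map_preimage[OF cont s.open_phi[OF G]])
  then have oT: "openin (top_of_set {a..b}) {t \<in> {a..b}. \<gamma> t \<in> ?W}" by simp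
  have "t0 \<in> {t \<in> {a..b}. \<gamma> t \<in> ?W}" using t0 pc(2) k0G by (simp add: x0_def)
  then obtain \<epsilon> where \<epsilon>: "0 < \<epsilon>" "ball t0 \<epsilon> \<inter> {a..b} \<subseteq> {t \<in> {a..b}. \<gamma> t \<in> ?W}"
    using oT unfolding openin_contains_ball by blast
  define a' where "a' = max a (t0 - \<epsilon> / 2)"
  define b' where "b' = min b (t0 + \<epsilon> / 2)"
  have J: "{a'..b'} \<subseteq> {a..b}" by (auto simp: a'_def b'_def)
  have JW: "\<gamma> t \<in> U \<and> \<phi> (\<gamma> t) \<in> G" if "t \<in> {a'..b'}" for t
  proof -
    have "t \<in> ball t0 \<epsilon> \<inter> {a..b}" using that J \<epsilon>(1) by (auto simp: a'_def b'_def dist_real_def)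
    then show ?thesis using \<epsilon>(2) by blast
  qed
  have t0J: "t0 \<in> {a'..b'}" using t0 \<epsilon>(1) by (auto simp: a'_def b'_def)
  let ?y = "\<lambda>t. \<psi> (p (\<gamma> t))"
  have yk: "?y t = c0 + C (\<phi> (\<gamma> t))" if "t \<in> {a'..b'}" for t using Ck JW[OF that] by simp
  have yb: "?y t \<in> ball ?q ?\<delta>" if "t \<in> {a'..b'}" for t
    using JW[OF that] unfolding yk[OF that] by (auto simp: G_def N_def)
  have kc: "\<phi> (\<gamma> t) \<in> cball ?kx r1" if "t \<in> {a'..b'}" for t
    using JW[OF that] r1(1) by (auto simp: G_def)
  have on_plaque: "?y t = w (?y t)" if t: "t \<in> {a'..b'}" for t
    unfolding w_def
  proof (rule q.pl.stay_on_plaque[OF qb Dq, where Y = "\<lambda>t. Y (\<phi> (\<gamma> t))" and a = a' and b = b' and s = t0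
        and BY = BY and C = "L\<Gamma> * norm Cq"])
    fix t assume t: "t \<in> {a'..b'}"
    have tU: "\<gamma> t \<in> U" and tG: "\<phi> (\<gamma> t) \<in> G" using JW[OF t] by auto
    show "?y t \<in> ball ?q ?\<delta>" by (rule yb[OF t])
    have "((\<lambda>t. \<phi> (\<gamma> t)) has_vector_derivative Xh (\<phi> (\<gamma> t))) (at t within {a'..b'})"
      unfolding Xh_def
      by (rule has_vector_derivative_subset[OF sb.hamiltonian_curve_chart[OF \<gamma> _ tU] J]) (use t J in blast)
    then have "((\<lambda>t. c0 + C (\<phi> (\<gamma> t))) has_vector_derivative 0 + Y (\<phi> (\<gamma> t))) (at t within {a'..b'})"
      unfolding Y_def
      by (intro has_vector_derivative_add has_vector_derivative_const
          bounded_linear.has_vector_derivative[OF blinfun.bounded_linear_right])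
    then show "(?y has_vector_derivative Y (\<phi> (\<gamma> t))) (at t within {a'..b'})"
      by (intro has_vector_derivative_transform[OF t, of ?y "\<lambda>t. c0 + C (\<phi> (\<gamma> t))"]) (simp_all add: yk)
    show "norm (Y (\<phi> (\<gamma> t))) \<le> BY" by (rule BY[OF kc[OF t]])
    let ?k = "\<phi> (\<gamma> t)" and ?w = "w (?y t)"
    \<comment> \<open>A point above the plaque point \<open>?w\<close>, no further from
      \<open>?k\<close> than \<open>norm Cq\<close> times the deviation. Since \<open>D\<close>
      vanishes at \<open>?w\<close>, condition (c) at \<open>\<kappa> ?z\<close> makes \<Gamma>
      vanish there, and comparing \<Gamma> at the two points gives the bound.\<close>
    let ?z = "?k + Cq (?w - ?y t)"
    have ny: "norm (?y t - ?q) \<le> \<rho>" using q.pl.ball_\<delta>(4)[OF qb yb[OF t]] by simp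
    have wE: "?w \<in> model M" unfolding w_def q.pl.phi_def by (rule q.curve_E[OF m0 qc ny]) simp
    have yE: "?y t \<in> model M" by (rule m.phi_E[OF p_in[OF tU]])
    have CCq: "C (Cq (?w - ?y t)) = ?w - ?y t" by (rule Cq(2)[OF subspace_diff[OF m.subE wE yE]])
    then have Cz: "c0 + C ?z = ?w" using yk[OF t] by (simp add: blinfun.add_right)
    have "norm (Cq (?w - ?y t)) \<le> norm Cq * norm (?w - ?y t)" by (rule norm_blinfun)
    also have "\<dots> < r1 / 2" using tG yk[OF t] by (simp add: G_def dev_def)
    finally have nz: "norm (Cq (?w - ?y t)) < r1 / 2" .
    have kn: "dist ?kx ?k < r1 / 2" using tG by (simp add: G_def)
    have "dist ?kx ?z \<le> dist ?kx ?k + dist ?k ?z" by (rule dist_triangle)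
    then have zc: "?z \<in> cball ?kx r1" using nz kn by (simp add: dist_norm)
    then have z\<Omega>: "?z \<in> \<Omega>" using r1(2) NU(2) by blast
    have zE: "?z \<in> model S" by (rule subspace_add[OF s.subE s.phi_E[OF tU] Cq(1)])
    let ?x = "\<kappa> ?z"
    have xU: "?x \<in> U" by (rule s.kappa_in[OF z\<Omega>])
    have px: "\<phi> ?x = ?z" by (rule s.phi_kappa_E[OF z\<Omega> zE])
    have pw: "\<psi> (p ?x) = ?w" using Ck[OF xU] Cz px by simp
    have Dw: "q.pl.D ?w = 0" unfolding w_def by (rule q.pl.phi_D[OF qc ny Dq])
    have w\<Omega>: "?w \<in> q.pl.\<Omega>1" using q.pl.phi_K[OF qc ny] q.pl.r0 by (auto simp: w_def)
    have "Y ?z \<in> range (mb.Pi ?w)"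
      using char[OF s.U_carrier[OF xU]] unfolding characteristic_iff_range[OF xU]
      by (auto simp: Y_def Xh_def px pw)
    then have \<Gamma>z: "\<Gamma> ?z = 0" unfolding \<Gamma>_def Cz using q.pl.range_eq[OF w\<Omega> Dw] by simp
    have "norm (\<Gamma> ?k) = norm (\<Gamma> ?k - \<Gamma> ?z)" by (simp add: \<Gamma>z)
    also have "\<dots> \<le> L\<Gamma> * norm (?k - ?z)" by (rule L\<Gamma>(2)[OF zc kc[OF t]])
    also have "norm (?k - ?z) = norm (Cq (?w - ?y t))" by simp
    also have "L\<Gamma> * norm (Cq (?w - ?y t)) \<le> L\<Gamma> * (norm Cq * norm (?w - ?y t))"
      by (intro mult_left_mono norm_blinfun L\<Gamma>(1))
    finally show "norm (Y ?k - ?H (?y t) (Y ?k)) \<le> L\<Gamma> * norm Cq * norm (?y t - ?phi (?y t - ?q))"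
      by (simp add: \<Gamma>_def yk[OF t, symmetric] w_def norm_minus_commute mult.assoc)
  next
    show "?y t0 = ?phi (?y t0 - ?q)" using w0 by (simp add: x0_def w_def)
  qed (use t0J t in auto)
  let ?T = "{a..b} \<inter> ball t0 (\<epsilon> / 2)"
  show ?thesis
  proof (intro exI conjI ballI)
    show "openin (top_of_set {a..b}) ?T" by (rule openin_open_Int) simp
    show "t0 \<in> ?T" using t0 \<epsilon>(1) by simp
    fix t assume "t \<in> ?T"
    then have "a \<le> t" "t \<le> b" "\<bar>t0 - t\<bar> < \<epsilon> / 2" by (auto simp: dist_real_def)
    then have t: "t \<in> {a'..b'}" unfolding a'_def b'_def abs_less_iff by simp
    have tV: "p (\<gamma> t) \<in> V" using JW[OF t] p_in by blast
    have ny: "norm (?y t - ?q) \<le> \<rho>" using q.pl.ball_\<delta>(4)[OF qb yb[OF t]] by simp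
    have "\<mu> (?phi (?y t - ?q)) = p (\<gamma> t)" using on_plaque[OF t] m.kappa_phi[OF tV] by (simp add: w_def)
    then show "hamiltonian_step M \<pi>M (p (\<gamma> t0)) (p (\<gamma> t))"
      using q.plaque_step[OF m0 qc ny] by (simp add: x0_def)
    have "q.pl.D (?y t) = 0" using q.pl.phi_D[OF qc ny Dq] on_plaque[OF t] by (simp add: w_def)
    then show "char_rank M \<pi>M (p (\<gamma> t)) = char_rank M \<pi>M (p (\<gamma> t0))"
      using q.D_zero_iff_char_rank[OF tV q.pl.ball_\<delta>(3)[OF yb[OF t]]] by (simp add: x0_def)
  qed
qed

text \<open>The local statement defines an equivalence relation on a connected interval. Equality of
  ranks is carried along because, for the identity map, it becomes constancy of the rank on
  leaves.\<close>

lemma hamiltonian_image: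
  assumes ps: "poisson_submersion S \<pi>S M \<pi>M p"
    and char: "\<And>x. x \<in> carrier S \<Longrightarrow> pushforward M p x ` characteristic_distribution S \<pi>S x
       \<subseteq> characteristic_distribution M \<pi>M (p x)"
    and st: "hamiltonian_step S \<pi>S x y"
  shows "(hamiltonian_step M \<pi>M)\<^sup>*\<^sup>* (p x) (p y)" "char_rank M \<pi>M (p x) = char_rank M \<pi>M (p y)"
proof -
  obtain Uh h a b \<gamma> where c: "hamiltonian_curve S \<pi>S Uh h a b \<gamma>" "\<gamma> a = x" "\<gamma> b = y"
    using st unfolding hamiltonian_step_def by blast
  have ab: "a \<in> {a..b}" "b \<in> {a..b}" using c by (auto simp: hamiltonian_curve_def)
  have M: "smooth_manifold M" "smooth_bivector M \<pi>M"
    using ps by (auto simp: poisson_submersion_def poisson_manifold_def)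
  let ?R = "\<lambda>s t. (hamiltonian_step M \<pi>M)\<^sup>*\<^sup>* (p (\<gamma> s)) (p (\<gamma> t)) \<and>
      char_rank M \<pi>M (p (\<gamma> s)) = char_rank M \<pi>M (p (\<gamma> t))"
  have "?R a b"
  proof (rule connected_equivalence_relation[of "{a..b}" a b ?R])
    fix t0 assume t0: "t0 \<in> {a..b}"
    obtain T where T: "openin (top_of_set {a..b}) T" "t0 \<in> T"
      "\<And>t. t \<in> T \<Longrightarrow> hamiltonian_step M \<pi>M (p (\<gamma> t0)) (p (\<gamma> t)) \<and>
         char_rank M \<pi>M (p (\<gamma> t)) = char_rank M \<pi>M (p (\<gamma> t0))"
      using hamiltonian_image_local[OF ps char c(1) t0] by blast
    show "\<exists>T. openin (top_of_set {a..b}) T \<and> t0 \<in> T \<and> (\<forall>t\<in>T. ?R t0 t)"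
    proof (intro exI[of _ T] conjI ballI T(1,2))
      fix t assume t: "t \<in> T"
      show "(hamiltonian_step M \<pi>M)\<^sup>*\<^sup>* (p (\<gamma> t0)) (p (\<gamma> t))"
        by (rule r_into_rtranclp[of "hamiltonian_step M \<pi>M", OF conjunct1[OF T(3)[OF t]]])
      show "char_rank M \<pi>M (p (\<gamma> t0)) = char_rank M \<pi>M (p (\<gamma> t))"
        using conjunct2[OF T(3)[OF t]] by (rule sym)
    qed
  next
    show "?R t s" if "?R s t" for s t using that by (auto intro: reachable_sym[OF M])
    show "?R r t" if "?R r s" "?R s t" for r s t using that by (auto intro: rtranclp_trans)
  qed (use ab in auto)
  then show "(hamiltonian_step M \<pi>M)\<^sup>*\<^sup>* (p x) (p y)" "char_rank M \<pi>M (p x) = char_rank M \<pi>M (p y)"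
    using c by auto
qed

theorem characteristic_imp_leaves:
  assumes ps: "poisson_submersion S \<pi>S M \<pi>M p"
    and char: "\<And>x. x \<in> carrier S \<Longrightarrow> pushforward M p x ` characteristic_distribution S \<pi>S x
       \<subseteq> characteristic_distribution M \<pi>M (p x)"
    and L: "L \<in> symplectic_leaves S \<pi>S"
  shows "\<exists>L'\<in>symplectic_leaves M \<pi>M. p ` L \<subseteq> L'"
proof -
  obtain x where x: "x \<in> carrier S" "L = {y. (hamiltonian_step S \<pi>S)\<^sup>*\<^sup>* x y}"
    using L by (auto simp: symplectic_leaves_def)
  have "smooth_map S M p" using ps by (simp add: poisson_submersion_def submersion_def)
  then have px: "p x \<in> carrier M" using x(1) by (auto simp: smooth_map_def continuous_map_def carrier_def)
  have "(hamiltonian_step M \<pi>M)\<^sup>*\<^sup>* (p x) (p y)" if "(hamiltonian_step S \<pi>S)\<^sup>*\<^sup>* x y" for y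
    using that
  proof (induction rule: rtranclp_induct)
    case (step y z)
    then show ?case using hamiltonian_image(1)[OF ps char step(2)] by (meson rtranclp_trans)
  qed simp
  then show ?thesis using px x(2) unfolding symplectic_leaves_def by auto
qed

section \<open>Constancy of the rank along leaves, via the identity map\<close>

subsection \<open>The rank is constant on leaves\<close>

lemma pushforward_id:
  assumes M: "smooth_manifold M" and x: "x \<in> carrier M" and v: "v \<in> tangent_space M x"
  shows "pushforward M id x v = v"
proof -
  obtain U \<phi> \<kappa> \<Omega> where c: "pchart M U \<phi> \<kappa> \<Omega>" "x \<in> U" using pchart_exists[OF M x] .
  interpret pchart M U \<phi> \<kappa> \<Omega> by (rule c(1))
  show ?thesis using tangent_vectorD(1)[OF v c(2)] by (auto simp: pushforward_def)
qed

lemma smooth_map_id: assumes M: "smooth_manifold M" shows "smooth_map M M id"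
  unfolding smooth_map_def
proof (intro conjI)
  show "\<forall>(U, \<phi>) \<in> charts M. \<forall>(V, \<psi>) \<in> charts M.
        smooth_on (model M) (\<phi> ` {x \<in> U. id x \<in> V}) (\<psi> \<circ> id \<circ> inv_into U \<phi>)"
  proof safe
    fix U \<phi> V \<psi> assume c: "(U, \<phi>) \<in> charts M" "(V, \<psi>) \<in> charts M"
    have "{x \<in> U. id x \<in> V} = U \<inter> V" by auto
    then show "smooth_on (model M) (\<phi> ` {x \<in> U. id x \<in> V}) (\<psi> \<circ> id \<circ> inv_into U \<phi>)"
      using chart_transition[OF M c] by simp
  qed
qed simp

text \<open>The identity trivially satisfies (c), so everything shown about images of Hamiltonian
  curves applies to the curves themselves.\<close>

lemma poisson_submersion_id:
  assumes poi: "poisson_manifold M \<pi>" shows "poisson_submersion M \<pi> M \<pi> id"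
proof -
  have M: "smooth_manifold M" using poi by (simp add: poisson_manifold_def)
  have "pullback M M id x \<xi> = \<xi>" if "x \<in> carrier M" "\<xi> \<in> cotangent_space M x" for x \<xi>
    using that pushforward_id[OF M that(1)] by (auto simp: pullback_def cotangent_space_def)
  moreover have "pushforward M id x ` tangent_space M x = tangent_space M (id x)" if "x \<in> carrier M" for x
    using pushforward_id[OF M that] by (simp cong: image_cong_simp)
  ultimately show ?thesis
    using poi smooth_map_id[OF M] by (simp add: poisson_submersion_def submersion_def)
qed

lemma characteristic_tangent:
  assumes M: "smooth_manifold M" and biv: "smooth_bivector M \<pi>" and x: "x \<in> carrier M"
  shows "characteristic_distribution M \<pi> x \<subseteq> tangent_space M x"
proof -
  obtain U \<phi> \<kappa> \<Omega> where c: "pchart M U \<phi> \<kappa> \<Omega>" "x \<in> U" using pchart_exists[OF M x] .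
  interpret bichart M U \<phi> \<kappa> \<Omega> \<pi> using c(1) biv by (simp add: bichart_def bichart_axioms_def)
  show ?thesis unfolding characteristic_eq[OF c(2)] using tv_in[OF c(2)] by auto
qed

lemma char_rank_reachable:
  assumes poi: "poisson_manifold M \<pi>" and "(hamiltonian_step M \<pi>)\<^sup>*\<^sup>* x y"
  shows "char_rank M \<pi> y = char_rank M \<pi> x"
  using assms(2)
proof (induction rule: rtranclp_induct)
  case (step y z)
  have M: "smooth_manifold M" "smooth_bivector M \<pi>" using poi by (auto simp: poisson_manifold_def)
  have "pushforward M id x ` characteristic_distribution M \<pi> x \<subseteq> characteristic_distribution M \<pi> (id x)"
    if x: "x \<in> carrier M" for x
  proof -
    have "pushforward M id x v = v" if "v \<in> characteristic_distribution M \<pi> x" for v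
      using pushforward_id[OF M(1) x] characteristic_tangent[OF M x] that by blast
    then show ?thesis by auto
  qed
  from hamiltonian_image(2)[OF poisson_submersion_id[OF poi] this step(2)] step(3)
  show ?case by simp
qed simp

section \<open>Curves tangent to the characteristic distribution and the counting of plaques\<close>

subsection \<open>Curves tangent to the characteristic distribution\<close>

text \<open>
  Segments inside a plaque are not obviously Hamiltonian curves, but they
  have a velocity in the characteristic distribution that varies continuously.
\<close>

definition char_curve ::
    "('a, 'e::euclidean_space) manifold \<Rightarrow> 'a bivector \<Rightarrow> real \<Rightarrow> real \<Rightarrow> (real \<Rightarrow> 'a) \<Rightarrow> bool" where
  "char_curve M \<pi> a b c \<longleftrightarrow> continuous_map (top_of_set {a..b}) (mtop M) c \<and>
     (\<exists>v. (\<forall>t\<in>{a..b}. v t \<in> characteristic_distribution M \<pi> (c t)) \<and>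
        (\<forall>U f. smooth_fun M U f \<longrightarrow> continuous_on {t\<in>{a..b}. c t \<in> U} (\<lambda>t. v t f) \<and>
           (\<forall>t\<in>{a..b}. c t \<in> U \<longrightarrow> ((f \<circ> c) has_real_derivative v t f) (at t within {a..b}))))"

lemma char_curve_continuous: "char_curve M \<pi> a b c \<Longrightarrow> continuous_map (top_of_set {a..b}) (mtop M) c"
  by (simp add: char_curve_def)

lemma char_curve_restrict:
  assumes c: "char_curve M \<pi> a b c" and sub: "{a'..b'} \<subseteq> {a..b}"
  shows "char_curve M \<pi> a' b' c"
proof -
  from c[unfolded char_curve_def, THEN conjunct2] obtain v
    where v': "\<forall>t\<in>{a..b}. v t \<in> characteristic_distribution M \<pi> (c t)"
      "\<forall>U f. smooth_fun M U f \<longrightarrow> continuous_on {t\<in>{a..b}. c t \<in> U} (\<lambda>t. v t f) \<and>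
           (\<forall>t\<in>{a..b}. c t \<in> U \<longrightarrow> ((f \<circ> c) has_real_derivative v t f) (at t within {a..b}))"
    by (elim exE conjE)
  note v = bspec[OF v'(1)] v'(2)[THEN spec, THEN spec, THEN mp, THEN conjunct1]
    v'(2)[THEN spec, THEN spec, THEN mp, THEN conjunct2, THEN bspec, THEN mp]
  show ?thesis
    unfolding char_curve_def
  proof (intro conjI exI[of _ v] ballI allI impI)
    show "continuous_map (top_of_set {a'..b'}) (mtop M) c"
      by (rule continuous_map_from_subtopology_mono[OF char_curve_continuous[OF c] sub])
    show "continuous_on {t\<in>{a'..b'}. c t \<in> U} (\<lambda>t. v t f)" if "smooth_fun M U f" for U f
      by (rule continuous_on_subset[OF v(2)[OF that]]) (use sub in auto)
    show "((f \<circ> c) has_real_derivative v t f) (at t within {a'..b'})"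
      if "smooth_fun M U f" "t \<in> {a'..b'}" "c t \<in> U" for U f t
      by (rule DERIV_subset[OF v(3)[OF that(1) _ that(3)] sub]) (use that(2) sub in blast)
  qed (use v(1) sub in blast)
qed

lemma hamiltonian_char_curve:
  assumes poi: "poisson_manifold M \<pi>" and h: "hamiltonian_curve M \<pi> W h a b \<gamma>"
  shows "char_curve M \<pi> a b \<gamma>"
  unfolding char_curve_def
proof (intro conjI exI[of _ "\<lambda>t. sharp M \<pi> (\<gamma> t) (differential M (\<gamma> t) h)"] ballI allI impI)
  have M: "smooth_manifold M" "smooth_bivector M \<pi>" using poi by (auto simp: poisson_manifold_def)
  have W: "smooth_fun M W h" "openin (mtop M) W" and g: "\<And>t. t \<in> {a..b} \<Longrightarrow> \<gamma> t \<in> W"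
    and der: "\<And>t f. t \<in> {a..b} \<Longrightarrow> smooth_near M (\<gamma> t) f \<Longrightarrow>
        ((f \<circ> \<gamma>) has_real_derivative sharp M \<pi> (\<gamma> t) (differential M (\<gamma> t) h) f) (at t within {a..b})"
    using h by (auto simp: hamiltonian_curve_def smooth_fun_def)
  show "continuous_map (top_of_set {a..b}) (mtop M) \<gamma>" using h by (simp add: hamiltonian_curve_def)
  show "sharp M \<pi> (\<gamma> t) (differential M (\<gamma> t) h) \<in> characteristic_distribution M \<pi> (\<gamma> t)" if t: "t \<in> {a..b}" for t
  proof -
    have "\<gamma> t \<in> carrier M" using g[OF t] openin_subset[OF W(2)] by (auto simp: carrier_def)
    then obtain U \<phi> \<kappa> \<Omega> where c: "pchart M U \<phi> \<kappa> \<Omega>" "\<gamma> t \<in> U" using pchart_exists[OF M(1)] by blast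
    interpret pchart M U \<phi> \<kappa> \<Omega> by (rule c(1))
    show ?thesis unfolding characteristic_distribution_def by (rule imageI[OF differential_in[OF c(2)]])
  qed
  fix U f assume f: "smooth_fun M U f"
  have near: "smooth_near M x f" if "x \<in> U" for x
    unfolding smooth_near_def using f that by (intro exI[of _ U] conjI)
  show "((f \<circ> \<gamma>) has_real_derivative sharp M \<pi> (\<gamma> t) (differential M (\<gamma> t) h) f) (at t within {a..b})"
    if "t \<in> {a..b}" "\<gamma> t \<in> U" for t by (rule der[OF that(1) near[OF that(2)]])
  \<comment> \<open>Tested on \<open>f\<close>, the velocity is the bracket of \<open>h\<close> and
    \<open>f\<close> along the curve; the bracket is again a smooth function, hence differentiable,
    in particular continuous, along the curve.\<close>
  let ?g = "poisson_bracket M \<pi> h f"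
  have "openin (mtop M) U" using f by (simp add: smooth_fun_def)
  then have "smooth_fun M (W \<inter> U) h" "smooth_fun M (W \<inter> U) f"
    using smooth_fun_subset[OF M(1) W(1), of "W \<inter> U"] smooth_fun_subset[OF M(1) f, of "W \<inter> U"] W(2) by auto
  then have sg: "smooth_fun M (W \<inter> U) ?g" using M(2) unfolding smooth_bivector_def by blast
  let ?T = "{t\<in>{a..b}. \<gamma> t \<in> U}"
  have "continuous_on ?T (?g \<circ> \<gamma>)"
    unfolding continuous_on_eq_continuous_within
  proof
    fix t assume t: "t \<in> ?T"
    then have "smooth_near M (\<gamma> t) ?g" unfolding smooth_near_def using sg g by (intro exI[of _ "W \<inter> U"] conjI) auto
    moreover have "t \<in> {a..b}" "?T \<subseteq> {a..b}" using t by auto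
    ultimately have "((?g \<circ> \<gamma>) has_real_derivative
        sharp M \<pi> (\<gamma> t) (differential M (\<gamma> t) h) ?g) (at t within ?T)"
      by (intro DERIV_subset[OF der])
    then show "continuous (at t within ?T) (?g \<circ> \<gamma>)" by (rule DERIV_continuous)
  qed
  then show "continuous_on ?T (\<lambda>t. sharp M \<pi> (\<gamma> t) (differential M (\<gamma> t) h) f)"
    by (rule continuous_on_eq) (simp add: poisson_bracket_def sharp_def near)
qed

context plaque_chart begin

definition nbhd :: "'b set" where "nbhd = {y\<in>V. \<psi> y \<in> ball (\<psi> m0) pl.\<delta>}"

definition plq :: "'b \<Rightarrow> 'b set" where
  "plq m = {y\<in>nbhd. \<psi> y = pl.phi (\<psi> m) (\<psi> y - \<psi> m)}"

lemma nbhd: "openin (mtop M) nbhd" "m0 \<in> nbhd"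
  unfolding nbhd_def using open_phi[OF open_ball] m0 pl.\<delta> by auto

lemma nbhdD:
  assumes "y \<in> nbhd"
  shows "y \<in> V" "\<psi> y \<in> ball (\<psi> m0) pl.\<delta>" "\<psi> y \<in> cball (\<psi> m0) r0" "\<psi> y \<in> pl.\<Omega>1"
  using assms pl.ball_\<delta>[of "\<psi> y"] by (auto simp: nbhd_def)

lemma nbhd_D: "y \<in> nbhd \<Longrightarrow> char_rank M \<pi> y = char_rank M \<pi> m0 \<Longrightarrow> pl.D (\<psi> y) = 0"
  using D_zero_iff_char_rank nbhdD by blast

lemma plq_self: "m \<in> nbhd \<Longrightarrow> m \<in> plq m"
  unfolding plq_def using pl.phi_0[OF nbhdD(3)] by simp

text \<open>At points of the rank of \<open>m0\<close> the range of \<open>Pi\<close> is the range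
  of \<open>H\<close>, so characteristic velocities are horizontal and \<open>stay_on_plaque\<close>
  applies with constant 0. Continuity of the velocity supplies its bound.\<close>

lemma plq_char_curve:
  assumes c: "char_curve M \<pi> a b c" and cO: "\<And>t. t \<in> {a..b} \<Longrightarrow> c t \<in> nbhd"
    and rk: "\<And>t. t \<in> {a..b} \<Longrightarrow> char_rank M \<pi> (c t) = char_rank M \<pi> m0"
    and m: "m \<in> nbhd" "char_rank M \<pi> m = char_rank M \<pi> m0"
    and s: "s \<in> {a..b}" "c s \<in> plq m" and t: "t \<in> {a..b}"
  shows "c t \<in> plq m"
proof -
  from c[unfolded char_curve_def, THEN conjunct2] obtain v
    where v': "\<forall>t\<in>{a..b}. v t \<in> characteristic_distribution M \<pi> (c t)"
      "\<forall>U f. smooth_fun M U f \<longrightarrow> continuous_on {t\<in>{a..b}. c t \<in> U} (\<lambda>t. v t f) \<and>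
           (\<forall>t\<in>{a..b}. c t \<in> U \<longrightarrow> ((f \<circ> c) has_real_derivative v t f) (at t within {a..b}))"
    by (elim exE conjE)
  note v = bspec[OF v'(1)] v'(2)[THEN spec, THEN spec, THEN mp, THEN conjunct1]
    v'(2)[THEN spec, THEN spec, THEN mp, THEN conjunct2, THEN bspec, THEN mp]
  define Y where "Y t = (\<Sum>i\<in>Basis. v t (\<lambda>y. \<psi> y \<bullet> i) *\<^sub>R i)" for t
  have cV: "c t \<in> V" if "t \<in> {a..b}" for t using cO[OF that] nbhdD by blast
  have TV: "{t\<in>{a..b}. c t \<in> V} = {a..b}" using cV by auto
  have Yi: "Y t \<bullet> i = v t (\<lambda>y. \<psi> y \<bullet> i)" if "i \<in> Basis" for t i
    unfolding Y_def using that by (simp add: inner_sum_left inner_Basis if_distrib cong: if_cong)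
  have der: "((\<lambda>t. \<psi> (c t)) has_vector_derivative Y t) (at t within {a..b})" if t: "t \<in> {a..b}" for t
    unfolding has_vector_derivative_def
  proof (subst has_derivative_componentwise_within, intro ballI)
    fix i :: 'f assume i: "i \<in> Basis"
    have "(((\<lambda>y. \<psi> y \<bullet> i) \<circ> c) has_real_derivative Y t \<bullet> i) (at t within {a..b})"
      unfolding Yi[OF i] by (rule v(3)[OF smooth_fun_coord t cV[OF t]])
    moreover have "(*) (Y t \<bullet> i) = (\<lambda>s. s *\<^sub>R Y t \<bullet> i)" by (auto simp: mult.commute)
    ultimately show "((\<lambda>t. \<psi> (c t) \<bullet> i) has_derivative (\<lambda>s. s *\<^sub>R Y t \<bullet> i)) (at t within {a..b})"
      unfolding has_field_derivative_def o_def by simp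
  qed
  have contY: "continuous_on {a..b} Y"
    unfolding Y_def
  proof (intro continuous_on_sum continuous_on_scaleR continuous_on_const)
    fix i :: 'f
    show "continuous_on {a..b} (\<lambda>t. v t (\<lambda>y. \<psi> y \<bullet> i))"
      using v(2)[OF smooth_fun_coord[of i]] unfolding TV .
  qed
  then have "bounded (Y ` {a..b})" using compact_continuous_image compact_imp_bounded by blast
  then obtain BY where BY: "\<And>t. t \<in> {a..b} \<Longrightarrow> norm (Y t) \<le> BY" unfolding bounded_iff by blast
  have HY: "pl.H (\<psi> (c t)) (Y t) = Y t" if t: "t \<in> {a..b}" for t
  proof -
    obtain a' where a': "v t = tv (c t) (Pi (\<psi> (c t)) a')"
      using v(1)[OF t] unfolding characteristic_eq[OF cV[OF t]] by blast
    have "Y t = Pi (\<psi> (c t)) a'"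
      unfolding Y_def a' tv_coord[OF cV[OF t]] euclidean_representation
      by (rule proj_id[OF subE Pi_in_E[OF phi_in[OF cV[OF t]]]])
    then show ?thesis using pl.range_eq[OF nbhdD(4)[OF cO[OF t]] nbhd_D[OF cO[OF t] rk[OF t]]] by simp
  qed
  have "\<psi> (c t) = pl.phi (\<psi> m) (\<psi> (c t) - \<psi> m)"
  proof (rule pl.stay_on_plaque[OF nbhdD(2)[OF m(1)] nbhd_D[OF m] _ der BY _ s(1) _ t])
    show "\<psi> (c t) \<in> ball (\<psi> m0) pl.\<delta>" if "t \<in> {a..b}" for t by (rule nbhdD(2)[OF cO[OF that]])
    show "norm (Y t - pl.H (\<psi> (c t)) (Y t)) \<le> 0 * norm (\<psi> (c t) - pl.phi (\<psi> m) (\<psi> (c t) - \<psi> m))"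
      if "t \<in> {a..b}" for t using HY[OF that] by simp
    show "\<psi> (c s) = pl.phi (\<psi> m) (\<psi> (c s) - \<psi> m)" using s(2) unfolding plq_def by blast
  qed
  then show ?thesis using cO[OF t] by (simp add: plq_def)
qed

text \<open>A straight segment of parameters in direction \<open>e - e'\<close> is mapped to a curve
  of velocity \<open>H (e - e')\<close>, because the derivative of \<open>phi q\<close> is
  \<open>H\<close>; and \<open>H\<close> takes values in the range of \<open>Pi\<close>.\<close>

lemma plq_segment_char_curve:
  assumes m: "m \<in> nbhd" "char_rank M \<pi> m = char_rank M \<pi> m0"
    and e: "norm e < \<rho>" "norm e' < \<rho>"
  shows "char_curve M \<pi> 0 1 (\<lambda>s. \<mu> (pl.phi (\<psi> m) (e' + s *\<^sub>R (e - e'))))"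
proof -
  let ?p = "pl.phi (\<psi> m)" and ?d = "e - e'"
  let ?l = "\<lambda>s. e' + s *\<^sub>R ?d"
  let ?z = "\<lambda>s. ?p (?l s)"
  let ?c = "\<lambda>s. \<mu> (?z s)"
  note mV = nbhdD(1)[OF m(1)] and q = nbhdD(3)[OF m(1)] and D = nbhd_D[OF m]
  have ln: "norm (?l s) < \<rho>" if "s \<in> {0..1}" for s
  proof -
    have "?l s \<in> ball 0 \<rho>"
    proof -
      have "?l s = (1 - s) *\<^sub>R e' + s *\<^sub>R e" by (simp add: algebra_simps)
      then show ?thesis using convexD[OF convex_ball[of 0 \<rho>], of e' e "1 - s" s] e that by simp
    qed
    then show ?thesis by simp
  qed
  have z\<Omega>1: "?z s \<in> pl.\<Omega>1" if "s \<in> {0..1}" for s using pl.phi_K[OF q less_imp_le[OF ln[OF that]]] pl.r0 by blast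
  have z\<Theta>: "?z s \<in> \<Theta>" if "s \<in> {0..1}" for s using z\<Omega>1[OF that] pl.\<Omega>1(3) by blast
  have zE: "?z s \<in> E" if "s \<in> {0..1}" for s
    unfolding pl.phi_def by (rule curve_E[OF mV q less_imp_le[OF ln[OF that]]]) simp
  have cV: "?c s \<in> V" "\<psi> (?c s) = ?z s" if "s \<in> {0..1}" for s
    using kappa_in[OF z\<Theta>[OF that]] phi_kappa_E[OF z\<Theta>[OF that] zE[OF that]] by auto
  have dz: "(?z has_derivative (\<lambda>h. h *\<^sub>R pl.H (?z s) ?d)) (at s within {0..1})" if s: "s \<in> {0..1}" for s
  proof -
    have "(?l has_derivative (\<lambda>h. h *\<^sub>R ?d)) (at s within {0..1})" by (auto intro!: derivative_eq_intros)
    from has_derivative_compose[OF this pl.phi_has_derivative[OF q D ln[OF s]]]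
    show ?thesis by (simp add: blinfun.scaleR_right)
  qed
  have contz: "continuous_on {0..1} ?z"
    using dz has_derivative_continuous by (metis (no_types, lifting) continuous_on_eq_continuous_within)
  show ?thesis
    unfolding char_curve_def
  proof (intro conjI exI[of _ "\<lambda>s. tv (?c s) (pl.H (?z s) ?d)"] ballI allI impI)
    have "continuous_map (top_of_set {0..1}) (top_of_set \<Theta>) ?z" using contz z\<Theta> by auto
    from continuous_map_compose[OF this continuous_map_kappa]
    show "continuous_map (top_of_set {0..1}) (mtop M) ?c" by (simp add: o_def)
    show "tv (?c s) (pl.H (?z s) ?d) \<in> characteristic_distribution M \<pi> (?c s)" if "s \<in> {0..1}" for s
      unfolding characteristic_eq[OF cV(1)[OF that]] cV(2)[OF that] pl.H_def by auto
    fix W f assume f: "smooth_fun M W f"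
    have near: "smooth_near M x f" if "x \<in> W" for x
      unfolding smooth_near_def using f that by (intro exI[of _ W] conjI)
    let ?G = "{z\<in>\<Theta>. \<mu> z \<in> W}"
    have W: "openin (mtop M) W" using f by (simp add: smooth_fun_def)
    have G: "open ?G" "smooth ?G (\<lambda>z. f (\<mu> z))" by (rule open_kappa[OF W], rule smooth_kappa[OF f])
    have tv: "tv (?c s) w f = Dop (\<lambda>z. f (\<mu> z)) (?z s) w" if "s \<in> {0..1}" "?c s \<in> W" for s w
      using tv_eqI[OF cV(1)[OF that(1)] near[OF that(2)], of "Dop (\<lambda>z. f (\<mu> z)) (?z s)" w] cV(2)[OF that(1)]
        has_derivative_Dop[OF G(2,1), of "?z s"] z\<Theta>[OF that(1)] that(2) by simp
    let ?T = "{s\<in>{0..1}. ?c s \<in> W}"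
    have "continuous_on ?T (\<lambda>s. Dop (\<lambda>z. f (\<mu> z)) (?z s) (pl.H (?z s) ?d))"
    proof (intro bounded_bilinear.continuous_on[OF bounded_bilinear_blinfun_apply] continuous_on_const)
      have cz: "continuous_on ?T ?z" by (rule continuous_on_subset[OF contz]) auto
      show "continuous_on ?T (\<lambda>s. Dop (\<lambda>z. f (\<mu> z)) (?z s))"
        by (rule continuous_on_compose2[OF smooth_continuous[OF smooth_Dop[OF G(2,1)] G(1)] cz]) (use z\<Theta> in auto)
      show "continuous_on ?T (\<lambda>s. pl.H (?z s))"
        by (rule continuous_on_compose2[OF smooth_continuous[OF pl.smooth1(3) pl.\<Omega>1(1)] cz]) (use z\<Omega>1 in auto)
    qed
    then show "continuous_on ?T (\<lambda>s. tv (?c s) (pl.H (?z s) ?d) f)"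
      by (rule continuous_on_eq) (simp add: tv)
    fix s :: real assume s: "s \<in> {0..1}" and cs: "?c s \<in> W"
    have "((\<lambda>s. f (?c s)) has_derivative (\<lambda>h. Dop (\<lambda>z. f (\<mu> z)) (?z s) (h *\<^sub>R pl.H (?z s) ?d))) (at s within {0..1})"
      by (rule has_derivative_compose[OF dz[OF s] has_derivative_Dop[OF G(2,1)]]) (use z\<Theta>[OF s] cs in simp)
    then show "((f \<circ> ?c) has_real_derivative tv (?c s) (pl.H (?z s) ?d) f) (at s within {0..1})"
      by (simp add: has_field_derivative_def o_def blinfun.scaleR_right tv[OF s cs] mult_commute_abs)
  qed
qed

text \<open>Closeness to a countable set alone would not identify the plaque of another chart
  containing \<open>y\<close>. The connecting curve inside \<open>G\<close> does, since a plaque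
  contains each tangent curve of the right rank that meets it.\<close>

lemma plq_dense:
  assumes m: "m \<in> nbhd" "char_rank M \<pi> m = char_rank M \<pi> m0"
  obtains N where "countable N" "\<And>y. y \<in> N \<Longrightarrow> hamiltonian_step M \<pi> m y"
    "\<And>y G. y \<in> plq m \<Longrightarrow> openin (mtop M) G \<Longrightarrow> y \<in> G \<Longrightarrow>
      \<exists>c. c 0 \<in> N \<and> c 1 = y \<and> char_curve M \<pi> 0 1 c \<and> (\<forall>s\<in>{0..1}. c s \<in> G \<and> hamiltonian_step M \<pi> m (c s))"
proof -
  obtain Dn :: "'f set" where Dn: "countable Dn" "\<And>X. open X \<Longrightarrow> X \<noteq> {} \<Longrightarrow> \<exists>d\<in>Dn. d \<in> X"
    using countable_dense_setE by metis
  note mV = nbhdD(1)[OF m(1)] and q = nbhdD(3)[OF m(1)] and D = nbhd_D[OF m]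
  let ?p = "pl.phi (\<psi> m)"
  define N where "N = (\<lambda>e. \<mu> (?p e)) ` (Dn \<inter> ball 0 \<rho>)"
  show ?thesis
  proof
    show "countable N" unfolding N_def using Dn(1) by blast
    show "hamiltonian_step M \<pi> m y" if "y \<in> N" for y
      using that plaque_step[OF mV q] by (auto simp: N_def)
    fix y G assume y: "y \<in> plq m" and G: "openin (mtop M) G" "y \<in> G"
    let ?e = "\<psi> y - \<psi> m"
    have yO: "y \<in> nbhd" and ye: "\<psi> y = ?p ?e" using y by (auto simp: plq_def)
    have en: "norm ?e < \<rho>" using pl.ball_\<delta>(4)[OF nbhdD(2)[OF m(1)] nbhdD(2)[OF yO]] .
    have py: "\<mu> (?p ?e) = y" using ye kappa_phi[OF nbhdD(1)[OF yO]] by simp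
    let ?G = "{z\<in>\<Theta>. \<mu> z \<in> G}"
    have "open ?G" by (rule open_kappa[OF G(1)])
    then have o: "open {e \<in> ball 0 \<rho>. ?p e \<in> ?G}"
      using continuous_open_preimage[OF pl.phi_continuous[OF q D] open_ball, of ?G] by (simp add: vimage_def Int_def)
    have "?p ?e \<in> ?G" using G(2) py phi_in[OF nbhdD(1)[OF yO]] ye by simp
    then have "?e \<in> {e \<in> ball 0 \<rho>. ?p e \<in> ?G}" using en by simp
    then obtain \<eta> where \<eta>: "0 < \<eta>" "ball ?e \<eta> \<subseteq> {e \<in> ball 0 \<rho>. ?p e \<in> ?G}"
      using o open_contains_ball by blast
    have "ball ?e \<eta> \<noteq> {}" using \<eta>(1) by simp
    then obtain e' where e': "e' \<in> Dn" "e' \<in> ball ?e \<eta>" using Dn(2)[OF open_ball] by blast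
    have e'n: "norm e' < \<rho>" using e'(2) \<eta>(2) by auto
    define c where "c s = \<mu> (?p (e' + s *\<^sub>R (?e - e')))" for s
    have seg: "e' + s *\<^sub>R (?e - e') \<in> ball ?e \<eta>" if "s \<in> {0..1}" for s
    proof -
      have "e' + s *\<^sub>R (?e - e') = (1 - s) *\<^sub>R e' + s *\<^sub>R ?e" by (simp add: algebra_simps)
      then show ?thesis using convexD[OF convex_ball[of ?e \<eta>] e'(2), of ?e "1 - s" s] \<eta>(1) that by simp
    qed
    have "c 0 \<in> N" using e'(1) e'n by (auto simp: c_def N_def)
    moreover have "c 1 = y" using py by (simp add: c_def)
    moreover have "char_curve M \<pi> 0 1 c"
      unfolding c_def[abs_def] by (rule plq_segment_char_curve[OF m en e'n])
    moreover have "c s \<in> G \<and> hamiltonian_step M \<pi> m (c s)" if "s \<in> {0..1}" for s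
    proof -
      have 1: "e' + s *\<^sub>R (?e - e') \<in> {e \<in> ball 0 \<rho>. ?p e \<in> ?G}" using seg[OF that] \<eta>(2) by blast
      then have "norm (e' + s *\<^sub>R (?e - e')) \<le> \<rho>" by simp
      then show ?thesis using 1 plaque_step[OF mV q] by (simp add: c_def)
    qed
    ultimately show "\<exists>c. c 0 \<in> N \<and> c 1 = y \<and> char_curve M \<pi> 0 1 c \<and> (\<forall>s\<in>{0..1}. c s \<in> G \<and> hamiltonian_step M \<pi> m (c s))"
      by blast
  qed
qed

end

subsection \<open>A leaf meets a neighbourhood in countably many plaques\<close>

lemma hamiltonian_curve_restrict:
  assumes c: "hamiltonian_curve M \<pi> W h a b \<gamma>" and sub: "{a'..b'} \<subseteq> {a..b}" "a' \<le> b'"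
  shows "hamiltonian_curve M \<pi> W h a' b' \<gamma>"
  unfolding hamiltonian_curve_def
proof (intro conjI ballI allI impI)
  show "smooth_fun M W h" "\<gamma> ` {a'..b'} \<subseteq> W" using c sub unfolding hamiltonian_curve_def by blast+
  show "continuous_map (top_of_set {a'..b'}) (mtop M) \<gamma>"
    by (rule continuous_map_from_subtopology_mono[OF _ sub(1)]) (use c in \<open>simp add: hamiltonian_curve_def\<close>)
  fix t f assume t: "t \<in> {a'..b'}" "smooth_near M (\<gamma> t) f"
  then have "((f \<circ> \<gamma>) has_real_derivative sharp M \<pi> (\<gamma> t) (differential M (\<gamma> t) h) f) (at t within {a..b})"
    using c sub(1) unfolding hamiltonian_curve_def by blast
  then show "((f \<circ> \<gamma>) has_real_derivative sharp M \<pi> (\<gamma> t) (differential M (\<gamma> t) h) f) (at t within {a'..b'})"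
    by (rule DERIV_subset[OF _ sub(1)])
qed (rule sub(2))

text \<open>
  \<open>Ob\<close> is a neighbourhood of \<open>m\<close> and \<open>W q\<close> the plaque through \<open>q\<close>; \<open>N\<close> is dense in the plaque, in the
  sense that its points can be joined to nearby points of the plaque by short curves.
\<close>

definition plaque_system ::
    "('b, 'f::euclidean_space) manifold \<Rightarrow> 'b bivector \<Rightarrow> 'b \<Rightarrow> 'b set \<Rightarrow> ('b \<Rightarrow> 'b set) \<Rightarrow> bool" where
  "plaque_system M \<pi> m Ob W \<longleftrightarrow> openin (mtop M) Ob \<and> m \<in> Ob \<and>
    (\<forall>q\<in>Ob. char_rank M \<pi> q = char_rank M \<pi> m \<longrightarrow>
      q \<in> W q \<and>
      (\<forall>a b c s t. char_curve M \<pi> a b c \<and> (\<forall>r\<in>{a..b}. c r \<in> Ob \<and> char_rank M \<pi> (c r) = char_rank M \<pi> m) \<and>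
         s \<in> {a..b} \<and> c s \<in> W q \<and> t \<in> {a..b} \<longrightarrow> c t \<in> W q) \<and>
      (\<exists>N. countable N \<and> (\<forall>y\<in>N. hamiltonian_step M \<pi> q y) \<and>
        (\<forall>y G. y \<in> W q \<and> openin (mtop M) G \<and> y \<in> G \<longrightarrow>
          (\<exists>c. c 0 \<in> N \<and> c 1 = y \<and> char_curve M \<pi> 0 1 c \<and>
             (\<forall>s\<in>{0..1}. c s \<in> G \<and> hamiltonian_step M \<pi> q (c s))))))"

lemma (in plaque_chart) plaque_system: "plaque_system M \<pi> m0 nbhd plq"
  unfolding plaque_system_def
proof (intro conjI ballI impI)
  fix q assume q: "q \<in> nbhd" "char_rank M \<pi> q = char_rank M \<pi> m0"
  show "q \<in> plq q" by (rule plq_self[OF q(1)])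
  show "\<forall>a b c s t. char_curve M \<pi> a b c \<and> (\<forall>r\<in>{a..b}. c r \<in> nbhd \<and> char_rank M \<pi> (c r) = char_rank M \<pi> m0) \<and>
         s \<in> {a..b} \<and> c s \<in> plq q \<and> t \<in> {a..b} \<longrightarrow> c t \<in> plq q"
  proof clarify
    fix a b c s t
    assume c: "char_curve M \<pi> a b c" "\<forall>r\<in>{a..b}. c r \<in> nbhd \<and> char_rank M \<pi> (c r) = char_rank M \<pi> m0"
      and s: "s \<in> {a..b}" "c s \<in> plq q" and t: "t \<in> {a..b}"
    show "c t \<in> plq q" by (rule plq_char_curve[OF c(1) _ _ q s t]) (use c(2) in auto)
  qed
  show "\<exists>N. countable N \<and> (\<forall>y\<in>N. hamiltonian_step M \<pi> q y) \<and>
        (\<forall>y G. y \<in> plq q \<and> openin (mtop M) G \<and> y \<in> G \<longrightarrow>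
          (\<exists>c. c 0 \<in> N \<and> c 1 = y \<and> char_curve M \<pi> 0 1 c \<and>
             (\<forall>s\<in>{0..1}. c s \<in> G \<and> hamiltonian_step M \<pi> q (c s))))"
  proof (rule plq_dense[OF q])
    fix N
    assume N: "countable N" "\<And>y. y \<in> N \<Longrightarrow> hamiltonian_step M \<pi> q y"
      "\<And>y G. y \<in> plq q \<Longrightarrow> openin (mtop M) G \<Longrightarrow> y \<in> G \<Longrightarrow>
        \<exists>c. c 0 \<in> N \<and> c 1 = y \<and> char_curve M \<pi> 0 1 c \<and> (\<forall>s\<in>{0..1}. c s \<in> G \<and> hamiltonian_step M \<pi> q (c s))"
    show ?thesis
    proof (intro exI[of _ N] conjI ballI allI impI N(1))
      fix y G assume "y \<in> plq q \<and> openin (mtop M) G \<and> y \<in> G"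
      then show "\<exists>c. c 0 \<in> N \<and> c 1 = y \<and> char_curve M \<pi> 0 1 c \<and> (\<forall>s\<in>{0..1}. c s \<in> G \<and> hamiltonian_step M \<pi> q (c s))"
        by (intro N(3)) auto
    qed (rule N(2))
  qed
qed (rule nbhd)+

lemma plaque_systemD:
  assumes "plaque_system M \<pi> m Ob W"
  shows "openin (mtop M) Ob" "m \<in> Ob"
    and "q \<in> Ob \<Longrightarrow> char_rank M \<pi> q = char_rank M \<pi> m \<Longrightarrow> q \<in> W q"
    and "q \<in> Ob \<Longrightarrow> char_rank M \<pi> q = char_rank M \<pi> m \<Longrightarrow> char_curve M \<pi> a b c \<Longrightarrow>
      (\<And>r. r \<in> {a..b} \<Longrightarrow> c r \<in> Ob \<and> char_rank M \<pi> (c r) = char_rank M \<pi> m) \<Longrightarrow>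
      s \<in> {a..b} \<Longrightarrow> c s \<in> W q \<Longrightarrow> t \<in> {a..b} \<Longrightarrow> c t \<in> W q"
    and "q \<in> Ob \<Longrightarrow> char_rank M \<pi> q = char_rank M \<pi> m \<Longrightarrow>
      \<exists>N. countable N \<and> (\<forall>y\<in>N. hamiltonian_step M \<pi> q y) \<and>
        (\<forall>y G. y \<in> W q \<and> openin (mtop M) G \<and> y \<in> G \<longrightarrow>
          (\<exists>c. c 0 \<in> N \<and> c 1 = y \<and> char_curve M \<pi> 0 1 c \<and>
             (\<forall>s\<in>{0..1}. c s \<in> G \<and> hamiltonian_step M \<pi> q (c s))))"
proof -
  note d = assms[unfolded plaque_system_def]
  show "openin (mtop M) Ob" "m \<in> Ob" using d by (rule conjunct1, rule conjunct1[OF conjunct2])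
  assume q: "q \<in> Ob" "char_rank M \<pi> q = char_rank M \<pi> m"
  note e = d[THEN conjunct2, THEN conjunct2, THEN bspec, OF q(1), THEN mp, OF q(2)]
  show "q \<in> W q" by (rule e[THEN conjunct1])
  show "c t \<in> W q" if "char_curve M \<pi> a b c"
      "\<And>r. r \<in> {a..b} \<Longrightarrow> c r \<in> Ob \<and> char_rank M \<pi> (c r) = char_rank M \<pi> m"
      "s \<in> {a..b}" "c s \<in> W q" "t \<in> {a..b}" for a b c s t
    using e[THEN conjunct2, THEN conjunct1, THEN spec, THEN spec, THEN spec, THEN spec, THEN spec,
        of a b c s t] that by blast
  show "\<exists>N. countable N \<and> (\<forall>y\<in>N. hamiltonian_step M \<pi> q y) \<and>
        (\<forall>y G. y \<in> W q \<and> openin (mtop M) G \<and> y \<in> G \<longrightarrow>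
          (\<exists>c. c 0 \<in> N \<and> c 1 = y \<and> char_curve M \<pi> 0 1 c \<and>
             (\<forall>s\<in>{0..1}. c s \<in> G \<and> hamiltonian_step M \<pi> q (c s))))"
    by (rule e[THEN conjunct2, THEN conjunct2])
qed

lemma plaque_system_exists:
  assumes poi: "poisson_manifold M \<pi>" and m: "m \<in> carrier M"
  shows "\<exists>OW. plaque_system M \<pi> m (fst OW) (snd OW)"
proof -
  have M: "smooth_manifold M" "smooth_bivector M \<pi>" using poi by (auto simp: poisson_manifold_def)
  obtain U \<phi> \<kappa> \<Omega> where c: "pchart M U \<phi> \<kappa> \<Omega>" "m \<in> U" using pchart_exists[OF M(1) m] .
  interpret bichart M U \<phi> \<kappa> \<Omega> \<pi> using c(1) M(2) by (simp add: bichart_def bichart_axioms_def)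
  obtain r0 B L C2 \<rho> where q: "plaque_chart M U \<phi> \<kappa> \<Omega> \<pi> m r0 B L C2 \<rho>"
    using plaque_chart_exists[OF poi c(2)] .
  interpret q: plaque_chart M U \<phi> \<kappa> \<Omega> \<pi> m r0 B L C2 \<rho> by (rule q)
  show ?thesis by (rule exI[of _ "(q.nbhd, q.plq)"]) (simp add: q.plaque_system)
qed

text \<open>
  The plaques of the cover are enumerated by starting at \<open>m\<close> and repeatedly passing from a plaque
  to those through a countable dense subset of it: by the Lindeloef property only countably many charts are needed.
\<close>

lemma leaf_countable_cover:
  assumes poi: "poisson_manifold M \<pi>" and m: "m \<in> carrier M"
  obtains Q where "countable Q" "\<And>q. q \<in> Q \<Longrightarrow> (hamiltonian_step M \<pi>)\<^sup>*\<^sup>* m q"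
    "\<And>j Ob W y. plaque_system M \<pi> j Ob W \<Longrightarrow> (hamiltonian_step M \<pi>)\<^sup>*\<^sup>* m j \<Longrightarrow>
      (hamiltonian_step M \<pi>)\<^sup>*\<^sup>* m y \<Longrightarrow> y \<in> Ob \<Longrightarrow> \<exists>q\<in>Q. q \<in> Ob \<and> y \<in> W q"
proof -
  define Lf where "Lf = {y. (hamiltonian_step M \<pi>)\<^sup>*\<^sup>* m y}"
  have LfI: "z \<in> Lf" if "y \<in> Lf" "hamiltonian_step M \<pi> y z" for y z
    using that unfolding Lf_def by (auto intro: rtranclp.rtrancl_into_rtrancl)
  have mL: "m \<in> Lf" by (simp add: Lf_def)
  have Lfc: "Lf \<subseteq> carrier M"
  proof
    fix y assume "y \<in> Lf"
    then have "(hamiltonian_step M \<pi>)\<^sup>*\<^sup>* m y" by (simp add: Lf_def)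
    then show "y \<in> carrier M"
      by (induction rule: rtranclp_induct) (rule m, rule hamiltonian_step_carrier(2))
  qed
  \<comment> \<open>All properties of a plaque system are conditional on the rank of its centre; on
    a leaf this condition holds everywhere.\<close>
  have rk: "char_rank M \<pi> y = char_rank M \<pi> z" if "y \<in> Lf" "z \<in> Lf" for y z
    using char_rank_reachable[OF poi, of m y] char_rank_reachable[OF poi, of m z] that
    unfolding Lf_def mem_Collect_eq by metis
  have "\<forall>i\<in>Lf. \<exists>OW. plaque_system M \<pi> i (fst OW) (snd OW)"
    using plaque_system_exists[OF poi] Lfc by blast
  from bchoice[OF this] obtain OW where OW: "\<And>i. i \<in> Lf \<Longrightarrow> plaque_system M \<pi> i (fst (OW i)) (snd (OW i))"
    by blast
  define Ob where "Ob i = fst (OW i)" for i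
  define W where "W i = snd (OW i)" for i
  have sys: "plaque_system M \<pi> i (Ob i) (W i)" if "i \<in> Lf" for i using OW[OF that] by (simp add: Ob_def W_def)
  let ?P = "\<lambda>i q N. countable N \<and> (\<forall>y\<in>N. hamiltonian_step M \<pi> q y) \<and>
        (\<forall>y G. y \<in> W i q \<and> openin (mtop M) G \<and> y \<in> G \<longrightarrow>
          (\<exists>c. c 0 \<in> N \<and> c 1 = y \<and> char_curve M \<pi> 0 1 c \<and>
             (\<forall>s\<in>{0..1}. c s \<in> G \<and> hamiltonian_step M \<pi> q (c s))))"
  define N where "N i q = (SOME N. ?P i q N)" for i q
  have NP: "?P i q (N i q)" if "i \<in> Lf" "q \<in> Lf" "q \<in> Ob i" for i q
    unfolding N_def by (rule someI_ex) (rule plaque_systemD(5)[OF sys[OF that(1)] that(3) rk[OF that(2,1)]])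
  have sec: "second_countable (mtop M)" using poi by (simp add: poisson_manifold_def smooth_manifold_def)
  have lin: "Lindelof_space (subtopology (mtop M) Lf)"
    by (rule second_countable_imp_Lindelof_space[OF second_countable_subtopology[OF sec]])
  have top: "topspace (subtopology (mtop M) Lf) = Lf" using Lfc by (auto simp: carrier_def)
  have op: "\<forall>U\<in>(\<lambda>i. Lf \<inter> Ob i) ` Lf. openin (subtopology (mtop M) Lf) U"
    using plaque_systemD(1)[OF sys] by (auto intro: openin_subtopology_Int2)
  have "\<Union>((\<lambda>i. Lf \<inter> Ob i) ` Lf) = Lf" using plaque_systemD(2)[OF sys] by blast
  from lin[unfolded Lindelof_space_def top, rule_format, OF conjI[OF op this]]
  obtain \<V> where \<V>: "countable \<V>" "\<V> \<subseteq> (\<lambda>i. Lf \<inter> Ob i) ` Lf" "\<Union>\<V> = Lf"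
    by (elim exE conjE)
  obtain I where I: "countable I" "I \<subseteq> Lf" "\<V> = (\<lambda>i. Lf \<inter> Ob i) ` I"
    using \<V>(1,2) by (metis countable_subset_image)
  have cover: "\<exists>i\<in>I. y \<in> Ob i" if "y \<in> Lf" for y using \<V>(3) that unfolding I(3) by blast
  define F where "F X = X \<union> (\<Union>i\<in>I. \<Union>q\<in>X \<inter> Ob i. N i q)" for X
  define Q where "Q = (\<Union>n. (F ^^ n) {m})"
  have Fn: "countable ((F ^^ n) {m}) \<and> (F ^^ n) {m} \<subseteq> Lf" for n
  proof (induction n)
    case 0 then show ?case using mL by simp
  next
    case (Suc n)
    define X where "X = (F ^^ n) {m}"
    have X: "countable X" "X \<subseteq> Lf" using Suc by (auto simp: X_def)
    have "countable (N i q)" "N i q \<subseteq> Lf" if "i \<in> I" "q \<in> X \<inter> Ob i" for i q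
    proof -
      have iq: "i \<in> Lf" "q \<in> Lf" "q \<in> Ob i" using that X(2) I(2) by auto
      note P = NP[OF iq]
      show "countable (N i q)" by (rule P[THEN conjunct1])
      show "N i q \<subseteq> Lf" using P[THEN conjunct2, THEN conjunct1] LfI[OF iq(2)] by blast
    qed
    then have "countable (F X)" "F X \<subseteq> Lf" unfolding F_def using X I(1) by (auto, blast)
    then show ?case by (simp add: X_def)
  qed
  have Q: "countable Q" "Q \<subseteq> Lf" "m \<in> Q"
    unfolding Q_def using Fn by (auto intro: exI[of _ 0] simp: UN_I[of 0])
  have Qcl: "N i q \<subseteq> Q" if iq: "i \<in> I" "q \<in> Q" "q \<in> Ob i" for i q
  proof -
    obtain n where "q \<in> (F ^^ n) {m}" using iq(2) by (auto simp: Q_def)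
    then have "N i q \<subseteq> F ((F ^^ n) {m})" using iq unfolding F_def by blast
    also have "F ((F ^^ n) {m}) = (F ^^ Suc n) {m}" by simp
    also have "\<dots> \<subseteq> Q" unfolding Q_def by blast
    finally show ?thesis .
  qed
  \<comment> \<open>Changes the chart: \<open>y\<close> is joined inside \<open>Ob'\<close> to a
    point of \<open>N i q\<close>, which belongs to \<open>Q\<close>. This curve begins on the
    \<open>W'\<close>-plaque of its own starting point, hence ends on it.\<close>
  have transfer: "\<exists>q\<in>Q. q \<in> Ob' \<and> y \<in> W' q"
    if i: "i \<in> I" "q \<in> Q" "q \<in> Ob i" "y \<in> W i q" and j: "plaque_system M \<pi> j Ob' W'" "j \<in> Lf" "y \<in> Ob'"
    for i q y j Ob' W'
  proof -
    have iL: "i \<in> Lf" "q \<in> Lf" using i(1,2) I(2) Q(2) by auto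
    have "y \<in> W i q \<and> openin (mtop M) Ob' \<and> y \<in> Ob'" using i(4) plaque_systemD(1)[OF j(1)] j(3) by blast
    from NP[OF iL i(3), THEN conjunct2, THEN conjunct2, rule_format, OF this]
    obtain c where c': "c 0 \<in> N i q" "c 1 = y" "char_curve M \<pi> 0 1 c"
      "\<forall>s\<in>{0..1}. c s \<in> Ob' \<and> hamiltonian_step M \<pi> q (c s)"
      by (elim exE conjE)
    note c = c'(1-3) bspec[OF c'(4)]
    have cL: "c s \<in> Lf" if "s \<in> {0..1}" for s using LfI[OF iL(2)] c(4)[OF that] by blast
    have 0: "(0::real) \<in> {0..1}" "(1::real) \<in> {0..1}" by auto
    have c0: "c 0 \<in> Ob'" "char_rank M \<pi> (c 0) = char_rank M \<pi> j" using c(4)[OF 0(1)] rk[OF cL[OF 0(1)] j(2)] by auto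
    have "c 1 \<in> W' (c 0)"
      by (rule plaque_systemD(4)[OF j(1) c0 c(3) _ 0(1) plaque_systemD(3)[OF j(1) c0] 0(2)])
        (use c(4) rk[OF cL j(2)] in auto)
    then show ?thesis using Qcl[OF i(1-3)] c(1,2) c0(1) by blast
  qed
  let ?C = "\<lambda>y. \<exists>i\<in>I. \<exists>q\<in>Q. q \<in> Ob i \<and> y \<in> W i q"
  have C: "?C y" if "y \<in> Lf" for y
  proof -
    have "(hamiltonian_step M \<pi>)\<^sup>*\<^sup>* m y" using that by (simp add: Lf_def)
    then show ?thesis
    proof (induction rule: rtranclp_induct)
      case base
      obtain i where i: "i \<in> I" "m \<in> Ob i" using cover[OF mL] by blast
      then have "m \<in> W i m" using plaque_systemD(3)[OF sys] rk[OF mL] I(2) by blast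
      then show ?case using i Q(3) by blast
    next
      case (step y z)
      have yL: "y \<in> Lf" using step(1) by (simp add: Lf_def)
      obtain U h a b \<gamma> where c: "hamiltonian_curve M \<pi> U h a b \<gamma>" "\<gamma> a = y" "\<gamma> b = z"
        using step(2) unfolding hamiltonian_step_def by blast
      have ab: "a \<in> {a..b}" "b \<in> {a..b}" and cont: "continuous_map (top_of_set {a..b}) (mtop M) \<gamma>"
        using c(1) by (auto simp: hamiltonian_curve_def)
      have gL: "\<gamma> t \<in> Lf" if t: "t \<in> {a..b}" for t
      proof (rule LfI[OF yL])
        have "hamiltonian_curve M \<pi> U h a t \<gamma>" by (rule hamiltonian_curve_restrict[OF c(1)]) (use t in auto)
        then show "hamiltonian_step M \<pi> y (\<gamma> t)" unfolding hamiltonian_step_def using c(2) by blast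
      qed
      note cc = hamiltonian_char_curve[OF poi c(1)]
      let ?R = "\<lambda>s t. ?C (\<gamma> s) \<longleftrightarrow> ?C (\<gamma> t)"
      have "?R a b"
      proof (rule connected_equivalence_relation[of "{a..b}" a b ?R])
        fix t0 assume t0: "t0 \<in> {a..b}"
        obtain i where i: "i \<in> I" "\<gamma> t0 \<in> Ob i" using cover[OF gL[OF t0]] by blast
        have iL: "i \<in> Lf" using i(1) I(2) by blast
        have "openin (top_of_set {a..b}) {t \<in> topspace (top_of_set {a..b}). \<gamma> t \<in> Ob i}"
          by (rule openin_continuous_map_preimage[OF cont plaque_systemD(1)[OF sys[OF iL]]])
        then obtain \<epsilon> where \<epsilon>: "0 < \<epsilon>" "ball t0 \<epsilon> \<inter> {a..b} \<subseteq> {t \<in> {a..b}. \<gamma> t \<in> Ob i}"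
          using t0 i(2) unfolding openin_contains_ball by auto
        \<comment> \<open>On a short piece inside one \<open>Ob i\<close>, \<open>transfer\<close>
          first moves the plaque containing the starting point into the system of \<open>i\<close>;
          the tangent curve then remains on that plaque.\<close>
        have tr: "?C (\<gamma> t)" if s: "s \<in> {a..b} \<inter> ball t0 \<epsilon>" and t: "t \<in> {a..b} \<inter> ball t0 \<epsilon>" and Cs: "?C (\<gamma> s)" for s t
        proof -
          have sO: "\<gamma> s \<in> Ob i" using s \<epsilon>(2) by auto
          obtain q where q: "q \<in> Q" "q \<in> Ob i" "\<gamma> s \<in> W i q"
            using Cs transfer[OF _ _ _ _ sys[OF iL] iL sO] by blast
          have qr: "char_rank M \<pi> q = char_rank M \<pi> i" by (rule rk[OF subsetD[OF Q(2) q(1)] iL])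
          define a' where "a' = min s t"
          define b' where "b' = max s t"
          have sub: "{a'..b'} \<subseteq> {a..b}" using s t by (auto simp: a'_def b'_def)
          have rO: "\<gamma> r \<in> Ob i \<and> char_rank M \<pi> (\<gamma> r) = char_rank M \<pi> i" if r: "r \<in> {a'..b'}" for r
          proof -
            have "r \<in> ball t0 \<epsilon>" using s t r by (auto simp: a'_def b'_def dist_real_def)
            then show ?thesis using \<epsilon>(2) r sub rk[OF gL iL] by blast
          qed
          have "\<gamma> t \<in> W i q"
            by (rule plaque_systemD(4)[OF sys[OF iL] q(2) qr char_curve_restrict[OF cc sub] rO _ q(3)])
              (auto simp: a'_def b'_def)
          then show ?thesis using i(1) q(1,2) by blast
        qed
        show "\<exists>T. openin (top_of_set {a..b}) T \<and> t0 \<in> T \<and> (\<forall>t\<in>T. ?R t0 t)"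
        proof (intro exI conjI ballI)
          show "openin (top_of_set {a..b}) ({a..b} \<inter> ball t0 \<epsilon>)" by (rule openin_open_Int) simp
          show t0': "t0 \<in> {a..b} \<inter> ball t0 \<epsilon>" using t0 \<epsilon>(1) by simp
          show "?R t0 t" if "t \<in> {a..b} \<inter> ball t0 \<epsilon>" for t using tr[OF t0' that] tr[OF that t0'] by (rule iffI)
        qed
      next
        show "?R t s" if "?R s t" for s t using that by (rule sym)
        show "?R r t" if "?R r s" "?R s t" for r s t using that by (rule trans)
      qed (use ab in auto)
      then show ?case using step(3) c(2,3) by simp
    qed
  qed
  show ?thesis
  proof (rule that[OF Q(1)])
    show "(hamiltonian_step M \<pi>)\<^sup>*\<^sup>* m q" if "q \<in> Q" for q using Q(2) that by (auto simp: Lf_def)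
    fix j Ob' W' y
    assume j: "plaque_system M \<pi> j Ob' W'" "(hamiltonian_step M \<pi>)\<^sup>*\<^sup>* m j"
      and y: "(hamiltonian_step M \<pi>)\<^sup>*\<^sup>* m y" "y \<in> Ob'"
    have L: "j \<in> Lf" "y \<in> Lf" using j(2) y(1) by (simp_all add: Lf_def)
    obtain i q where "i \<in> I" "q \<in> Q" "q \<in> Ob i" "y \<in> W i q" using C[OF L(2)] by blast
    then show "\<exists>q\<in>Q. q \<in> Ob' \<and> y \<in> W' q" by (rule transfer[OF _ _ _ _ j(1) L(1) y(2)])
  qed
qed

text \<open>Each point is cut out by an interval with rational end points, and such an interval
  determines its point.\<close>

lemma isolated_imp_countable:
  fixes A :: "real set"
  assumes A: "\<And>t. t \<in> A \<Longrightarrow> \<exists>\<epsilon>>0. \<forall>s\<in>A. \<not> (0 < \<bar>s - t\<bar> \<and> \<bar>s - t\<bar> < \<epsilon>)"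
  shows "countable A"
proof -
  have "\<exists>r. fst r \<in> \<rat> \<and> snd r \<in> \<rat> \<and> A \<inter> {fst r<..<snd r} = {t}" if t: "t \<in> A" for t
  proof -
    obtain \<epsilon> where \<epsilon>: "0 < \<epsilon>" "\<And>s. s \<in> A \<Longrightarrow> \<not> (0 < \<bar>s - t\<bar> \<and> \<bar>s - t\<bar> < \<epsilon>)" using A[OF t] by blast
    obtain r1 where r1: "r1 \<in> \<rat>" "t - \<epsilon> < r1" "r1 < t" using Rats_dense_in_real[of "t - \<epsilon>" t] \<epsilon>(1) by auto
    obtain r2 where r2: "r2 \<in> \<rat>" "t < r2" "r2 < t + \<epsilon>" using Rats_dense_in_real[of t "t + \<epsilon>"] \<epsilon>(1) by auto
    have eq: "s = t" if "s \<in> A \<inter> {r1<..<r2}" for s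
    proof -
      have "\<bar>s - t\<bar> < \<epsilon>" using that r1(2) r2(3) by (simp add: abs_less_iff)
      then have "\<not> 0 < \<bar>s - t\<bar>" using \<epsilon>(2)[of s] that by blast
      then show "s = t" by simp
    qed
    have "t \<in> A \<inter> {r1<..<r2}" using r1(3) r2(2) t by simp
    then have "A \<inter> {r1<..<r2} = {t}" using eq by blast
    then show ?thesis using r1(1) r2(1) by (intro exI[of _ "(r1, r2)"] conjI) simp_all
  qed
  then obtain f where f: "\<And>t. t \<in> A \<Longrightarrow> fst (f t) \<in> \<rat> \<and> snd (f t) \<in> \<rat> \<and> A \<inter> {fst (f t)<..<snd (f t)} = {t}"
    by metis
  have "inj_on f A"
  proof (rule inj_onI)
    fix s t assume st: "s \<in> A" "t \<in> A" and eq: "f s = f t"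
    from f[OF st(1)] f[OF st(2)] have "{s} = {t}" unfolding eq by metis
    then show "s = t" by simp
  qed
  moreover have "countable (f ` A)"
    by (rule countable_subset[of _ "\<rat> \<times> \<rat>"]) (use f countable_SIGMA[OF countable_rat countable_rat] in \<open>simp_all add: image_subset_iff mem_Times_iff\<close>)
  ultimately show ?thesis by (rule countable_image_inj_on[rotated])
qed

section \<open>From leaves to the characteristic condition\<close>

section \<open>Leaf-preserving submersions\<close>

lemma (in bichart) integral_curve_hamiltonian:
  assumes h: "smooth_fun M W h" and ab: "a \<le> b"
    and k: "\<And>t. t \<in> {a..b} \<Longrightarrow> k t \<in> \<Omega> \<and> k t \<in> E \<and> \<kappa> (k t) \<in> W"
    and der: "\<And>t. t \<in> {a..b} \<Longrightarrow> (k has_vector_derivative Pi (k t) (grad h (k t))) (at t within {a..b})"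
  shows "hamiltonian_curve M \<pi> W h a b (\<lambda>t. \<kappa> (k t))"
  unfolding hamiltonian_curve_def
proof (intro conjI ballI allI impI h ab)
  show "(\<lambda>t. \<kappa> (k t)) ` {a..b} \<subseteq> W" using k by auto
  have "continuous_on {a..b} k"
    using der has_vector_derivative_continuous by (metis continuous_on_eq_continuous_within)
  then have "continuous_map (top_of_set {a..b}) (top_of_set \<Omega>) k" using k by auto
  from continuous_map_compose[OF this continuous_map_kappa]
  show "continuous_map (top_of_set {a..b}) (mtop M) (\<lambda>t. \<kappa> (k t))" by (simp add: o_def)
  fix t f assume t: "t \<in> {a..b}" and f: "smooth_near M (\<kappa> (k t)) f"
  have V: "\<kappa> (k t) \<in> U" and pk: "\<phi> (\<kappa> (k t)) = k t" using k[OF t] kappa_in phi_kappa_E by auto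
  have hn: "smooth_near M (\<kappa> (k t)) h" unfolding smooth_near_def using h k[OF t] by (intro exI[of _ W] conjI) auto
  let ?X = "Pi (k t) (grad h (k t))"
  have sh: "sharp M \<pi> (\<kappa> (k t)) (differential M (\<kappa> (k t)) h) = tv (\<kappa> (k t)) ?X"
    using sharp_differential[OF V hn] by (simp add: pk)
  let ?d = "frechet_derivative (\<lambda>z. f (\<kappa> z)) (at (k t))"
  have d: "((\<lambda>z. f (\<kappa> z)) has_derivative ?d) (at (k t))" using smooth_near_diff[OF V f] by (simp add: pk)
  have "((\<lambda>t. f (\<kappa> (k t))) has_derivative (\<lambda>s. ?d (s *\<^sub>R ?X))) (at t within {a..b})"
    by (rule has_derivative_compose[OF der[OF t, unfolded has_vector_derivative_def] d])
  moreover have "?d (s *\<^sub>R w) = tv (\<kappa> (k t)) w f * s" for s w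
    using linear_cmul[OF has_derivative_linear[OF d], of s w] f by (simp add: tv_def pk)
  ultimately show "((f \<circ> (\<lambda>t. \<kappa> (k t))) has_real_derivative sharp M \<pi> (\<kappa> (k t)) (differential M (\<kappa> (k t)) h) f) (at t within {a..b})"
    unfolding sh by (simp add: has_field_derivative_def o_def)
qed

text \<open>
  If the image of a Hamiltonian vector at \<open>x\<close> were not tangent to the characteristic distribution,
  the image of its integral curve would be transverse to the plaques of the leaf of \<open>p x\<close>. It would
  then meet each of these plaques in a countable set of times; but only countably many plaques of
  that leaf exist near \<open>p x\<close>.
\<close>

theorem leaves_imp_characteristic:
  assumes ps: "poisson_submersion S \<pi>S M \<pi>M p"
    and leaves: "\<And>L. L \<in> symplectic_leaves S \<pi>S \<Longrightarrow> \<exists>L'\<in>symplectic_leaves M \<pi>M. p ` L \<subseteq> L'"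
    and x: "x \<in> carrier S"
  shows "pushforward M p x ` characteristic_distribution S \<pi>S x \<subseteq> characteristic_distribution M \<pi>M (p x)"
proof -
  obtain K where K: "subspace K" "K \<subseteq> model S" "dim K + dim (model M) = dim (model S)"
    using complement_dim_exists[OF ps x] .
  obtain U \<phi> \<kappa> \<Omega> V \<psi> \<mu> \<Theta> C c0 where pc: "poisson_chart_map S U \<phi> \<kappa> \<Omega> M V \<psi> \<mu> \<Theta> p C c0 \<pi>S \<pi>M" "x \<in> U"
    by (rule poisson_chart_map_exists[OF ps x K])
  interpret poisson_chart_map S U \<phi> \<kappa> \<Omega> M V \<psi> \<mu> \<Theta> p C c0 \<pi>S \<pi>M by (rule pc(1))
  have poiM: "poisson_manifold M \<pi>M" using ps by (simp add: poisson_submersion_def)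
  then have M: "smooth_manifold M" "smooth_bivector M \<pi>M" by (auto simp: poisson_manifold_def)
  have m0: "p x \<in> V" by (rule p_in[OF pc(2)])
  have pxM: "p x \<in> carrier M" by (rule m.U_carrier[OF m0])
  obtain r0 B L C2 \<rho> where pq: "plaque_chart M V \<psi> \<mu> \<Theta> \<pi>M (p x) r0 B L C2 \<rho>"
    using mb.plaque_chart_exists[OF poiM m0] .
  interpret q: plaque_chart M V \<psi> \<mu> \<Theta> \<pi>M "p x" r0 B L C2 \<rho> by (rule pq)
  let ?b = "ball (\<psi> (p x)) q.pl.\<delta>" and ?H = "q.pl.H"
  have Ck: "c0 + C (\<phi> y) = \<psi> (p y)" if "y \<in> U" for y using p_lin[OF that] by simp
  have qb: "\<psi> (p x) \<in> ?b" using q.pl.\<delta> by simp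
  obtain Q where Q: "countable Q" "\<And>q. q \<in> Q \<Longrightarrow> (hamiltonian_step M \<pi>M)\<^sup>*\<^sup>* (p x) q"
    and cover: "\<And>j Ob W y. plaque_system M \<pi>M j Ob W \<Longrightarrow> (hamiltonian_step M \<pi>M)\<^sup>*\<^sup>* (p x) j \<Longrightarrow>
      (hamiltonian_step M \<pi>M)\<^sup>*\<^sup>* (p x) y \<Longrightarrow> y \<in> Ob \<Longrightarrow> \<exists>q\<in>Q. q \<in> Ob \<and> y \<in> W q"
    by (rule leaf_countable_cover[OF poiM pxM]) blast
  show ?thesis
    unfolding characteristic_iff_range[OF pc(2)]
  proof (rule ccontr)
    assume "\<not> range (C o\<^sub>L PS x) \<subseteq> range (PM x)"
    then obtain a where a: "C (PS x a) \<notin> range (PM x)" by auto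
    \<comment> \<open>A coordinate function with differential \<open>s.dphi x a\<close> at
      \<open>x\<close>, so that its Hamiltonian vector at \<open>x\<close> is the one whose image
      under \<open>C\<close> violates (c).\<close>
    let ?h = "\<lambda>y. \<phi> y \<bullet> a"
    have h: "smooth_fun S U ?h" by (rule s.smooth_fun_coord)
    have hn: "smooth_near S x ?h" by (rule s.smooth_near_coord[OF pc(2)])
    define F where "F z = sb.Pi z (s.grad ?h z)" for z
    have smF: "smooth \<Omega> F"
    proof -
      have "{z\<in>\<Omega>. \<kappa> z \<in> U} = \<Omega>" using s.kappa_in by auto
      then have "smooth \<Omega> (\<lambda>z. ?h (\<kappa> z))" using s.smooth_kappa[OF h] by simp
      from smooth_blinfun_apply[OF s.open\<Omega> sb.smooth_Pi s.smooth_grad[OF this s.open\<Omega>]]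
      show ?thesis by (simp add: F_def[abs_def])
    qed
    have Fx: "F (\<phi> x) = PS x a"
    proof -
      have "s.dphi x a = s.dphi x (s.grad ?h (\<phi> x))"
        using s.differential_eq[OF pc(2) hn] by (simp add: s.dphi_def)
      from s.dphi_inj[OF pc(2) this] show ?thesis
        unfolding F_def using sb.Pi_proj_arg[OF s.phi_in[OF pc(2)]] by metis
    qed
    define N1 where "N1 = \<Omega> \<inter> (\<lambda>z. c0 + C z) -` ?b"
    have N1: "open N1" unfolding N1_def
      by (intro open_Int s.open\<Omega> open_vimage open_ball continuous_intros)
    \<comment> \<open>Measures transversality of the image velocity to the horizontal space. It is
      non-zero at \<open>\<phi> x\<close>, since the range of \<open>H\<close> is contained in that
      of \<open>Pi\<close>, and by continuity on a neighbourhood.\<close>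
    define \<Gamma> where "\<Gamma> z = ?H (c0 + C z) (C (F z)) - C (F z)" for z
    have "continuous_on N1 \<Gamma>"
      unfolding \<Gamma>_def
    proof (intro continuous_on_diff bounded_bilinear.continuous_on[OF bounded_bilinear_blinfun_apply] continuous_on_const)
      show "continuous_on N1 F" by (rule continuous_on_subset[OF smooth_continuous[OF smF s.open\<Omega>]]) (auto simp: N1_def)
      then show "continuous_on N1 F" .
      show "continuous_on N1 (\<lambda>z. ?H (c0 + C z))"
        by (rule continuous_on_compose2[OF smooth_continuous[OF q.pl.smooth1(3) q.pl.\<Omega>1(1)]])
          (use q.pl.ball_\<delta>(3) in \<open>auto simp: N1_def intro!: continuous_intros\<close>)
    qed
    then have Z: "open (N1 \<inter> \<Gamma> -` (- {0}))"
      by (rule continuous_open_preimage[OF _ N1]) (rule open_Compl[OF closed_singleton])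
    have "\<Gamma> (\<phi> x) \<noteq> 0"
    proof
      assume "\<Gamma> (\<phi> x) = 0"
      then have "C (PS x a) = ?H (\<psi> (p x)) (C (PS x a))" by (simp add: \<Gamma>_def Ck[OF pc(2)] Fx)
      then have "C (PS x a) \<in> range (?H (\<psi> (p x)))" by (rule range_eqI)
      then show False using q.pl.range_H[OF q.pl.ball_\<delta>(3)[OF qb]] a by blast
    qed
    then have xZ: "\<phi> x \<in> N1 \<inter> \<Gamma> -` (- {0})"
      using s.phi_in[OF pc(2)] qb by (simp add: N1_def Ck[OF pc(2)])
    \<comment> \<open>Solving the equation inside the open set where \<Gamma> is non-zero keeps the
      image curve transverse at all times, not merely at time 0.\<close>
    have smZ: "smooth (N1 \<inter> \<Gamma> -` (- {0})) F" by (rule smooth_subset[OF s.open\<Omega> Z _ smF]) (auto simp: N1_def)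
    obtain \<epsilon> k where \<epsilon>: "0 < \<epsilon>" and k0: "k 0 = \<phi> x" and kZ: "\<And>t. t \<in> {0..\<epsilon>} \<Longrightarrow> k t \<in> N1 \<inter> \<Gamma> -` (- {0})"
      and der: "\<And>t. t \<in> {0..\<epsilon>} \<Longrightarrow> (k has_vector_derivative F (k t)) (at t within {0..\<epsilon>})"
      by (rule local_integral_curve[OF smZ Z xZ]) blast
    have k\<Omega>: "k t \<in> \<Omega>" and kb: "c0 + C (k t) \<in> ?b"
      and kH: "?H (c0 + C (k t)) (C (F (k t))) \<noteq> C (F (k t))" if "t \<in> {0..\<epsilon>}" for t
      using kZ[OF that] by (auto simp: N1_def \<Gamma>_def)
    have kE: "k t \<in> model S" if t: "t \<in> {0..\<epsilon>}" for t
    proof (rule derivative_in_subspace[OF s.subE _ _ der t])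
      show "k 0 \<in> model S" using k0 s.phi_E[OF pc(2)] by simp
      show "F (k t) \<in> model S" if "t \<in> {0..\<epsilon>}" for t unfolding F_def by (rule sb.Pi_in_E[OF k\<Omega>[OF that]])
    qed
    define \<gamma> where "\<gamma> t = \<kappa> (k t)" for t
    have gU: "\<gamma> t \<in> U" and gk: "\<phi> (\<gamma> t) = k t" if "t \<in> {0..\<epsilon>}" for t
      unfolding \<gamma>_def using s.kappa_in[OF k\<Omega>[OF that]] s.phi_kappa_E[OF k\<Omega>[OF that] kE[OF that]] by auto
    have y: "\<psi> (p (\<gamma> t)) = c0 + C (k t)" if "t \<in> {0..\<epsilon>}" for t using Ck[OF gU[OF that]] gk[OF that] by simp
    have "hamiltonian_curve S \<pi>S U ?h 0 \<epsilon> \<gamma>"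
      unfolding \<gamma>_def
      by (rule sb.integral_curve_hamiltonian[OF h])
        (use \<epsilon> k\<Omega> kE gU der in \<open>auto simp: \<gamma>_def F_def\<close>)
    note ham = this
    have reach: "(hamiltonian_step M \<pi>M)\<^sup>*\<^sup>* (p x) (p (\<gamma> t))" if t: "t \<in> {0..\<epsilon>}" for t
    proof -
      have "hamiltonian_curve S \<pi>S U ?h 0 t \<gamma>" by (rule hamiltonian_curve_restrict[OF ham]) (use t in auto)
      moreover have "\<gamma> 0 = x" using k0 s.kappa_phi[OF pc(2)] by (simp add: \<gamma>_def)
      ultimately have "hamiltonian_step S \<pi>S x (\<gamma> t)" unfolding hamiltonian_step_def by blast
      then have 1: "\<gamma> t \<in> {y. (hamiltonian_step S \<pi>S)\<^sup>*\<^sup>* x y}" "x \<in> {y. (hamiltonian_step S \<pi>S)\<^sup>*\<^sup>* x y}" by auto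
      have "{y. (hamiltonian_step S \<pi>S)\<^sup>*\<^sup>* x y} \<in> symplectic_leaves S \<pi>S"
        using x unfolding symplectic_leaves_def by blast
      from leaves[OF this] obtain L' where L': "L' \<in> symplectic_leaves M \<pi>M" "p (\<gamma> t) \<in> L'" "p x \<in> L'"
        using 1 by blast
      \<comment> \<open>The leaf \<open>L'\<close> comes with an unknown base point; symmetry of
        reachability allows \<open>p x\<close> to take its place.\<close>
      then obtain m' where m': "(hamiltonian_step M \<pi>M)\<^sup>*\<^sup>* m' (p x)" "(hamiltonian_step M \<pi>M)\<^sup>*\<^sup>* m' (p (\<gamma> t))"
        by (auto simp: symplectic_leaves_def)
      show ?thesis by (rule rtranclp_trans[OF reachable_sym[OF M m'(1)] m'(2)])
    qed
    let ?A = "\<lambda>q'. {t\<in>{0..\<epsilon>}. p (\<gamma> t) \<in> q.plq q'}"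
    \<comment> \<open>Transversality isolates each time in \<open>?A q'\<close>. Constancy of the
      rank on the leaf provides \<open>D = 0\<close> at \<open>q'\<close>, which
      \<open>transverse_isolated\<close> requires.\<close>
    have "countable (?A q')" if q': "q' \<in> Q" "q' \<in> q.nbhd" for q'
    proof (rule isolated_imp_countable)
      fix t assume t: "t \<in> ?A q'"
      then have t0: "t \<in> {0..\<epsilon>}" by simp
      have D: "q.pl.D (\<psi> q') = 0"
        by (rule q.nbhd_D[OF q'(2) char_rank_reachable[OF poiM Q(2)[OF q'(1)]]])
      have "((\<lambda>t. c0 + C (k t)) has_vector_derivative 0 + C (F (k t))) (at t within {0..\<epsilon>})"
        by (intro has_vector_derivative_add has_vector_derivative_const
            bounded_linear.has_vector_derivative[OF blinfun.bounded_linear_right der[OF t0]])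
      then have dy: "((\<lambda>t. c0 + C (k t)) has_vector_derivative C (F (k t))) (at t within {0..\<epsilon>})" by simp
      have on: "c0 + C (k t) = q.pl.phi (\<psi> q') (c0 + C (k t) - \<psi> q')" if "t \<in> ?A q'" for t
        using that y[of t] by (simp add: q.plq_def)
      obtain e where e: "e > 0" "\<forall>s\<in>{0..\<epsilon>}. 0 < \<bar>s - t\<bar> \<and> \<bar>s - t\<bar> < e \<longrightarrow>
          c0 + C (k s) \<noteq> q.pl.phi (\<psi> q') (c0 + C (k s) - \<psi> q')"
        using q.pl.transverse_isolated[OF q.nbhdD(2)[OF q'(2)] D kb[OF t0] dy on[OF t] kH[OF t0]] by blast
      show "\<exists>e>0. \<forall>s\<in>?A q'. \<not> (0 < \<bar>s - t\<bar> \<and> \<bar>s - t\<bar> < e)"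
      proof (intro exI[of _ e] conjI ballI notI e(1))
        fix s assume s: "s \<in> ?A q'" "0 < \<bar>s - t\<bar> \<and> \<bar>s - t\<bar> < e"
        then have "s \<in> {0..\<epsilon>}" by simp
        from e(2)[rule_format, OF this s(2)] on[OF s(1)] show False by (rule notE)
      qed
    qed
    then have "countable (\<Union>q'\<in>Q \<inter> q.nbhd. ?A q')" using Q(1) by auto
    moreover have "{0..\<epsilon>} \<subseteq> (\<Union>q'\<in>Q \<inter> q.nbhd. ?A q')"
    proof
      fix t assume t: "t \<in> {0..\<epsilon>}"
      have "p (\<gamma> t) \<in> q.nbhd" using p_in[OF gU[OF t]] kb[OF t] by (simp add: q.nbhd_def y[OF t])
      from cover[OF q.plaque_system rtranclp.rtrancl_refl reach[OF t] this]
      show "t \<in> (\<Union>q'\<in>Q \<inter> q.nbhd. ?A q')" using t by blast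
    qed
    ultimately have "countable {0..\<epsilon>}" by (rule countable_subset[rotated])
    then show False using uncountable_closed_interval[of 0 \<epsilon>] \<epsilon> by blast
  qed
qed

theorem mainTheorem3:
  fixes S :: "('a, 'e::euclidean_space) manifold" and \<pi>S :: "'a bivector"
    and M :: "('b, 'f::euclidean_space) manifold" and \<pi>M :: "'b bivector"
    and p :: "'a \<Rightarrow> 'b"
  assumes "poisson_submersion S \<pi>S M \<pi>M p"
  shows "((poisson_submersion S \<pi>S M \<pi>M p \<and> has_poisson_fibres S \<pi>S M p) \<longleftrightarrow>
          (\<forall>L\<in>symplectic_leaves S \<pi>S. \<exists>L'\<in>symplectic_leaves M \<pi>M. p ` L \<subseteq> L')) \<and>
         ((\<forall>L\<in>symplectic_leaves S \<pi>S. \<exists>L'\<in>symplectic_leaves M \<pi>M. p ` L \<subseteq> L') \<longleftrightarrow>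
          (\<forall>x\<in>carrier S. pushforward M p x ` characteristic_distribution S \<pi>S x
                          \<subseteq> characteristic_distribution M \<pi>M (p x)))"
    (is "(?P \<longleftrightarrow> ?b) \<and> (?b \<longleftrightarrow> ?c)")
proof -
  have "?P \<longleftrightarrow> ?c"
  proof
    show ?c if ?P using poisson_fibres_imp_characteristic[OF assms] that by blast
    show ?P if ?c using characteristic_imp_poisson_fibres[OF assms] that assms by blast
  qed
  moreover have "?b \<longleftrightarrow> ?c"
  proof
    show ?c if b: ?b
      using leaves_imp_characteristic[OF assms bspec[OF b]] by (rule ballI)
    show ?b if c: ?c
      using characteristic_imp_leaves[OF assms bspec[OF c]] by (rule ballI)
  qed
  ultimately show ?thesis by simp
qed

end
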